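(* Let $Q$ be a finite tree quiver, $A=\Bbbk Q$ its path algebra, and $\mathscr{D}_A'$ the $2$-category defined in the context. All cells in $\mathcal{S}_{\mathscr{D}_A'}$ are listed as follows: (i) For each indecomposable ideal $I$ of $A$ such that $|G(I)|\neq 1$, the set $\{[\mathrm{Dp}_I]\}$ is a left cell, a right cell and thus a two-sided cell. (ii) For $j\in Q_0$, the set $\{[F_{ij}]\mid i\in Q_0\}$ is a left cell; for $i\in Q_0$, the set $\{[F_{ij}]\mid j\in Q_0\}$ is a right cell; and the set $\{[F_{ij}]\mid i,j\in Q_0\}$ is a two-sided cell which is maximal with respect to $\geq_J$.
   Context: $\Bbbk$ is an algebraically closed field; all categories and functors are $\Bbbk$-linear. A finite tree quiver $Q=(Q_0,Q_1,s,t)$ is a finite quiver whose underlying graph is a tree. For $v\in Q_0$, $\varepsilon_v$ is the trivial path at $v$. "Ideal" means two-sided ideal; ideals of $A$ are identified with subbimodules of ${}_AA_A$, and an ideal is indecomposable if it is (nonzero and) indecomposable as an $A$-$A$-bimodule. Every ideal $I$ is generated by a unique minimal set of paths, denoted $G(I)$. For an ideal $I$, $\mathrm{Dp}_I$ is the functor $I\otimes_A{}_-:A\text{-mod}\to A\text{-mod}$; for $i,j\in Q_0$, $F_{ij}$ is the functor $A\varepsilon_i\otimes_\Bbbk\varepsilon_jA\otimes_A{}_-$. The $2$-category $\mathscr{D}_A'$ has one object $\mathtt{i}$ (identified with a small category equivalent to $A$-mod); its $1$-morphisms are the functors given, up to equivalence with $A$-mod, by functors in the additive closure of ${}_AA\otimes_\Bbbk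 A_A\otimes_A{}_-$ and all $\mathrm{Dp}_I$, $I$ an ideal of $A$; its $2$-morphisms are all natural transformations. For a finitary $2$-category $\mathscr{C}$, $\mathcal{S}_{\mathscr{C}}$ is the set of isomorphism classes of indecomposable $1$-morphisms (with an added external zero element, which plays no role in cells). For indecomposable $1$-morphisms $F,G$: $G\geq_L F$ if $G$ is isomorphic to a direct summand of $H\circ F$ for some $1$-morphism $H$; $G\geq_R F$ if $G$ is isomorphic to a direct summand of $F\circ H$ for some $H$; $G\geq_J F$ if $G$ is isomorphic to a direct summand of $H\circ F\circ H'$ for some $H,H'$. Left, right and two-sided cells are the equivalence classes of the equivalence relations associated with the preorders $\geq_L$, $\geq_R$ and $\geq_J$, respectively. *)

theory Defs
  imports
    "HOL-Library.Poly_Mapping"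
    "HOL-Algebra.Free_Abelian_Groups"
    "HOL-Algebra.Ideal"
    "HOL-Algebra.Algebraic_Closure_Type"
    "Graph_Theory.Graph_Theory"
begin

text \<open>
  A quiver is a \<^typ>\<open>('v, 'e) pre_digraph\<close> (loops and parallel arcs are allowed).  The library
  predicates \<^const>\<open>forest\<close> and \<^const>\<open>tree\<close> only exclude \<^emph>\<open>directed\<close> cycles, so they do not
  express that the underlying graph is a tree.  A cycle of the underlying graph is a cycle
  of the quiver with formal inverses of arcs added which uses no arc twice (in either direction).
\<close>

definition double_quiver :: "('v, 'e) pre_digraph \<Rightarrow> ('v, 'e \<times> bool) pre_digraph" where
  "double_quiver Q =
    \<lparr> verts = verts Q, arcs = arcs Q \<times> UNIV,
      tail = (\<lambda>(e, b). if b then tail Q e else head Q e),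
      head = (\<lambda>(e, b). if b then head Q e else tail Q e) \<rparr>"

definition underlying_cycle :: "('v, 'e) pre_digraph \<Rightarrow> ('e \<times> bool) list \<Rightarrow> bool" where
  "underlying_cycle Q p \<longleftrightarrow> pre_digraph.cycle (double_quiver Q) p \<and> distinct (map fst p)"

text \<open>\<^const>\<open>connected\<close> means weakly connected and includes that there is at least one vertex.\<close>

definition finite_tree_quiver :: "('v, 'e) pre_digraph \<Rightarrow> bool" where
  "finite_tree_quiver Q \<longleftrightarrow> fin_digraph Q \<and> connected Q \<and> (\<nexists>p. underlying_cycle Q p)"

text \<open>
  A path is given by its starting vertex and its list of arcs in the order of traversal.  Paths
  are multiplied like maps: \<open>q\<close> times \<open>p\<close> is \<open>p\<close> followed by \<open>q\<close>.
\<close>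

type_synonym ('v, 'e) qpath = "'v \<times> 'e list"

definition qpaths :: "('v, 'e) pre_digraph \<Rightarrow> ('v, 'e) qpath set" where
  "qpaths Q = {(u, p). \<exists>v. pre_digraph.awalk Q u p v}"

definition path_algebra ::
    "('v, 'e) pre_digraph \<Rightarrow> ('k::field, ('v, 'e) qpath \<Rightarrow> 'k) module" where
  "path_algebra Q =
    \<lparr> carrier = {f. finite {p. f p \<noteq> 0} \<and> {p. f p \<noteq> 0} \<subseteq> qpaths Q},
      monoid.mult = (\<lambda>f g (u, p). \<Sum>n\<le>length p.
                f (last (pre_digraph.awalk_verts Q u (take n p)), drop n p) * g (u, take n p)),
      one = (\<lambda>(u, p). if u \<in> verts Q \<and> p = [] then 1 else 0),
      zero = (\<lambda>_. 0),
      ring.add = (\<lambda>f g p. f p + g p),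
      module.smult = (\<lambda>c f p. c * f p) \<rparr>"

definition path_elem :: "('v, 'e) qpath \<Rightarrow> ('v, 'e) qpath \<Rightarrow> 'k::field" where
  "path_elem p = (\<lambda>q. if q = p then 1 else 0)"

abbreviation vertex_idem :: "'v \<Rightarrow> ('v, 'e) qpath \<Rightarrow> 'k::field" (\<open>\<epsilon>\<close>) where
  "\<epsilon> v \<equiv> path_elem (v, [])"

text \<open>
  The set \<open>G(I)\<close>, identified with a set of paths; for a tree quiver, every ideal has exactly one
  inclusion-minimal generating set consisting of paths.
\<close>

definition path_gens ::
    "('v, 'e) pre_digraph \<Rightarrow> (('v, 'e) qpath \<Rightarrow> 'k::field) set \<Rightarrow> ('v, 'e) qpath set" where
  "path_gens Q I =
    (THE S. S \<subseteq> qpaths Q \<and> Idl\<^bsub>path_algebra Q\<^esub> (path_elem ` S) = I \<and>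
            (\<forall>T. T \<subset> S \<longrightarrow> Idl\<^bsub>path_algebra Q\<^esub> (path_elem ` T) \<noteq> I))"

text \<open>
  The locale \<^locale>\<open>module\<close> of the library only covers commutative rings.  Throughout, the ring
  fields \<^const>\<open>monoid.mult\<close> and \<^const>\<open>one\<close> of module records are meaningless.  A \<open>k\<close>-algebra
  \<open>A\<close> is a record \<^typ>\<open>('k, 'a) module\<close> whose \<^const>\<open>module.smult\<close> is the action of \<open>k\<close>; the
  action of \<open>k\<close> on an \<open>A\<close>-module is the one through the unit of \<open>A\<close>.
\<close>

locale left_module = R?: ring R + M?: abelian_group M
    for R :: "('a, 'r) ring_scheme" (structure) and M :: "('a, 'u, 'm) module_scheme" (structure) +
  assumes lsmult_closed: "\<lbrakk>a \<in> carrier R; x \<in> carrier M\<rbrakk> \<Longrightarrow> a \<odot>\<^bsub>M\<^esub> x \<in> carrier M"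
    and lsmult_l_distr: "\<lbrakk>a \<in> carrier R; b \<in> carrier R; x \<in> carrier M\<rbrakk> \<Longrightarrow>
      (a \<oplus>\<^bsub>R\<^esub> b) \<odot>\<^bsub>M\<^esub> x = a \<odot>\<^bsub>M\<^esub> x \<oplus>\<^bsub>M\<^esub> b \<odot>\<^bsub>M\<^esub> x"
    and lsmult_r_distr: "\<lbrakk>a \<in> carrier R; x \<in> carrier M; y \<in> carrier M\<rbrakk> \<Longrightarrow>
      a \<odot>\<^bsub>M\<^esub> (x \<oplus>\<^bsub>M\<^esub> y) = a \<odot>\<^bsub>M\<^esub> x \<oplus>\<^bsub>M\<^esub> a \<odot>\<^bsub>M\<^esub> y"
    and lsmult_assoc: "\<lbrakk>a \<in> carrier R; b \<in> carrier R; x \<in> carrier M\<rbrakk> \<Longrightarrow>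
      (a \<otimes>\<^bsub>R\<^esub> b) \<odot>\<^bsub>M\<^esub> x = a \<odot>\<^bsub>M\<^esub> (b \<odot>\<^bsub>M\<^esub> x)"
    and lsmult_one: "x \<in> carrier M \<Longrightarrow> \<one>\<^bsub>R\<^esub> \<odot>\<^bsub>M\<^esub> x = x"

definition kscale :: "('k, 'a) module \<Rightarrow> ('a, 'u) module \<Rightarrow> 'k \<Rightarrow> 'u \<Rightarrow> 'u" where
  "kscale A M c x = (c \<odot>\<^bsub>A\<^esub> \<one>\<^bsub>A\<^esub>) \<odot>\<^bsub>M\<^esub> x"

definition fdmod :: "('k, 'a) module \<Rightarrow> ('a, 'u) module set" where
  "fdmod A = {M. left_module A M \<and>
     (\<exists>S. finite S \<and> S \<subseteq> carrier M \<and>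
       (\<forall>x\<in>carrier M. \<exists>c. x = finsum M (\<lambda>s. kscale A M (c s) s) S))}"

definition mhom :: "('k, 'a) module \<Rightarrow> ('a, 'u) module \<Rightarrow> ('a, 'w) module \<Rightarrow> ('u \<Rightarrow> 'w) set" where
  "mhom A M N = {f \<in> carrier M \<rightarrow>\<^sub>E carrier N.
     (\<forall>x\<in>carrier M. \<forall>y\<in>carrier M. f (x \<oplus>\<^bsub>M\<^esub> y) = f x \<oplus>\<^bsub>N\<^esub> f y) \<and>
     (\<forall>a\<in>carrier A. \<forall>x\<in>carrier M. f (a \<odot>\<^bsub>M\<^esub> x) = a \<odot>\<^bsub>N\<^esub> f x)}"

record ('l, 'b, 'r) bimodule = "('l, 'b) module" +
  rsmult :: "'b \<Rightarrow> 'r \<Rightarrow> 'b"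

definition subbimodule :: "('k, 'a) module \<Rightarrow> ('a, 'b, 'a) bimodule \<Rightarrow> 'b set \<Rightarrow> bool" where
  "subbimodule A B N \<longleftrightarrow> additive_subgroup N B \<and>
     (\<forall>a\<in>carrier A. \<forall>x\<in>N. a \<odot>\<^bsub>B\<^esub> x \<in> N \<and> rsmult B x a \<in> N)"

definition indecomposable_bimodule :: "('k, 'a) module \<Rightarrow> ('a, 'b, 'a) bimodule \<Rightarrow> bool" where
  "indecomposable_bimodule A B \<longleftrightarrow> carrier B \<noteq> {\<zero>\<^bsub>B\<^esub>} \<and>
     (\<forall>N1 N2. subbimodule A B N1 \<and> subbimodule A B N2 \<and>
        N1 <+>\<^bsub>B\<^esub> N2 = carrier B \<and> N1 \<inter> N2 = {\<zero>\<^bsub>B\<^esub>} \<longrightarrow> N1 = {\<zero>\<^bsub>B\<^esub>} \<or> N2 = {\<zero>\<^bsub>B\<^esub>})"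

definition sub_bimod ::
    "('k, 'a) module \<Rightarrow> 'a set \<Rightarrow> ('l \<Rightarrow> 'a \<Rightarrow> 'a) \<Rightarrow> ('a \<Rightarrow> 'r \<Rightarrow> 'a) \<Rightarrow> ('l, 'a, 'r) bimodule" where
  "sub_bimod A S lact ract =
    \<lparr> carrier = S, monoid.mult = monoid.mult A, one = \<one>\<^bsub>A\<^esub>, zero = \<zero>\<^bsub>A\<^esub>, ring.add = ring.add A,
      module.smult = lact, rsmult = ract \<rparr>"

definition ideal_bimod :: "('k, 'a) module \<Rightarrow> 'a set \<Rightarrow> ('a, 'a, 'a) bimodule" where
  "ideal_bimod A I = sub_bimod A I (monoid.mult A) (monoid.mult A)"

definition indecomposable_ideal :: "('k, 'a) module \<Rightarrow> 'a set \<Rightarrow> bool" where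
  "indecomposable_ideal A I \<longleftrightarrow> ideal I A \<and> indecomposable_bimodule A (ideal_bimod A I)"

text \<open>
  For a right \<open>R\<close>-module \<open>M\<close> and a left \<open>R\<close>-module \<open>N\<close>, the tensor product over \<open>R\<close> is the
  free abelian group on the pairs \<open>(x, y)\<close> modulo the subgroup generated by the usual
  relations.  It inherits the left action of \<open>M\<close> and the right action of \<open>N\<close>.
\<close>

definition tensor_relators ::
    "('r, 's) ring_scheme \<Rightarrow> ('l, 'x, 'r) bimodule \<Rightarrow> ('r, 'y, 'm) module_scheme
      \<Rightarrow> ('x \<times> 'y \<Rightarrow>\<^sub>0 int) set" where
  "tensor_relators R M N =
     {frag_of (x \<oplus>\<^bsub>M\<^esub> x', y) - frag_of (x, y) - frag_of (x', y) | x x' y.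
        x \<in> carrier M \<and> x' \<in> carrier M \<and> y \<in> carrier N} \<union>
     {frag_of (x, y \<oplus>\<^bsub>N\<^esub> y') - frag_of (x, y) - frag_of (x, y') | x y y'.
        x \<in> carrier M \<and> y \<in> carrier N \<and> y' \<in> carrier N} \<union>
     {frag_of (rsmult M x r, y) - frag_of (x, r \<odot>\<^bsub>N\<^esub> y) | x r y.
        x \<in> carrier M \<and> r \<in> carrier R \<and> y \<in> carrier N}"

definition tensor_kernel ::
    "('r, 's) ring_scheme \<Rightarrow> ('l, 'x, 'r) bimodule \<Rightarrow> ('r, 'y, 'm) module_scheme
      \<Rightarrow> ('x \<times> 'y \<Rightarrow>\<^sub>0 int) set" where
  "tensor_kernel R M N =
     generate (free_Abelian_group (carrier M \<times> carrier N)) (tensor_relators R M N)"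

definition tensor_group ::
    "('r, 's) ring_scheme \<Rightarrow> ('l, 'x, 'r) bimodule \<Rightarrow> ('r, 'y, 'm) module_scheme
      \<Rightarrow> ('x \<times> 'y \<Rightarrow>\<^sub>0 int) set monoid" where
  "tensor_group R M N = free_Abelian_group (carrier M \<times> carrier N) Mod tensor_kernel R M N"

text \<open>
  The map between tensor products (\<open>M \<otimes> N\<close> to \<open>M \<otimes> N'\<close>) induced by a map \<open>\<phi>\<close> on pairs.  Elements
  of a tensor product are cosets; the image of a coset is the common coset of all images.
\<close>

definition tensor_map ::
    "('r, 's) ring_scheme \<Rightarrow> ('l, 'x, 'r) bimodule \<Rightarrow> ('r, 'y, 'm) module_scheme
      \<Rightarrow> ('z \<Rightarrow> 'x \<times> 'y) \<Rightarrow> ('z \<Rightarrow>\<^sub>0 int) set \<Rightarrow> ('x \<times> 'y \<Rightarrow>\<^sub>0 int) set" where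
  "tensor_map R M N \<phi> Z =
     (\<Union>f\<in>Z. tensor_kernel R M N #>\<^bsub>free_Abelian_group (carrier M \<times> carrier N)\<^esub>
        frag_extend (\<lambda>p. frag_of (\<phi> p)) f)"

definition tensor ::
    "('r, 's) ring_scheme \<Rightarrow> ('l, 'x, 'r) bimodule \<Rightarrow> ('r, 'y, 'm) module_scheme
      \<Rightarrow> ('l, ('x \<times> 'y \<Rightarrow>\<^sub>0 int) set) module" where
  "tensor R M N =
    \<lparr> carrier = carrier (tensor_group R M N),
      monoid.mult = monoid.mult (tensor_group R M N), one = \<one>\<^bsub>tensor_group R M N\<^esub>,
      zero = \<one>\<^bsub>tensor_group R M N\<^esub>, ring.add = monoid.mult (tensor_group R M N),
      module.smult = (\<lambda>a. tensor_map R M N (\<lambda>(x, y). (a \<odot>\<^bsub>M\<^esub> x, y))) \<rparr>"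

definition tensor_bimod ::
    "('r, 's) ring_scheme \<Rightarrow> ('l, 'x, 'r) bimodule \<Rightarrow> ('r, 'y, 'q) bimodule
      \<Rightarrow> ('l, ('x \<times> 'y \<Rightarrow>\<^sub>0 int) set, 'q) bimodule" where
  "tensor_bimod R M N = module.extend (tensor R M N)
    \<lparr> rsmult = (\<lambda>Z b. tensor_map R M N (\<lambda>(x, y). (x, rsmult N y b)) Z) \<rparr>"

definition outer_bimod ::
    "('k::field, 'a) module \<Rightarrow> 'a set \<Rightarrow> 'a set \<Rightarrow> ('a, ('a \<times> 'a \<Rightarrow>\<^sub>0 int) set, 'a) bimodule" where
  "outer_bimod A S T = tensor_bimod (ring_of_type_algebra :: 'k ring)
     (sub_bimod A S (monoid.mult A) (\<lambda>x c. c \<odot>\<^bsub>A\<^esub> x)) (sub_bimod A T (module.smult A) (monoid.mult A))"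

text \<open>
  Functors from finite-dimensional \<open>A\<close>-modules with underlying set in \<^typ>\<open>'u\<close> to
  \<open>A\<close>-modules with underlying set in \<^typ>\<open>'w\<close>.  As module homomorphisms do not determine their
  source and target, these are arguments of the action on morphisms.
\<close>

record ('a, 'u, 'w) mod_functor =
  obj :: "('a, 'u) module \<Rightarrow> ('a, 'w) module"
  mor :: "('a, 'u) module \<Rightarrow> ('a, 'u) module \<Rightarrow> ('u \<Rightarrow> 'u) \<Rightarrow> 'w \<Rightarrow> 'w"

definition lin_functors :: "('k, 'a) module \<Rightarrow> ('a, 'u, 'w) mod_functor set" where
  "lin_functors A = {F.
     (\<forall>M\<in>fdmod A. obj F M \<in> fdmod A) \<and>
     (\<forall>M\<in>fdmod A. \<forall>N\<in>fdmod A. \<forall>f\<in>mhom A M N. mor F M N f \<in> mhom A (obj F M) (obj F N)) \<and>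
     (\<forall>M\<in>fdmod A. mor F M M (\<lambda>x\<in>carrier M. x) = (\<lambda>x\<in>carrier (obj F M). x)) \<and>
     (\<forall>L\<in>fdmod A. \<forall>M\<in>fdmod A. \<forall>N\<in>fdmod A. \<forall>f\<in>mhom A L M. \<forall>g\<in>mhom A M N.
        mor F L N (compose (carrier L) g f) =
        compose (carrier (obj F L)) (mor F M N g) (mor F L M f)) \<and>
     (\<forall>M\<in>fdmod A. \<forall>N\<in>fdmod A. \<forall>f\<in>mhom A M N. \<forall>g\<in>mhom A M N.
        mor F M N (\<lambda>x\<in>carrier M. f x \<oplus>\<^bsub>N\<^esub> g x) =
        (\<lambda>x\<in>carrier (obj F M). mor F M N f x \<oplus>\<^bsub>obj F N\<^esub> mor F M N g x)) \<and>
     (\<forall>M\<in>fdmod A. \<forall>N\<in>fdmod A. \<forall>f\<in>mhom A M N. \<forall>c.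
        mor F M N (\<lambda>x\<in>carrier M. kscale A N c (f x)) =
        (\<lambda>x\<in>carrier (obj F M). kscale A (obj F N) c (mor F M N f x)))}"

definition functor_comp ::
    "('a, 'v, 'w) mod_functor \<Rightarrow> ('a, 'u, 'v) mod_functor \<Rightarrow> ('a, 'u, 'w) mod_functor"
    (infixl \<open>\<circ>\<^sub>F\<close> 55) where
  "H \<circ>\<^sub>F F = \<lparr> obj = (\<lambda>M. obj H (obj F M)),
               mor = (\<lambda>M N f. mor H (obj F M) (obj F N) (mor F M N f)) \<rparr>"

definition tensor_functor ::
    "('k, 'a) module \<Rightarrow> ('a, 'b, 'a) bimodule
      \<Rightarrow> ('a, 'u, ('b \<times> 'u \<Rightarrow>\<^sub>0 int) set) mod_functor" where
  "tensor_functor A B =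
    \<lparr> obj = (\<lambda>M. tensor A B M),
      mor = (\<lambda>M N f. \<lambda>Z\<in>carrier (tensor A B M). tensor_map A B N (\<lambda>(b, x). (b, f x)) Z) \<rparr>"

definition nat_trans ::
    "('k, 'a) module \<Rightarrow> ('a, 'u, 'v) mod_functor \<Rightarrow> ('a, 'u, 'w) mod_functor
      \<Rightarrow> (('a, 'u) module \<Rightarrow> 'v \<Rightarrow> 'w) \<Rightarrow> bool" where
  "nat_trans A F G \<eta> \<longleftrightarrow>
     (\<forall>M\<in>fdmod A. \<eta> M \<in> mhom A (obj F M) (obj G M)) \<and>
     (\<forall>M\<in>fdmod A. \<forall>N\<in>fdmod A. \<forall>f\<in>mhom A M N.
        compose (carrier (obj F M)) (\<eta> N) (mor F M N f) =
        compose (carrier (obj F M)) (mor G M N f) (\<eta> M))"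

definition nat_iso ::
    "('k, 'a) module \<Rightarrow> ('a, 'u, 'v) mod_functor \<Rightarrow> ('a, 'u, 'w) mod_functor \<Rightarrow> bool" where
  "nat_iso A F G \<longleftrightarrow> (\<exists>\<eta> \<theta>. nat_trans A F G \<eta> \<and> nat_trans A G F \<theta> \<and>
     (\<forall>M\<in>fdmod A. (\<forall>x\<in>carrier (obj F M). \<theta> M (\<eta> M x) = x) \<and>
                  (\<forall>y\<in>carrier (obj G M). \<eta> M (\<theta> M y) = y)))"

definition zero_functor :: "('k, 'a) module \<Rightarrow> ('a, 'u, 'w) mod_functor \<Rightarrow> bool" where
  "zero_functor A F \<longleftrightarrow> (\<forall>M\<in>fdmod A. carrier (obj F M) = {\<zero>\<^bsub>obj F M\<^esub>})"

definition is_direct_sum ::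
    "('k, 'a) module \<Rightarrow> ('a, 'u, 'u) mod_functor \<Rightarrow> ('a, 'u, 'u) mod_functor list \<Rightarrow> bool" where
  "is_direct_sum A H Fs \<longleftrightarrow> (\<exists>\<iota> \<pi>.
     (\<forall>i<length Fs. nat_trans A (Fs ! i) H (\<iota> i) \<and> nat_trans A H (Fs ! i) (\<pi> i)) \<and>
     (\<forall>M\<in>fdmod A. \<forall>i<length Fs. \<forall>j<length Fs. \<forall>x\<in>carrier (obj (Fs ! j) M).
        \<pi> i M (\<iota> j M x) = (if i = j then x else \<zero>\<^bsub>obj (Fs ! i) M\<^esub>)) \<and>
     (\<forall>M\<in>fdmod A. \<forall>x\<in>carrier (obj H M).
        finsum (obj H M) (\<lambda>i. \<iota> i M (\<pi> i M x)) {..<length Fs} = x))"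

text \<open>\<open>G\<close> is isomorphic to a direct summand of \<open>H\<close>, with a complement in \<open>C\<close>.\<close>

definition is_summand ::
    "('k, 'a) module \<Rightarrow> ('a, 'u, 'u) mod_functor set
      \<Rightarrow> ('a, 'u, 'u) mod_functor \<Rightarrow> ('a, 'u, 'u) mod_functor \<Rightarrow> bool" where
  "is_summand A C G H \<longleftrightarrow> (\<exists>K\<in>C. is_direct_sum A H [G, K])"

definition additive_closure ::
    "('k, 'a) module \<Rightarrow> ('a, 'u, 'u) mod_functor set \<Rightarrow> ('a, 'u, 'u) mod_functor set" where
  "additive_closure A Gs = {F \<in> lin_functors A. \<exists>Fs H. set Fs \<subseteq> Gs \<and> H \<in> lin_functors A \<and>
     is_direct_sum A H Fs \<and> is_summand A (lin_functors A) F H}"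

text \<open>
  A \<open>2\<close>-category with the single object \<^term>\<open>fdmod A\<close> whose \<open>2\<close>-morphisms are all natural
  transformations is given by its set \<open>C\<close> of \<open>1\<close>-morphisms.
\<close>

type_synonym ('a, 'u) endofunctor = "('a, 'u, 'u) mod_functor"

definition indecomposable_in ::
    "('k, 'a) module \<Rightarrow> ('a, 'u) endofunctor set \<Rightarrow> ('a, 'u) endofunctor \<Rightarrow> bool" where
  "indecomposable_in A C F \<longleftrightarrow> F \<in> C \<and> \<not> zero_functor A F \<and>
     (\<forall>F1\<in>C. \<forall>F2\<in>C. is_direct_sum A F [F1, F2] \<longrightarrow> zero_functor A F1 \<or> zero_functor A F2)"

definition iso_class ::
    "('k, 'a) module \<Rightarrow> ('a, 'u) endofunctor set \<Rightarrow> ('a, 'u, 'w) mod_functor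
      \<Rightarrow> ('a, 'u) endofunctor set" where
  "iso_class A C F = {G \<in> C. nat_iso A G F}"

definition indec_classes ::
    "('k, 'a) module \<Rightarrow> ('a, 'u) endofunctor set \<Rightarrow> ('a, 'u) endofunctor set set" where
  "indec_classes A C = iso_class A C ` {F. indecomposable_in A C F}"

definition ge_L ::
    "('k, 'a) module \<Rightarrow> ('a, 'u) endofunctor set
      \<Rightarrow> ('a, 'u) endofunctor \<Rightarrow> ('a, 'u) endofunctor \<Rightarrow> bool" where
  "ge_L A C G F \<longleftrightarrow> (\<exists>H\<in>C. is_summand A C G (H \<circ>\<^sub>F F))"

definition ge_R ::
    "('k, 'a) module \<Rightarrow> ('a, 'u) endofunctor set
      \<Rightarrow> ('a, 'u) endofunctor \<Rightarrow> ('a, 'u) endofunctor \<Rightarrow> bool" where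
  "ge_R A C G F \<longleftrightarrow> (\<exists>H\<in>C. is_summand A C G (F \<circ>\<^sub>F H))"

definition ge_J ::
    "('k, 'a) module \<Rightarrow> ('a, 'u) endofunctor set
      \<Rightarrow> ('a, 'u) endofunctor \<Rightarrow> ('a, 'u) endofunctor \<Rightarrow> bool" where
  "ge_J A C G F \<longleftrightarrow> (\<exists>H\<in>C. \<exists>H'\<in>C. is_summand A C G (H \<circ>\<^sub>F F \<circ>\<^sub>F H'))"

definition class_ge ::
    "(('a, 'u) endofunctor \<Rightarrow> ('a, 'u) endofunctor \<Rightarrow> bool)
      \<Rightarrow> ('a, 'u) endofunctor set \<Rightarrow> ('a, 'u) endofunctor set \<Rightarrow> bool" where
  "class_ge ge U V \<longleftrightarrow> (\<exists>G\<in>U. \<exists>F\<in>V. ge G F)"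

definition cells ::
    "('k, 'a) module \<Rightarrow> ('a, 'u) endofunctor set
      \<Rightarrow> (('a, 'u) endofunctor \<Rightarrow> ('a, 'u) endofunctor \<Rightarrow> bool)
      \<Rightarrow> ('a, 'u) endofunctor set set set" where
  "cells A C ge = indec_classes A C //
     {(U, V) \<in> indec_classes A C \<times> indec_classes A C. class_ge ge U V \<and> class_ge ge V U}"

definition left_cells where "left_cells A C = cells A C (ge_L A C)"

definition right_cells where "right_cells A C = cells A C (ge_R A C)"

definition two_sided_cells where "two_sided_cells A C = cells A C (ge_J A C)"

definition maximal_two_sided_cell ::
    "('k, 'a) module \<Rightarrow> ('a, 'u) endofunctor set \<Rightarrow> ('a, 'u) endofunctor set set \<Rightarrow> bool" where
  "maximal_two_sided_cell A C J \<longleftrightarrow> J \<in> two_sided_cells A C \<and>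
     (\<forall>J'\<in>two_sided_cells A C. (\<exists>V\<in>J'. \<exists>U\<in>J. class_ge (ge_J A C) V U) \<longrightarrow> J' = J)"

definition Dp ::
    "('k, 'a) module \<Rightarrow> 'a set \<Rightarrow> ('a, 'u, ('a \<times> 'u \<Rightarrow>\<^sub>0 int) set) mod_functor" where
  "Dp A I = tensor_functor A (ideal_bimod A I)"

definition F_proj ::
    "('k::field, ('v, 'e) qpath \<Rightarrow> 'k) module \<Rightarrow> 'v \<Rightarrow> 'v
      \<Rightarrow> (('v, 'e) qpath \<Rightarrow> 'k, 'u,
          (((('v, 'e) qpath \<Rightarrow> 'k) \<times> (('v, 'e) qpath \<Rightarrow> 'k) \<Rightarrow>\<^sub>0 int) set \<times> 'u \<Rightarrow>\<^sub>0 int) set)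
         mod_functor" where
  "F_proj A i j = tensor_functor A
     (outer_bimod A ((\<lambda>a. a \<otimes>\<^bsub>A\<^esub> \<epsilon> i) ` carrier A) ((\<lambda>a. \<epsilon> j \<otimes>\<^bsub>A\<^esub> a) ` carrier A))"

text \<open>
  Every finite-dimensional vector space over \<^typ>\<open>'k\<close> is isomorphic to one whose underlying set
  consists of elements of \<^typ>\<open>nat \<Rightarrow> 'k\<close>, so with this choice of the carrier type
  \<^const>\<open>fdmod\<close> is a small category equivalent to \<open>A\<close>-mod.
\<close>

definition D' :: "('k::field, 'a) module \<Rightarrow> ('a, nat \<Rightarrow> 'k) endofunctor set" where
  "D' A = additive_closure A
     ({G \<in> lin_functors A. nat_iso A G (tensor_functor A (outer_bimod A (carrier A) (carrier A)))} \<union>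
      {G \<in> lin_functors A. \<exists>I. ideal I A \<and> nat_iso A G (Dp A I)})"

end

theory Submission
 imports Defs "HOL-Library.Function_Algebras"
begin

text \<open>
 The path algebra \<open>A\<close> of a tree quiver is the incidence algebra of a finite poset whose intervals are
 chains.  All functors \<open>Dp\<^sub>I\<close> and \<open>F\<^sub>i\<^sub>j\<close> are given by thin bimodules: such a bimodule has a basis
 indexed by an up-closed set \<open>S\<close> of pairs of vertices, and paths act by moving basis elements.  Ideals
 correspond to the sets \<open>S\<close> contained in the order relation, and \<open>F\<^sub>i\<^sub>j\<close> to the principal up-set of
 \<open>(i, j)\<close>.  If \<open>S\<close> is connected, all endomorphisms are scalars; hence an indecomposable \<open>1\<close>-morphism, through
 whose identity a sum of maps over thin functors factors, is itself thin with \<open>S\<close> connected.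

 Let \<open>S\<close> be connected and not principal.  It has two minimal elements with a common upper bound, and since
 intervals are chains they have the form \<open>(i, j)\<close>, \<open>(i', j')\<close> with paths from \<open>i\<close> to \<open>i'\<close> and from \<open>j\<close> to
 \<open>j'\<close>, and \<open>(i, j')\<close> not in \<open>S\<close>.  The functor of \<open>S\<close> is not a summand of \<open>U F\<^sub>k\<^sub>l W\<close>: as \<open>F\<^sub>k\<^sub>l\<close> is defined on
 all \<open>k\<close>-linear maps, the map induced by the path from \<open>j\<close> to \<open>j'\<close> has a generalized inverse there, and this
 would produce a nonzero component at \<open>(i, j')\<close>.  So if the functor of \<open>S\<close> is a summand of a product, all
 factors are given by nonprincipal ideals, and \<open>S\<close> is contained in the up-set of each factor; this gives
 the singleton cells.  The remaining cell structure comes from \<open>F\<^sub>i\<^sub>j F\<^sub>j\<^sub>l = F\<^sub>i\<^sub>l\<close>.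
\<close>

no_notation vwalk_join (infixr \<open>\<oplus>\<close> 65)

section \<open>Tensor products of abelian groups\<close>

text \<open>Membership in \<open>D' A\<close> is given up to isomorphism and up to summands, on
  modules of sequences, so no bimodule can simply be read off from a \<open>1\<close>-morphism. What
  stays visible is the value at a copy \<open>PA\<close> of the regular module: it has a left
  action, and a right action because right multiplications are endomorphisms of the regular module.
  A functor isomorphic to a tensor functor is generated by the images of elements of this value and
  has the matching universal property; these two facts replace the bimodule, and composites are
  computed on elements without forming products of bimodules. In place of a Krull-Schmidt argument,
  a decomposition is kept as an expression of an identity as a sum of maps through simpler functors.
  If all endomorphisms are scalars, an identity cannot be a sum of noninvertible maps, and this
  suffices both to recognize indecomposable functors and to replace arbitrary factors of a composite
  by indecomposable ones. The reason that nonprincipal sets stay apart from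
  \<open>F\<^sub>i\<^sub>j\<close> is that \<open>A e \<otimes> f A\<close> sees its argument as a
  vector space only, and every linear map of vector spaces has a generalized inverse.\<close>

definition add_hom :: "('a, 'm) ring_scheme \<Rightarrow> ('b, 'n) ring_scheme \<Rightarrow> ('a \<Rightarrow> 'b) \<Rightarrow> bool" where
 "add_hom M N f \<longleftrightarrow> (\<forall>x\<in>carrier M. f x \<in> carrier N) \<and>
   (\<forall>x\<in>carrier M. \<forall>y\<in>carrier M. f (x \<oplus>\<^bsub>M\<^esub> y) = f x \<oplus>\<^bsub>N\<^esub> f y)"

lemma add_homI:
 assumes "\<And>x. x \<in> carrier M \<Longrightarrow> f x \<in> carrier N"
  and "\<And>x y. x \<in> carrier M \<Longrightarrow> y \<in> carrier M \<Longrightarrow> f (x \<oplus>\<^bsub>M\<^esub> y) = f x \<oplus>\<^bsub>N\<^esub> f y"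
 shows "add_hom M N f"
 using assms by (simp add: add_hom_def)

lemma add_homD:
 assumes "add_hom M N f"
 shows "x \<in> carrier M \<Longrightarrow> f x \<in> carrier N"
  and "x \<in> carrier M \<Longrightarrow> y \<in> carrier M \<Longrightarrow> f (x \<oplus>\<^bsub>M\<^esub> y) = f x \<oplus>\<^bsub>N\<^esub> f y"
 using assms by (auto simp: add_hom_def)

lemma add_hom_zero:
 assumes "abelian_group M" "abelian_group N" "add_hom M N f"
 shows "f \<zero>\<^bsub>M\<^esub> = \<zero>\<^bsub>N\<^esub>"
proof -
 interpret M: abelian_group M by fact
 interpret N: abelian_group N by fact
 have "f \<zero>\<^bsub>M\<^esub> \<oplus>\<^bsub>N\<^esub> f \<zero>\<^bsub>M\<^esub> = f \<zero>\<^bsub>M\<^esub>"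
  using add_homD[OF assms(3)] by (metis M.l_zero M.zero_closed)
 then show ?thesis
  using add_homD[OF assms(3)] N.add.r_cancel_one' by (metis M.zero_closed)
qed

lemma add_hom_uminus:
 assumes "abelian_group M" "abelian_group N" "add_hom M N f" "x \<in> carrier M"
 shows "f (\<ominus>\<^bsub>M\<^esub> x) = \<ominus>\<^bsub>N\<^esub> f x"
proof -
 interpret M: abelian_group M by fact
 interpret N: abelian_group N by fact
 have "f (\<ominus>\<^bsub>M\<^esub> x) \<oplus>\<^bsub>N\<^esub> f x = \<zero>\<^bsub>N\<^esub>"
  using add_homD[OF assms(3)] add_hom_zero[OF assms(1-3)] assms(4)
  by (metis M.a_inv_closed M.l_neg)
 then show ?thesis
  using add_homD[OF assms(3)] assms(4) by (metis M.a_inv_closed N.minus_equality)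
qed

lemma add_hom_finsum:
 assumes "abelian_group M" "abelian_group N" "add_hom M N f" "finite S" "g \<in> S \<rightarrow> carrier M"
 shows "f (finsum M g S) = finsum N (\<lambda>s. f (g s)) S"
proof -
 interpret M: abelian_group M by fact
 interpret N: abelian_group N by fact
 show ?thesis
  using assms(4,5)
 proof (induction S)
  case empty
  then show ?case by (simp add: add_hom_zero[OF assms(1-3)])
 next
  case (insert s S)
  then show ?case
   using add_homD[OF assms(3)] by (auto simp: M.finsum_insert N.finsum_insert Pi_iff M.finsum_closed)
 qed
qed

text \<open>The submonoid generated by \<open>U\<close>; it is a subgroup in all uses.\<close>

inductive_set add_span :: "('a, 'm) ring_scheme \<Rightarrow> 'a set \<Rightarrow> 'a set" for M U where
 zero: "\<zero>\<^bsub>M\<^esub> \<in> add_span M U"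
| add: "x \<in> U \<Longrightarrow> y \<in> add_span M U \<Longrightarrow> x \<oplus>\<^bsub>M\<^esub> y \<in> add_span M U"

context abelian_group
begin

lemma add_span_closed: "x \<in> add_span G U \<Longrightarrow> U \<subseteq> carrier G \<Longrightarrow> x \<in> carrier G"
 by (induction rule: add_span.induct) auto

lemma add_span_incl: "x \<in> U \<Longrightarrow> U \<subseteq> carrier G \<Longrightarrow> x \<in> add_span G U"
 using add_span.add[OF _ add_span.zero, of x U G] by auto

lemma add_span_add:
 "x \<in> add_span G U \<Longrightarrow> y \<in> add_span G U \<Longrightarrow> U \<subseteq> carrier G \<Longrightarrow> x \<oplus> y \<in> add_span G U"
proof (induction rule: add_span.induct)
 case zero
 then show ?case using add_span_closed by auto
next
 case (add x z)
 then have "x \<oplus> (z \<oplus> y) \<in> add_span G U" by (auto intro: add_span.add)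
 moreover have "x \<oplus> (z \<oplus> y) = (x \<oplus> z) \<oplus> y"
  using add add_span_closed by (intro a_assoc[symmetric]) auto
 ultimately show ?case by simp
qed

lemma add_span_finsum:
 assumes "finite S" "U \<subseteq> carrier G" "\<And>s. s \<in> S \<Longrightarrow> g s \<in> add_span G U"
 shows "finsum G g S \<in> add_span G U"
 using assms(1,3)
proof (induction S)
 case empty
 then show ?case by (simp add: add_span.zero)
next
 case (insert s S)
 then have "g \<in> insert s S \<rightarrow> carrier G" using add_span_closed assms(2) by auto
 then show ?case using insert by (simp add: finsum_insert add_span_add assms(2) Pi_iff)
qed

end

lemma add_span_mono: "x \<in> add_span M U \<Longrightarrow> U \<subseteq> Y \<Longrightarrow> x \<in> add_span M Y"
 by (induction rule: add_span.induct) (auto intro: add_span.intros)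

text \<open>Nearly all identities between maps of modules are reduced by this to generators, such as
  elementary tensors, multiples of basis elements or images of a universal element.\<close>

lemma add_hom_eq_on_span:
 assumes "abelian_group M" "abelian_group N" "add_hom M N f" "add_hom M N g"
  and "U \<subseteq> carrier M" "\<And>x. x \<in> U \<Longrightarrow> f x = g x" "y \<in> add_span M U"
 shows "f y = g y"
 using assms(7)
proof (induction rule: add_span.induct)
 case zero
 then show ?case using add_hom_zero[OF assms(1-3)] add_hom_zero[OF assms(1,2,4)] by simp
next
 case (add x y)
 have "y \<in> carrier M" by (rule abelian_group.add_span_closed[OF assms(1) add(2) assms(5)])
 moreover have "x \<in> carrier M" "f x = g x" using add assms(5,6) by auto
 ultimately show ?case
  using add(3) add_homD(2)[OF assms(3), of x y] add_homD(2)[OF assms(4), of x y] by simp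
qed

definition pure_tensor where
 "pure_tensor R M N x y =
   tensor_kernel R M N #>\<^bsub>free_Abelian_group (carrier M \<times> carrier N)\<^esub> frag_of (x, y)"

definition balanced_map where
 "balanced_map R M N L \<beta> \<longleftrightarrow>
   (\<forall>x\<in>carrier M. \<forall>y\<in>carrier N. \<beta> x y \<in> carrier L) \<and>
   (\<forall>x\<in>carrier M. \<forall>x'\<in>carrier M. \<forall>y\<in>carrier N. \<beta> (x \<oplus>\<^bsub>M\<^esub> x') y = \<beta> x y \<oplus>\<^bsub>L\<^esub> \<beta> x' y) \<and>
   (\<forall>x\<in>carrier M. \<forall>y\<in>carrier N. \<forall>y'\<in>carrier N. \<beta> x (y \<oplus>\<^bsub>N\<^esub> y') = \<beta> x y \<oplus>\<^bsub>L\<^esub> \<beta> x y') \<and>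
   (\<forall>x\<in>carrier M. \<forall>r\<in>carrier R. \<forall>y\<in>carrier N. \<beta> (rsmult M x r) y = \<beta> x (r \<odot>\<^bsub>N\<^esub> y))"

lemma balanced_mapI:
 assumes "\<And>x y. x \<in> carrier M \<Longrightarrow> y \<in> carrier N \<Longrightarrow> \<beta> x y \<in> carrier L"
  and "\<And>x x' y. x \<in> carrier M \<Longrightarrow> x' \<in> carrier M \<Longrightarrow> y \<in> carrier N \<Longrightarrow>
   \<beta> (x \<oplus>\<^bsub>M\<^esub> x') y = \<beta> x y \<oplus>\<^bsub>L\<^esub> \<beta> x' y"
  and "\<And>x y y'. x \<in> carrier M \<Longrightarrow> y \<in> carrier N \<Longrightarrow> y' \<in> carrier N \<Longrightarrow>
   \<beta> x (y \<oplus>\<^bsub>N\<^esub> y') = \<beta> x y \<oplus>\<^bsub>L\<^esub> \<beta> x y'"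
  and "\<And>x r y. x \<in> carrier M \<Longrightarrow> r \<in> carrier R \<Longrightarrow> y \<in> carrier N \<Longrightarrow>
   \<beta> (rsmult M x r) y = \<beta> x (r \<odot>\<^bsub>N\<^esub> y)"
 shows "balanced_map R M N L \<beta>"
 using assms by (simp add: balanced_map_def)

text \<open>Only the structure that makes the relators well formed is fixed, so that one development
  serves tensor products over \<open>A\<close> (\<open>bimod_setup\<close>) and over the ground
  field (\<open>outer_setup\<close>).\<close>

locale tensor_setup =
 fixes R :: "('r, 's) ring_scheme" and M :: "('l, 'x, 'r) bimodule"
  and N :: "('r, 'y, 'm) module_scheme"
 assumes M: "abelian_group M" and N: "abelian_group N"
  and rsmult_closed: "x \<in> carrier M \<Longrightarrow> r \<in> carrier R \<Longrightarrow> rsmult M x r \<in> carrier M"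
  and lsmult_closed: "r \<in> carrier R \<Longrightarrow> y \<in> carrier N \<Longrightarrow> r \<odot>\<^bsub>N\<^esub> y \<in> carrier N"
begin

abbreviation FG where "FG \<equiv> free_Abelian_group (carrier M \<times> carrier N)"
abbreviation K where "K \<equiv> tensor_kernel R M N"
abbreviation T where "T \<equiv> tensor R M N"
abbreviation pt where "pt \<equiv> pure_tensor R M N"

sublocale M: abelian_group M by (rule M)
sublocale N: abelian_group N by (rule N)
sublocale FG: comm_group FG by (rule abelian_free_Abelian_group)

lemma relators_carrier: "tensor_relators R M N \<subseteq> carrier FG"
proof -
 have *: "frag_of p \<in> carrier FG" if "p \<in> carrier M \<times> carrier N" for p
  using that by simp
 have d: "a - b \<in> carrier FG" if "a \<in> carrier FG" "b \<in> carrier FG" for a b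
  using that keys_diff[of a b] by auto
 show ?thesis
  unfolding tensor_relators_def
  by (auto simp del: carrier_free_Abelian_group_iff frag_of_in_free_Abelian_group
    intro!: d * rsmult_closed lsmult_closed)
qed

lemma kernel_subgroup: "subgroup K FG"
 unfolding tensor_kernel_def by (rule FG.generate_is_subgroup[OF relators_carrier])

lemma kernel_normal: "K \<lhd> FG"
 by (rule FG.subgroup_imp_normal[OF kernel_subgroup])

lemma tensor_group_comm: "comm_group (tensor_group R M N)"
 unfolding tensor_group_def by (rule FG.abelian_FactGroup[OF kernel_subgroup])

lemma carrier_T: "carrier T = carrier (FG Mod K)"
 by (simp add: tensor_def tensor_group_def)

lemma add_T: "x \<oplus>\<^bsub>T\<^esub> y = x \<otimes>\<^bsub>FG Mod K\<^esub> y"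
 by (simp add: tensor_def tensor_group_def)

lemma abelian_group_tensor: "abelian_group T"
proof -
 interpret G: comm_group "tensor_group R M N" by (rule tensor_group_comm)
 show ?thesis
  by (rule abelian_groupI, simp_all add: tensor_def G.m_assoc G.l_inv_ex) (rule G.m_comm; assumption)
qed

sublocale T: abelian_group T by (rule abelian_group_tensor)

lemma coset_carrier: "f \<in> carrier FG \<Longrightarrow> K #>\<^bsub>FG\<^esub> f \<in> carrier T"
 unfolding carrier_T by (auto simp: FactGroup_def RCOSETS_def)

lemma coset_exhaust: "Z \<in> carrier T \<Longrightarrow> \<exists>f\<in>carrier FG. Z = K #>\<^bsub>FG\<^esub> f"
 unfolding carrier_T by (auto simp: FactGroup_def RCOSETS_def)

lemma coset_add: "f \<in> carrier FG \<Longrightarrow> g \<in> carrier FG \<Longrightarrow>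
  (K #>\<^bsub>FG\<^esub> f) \<oplus>\<^bsub>T\<^esub> (K #>\<^bsub>FG\<^esub> g) = K #>\<^bsub>FG\<^esub> (f + g)"
 unfolding add_T using normal.rcos_sum[OF kernel_normal] by (simp add: FactGroup_def)

lemma coset_eq: "f \<in> carrier FG \<Longrightarrow> g \<in> carrier FG \<Longrightarrow> f - g \<in> K \<Longrightarrow> K #>\<^bsub>FG\<^esub> f = K #>\<^bsub>FG\<^esub> g"
proof -
 assume a: "f \<in> carrier FG" "g \<in> carrier FG" "f - g \<in> K"
 have "f \<in> K #>\<^bsub>FG\<^esub> g"
  unfolding r_coset_def using a(3) by (auto intro!: bexI[of _ "f - g"])
 then show ?thesis using FG.repr_independence[OF _ a(2) kernel_subgroup] by simp
qed

lemma coset_zero: "K #>\<^bsub>FG\<^esub> 0 = \<zero>\<^bsub>T\<^esub>"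
 using FG.coset_mult_one[OF FG.generate_incl[OF relators_carrier]]
 by (simp add: tensor_def tensor_group_def FactGroup_def tensor_kernel_def)

lemma pt_closed: "x \<in> carrier M \<Longrightarrow> y \<in> carrier N \<Longrightarrow> pt x y \<in> carrier T"
 unfolding pure_tensor_def by (rule coset_carrier) simp

lemma relator_kernel: "r \<in> tensor_relators R M N \<Longrightarrow> r \<in> K"
 unfolding tensor_kernel_def by (rule generate.incl)

lemma pt_add_left:
 assumes "x \<in> carrier M" "x' \<in> carrier M" "y \<in> carrier N"
 shows "pt (x \<oplus>\<^bsub>M\<^esub> x') y = pt x y \<oplus>\<^bsub>T\<^esub> pt x' y"
proof -
 have f: "frag_of (x, y) \<in> carrier FG" "frag_of (x', y) \<in> carrier FG" using assms by auto
 then have "frag_of (x, y) + frag_of (x', y) \<in> carrier FG" by (metis FG.m_closed mult_free_Abelian_group)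
 moreover have "frag_of (x \<oplus>\<^bsub>M\<^esub> x', y) - (frag_of (x, y) + frag_of (x', y)) \<in> K"
  by (rule relator_kernel) (use assms in \<open>auto simp: tensor_relators_def diff_diff_eq\<close>)
 ultimately show ?thesis
  unfolding pure_tensor_def using assms by (subst coset_add[OF f]) (intro coset_eq; simp)
qed

lemma pt_add_right:
 assumes "x \<in> carrier M" "y \<in> carrier N" "y' \<in> carrier N"
 shows "pt x (y \<oplus>\<^bsub>N\<^esub> y') = pt x y \<oplus>\<^bsub>T\<^esub> pt x y'"
proof -
 have f: "frag_of (x, y) \<in> carrier FG" "frag_of (x, y') \<in> carrier FG" using assms by auto
 then have "frag_of (x, y) + frag_of (x, y') \<in> carrier FG" by (metis FG.m_closed mult_free_Abelian_group)
 moreover have "frag_of (x, y \<oplus>\<^bsub>N\<^esub> y') - (frag_of (x, y) + frag_of (x, y')) \<in> K"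
  by (rule relator_kernel) (use assms in \<open>auto simp: tensor_relators_def diff_diff_eq\<close>)
 ultimately show ?thesis
  unfolding pure_tensor_def using assms by (subst coset_add[OF f]) (intro coset_eq; simp)
qed

lemma pt_balanced:
 assumes "x \<in> carrier M" "r \<in> carrier R" "y \<in> carrier N"
 shows "pt (rsmult M x r) y = pt x (r \<odot>\<^bsub>N\<^esub> y)"
 unfolding pure_tensor_def
 by (rule coset_eq)
  (use assms in \<open>auto intro!: rsmult_closed lsmult_closed relator_kernel simp: tensor_relators_def\<close>)

lemma pt_balanced_map: "balanced_map R M N T pt"
 by (rule balanced_mapI) (auto simp: pt_closed pt_add_left pt_add_right pt_balanced)

lemma add_hom_pt_left: "y \<in> carrier N \<Longrightarrow> add_hom M T (\<lambda>x. pt x y)"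
 by (rule add_homI) (auto simp: pt_closed pt_add_left)

lemma tensor_generated:
 assumes "Z \<in> carrier T"
 shows "Z \<in> add_span T {pt x y | x y. x \<in> carrier M \<and> y \<in> carrier N}"
proof -
 let ?X = "{pt x y | x y. x \<in> carrier M \<and> y \<in> carrier N}"
 have U: "?X \<subseteq> carrier T" using pt_closed by auto
 \<comment> \<open>\<open>add_span\<close> closes under sums only. Negatives come along because
   \<open>- (x \<otimes> y) = (- x) \<otimes> y\<close> is again an elementary tensor.\<close>
 have neg: "\<ominus>\<^bsub>T\<^esub> Z \<in> add_span T ?X" if "Z \<in> add_span T ?X" for Z
  using that
 proof (induction rule: add_span.induct)
  case zero
  have "\<ominus>\<^bsub>T\<^esub> \<zero>\<^bsub>T\<^esub> = \<zero>\<^bsub>T\<^esub>" by (metis T.l_zero T.minus_equality T.zero_closed)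
  then show ?case by (metis add_span.zero)
 next
  case (add z Y)
  then obtain x y where xy: "z = pt x y" "x \<in> carrier M" "y \<in> carrier N" by auto
  have "\<ominus>\<^bsub>T\<^esub> z = pt (\<ominus>\<^bsub>M\<^esub> x) y"
   using add_hom_uminus[OF M abelian_group_tensor add_hom_pt_left xy(2)] xy by simp
  then have "\<ominus>\<^bsub>T\<^esub> z \<in> ?X" using xy by auto
  moreover have "\<ominus>\<^bsub>T\<^esub> (z \<oplus>\<^bsub>T\<^esub> Y) = \<ominus>\<^bsub>T\<^esub> z \<oplus>\<^bsub>T\<^esub> \<ominus>\<^bsub>T\<^esub> Y"
   using add U T.add_span_closed[OF _ U] by (intro T.minus_add) auto
  ultimately show ?case using add by (auto intro: add_span.add)
 qed
 obtain f where f: "f \<in> carrier FG" "Z = K #>\<^bsub>FG\<^esub> f" using coset_exhaust assms by blast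
 have "K #>\<^bsub>FG\<^esub> f \<in> add_span T ?X"
 proof (rule free_Abelian_group_induct[of f "carrier M \<times> carrier N"])
  show "Poly_Mapping.keys f \<subseteq> carrier M \<times> carrier N" using f by simp
  show "K #>\<^bsub>FG\<^esub> 0 \<in> add_span T ?X" by (simp add: coset_zero add_span.zero)
  show "K #>\<^bsub>FG\<^esub> frag_of a \<in> add_span T ?X" if "a \<in> carrier M \<times> carrier N" for a
   using that T.add_span_incl[OF _ U] by (auto simp: pure_tensor_def)
  fix a b
  assume a: "Poly_Mapping.keys a \<subseteq> carrier M \<times> carrier N" "Poly_Mapping.keys b \<subseteq> carrier M \<times> carrier N"
   "K #>\<^bsub>FG\<^esub> a \<in> add_span T ?X" "K #>\<^bsub>FG\<^esub> b \<in> add_span T ?X"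
  have c: "a \<in> carrier FG" "b \<in> carrier FG" "- b \<in> carrier FG" "a - b \<in> carrier FG"
   using a keys_diff[of a b] by auto
  have "(K #>\<^bsub>FG\<^esub> (- b)) \<oplus>\<^bsub>T\<^esub> (K #>\<^bsub>FG\<^esub> b) = \<zero>\<^bsub>T\<^esub>"
   by (subst coset_add[OF c(3,2)]) (simp add: coset_zero)
  then have "K #>\<^bsub>FG\<^esub> (- b) = \<ominus>\<^bsub>T\<^esub> (K #>\<^bsub>FG\<^esub> b)"
   using T.minus_equality coset_carrier c by metis
  then have "(K #>\<^bsub>FG\<^esub> a) \<oplus>\<^bsub>T\<^esub> (K #>\<^bsub>FG\<^esub> (- b)) \<in> add_span T ?X"
   using neg[OF a(4)] a(3) T.add_span_add U by simp
  then show "K #>\<^bsub>FG\<^esub> (a - b) \<in> add_span T ?X"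
   by (subst (asm) coset_add[OF c(1,3)]) simp
 qed
 then show ?thesis using f by simp
qed

text \<open>The map \<open>\<beta>\<close> extends to the free abelian group; the extension kills
  every relator by balancedness, hence the subgroup they generate, and so factors through the
  quotient.\<close>

lemma tensor_lift:
 assumes L: "abelian_group L" and \<beta>: "balanced_map R M N L \<beta>"
 obtains h where "add_hom T L h" "\<And>x y. x \<in> carrier M \<Longrightarrow> y \<in> carrier N \<Longrightarrow> h (pt x y) = \<beta> x y"
proof -
 interpret L: abelian_group L by fact
 have "(\<lambda>(x, y). \<beta> x y) ` (carrier M \<times> carrier N) \<subseteq> carrier (add_monoid L)"
  using \<beta> by (auto simp: balanced_map_def)
 then obtain g where g: "g \<in> hom FG (add_monoid L)"
   "\<And>p. p \<in> carrier M \<times> carrier N \<Longrightarrow> g (frag_of p) = (\<lambda>(x, y). \<beta> x y) p"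
  using comm_group.free_Abelian_group_universal[OF L.a_comm_group] by blast
 interpret g: group_hom FG "add_monoid L" g
  by unfold_locales (rule g(1))
 have g_diff: "g (a - b) = g a \<ominus>\<^bsub>L\<^esub> g b" if "a \<in> carrier FG" "b \<in> carrier FG" for a b
 proof -
  have "g (a \<otimes>\<^bsub>FG\<^esub> inv\<^bsub>FG\<^esub> b) = g a \<otimes>\<^bsub>add_monoid L\<^esub> inv\<^bsub>add_monoid L\<^esub> g b"
   using that by (metis FG.inv_closed g.hom_inv g.hom_mult)
  then show ?thesis using that by (simp add: a_minus_def a_inv_def)
 qed
 have "tensor_relators R M N \<subseteq> kernel FG (add_monoid L) g"
 proof
  fix r assume r: "r \<in> tensor_relators R M N"
  have d: "a - b \<in> carrier FG" if "a \<in> carrier FG" "b \<in> carrier FG" for a b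
   using that keys_diff[of a b] by auto
  have fr: "frag_of (x, y) \<in> carrier FG" if "x \<in> carrier M" "y \<in> carrier N" for x y using that by simp
  have gf: "g (frag_of (x, y)) = \<beta> x y" if "x \<in> carrier M" "y \<in> carrier N" for x y using g(2) that by simp
  have b: "\<beta> x y \<in> carrier L" if "x \<in> carrier M" "y \<in> carrier N" for x y
   using \<beta> that by (auto simp: balanced_map_def)
  have z: "(p \<oplus>\<^bsub>L\<^esub> q) \<ominus>\<^bsub>L\<^esub> p \<ominus>\<^bsub>L\<^esub> q = \<zero>\<^bsub>L\<^esub>" if "p \<in> carrier L" "q \<in> carrier L" for p q
   using that by (simp add: a_minus_def L.a_comm[of p q] L.a_assoc L.r_neg L.r_neg2)
  have "g r = \<zero>\<^bsub>L\<^esub>"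
   using r \<beta> z
   unfolding tensor_relators_def balanced_map_def
   by (auto simp: g_diff d fr gf b rsmult_closed lsmult_closed L.r_neg a_minus_def
     simp del: carrier_free_Abelian_group_iff frag_of_in_free_Abelian_group)
  then show "r \<in> kernel FG (add_monoid L) g" using r relators_carrier by (auto simp: kernel_def simp del: carrier_free_Abelian_group_iff)
 qed
 then have "K \<subseteq> kernel FG (add_monoid L) g"
  unfolding tensor_kernel_def by (rule FG.generate_subgroup_incl[OF _ g.subgroup_kernel])
 then obtain h where h: "h \<in> hom (FG Mod K) (add_monoid L)" "\<And>f. f \<in> carrier FG \<Longrightarrow> h (K #>\<^bsub>FG\<^esub> f) = g f"
  using g.FactGroup_universal_kernel[OF kernel_normal] by metis
 show ?thesis
 proof
  show "add_hom T L h"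
   using h(1) by (auto simp: add_hom_def carrier_T add_T hom_def)
  show "h (pt x y) = \<beta> x y" if "x \<in> carrier M" "y \<in> carrier N" for x y
   unfolding pure_tensor_def using that h(2)[of "frag_of (x, y)"] g(2) by simp
 qed
qed

lemma tensor_hom_eq:
 assumes "abelian_group L" "add_hom T L g" "add_hom T L h"
  and "\<And>x y. x \<in> carrier M \<Longrightarrow> y \<in> carrier N \<Longrightarrow> g (pt x y) = h (pt x y)" "Z \<in> carrier T"
 shows "g Z = h Z"
proof -
 have "{pt x y | x y. x \<in> carrier M \<and> y \<in> carrier N} \<subseteq> carrier T" using pt_closed by auto
 moreover have "g z = h z" if "z \<in> {pt x y | x y. x \<in> carrier M \<and> y \<in> carrier N}" for z
  using that assms(4) by auto
 ultimately show ?thesis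
  using add_hom_eq_on_span[OF abelian_group_tensor assms(1-3)] tensor_generated[OF assms(5)] by blast
qed

end

text \<open>\<open>tensor_map\<close> is a union over all representatives of a coset. The universal
  property gives a homomorphism \<open>h\<close> with the right values on elementary tensors, and
  every representative yields the coset predicted by \<open>h\<close>, so the union is a single
  coset.\<close>

lemma tensor_map_add_hom:
 assumes "tensor_setup R M N" "tensor_setup R' M' N'"
  and \<phi>: "balanced_map R' M' N' (tensor R M N) (\<lambda>x y. pure_tensor R M N (fst (\<phi> (x, y))) (snd (\<phi> (x, y))))"
  and \<phi>c: "\<And>x y. x \<in> carrier M' \<Longrightarrow> y \<in> carrier N' \<Longrightarrow> \<phi> (x, y) \<in> carrier M \<times> carrier N"
 shows "add_hom (tensor R' M' N') (tensor R M N) (tensor_map R M N \<phi>)"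
  and "\<And>x y. x \<in> carrier M' \<Longrightarrow> y \<in> carrier N' \<Longrightarrow>
   tensor_map R M N \<phi> (pure_tensor R' M' N' x y) =
   pure_tensor R M N (fst (\<phi> (x, y))) (snd (\<phi> (x, y)))"
proof -
 interpret S: tensor_setup R M N by fact
 interpret S': tensor_setup R' M' N' by fact
 obtain h where h: "add_hom S'.T S.T h"
  "\<And>x y. x \<in> carrier M' \<Longrightarrow> y \<in> carrier N' \<Longrightarrow> h (S'.pt x y) = S.pt (fst (\<phi> (x, y))) (snd (\<phi> (x, y)))"
  using S'.tensor_lift[OF S.abelian_group_tensor \<phi>] by metis
 let ?e = "frag_extend (\<lambda>p. frag_of (\<phi> p))"
 have key: "?e f \<in> carrier S.FG \<and> S.K #>\<^bsub>S.FG\<^esub> ?e f = h (S'.K #>\<^bsub>S'.FG\<^esub> f)" if f: "f \<in> carrier S'.FG" for f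
 proof (rule free_Abelian_group_induct[of f "carrier M' \<times> carrier N'"])
  show "Poly_Mapping.keys f \<subseteq> carrier M' \<times> carrier N'" using f by simp
  show "?e 0 \<in> carrier S.FG \<and> S.K #>\<^bsub>S.FG\<^esub> ?e 0 = h (S'.K #>\<^bsub>S'.FG\<^esub> 0)"
   using add_hom_zero[OF S'.abelian_group_tensor S.abelian_group_tensor h(1)]
   by (simp add: S.coset_zero S'.coset_zero)
  show "?e (frag_of a) \<in> carrier S.FG \<and> S.K #>\<^bsub>S.FG\<^esub> ?e (frag_of a) = h (S'.K #>\<^bsub>S'.FG\<^esub> frag_of a)"
   if "a \<in> carrier M' \<times> carrier N'" for a
   using that h(2)[of "fst a" "snd a"] \<phi>c[of "fst a" "snd a"] by (auto simp: pure_tensor_def)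
  fix a b
  assume a: "Poly_Mapping.keys a \<subseteq> carrier M' \<times> carrier N'" "Poly_Mapping.keys b \<subseteq> carrier M' \<times> carrier N'"
   and ia: "?e a \<in> carrier S.FG \<and> S.K #>\<^bsub>S.FG\<^esub> ?e a = h (S'.K #>\<^bsub>S'.FG\<^esub> a)"
   and ib: "?e b \<in> carrier S.FG \<and> S.K #>\<^bsub>S.FG\<^esub> ?e b = h (S'.K #>\<^bsub>S'.FG\<^esub> b)"
  have c: "a - b \<in> carrier S'.FG" "b \<in> carrier S'.FG" "a \<in> carrier S'.FG"
   using a keys_diff[of a b] by auto
  have c': "?e a - ?e b \<in> carrier S.FG" using ia ib keys_diff[of "?e a" "?e b"] by auto
  have "h (S'.K #>\<^bsub>S'.FG\<^esub> (a - b)) \<oplus>\<^bsub>S.T\<^esub> h (S'.K #>\<^bsub>S'.FG\<^esub> b) = h (S'.K #>\<^bsub>S'.FG\<^esub> a)"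
   using c add_homD(2)[OF h(1), symmetric] S'.coset_carrier S'.coset_add by simp
  moreover have "(S.K #>\<^bsub>S.FG\<^esub> (?e a - ?e b)) \<oplus>\<^bsub>S.T\<^esub> (S.K #>\<^bsub>S.FG\<^esub> ?e b) = S.K #>\<^bsub>S.FG\<^esub> ?e a"
   using S.coset_add[OF c' conjunct1[OF ib]] by simp
  ultimately have "S.K #>\<^bsub>S.FG\<^esub> (?e a - ?e b) = h (S'.K #>\<^bsub>S'.FG\<^esub> (a - b))"
   using ia ib c c' S.coset_carrier S'.coset_carrier add_homD(1)[OF h(1)]
   by (metis S.T.add.right_cancel)
  then show "?e (a - b) \<in> carrier S.FG \<and> S.K #>\<^bsub>S.FG\<^esub> ?e (a - b) = h (S'.K #>\<^bsub>S'.FG\<^esub> (a - b))"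
   using c' by (simp add: frag_extend_diff)
 qed
 have eq: "tensor_map R M N \<phi> Z = h Z" if Z: "Z \<in> carrier S'.T" for Z
 proof -
  obtain f where f: "f \<in> carrier S'.FG" "Z = S'.K #>\<^bsub>S'.FG\<^esub> f" using S'.coset_exhaust Z by blast
  have *: "S.K #>\<^bsub>S.FG\<^esub> ?e g = h Z" if g: "g \<in> Z" for g
  proof -
   have "g \<in> carrier S'.FG"
    using g f subgroup.elemrcos_carrier[OF S'.kernel_subgroup S'.FG.is_group f(1)] by simp
   moreover have "S'.K #>\<^bsub>S'.FG\<^esub> g = Z"
    using S'.FG.repr_independence[OF _ f(1) S'.kernel_subgroup] g f(2) by simp
   ultimately show ?thesis using key by auto
  qed
  have "f \<in> Z" using f S'.FG.rcos_self[OF f(1) S'.kernel_subgroup] by simp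
  then show ?thesis unfolding tensor_map_def using * by blast
 qed
 show "add_hom S'.T S.T (tensor_map R M N \<phi>)"
  using h(1) eq by (auto simp: add_hom_def)
 show "tensor_map R M N \<phi> (S'.pt x y) = S.pt (fst (\<phi> (x, y))) (snd (\<phi> (x, y)))"
  if "x \<in> carrier M'" "y \<in> carrier N'" for x y
  using eq[OF S'.pt_closed[OF that]] h(2)[OF that] by simp
qed

section \<open>Algebras, modules and linear functors\<close>

context left_module
begin

lemma lsmult_zero_left: "x \<in> carrier M \<Longrightarrow> \<zero>\<^bsub>R\<^esub> \<odot>\<^bsub>M\<^esub> x = \<zero>\<^bsub>M\<^esub>"
 using lsmult_l_distr[of "\<zero>\<^bsub>R\<^esub>" "\<zero>\<^bsub>R\<^esub>" x] lsmult_closed[of "\<zero>\<^bsub>R\<^esub>" x]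
 by (simp add: M.add.r_cancel_one')

lemma add_hom_lsmult: "a \<in> carrier R \<Longrightarrow> add_hom M M (\<lambda>x. a \<odot>\<^bsub>M\<^esub> x)"
 by (rule add_homI) (auto simp: lsmult_closed lsmult_r_distr)

lemma add_hom_lsmult_left: "x \<in> carrier M \<Longrightarrow> add_hom R M (\<lambda>a. a \<odot>\<^bsub>M\<^esub> x)"
 by (rule add_homI) (auto simp: lsmult_closed lsmult_l_distr)

lemma M_abelian: "abelian_group M" ..

lemma lsmult_zero_right: "a \<in> carrier R \<Longrightarrow> a \<odot>\<^bsub>M\<^esub> \<zero>\<^bsub>M\<^esub> = \<zero>\<^bsub>M\<^esub>"
 by (rule add_hom_zero[OF M_abelian M_abelian add_hom_lsmult])

end

type_synonym ('a, 'k) mod_k = "('a, nat \<Rightarrow> 'k) module"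
type_synonym ('a, 'k) endo_k = "('a, nat \<Rightarrow> 'k) endofunctor"

abbreviation "el F M x \<equiv> x \<in> carrier (obj F M)"

text \<open>Finite dimension is stated through \<open>add_span\<close> and not through coefficient
  families, so that claims about all of \<open>A\<close> can be proved by induction over sums of
  multiples of generators.\<close>

locale kalg = ring A for A :: "('k::field, 'a) module" (structure) +
 assumes ksmult_closed: "a \<in> carrier A \<Longrightarrow> c \<odot> a \<in> carrier A"
  and ksmult_l_distr: "a \<in> carrier A \<Longrightarrow> (c + d) \<odot> a = c \<odot> a \<oplus> d \<odot> a"
  and ksmult_r_distr: "a \<in> carrier A \<Longrightarrow> b \<in> carrier A \<Longrightarrow>
   c \<odot> (a \<oplus> b) = c \<odot> a \<oplus> c \<odot> b"
  and ksmult_assoc: "a \<in> carrier A \<Longrightarrow> (c * d) \<odot> a = c \<odot> (d \<odot> a)"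
  and ksmult_one: "a \<in> carrier A \<Longrightarrow> 1 \<odot> a = a"
  and ksmult_mult_left: "a \<in> carrier A \<Longrightarrow> b \<in> carrier A \<Longrightarrow>
   (c \<odot> a) \<otimes> b = c \<odot> (a \<otimes> b)"
  and ksmult_mult_right: "a \<in> carrier A \<Longrightarrow> b \<in> carrier A \<Longrightarrow>
   a \<otimes> (c \<odot> b) = c \<odot> (a \<otimes> b)"
  and fin_gen: "\<exists>S. finite S \<and> S \<subseteq> carrier A \<and>
   carrier A \<subseteq> add_span A {c \<odot> s | c s. s \<in> S}"
begin

abbreviation "fd M \<equiv> M \<in> fdmod A"
abbreviation "lin F \<equiv> F \<in> lin_functors A"

abbreviation sc :: "'k \<Rightarrow> 'a" where "sc c \<equiv> c \<odot> \<one>"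

lemma A_ring: "ring A" ..

lemma A_abelian: "abelian_group A" ..

lemma sc_closed: "sc c \<in> carrier A"
 by (simp add: ksmult_closed)

lemma sc_mult: "a \<in> carrier A \<Longrightarrow> sc c \<otimes> a = c \<odot> a"
 by (simp add: ksmult_mult_left)

lemma mult_sc: "a \<in> carrier A \<Longrightarrow> a \<otimes> sc c = c \<odot> a"
 by (simp add: ksmult_mult_right)

lemma sc_central: "a \<in> carrier A \<Longrightarrow> a \<otimes> sc c = sc c \<otimes> a"
 by (simp add: sc_mult mult_sc)

lemma sc_add: "sc (c + d) = sc c \<oplus> sc d"
 by (simp add: ksmult_l_distr)

lemma sc_times: "sc (c * d) = sc c \<otimes> sc d"
 by (simp add: ksmult_assoc sc_mult ksmult_closed)

lemma sc_one: "sc 1 = \<one>"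
 by (simp add: ksmult_one)

lemma sc_zero: "sc 0 = \<zero>"
 using sc_add[of 0 0] sc_closed[of 0] by (simp add: add.r_cancel_one')

lemma ksmult_zero: "a \<in> carrier A \<Longrightarrow> 0 \<odot> a = \<zero>"
 using sc_mult[of a 0] by (simp add: sc_zero)

lemma ksmult_zero_right: "c \<odot> \<zero> = \<zero>"
 using sc_mult[of "\<zero>" c] by (simp add: sc_closed)

lemma lmod_ks:
 fixes M :: "('a, 'u) module"
 assumes "left_module A M" "x \<in> carrier M"
 shows lmod_ks_closed: "kscale A M c x \<in> carrier M"
  and lmod_ks_add: "kscale A M (c + d) x = kscale A M c x \<oplus>\<^bsub>M\<^esub> kscale A M d x"
  and lmod_ks_mult: "kscale A M (c * d) x = kscale A M c (kscale A M d x)"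
  and lmod_ks_one: "kscale A M 1 x = x"
  and lmod_ks_zero: "kscale A M 0 x = \<zero>\<^bsub>M\<^esub>"
  and lmod_ks_comm: "a \<in> carrier A \<Longrightarrow> a \<odot>\<^bsub>M\<^esub> kscale A M c x = kscale A M c (a \<odot>\<^bsub>M\<^esub> x)"
proof -
 interpret M: left_module A M by fact
 note [simp] = sc_closed assms(2)
 show "kscale A M c x \<in> carrier M" by (simp add: kscale_def M.lsmult_closed)
 show "kscale A M (c + d) x = kscale A M c x \<oplus>\<^bsub>M\<^esub> kscale A M d x"
  by (simp add: kscale_def sc_add M.lsmult_l_distr)
 show "kscale A M (c * d) x = kscale A M c (kscale A M d x)"
  by (simp add: kscale_def sc_times M.lsmult_assoc)
 show "kscale A M 1 x = x" by (simp add: kscale_def sc_one M.lsmult_one)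
 show "kscale A M 0 x = \<zero>\<^bsub>M\<^esub>" by (simp add: kscale_def sc_zero M.lsmult_zero_left)
 show "a \<odot>\<^bsub>M\<^esub> kscale A M c x = kscale A M c (a \<odot>\<^bsub>M\<^esub> x)" if "a \<in> carrier A"
  using that by (simp add: kscale_def sc_central flip: M.lsmult_assoc)
qed

definition kspan :: "('a, 'u) module \<Rightarrow> 'u set \<Rightarrow> 'u set" where
 "kspan M S = add_span M {kscale A M c s | c s. s \<in> S}"

lemma kscale_set_closed:
 "left_module A M \<Longrightarrow> S \<subseteq> carrier M \<Longrightarrow> {kscale A M c s | c s. s \<in> S} \<subseteq> carrier M"
 by (auto simp: lmod_ks_closed subset_iff)

lemma fdmodI:
 fixes M :: "('a, 'u) module"
 assumes lm: "left_module A M" and S: "finite S" "S \<subseteq> carrier M" "carrier M \<subseteq> kspan M S"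
 shows "fd M"
proof -
 interpret M: left_module A M by fact
 have "\<exists>c. x = finsum M (\<lambda>s. kscale A M (c s) s) S" if "x \<in> kspan M S" for x
  using that unfolding kspan_def
 proof (induction rule: add_span.induct)
  case zero
  have "finsum M (\<lambda>s. kscale A M 0 s) S = finsum M (\<lambda>s. \<zero>\<^bsub>M\<^esub>) S"
   by (rule M.add.finprod_cong') (use S lmod_ks_zero[OF lm] in auto)
  then show ?case by (intro exI[of _ "\<lambda>_. 0"]) simp
 next
  case (add x y)
  then obtain d t c where dt: "x = kscale A M d t" "t \<in> S" "y = finsum M (\<lambda>s. kscale A M (c s) s) S"
   by blast
  have ks: "kscale A M e s \<in> carrier M" if "s \<in> S" for e s using that S lmod_ks_closed[OF lm] by auto
  \<comment> \<open>Adding a multiple of \<open>t\<close> alters the coefficient at \<open>t\<close>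
    alone; the term at \<open>t\<close> is split off, changed and put back.\<close>
  define c' where "c' = c(t := d + c t)"
  have "finsum M (\<lambda>s. kscale A M (c' s) s) S =
     kscale A M (c' t) t \<oplus>\<^bsub>M\<^esub> finsum M (\<lambda>s. kscale A M (c' s) s) (S - {t})"
   using M.finsum_insert[of "S - {t}" t "\<lambda>s. kscale A M (c' s) s"] S dt ks
   by (simp add: insert_absorb insert_Diff Pi_iff)
  also have "finsum M (\<lambda>s. kscale A M (c' s) s) (S - {t}) = finsum M (\<lambda>s. kscale A M (c s) s) (S - {t})"
   by (rule M.add.finprod_cong') (use ks in \<open>auto simp: c'_def\<close>)
  also have "kscale A M (c' t) t = kscale A M d t \<oplus>\<^bsub>M\<^esub> kscale A M (c t) t"
   using dt S lmod_ks_add[OF lm] by (auto simp: c'_def)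
  also have "(kscale A M d t \<oplus>\<^bsub>M\<^esub> kscale A M (c t) t) \<oplus>\<^bsub>M\<^esub> finsum M (\<lambda>s. kscale A M (c s) s) (S - {t})
    = kscale A M d t \<oplus>\<^bsub>M\<^esub> (kscale A M (c t) t \<oplus>\<^bsub>M\<^esub> finsum M (\<lambda>s. kscale A M (c s) s) (S - {t}))"
   using dt ks by (intro M.a_assoc) (auto intro!: M.finsum_closed)
  also have "kscale A M (c t) t \<oplus>\<^bsub>M\<^esub> finsum M (\<lambda>s. kscale A M (c s) s) (S - {t}) =
    finsum M (\<lambda>s. kscale A M (c s) s) S"
   using M.finsum_insert[of "S - {t}" t "\<lambda>s. kscale A M (c s) s"] S dt ks
   by (simp add: insert_absorb insert_Diff Pi_iff)
  finally show ?case using dt by metis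
 qed
 then show ?thesis using assms by (auto simp: fdmod_def)
qed

lemma fdmod_lmod: "fd M \<Longrightarrow> left_module A M"
 by (simp add: fdmod_def)

lemma fdmod_kspan:
 fixes M :: "('a, 'u) module"
 assumes "fd M"
 obtains S where "finite S" "S \<subseteq> carrier M" "carrier M \<subseteq> kspan M S"
proof -
 interpret M: left_module A M using assms by (rule fdmod_lmod)
 obtain S where S: "finite S" "S \<subseteq> carrier M"
   "\<And>x. x \<in> carrier M \<Longrightarrow> \<exists>c. x = finsum M (\<lambda>s. kscale A M (c s) s) S"
  using assms by (auto simp: fdmod_def)
 note c = kscale_set_closed[OF fdmod_lmod[OF assms] S(2)]
 have "x \<in> kspan M S" if x: "x \<in> carrier M" for x
 proof -
  obtain c where "x = finsum M (\<lambda>s. kscale A M (c s) s) S" using S(3)[OF x] by blast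
  moreover have "finsum M (\<lambda>s. kscale A M (c s) s) S \<in> kspan M S"
   unfolding kspan_def
  proof (rule M.add_span_finsum[OF S(1) c])
   show "kscale A M (c s) s \<in> add_span M {kscale A M c s | c s. s \<in> S}" if "s \<in> S" for s
    by (rule M.add_span_incl[OF _ c]) (use that in blast)
  qed
  ultimately show ?thesis by simp
 qed
 then show ?thesis using that S by blast
qed

lemma m_ab: "fd M \<Longrightarrow> abelian_group M"
 by (rule left_module.M_abelian[OF fdmod_lmod])

lemma m_closed: "fd M \<Longrightarrow> a \<in> carrier A \<Longrightarrow> x \<in> carrier M \<Longrightarrow> a \<odot>\<^bsub>M\<^esub> x \<in> carrier M"
 by (rule left_module.lsmult_closed[OF fdmod_lmod])

lemma m_add_left: "fd M \<Longrightarrow> a \<in> carrier A \<Longrightarrow> b \<in> carrier A \<Longrightarrow> x \<in> carrier M \<Longrightarrow>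
  (a \<oplus> b) \<odot>\<^bsub>M\<^esub> x = a \<odot>\<^bsub>M\<^esub> x \<oplus>\<^bsub>M\<^esub> b \<odot>\<^bsub>M\<^esub> x"
 by (rule left_module.lsmult_l_distr[OF fdmod_lmod])

lemma m_add_right: "fd M \<Longrightarrow> a \<in> carrier A \<Longrightarrow> x \<in> carrier M \<Longrightarrow> y \<in> carrier M \<Longrightarrow>
  a \<odot>\<^bsub>M\<^esub> (x \<oplus>\<^bsub>M\<^esub> y) = a \<odot>\<^bsub>M\<^esub> x \<oplus>\<^bsub>M\<^esub> a \<odot>\<^bsub>M\<^esub> y"
 by (rule left_module.lsmult_r_distr[OF fdmod_lmod])

lemma m_mult: "fd M \<Longrightarrow> a \<in> carrier A \<Longrightarrow> b \<in> carrier A \<Longrightarrow> x \<in> carrier M \<Longrightarrow>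
  (a \<otimes> b) \<odot>\<^bsub>M\<^esub> x = a \<odot>\<^bsub>M\<^esub> (b \<odot>\<^bsub>M\<^esub> x)"
 by (rule left_module.lsmult_assoc[OF fdmod_lmod])

lemma m_one: "fd M \<Longrightarrow> x \<in> carrier M \<Longrightarrow> \<one> \<odot>\<^bsub>M\<^esub> x = x"
 by (rule left_module.lsmult_one[OF fdmod_lmod])

lemma m_zero_left: "fd M \<Longrightarrow> x \<in> carrier M \<Longrightarrow> \<zero> \<odot>\<^bsub>M\<^esub> x = \<zero>\<^bsub>M\<^esub>"
 by (rule left_module.lsmult_zero_left[OF fdmod_lmod])

lemma m_zero_right: "fd M \<Longrightarrow> a \<in> carrier A \<Longrightarrow> a \<odot>\<^bsub>M\<^esub> \<zero>\<^bsub>M\<^esub> = \<zero>\<^bsub>M\<^esub>"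
 by (rule left_module.lsmult_zero_right[OF fdmod_lmod])

lemma m_zero_closed: "fd M \<Longrightarrow> \<zero>\<^bsub>M\<^esub> \<in> carrier M"
 by (rule abelian_monoid.zero_closed[OF abelian_group.axioms(1)[OF m_ab]])

lemma m_add_closed: "fd M \<Longrightarrow> x \<in> carrier M \<Longrightarrow> y \<in> carrier M \<Longrightarrow> x \<oplus>\<^bsub>M\<^esub> y \<in> carrier M"
 by (rule abelian_monoid.a_closed[OF abelian_group.axioms(1)[OF m_ab]])

lemmas ks_closed = lmod_ks_closed[OF fdmod_lmod]
lemmas ks_add = lmod_ks_add[OF fdmod_lmod]
lemmas ks_mult = lmod_ks_mult[OF fdmod_lmod]
lemmas ks_one = lmod_ks_one[OF fdmod_lmod]
lemmas ks_zero = lmod_ks_zero[OF fdmod_lmod]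
lemmas ks_comm = lmod_ks_comm[OF fdmod_lmod]

lemma ks_add_right: "fd M \<Longrightarrow> x \<in> carrier M \<Longrightarrow> y \<in> carrier M \<Longrightarrow>
  kscale A M c (x \<oplus>\<^bsub>M\<^esub> y) = kscale A M c x \<oplus>\<^bsub>M\<^esub> kscale A M c y"
 by (simp add: kscale_def m_add_right sc_closed)

text \<open>Members of \<open>mhom\<close> are extensional, which lambda terms and pointwise
  composites are not. This predicate drops extensionality, and \<open>lin_mhom\<close> restores it
  by \<open>restrict\<close>; \<open>ntr\<close> relates to \<open>nat_trans\<close> in the same
  way.\<close>

definition lin_map :: "('a, 'u) module \<Rightarrow> ('a, 'w) module \<Rightarrow> ('u \<Rightarrow> 'w) \<Rightarrow> bool" where
 "lin_map M N f \<longleftrightarrow> add_hom M N f \<and>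
   (\<forall>a\<in>carrier A. \<forall>x\<in>carrier M. f (a \<odot>\<^bsub>M\<^esub> x) = a \<odot>\<^bsub>N\<^esub> f x)"

lemma lin_mapI:
 assumes "\<And>x. x \<in> carrier M \<Longrightarrow> f x \<in> carrier N"
  and "\<And>x y. x \<in> carrier M \<Longrightarrow> y \<in> carrier M \<Longrightarrow> f (x \<oplus>\<^bsub>M\<^esub> y) = f x \<oplus>\<^bsub>N\<^esub> f y"
  and "\<And>a x. a \<in> carrier A \<Longrightarrow> x \<in> carrier M \<Longrightarrow> f (a \<odot>\<^bsub>M\<^esub> x) = a \<odot>\<^bsub>N\<^esub> f x"
 shows "lin_map M N f"
 using assms by (auto simp: lin_map_def add_hom_def)

lemma lin_mapD:
 assumes "lin_map M N f"
 shows "x \<in> carrier M \<Longrightarrow> f x \<in> carrier N"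
  and "x \<in> carrier M \<Longrightarrow> y \<in> carrier M \<Longrightarrow> f (x \<oplus>\<^bsub>M\<^esub> y) = f x \<oplus>\<^bsub>N\<^esub> f y"
  and "a \<in> carrier A \<Longrightarrow> x \<in> carrier M \<Longrightarrow> f (a \<odot>\<^bsub>M\<^esub> x) = a \<odot>\<^bsub>N\<^esub> f x"
  and "add_hom M N f"
 using assms by (auto simp: lin_map_def add_hom_def)

lemma lin_map_ks: "lin_map M N f \<Longrightarrow> x \<in> carrier M \<Longrightarrow> f (kscale A M c x) = kscale A N c (f x)"
 by (simp add: kscale_def lin_mapD(3) sc_closed)

lemma lin_map_zero: "fd M \<Longrightarrow> fd N \<Longrightarrow> lin_map M N f \<Longrightarrow> f \<zero>\<^bsub>M\<^esub> = \<zero>\<^bsub>N\<^esub>"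
 by (rule add_hom_zero[OF m_ab m_ab lin_mapD(4)])

lemma mhom_lin: "f \<in> mhom A M N \<Longrightarrow> lin_map M N f"
 by (rule lin_mapI) (auto simp: mhom_def PiE_def Pi_iff)

lemma lin_mhom:
 "lin_map M N f \<Longrightarrow> fd M \<Longrightarrow> restrict f (carrier M) \<in> mhom A M N"
 by (auto simp: mhom_def lin_mapD m_closed m_add_closed)

lemma lin_map_comp: "lin_map L M f \<Longrightarrow> lin_map M N g \<Longrightarrow> lin_map L N (\<lambda>x. g (f x))"
 by (rule lin_mapI) (simp_all add: lin_mapD)

lemma mhom_comp: "fd L \<Longrightarrow> f \<in> mhom A L M \<Longrightarrow> g \<in> mhom A M N \<Longrightarrow> compose (carrier L) g f \<in> mhom A L N"
 unfolding compose_def by (rule lin_mhom[OF lin_map_comp]) (auto dest: mhom_lin)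

lemma mhom_eqI:
 "f \<in> mhom A M N \<Longrightarrow> g \<in> mhom A M N \<Longrightarrow> (\<And>x. x \<in> carrier M \<Longrightarrow> f x = g x) \<Longrightarrow> f = g"
 by (rule PiE_ext[of _ "carrier M" "\<lambda>_. carrier N"]) (auto simp: mhom_def)

definition ntr :: "('a, 'u, 'v) mod_functor \<Rightarrow> ('a, 'u, 'w) mod_functor
   \<Rightarrow> (('a, 'u) module \<Rightarrow> 'v \<Rightarrow> 'w) \<Rightarrow> bool" where
 "ntr F G \<eta> \<longleftrightarrow> (\<forall>M\<in>fdmod A. lin_map (obj F M) (obj G M) (\<eta> M)) \<and>
   (\<forall>M\<in>fdmod A. \<forall>N\<in>fdmod A. \<forall>f\<in>mhom A M N. \<forall>x\<in>carrier (obj F M).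
    \<eta> N (mor F M N f x) = mor G M N f (\<eta> M x))"

lemma ntrI:
 assumes "\<And>M. fd M \<Longrightarrow> lin_map (obj F M) (obj G M) (\<eta> M)"
  and "\<And>M N f x. fd M \<Longrightarrow> fd N \<Longrightarrow> f \<in> mhom A M N \<Longrightarrow> el F M x \<Longrightarrow>
   \<eta> N (mor F M N f x) = mor G M N f (\<eta> M x)"
 shows "ntr F G \<eta>"
 using assms by (simp add: ntr_def)

lemma ntr_lin: "ntr F G \<eta> \<Longrightarrow> fd M \<Longrightarrow> lin_map (obj F M) (obj G M) (\<eta> M)"
 by (simp add: ntr_def)

lemma ntr_nat: "ntr F G \<eta> \<Longrightarrow> fd M \<Longrightarrow> fd N \<Longrightarrow> f \<in> mhom A M N \<Longrightarrow> el F M x \<Longrightarrow>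
   \<eta> N (mor F M N f x) = mor G M N f (\<eta> M x)"
 by (simp add: ntr_def)

lemmas ntr_closed = lin_mapD(1)[OF ntr_lin]
lemmas ntr_add = lin_mapD(2)[OF ntr_lin]
lemmas ntr_smult = lin_mapD(3)[OF ntr_lin]

lemma lf_obj: "lin F \<Longrightarrow> fd M \<Longrightarrow> obj F M \<in> fdmod A"
 by (simp add: lin_functors_def)

lemma lf_mor: "lin F \<Longrightarrow> fd M \<Longrightarrow> fd N \<Longrightarrow> f \<in> mhom A M N \<Longrightarrow>
  mor F M N f \<in> mhom A (obj F M) (obj F N)"
 by (simp add: lin_functors_def)

lemmas lf_lin = mhom_lin[OF lf_mor]
lemmas lf_closed = lin_mapD(1)[OF lf_lin]

lemma lf_id: "lin F \<Longrightarrow> fd M \<Longrightarrow> el F M x \<Longrightarrow>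
  mor F M M (\<lambda>x\<in>carrier M. x) x = x"
 by (simp add: lin_functors_def)

lemma lf_comp: "lin F \<Longrightarrow> fd L \<Longrightarrow> fd M \<Longrightarrow> fd N \<Longrightarrow>
  f \<in> mhom A L M \<Longrightarrow> g \<in> mhom A M N \<Longrightarrow> el F L x \<Longrightarrow>
  mor F L N (compose (carrier L) g f) x = mor F M N g (mor F L M f x)"
 by (simp add: lin_functors_def compose_def)

lemma lf_add: "lin F \<Longrightarrow> fd M \<Longrightarrow> fd N \<Longrightarrow>
  f \<in> mhom A M N \<Longrightarrow> g \<in> mhom A M N \<Longrightarrow> el F M x \<Longrightarrow>
  mor F M N (\<lambda>x\<in>carrier M. f x \<oplus>\<^bsub>N\<^esub> g x) x = mor F M N f x \<oplus>\<^bsub>obj F N\<^esub> mor F M N g x"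
 by (simp add: lin_functors_def)

lemma lf_ks: "lin F \<Longrightarrow> fd M \<Longrightarrow> fd N \<Longrightarrow>
  f \<in> mhom A M N \<Longrightarrow> el F M x \<Longrightarrow>
  mor F M N (\<lambda>x\<in>carrier M. kscale A N c (f x)) x = kscale A (obj F N) c (mor F M N f x)"
 by (simp add: lin_functors_def)

text \<open>Pointwise equations suffice because both sides are extensional on a carrier. For this,
  sums and scalar multiples of homomorphisms first have to be recognized as homomorphisms.\<close>

lemma lin_functorsI:
 assumes "\<And>M. fd M \<Longrightarrow> obj F M \<in> fdmod A"
  and mor: "\<And>M N f. fd M \<Longrightarrow> fd N \<Longrightarrow> f \<in> mhom A M N \<Longrightarrow> mor F M N f \<in> mhom A (obj F M) (obj F N)"
  and "\<And>M x. fd M \<Longrightarrow> el F M x \<Longrightarrow> mor F M M (\<lambda>x\<in>carrier M. x) x = x"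
  and "\<And>L M N f g x. fd L \<Longrightarrow> fd M \<Longrightarrow> fd N \<Longrightarrow>
   f \<in> mhom A L M \<Longrightarrow> g \<in> mhom A M N \<Longrightarrow> el F L x \<Longrightarrow>
   mor F L N (compose (carrier L) g f) x = mor F M N g (mor F L M f x)"
  and "\<And>M N f g x. fd M \<Longrightarrow> fd N \<Longrightarrow>
   f \<in> mhom A M N \<Longrightarrow> g \<in> mhom A M N \<Longrightarrow> el F M x \<Longrightarrow>
   mor F M N (\<lambda>x\<in>carrier M. f x \<oplus>\<^bsub>N\<^esub> g x) x = mor F M N f x \<oplus>\<^bsub>obj F N\<^esub> mor F M N g x"
  and "\<And>M N f x c. fd M \<Longrightarrow> fd N \<Longrightarrow>
   f \<in> mhom A M N \<Longrightarrow> el F M x \<Longrightarrow>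
   mor F M N (\<lambda>x\<in>carrier M. kscale A N c (f x)) x = kscale A (obj F N) c (mor F M N f x)"
 shows "lin F"
proof -
 have ext: "f = restrict g (carrier M)" if "f \<in> mhom A M N" "\<And>x. x \<in> carrier M \<Longrightarrow> f x = g x"
  for f g and M :: "('a, 'c) module" and N :: "('a, 'd) module"
  using that by (auto simp: mhom_def PiE_def extensional_def restrict_def)
 have id: "(\<lambda>x\<in>carrier M. x) \<in> mhom A M M" if "fd M" for M :: "('a, 'b) module"
  by (rule lin_mhom[OF _ that]) (rule lin_mapI; simp)
 have add: "(\<lambda>x\<in>carrier M. f x \<oplus>\<^bsub>N\<^esub> g x) \<in> mhom A M N"
  if "fd M" "fd N" "f \<in> mhom A M N" "g \<in> mhom A M N" for M N :: "('a, 'b) module" and f g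
 proof (rule lin_mhom[OF _ that(1)], rule lin_mapI)
  note Nfd = that(2)
  interpret N: abelian_group N by (rule m_ab[OF Nfd])
  note f = lin_mapD[OF mhom_lin[OF that(3)]] and g = lin_mapD[OF mhom_lin[OF that(4)]]
  show "f x \<oplus>\<^bsub>N\<^esub> g x \<in> carrier N" if "x \<in> carrier M" for x using f g that by simp
  show "f (x \<oplus>\<^bsub>M\<^esub> y) \<oplus>\<^bsub>N\<^esub> g (x \<oplus>\<^bsub>M\<^esub> y) = f x \<oplus>\<^bsub>N\<^esub> g x \<oplus>\<^bsub>N\<^esub> (f y \<oplus>\<^bsub>N\<^esub> g y)"
   if "x \<in> carrier M" "y \<in> carrier M" for x y
   using f g that by (simp add: N.a_ac)
  show "f (a \<odot>\<^bsub>M\<^esub> x) \<oplus>\<^bsub>N\<^esub> g (a \<odot>\<^bsub>M\<^esub> x) = a \<odot>\<^bsub>N\<^esub> (f x \<oplus>\<^bsub>N\<^esub> g x)"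
   if "a \<in> carrier A" "x \<in> carrier M" for a x
   using f g that by (simp add: m_add_right[OF Nfd])
 qed
 have ks: "(\<lambda>x\<in>carrier M. kscale A N c (f x)) \<in> mhom A M N"
  if "fd M" "fd N" "f \<in> mhom A M N" for M N :: "('a, 'b) module" and f c
  using lin_mapD[OF mhom_lin[OF that(3)]]
  by (intro lin_mhom[OF _ that(1)] lin_mapI)
   (auto simp: ks_closed[OF that(2)] ks_add_right[OF that(2)] ks_comm[OF that(2)])
 show ?thesis
  unfolding lin_functors_def mem_Collect_eq compose_def
  apply (intro conjI ballI allI)
  subgoal by (rule assms(1))
  subgoal by (rule mor)
  subgoal by (rule ext[OF mor[OF _ _ id]]) (auto simp: assms)
  subgoal by (rule ext[OF mor]) (auto simp: assms mhom_comp simp flip: compose_def)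
  subgoal by (rule ext[OF mor[OF _ _ add]]) (auto simp: assms)
  subgoal by (rule ext[OF mor[OF _ _ ks]]) (auto simp: assms)
  done
qed

lemma nat_trans_ntr: "nat_trans A F G \<eta> \<Longrightarrow> ntr F G \<eta>"
 unfolding nat_trans_def
 by (rule ntrI) (auto dest: mhom_lin simp: compose_def restrict_def fun_eq_iff split: if_splits)

lemma ntr_nat_trans:
 assumes "ntr F G \<eta>" "lin F"
 shows "nat_trans A F G (\<lambda>M. restrict (\<eta> M) (carrier (obj F M)))"
 unfolding nat_trans_def
proof (intro conjI ballI)
 show "restrict (\<eta> M) (carrier (obj F M)) \<in> mhom A (obj F M) (obj G M)" if "fd M" for M
  by (rule lin_mhom[OF ntr_lin[OF assms(1) that] lf_obj[OF assms(2) that]])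
 show "compose (carrier (obj F M)) (restrict (\<eta> N) (carrier (obj F N))) (mor F M N f) =
    compose (carrier (obj F M)) (mor G M N f) (restrict (\<eta> M) (carrier (obj F M)))"
  if "fd M" "fd N" "f \<in> mhom A M N" for M N f
  using ntr_nat[OF assms(1) that] lf_closed[OF assms(2) that] by (auto simp: compose_def)
qed

lemma ntr_comp: "ntr F G \<eta> \<Longrightarrow> ntr G H \<theta> \<Longrightarrow> ntr F H (\<lambda>M x. \<theta> M (\<eta> M x))"
 by (rule ntrI) (auto intro: lin_map_comp dest: ntr_lin simp: ntr_nat ntr_closed)

lemma ntr_id: "ntr F F (\<lambda>M x. x)"
 by (rule ntrI) (auto intro: lin_mapI)

lemma nat_isoD:
 assumes "nat_iso A F G"
 obtains \<eta> \<theta> where "ntr F G \<eta>" "ntr G F \<theta>"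
  "\<And>M x. fd M \<Longrightarrow> el F M x \<Longrightarrow> \<theta> M (\<eta> M x) = x"
  "\<And>M y. fd M \<Longrightarrow> el G M y \<Longrightarrow> \<eta> M (\<theta> M y) = y"
proof -
 obtain \<eta> \<theta> where *: "nat_trans A F G \<eta>" "nat_trans A G F \<theta>"
  "\<forall>M\<in>fdmod A. (\<forall>x\<in>carrier (obj F M). \<theta> M (\<eta> M x) = x) \<and>
         (\<forall>y\<in>carrier (obj G M). \<eta> M (\<theta> M y) = y)"
  using assms unfolding nat_iso_def by (elim exE conjE)
 show thesis
  by (rule that[OF nat_trans_ntr[OF *(1)] nat_trans_ntr[OF *(2)]]) (simp_all add: *(3))
qed

lemma nat_isoI:
 assumes "lin F" "lin G" "ntr F G \<eta>" "ntr G F \<theta>"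
  and "\<And>M x. fd M \<Longrightarrow> el F M x \<Longrightarrow> \<theta> M (\<eta> M x) = x"
  and "\<And>M y. fd M \<Longrightarrow> el G M y \<Longrightarrow> \<eta> M (\<theta> M y) = y"
 shows "nat_iso A F G"
 unfolding nat_iso_def
 using ntr_nat_trans[OF assms(3,1)] ntr_nat_trans[OF assms(4,2)] assms ntr_closed[OF assms(3)] ntr_closed[OF assms(4)]
 by (intro exI[of _ "\<lambda>M. restrict (\<eta> M) (carrier (obj F M))"] exI[of _ "\<lambda>M. restrict (\<theta> M) (carrier (obj G M))"]) simp

lemma nat_iso_sym: "nat_iso A F G \<Longrightarrow> nat_iso A G F"
 unfolding nat_iso_def by blast

lemma nat_iso_trans:
 assumes "lin F" "lin H" "nat_iso A F G" "nat_iso A G H"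
 shows "nat_iso A F H"
proof -
 obtain \<eta> \<theta> where 1: "ntr F G \<eta>" "ntr G F \<theta>"
  "\<And>M x. fd M \<Longrightarrow> el F M x \<Longrightarrow> \<theta> M (\<eta> M x) = x"
  "\<And>M y. fd M \<Longrightarrow> el G M y \<Longrightarrow> \<eta> M (\<theta> M y) = y"
  by (rule nat_isoD[OF assms(3)]) blast
 obtain \<eta>' \<theta>' where 2: "ntr G H \<eta>'" "ntr H G \<theta>'"
  "\<And>M x. fd M \<Longrightarrow> el G M x \<Longrightarrow> \<theta>' M (\<eta>' M x) = x"
  "\<And>M y. fd M \<Longrightarrow> el H M y \<Longrightarrow> \<eta>' M (\<theta>' M y) = y"
  by (rule nat_isoD[OF assms(4)]) blast
 show ?thesis
  by (rule nat_isoI[OF assms(1,2) ntr_comp[OF 1(1) 2(1)] ntr_comp[OF 2(2) 1(2)]])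
   (simp_all add: 1 2 ntr_closed[OF 1(1)] ntr_closed[OF 2(2)])
qed

lemma functor_comp_lin:
 fixes F :: "('a, 'u, 'v) mod_functor" and H :: "('a, 'v, 'w) mod_functor"
 assumes H: "lin H" and F: "lin F"
 shows "H \<circ>\<^sub>F F \<in> lin_functors A"
proof (rule lin_functorsI, unfold functor_comp_def mod_functor.simps)
 fix L M N :: "('a, 'u) module" and f g x c
 assume M: "fd M"
 note oM = lf_obj[OF F M]
 show "obj H (obj F M) \<in> fdmod A" by (rule lf_obj[OF H oM])
 show "mor H (obj F M) (obj F M) (mor F M M (\<lambda>x\<in>carrier M. x)) x = x" if "x \<in> carrier (obj H (obj F M))"
 proof -
  have "mor F M M (\<lambda>x\<in>carrier M. x) = (\<lambda>x\<in>carrier (obj F M). x)" using F M by (simp add: lin_functors_def)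
  then show ?thesis using lf_id[OF H oM that] by simp
 qed
 assume N: "fd N"
 note oN = lf_obj[OF F N]
 show "mor H (obj F M) (obj F N) (mor F M N f) \<in> mhom A (obj H (obj F M)) (obj H (obj F N))"
  if "f \<in> mhom A M N" by (intro lf_mor H oM oN F M N that)
 show "mor H (obj F M) (obj F N) (mor F M N (\<lambda>x\<in>carrier M. f x \<oplus>\<^bsub>N\<^esub> g x)) x =
   mor H (obj F M) (obj F N) (mor F M N f) x \<oplus>\<^bsub>obj H (obj F N)\<^esub> mor H (obj F M) (obj F N) (mor F M N g) x"
  if "f \<in> mhom A M N" "g \<in> mhom A M N" "x \<in> carrier (obj H (obj F M))"
 proof -
  have "mor F M N (\<lambda>x\<in>carrier M. f x \<oplus>\<^bsub>N\<^esub> g x) = (\<lambda>x\<in>carrier (obj F M). mor F M N f x \<oplus>\<^bsub>obj F N\<^esub> mor F M N g x)"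
   using F M N that by (simp add: lin_functors_def)
  then show ?thesis using lf_add[OF H oM oN lf_mor[OF F M N that(1)] lf_mor[OF F M N that(2)] that(3)] by simp
 qed
 show "mor H (obj F M) (obj F N) (mor F M N (\<lambda>x\<in>carrier M. kscale A N c (f x))) x =
   kscale A (obj H (obj F N)) c (mor H (obj F M) (obj F N) (mor F M N f) x)"
  if "f \<in> mhom A M N" "x \<in> carrier (obj H (obj F M))"
 proof -
  have "mor F M N (\<lambda>x\<in>carrier M. kscale A N c (f x)) = (\<lambda>x\<in>carrier (obj F M). kscale A (obj F N) c (mor F M N f x))"
   using F M N that by (simp add: lin_functors_def)
  then show ?thesis using lf_ks[OF H oM oN lf_mor[OF F M N that(1)] that(2)] by simp
 qed
 assume L: "fd L"
 note oL = lf_obj[OF F L]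
 show "mor H (obj F L) (obj F N) (mor F L N (compose (carrier L) g f)) x =
   mor H (obj F M) (obj F N) (mor F M N g) (mor H (obj F L) (obj F M) (mor F L M f) x)"
  if "f \<in> mhom A L M" "g \<in> mhom A M N" "x \<in> carrier (obj H (obj F L))"
 proof -
  have "mor F L N (compose (carrier L) g f) = compose (carrier (obj F L)) (mor F M N g) (mor F L M f)"
   using F L M N that by (simp add: lin_functors_def)
  then show ?thesis
   using lf_comp[OF H oL oM oN lf_mor[OF F L M that(1)] lf_mor[OF F M N that(2)] that(3)] by simp
 qed
qed

end

section \<open>Transport of functors and bimodules\<close>

definition transport :: "('u \<Rightarrow> 'w) \<Rightarrow> ('a, 'u) module \<Rightarrow> ('a, 'w) module" where
 "transport \<phi> M =
  \<lparr> carrier = \<phi> ` carrier M, monoid.mult = undefined, one = undefined, zero = \<phi> \<zero>\<^bsub>M\<^esub>,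
   ring.add = (\<lambda>x y. \<phi> (inv_into (carrier M) \<phi> x \<oplus>\<^bsub>M\<^esub> inv_into (carrier M) \<phi> y)),
   module.smult = (\<lambda>a x. \<phi> (a \<odot>\<^bsub>M\<^esub> inv_into (carrier M) \<phi> x)) \<rparr>"

lemma transport_simps:
 assumes "inj_on \<phi> (carrier M)"
 shows "carrier (transport \<phi> M) = \<phi> ` carrier M"
  and "\<zero>\<^bsub>transport \<phi> M\<^esub> = \<phi> \<zero>\<^bsub>M\<^esub>"
  and "x \<in> carrier M \<Longrightarrow> y \<in> carrier M \<Longrightarrow> \<phi> x \<oplus>\<^bsub>transport \<phi> M\<^esub> \<phi> y = \<phi> (x \<oplus>\<^bsub>M\<^esub> y)"
  and "x \<in> carrier M \<Longrightarrow> a \<odot>\<^bsub>transport \<phi> M\<^esub> \<phi> x = \<phi> (a \<odot>\<^bsub>M\<^esub> x)"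
  and "x \<in> carrier M \<Longrightarrow> inv_into (carrier M) \<phi> (\<phi> x) = x"
 using assms by (simp_all add: transport_def)

context kalg
begin

lemma transport_lmod:
 fixes M :: "('a, 'u) module"
 assumes "left_module A M" "inj_on \<phi> (carrier M)"
 shows "left_module A (transport \<phi> M)"
proof -
 interpret M: left_module A M by fact
 note [simp] = transport_simps[OF assms(2)] M.lsmult_closed
 have "abelian_group (transport \<phi> M)"
 proof (rule abelian_groupI)
  show "\<exists>y\<in>carrier (transport \<phi> M). y \<oplus>\<^bsub>transport \<phi> M\<^esub> x = \<zero>\<^bsub>transport \<phi> M\<^esub>"
   if x: "x \<in> carrier (transport \<phi> M)" for x
  proof -
   obtain x' where "x = \<phi> x'" "x' \<in> carrier M" using x by auto
   then show ?thesis by (intro bexI[of _ "\<phi> (\<ominus>\<^bsub>M\<^esub> x')"]) (auto simp: M.l_neg)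
  qed
 qed (auto simp: M.a_ac)
 moreover have "left_module_axioms A (transport \<phi> M)"
  by unfold_locales
   (auto simp: M.lsmult_l_distr M.lsmult_r_distr M.lsmult_assoc M.lsmult_one)
 ultimately show ?thesis using A_ring by (simp add: left_module_def)
qed

lemma transport_lin:
 fixes M :: "('a, 'u) module"
 assumes "fd M" "inj_on \<phi> (carrier M)"
 shows "lin_map M (transport \<phi> M) \<phi>"
  and "lin_map (transport \<phi> M) M (inv_into (carrier M) \<phi>)"
 by (rule lin_mapI; auto simp: transport_simps[OF assms(2)] m_closed[OF assms(1)] m_add_closed[OF assms(1)])+

lemma transport_fdmod:
 fixes M :: "('a, 'u) module"
 assumes "fd M" "inj_on \<phi> (carrier M)"
 shows "transport \<phi> M \<in> fdmod A"
proof -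
 obtain S where S: "finite S" "S \<subseteq> carrier M" "carrier M \<subseteq> kspan M S"
  by (rule fdmod_kspan[OF assms(1)])
 interpret M: left_module A M by (rule fdmod_lmod[OF assms(1)])
 note c = kscale_set_closed[OF fdmod_lmod[OF assms(1)] S(2)]
 have "\<phi> x \<in> kspan (transport \<phi> M) (\<phi> ` S)" if "x \<in> kspan M S" for x
  using that unfolding kspan_def
 proof (induction rule: add_span.induct)
  case zero
  then show ?case using add_span.zero[of "transport \<phi> M"] by (simp add: transport_simps[OF assms(2)])
 next
  case (add x y)
  have y: "y \<in> carrier M" by (rule M.add_span_closed[OF add(2) c])
  obtain d s where s: "x = kscale A M d s" "s \<in> S" using add by blast
  have x: "x \<in> carrier M" using add c by blast
  have "\<phi> x = kscale A (transport \<phi> M) d (\<phi> s)"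
   using s S by (auto simp: lin_map_ks[OF transport_lin(1)[OF assms]])
  then have "\<phi> x \<in> {kscale A (transport \<phi> M) c s | c s. s \<in> \<phi> ` S}" using s by blast
  moreover have "\<phi> (x \<oplus>\<^bsub>M\<^esub> y) = \<phi> x \<oplus>\<^bsub>transport \<phi> M\<^esub> \<phi> y"
   by (rule transport_simps(3)[OF assms(2) x y, symmetric])
  ultimately show ?case using add_span.add[OF _ add(3)] by simp
 qed
 then have "carrier (transport \<phi> M) \<subseteq> kspan (transport \<phi> M) (\<phi> ` S)"
  using S(3) by (auto simp: transport_simps[OF assms(2)])
 moreover have "finite (\<phi> ` S)" "\<phi> ` S \<subseteq> carrier (transport \<phi> M)"
  using S by (auto simp: transport_simps[OF assms(2)])
 ultimately show ?thesis
  by (intro fdmodI[OF transport_lmod[OF fdmod_lmod[OF assms(1)] assms(2)]])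
qed

text \<open>For each element a coefficient family over a finite spanning set is chosen and indexed
  by natural numbers. An element is recovered from its chosen coefficients, so equal coefficients
  force equal elements, whether or not the spanning set is independent.\<close>

lemma fdmod_inj:
 fixes M :: "('a, 'u) module"
 assumes "fd M"
 shows "\<exists>\<phi> :: 'u \<Rightarrow> nat \<Rightarrow> 'k. inj_on \<phi> (carrier M)"
proof -
 obtain S where S: "finite S" "S \<subseteq> carrier M"
   "\<forall>x\<in>carrier M. \<exists>c. x = finsum M (\<lambda>s. kscale A M (c s) s) S"
  using assms unfolding fdmod_def by blast
 interpret M: left_module A M by (rule fdmod_lmod[OF assms])
 obtain e where e: "bij_betw e {..<card S} S"
  using ex_bij_betw_nat_finite[OF S(1)] by (auto simp: atLeast0LessThan)
 obtain c where c: "\<And>x. x \<in> carrier M \<Longrightarrow> x = finsum M (\<lambda>s. kscale A M (c x s) s) S"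
  using bchoice[OF S(3)] by blast
 have "inj_on (\<lambda>x i. c x (e i)) (carrier M)"
 proof (rule inj_onI)
  fix x y assume xy: "x \<in> carrier M" "y \<in> carrier M" "(\<lambda>i. c x (e i)) = (\<lambda>i. c y (e i))"
  have cs: "c x s = c y s" if s: "s \<in> S" for s
  proof -
   have "s \<in> e ` {..<card S}" using s e by (simp add: bij_betw_def)
   then obtain i where "e i = s" by (elim imageE) simp
   then show ?thesis using xy(3) by (auto dest: fun_cong[of _ _ i])
  qed
  have "finsum M (\<lambda>s. kscale A M (c x s) s) S = finsum M (\<lambda>s. kscale A M (c y s) s) S"
   by (rule M.add.finprod_cong') (use S cs ks_closed[OF assms] in auto)
  then show "x = y" using c[OF xy(1)] c[OF xy(2)] by simp
 qed
 then show ?thesis by blast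
qed

text \<open>A tensor functor takes values in a type of cosets and is no endofunctor of the small
  module category. Copying each value along an injection into sequences gives an isomorphic functor
  of the right type; members of \<open>D' A\<close> are produced in this way.\<close>

lemma functor_transport:
 fixes F :: "('a, 'u, 'w) mod_functor"
 assumes F: "lin F"
 shows "\<exists>G :: ('a, 'u, nat \<Rightarrow> 'k) mod_functor. lin G \<and> nat_iso A G F"
proof -
 define \<phi> where "\<phi> M = (SOME \<phi> :: 'w \<Rightarrow> nat \<Rightarrow> 'k. inj_on \<phi> (carrier (obj F M)))" for M
 have \<phi>: "inj_on (\<phi> M) (carrier (obj F M))" if "fd M" for M
  unfolding \<phi>_def by (rule someI_ex[OF fdmod_inj[OF lf_obj[OF F that]]])
 define iv where "iv M = inv_into (carrier (obj F M)) (\<phi> M)" for M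
 define G :: "('a, 'u, nat \<Rightarrow> 'k) mod_functor" where
  "G = \<lparr> obj = (\<lambda>M. transport (\<phi> M) (obj F M)),
      mor = (\<lambda>M N f. \<lambda>y\<in>\<phi> M ` carrier (obj F M). \<phi> N (mor F M N f (iv M y))) \<rparr>"
 have G: "obj G M = transport (\<phi> M) (obj F M)" for M by (simp add: G_def)
 have ca: "carrier (obj G M) = \<phi> M ` carrier (obj F M)" for M by (simp add: G transport_def)
 have iv: "iv M (\<phi> M x) = x" if "fd M" "el F M x" for M x
  using that \<phi> by (simp add: iv_def)
 have mG: "mor G M N f (\<phi> M x) = \<phi> N (mor F M N f x)" if "fd M" "el F M x" for M N f x
  using that by (simp add: G_def iv)
 have l1: "lin_map (obj F M) (obj G M) (\<phi> M)" if "fd M" for M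
  unfolding G by (rule transport_lin(1)[OF lf_obj[OF F that] \<phi>[OF that]])
 have l2: "lin_map (obj G M) (obj F M) (iv M)" if "fd M" for M
  unfolding G iv_def by (rule transport_lin(2)[OF lf_obj[OF F that] \<phi>[OF that]])
 have fdG: "obj G M \<in> fdmod A" if "fd M" for M
  unfolding G by (rule transport_fdmod[OF lf_obj[OF F that] \<phi>[OF that]])
 have Glin: "lin G"
 proof (rule lin_functorsI)
  fix L M N :: "('a, 'u) module" and f g c x
  assume M: "fd M"
  show "obj G M \<in> fdmod A" by (rule fdG[OF M])
  show "mor G M M (\<lambda>x\<in>carrier M. x) x = x" if "el G M x"
   using that by (auto simp: ca mG[OF M] lf_id[OF F M])
  assume N: "fd N"
  show "mor G M N f \<in> mhom A (obj G M) (obj G N)" if "f \<in> mhom A M N"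
  proof -
   have "lin_map (obj G M) (obj G N) (\<lambda>y. \<phi> N (mor F M N f (iv M y)))"
    by (rule lin_map_comp[OF lin_map_comp[OF l2[OF M] lf_lin[OF F M N that]] l1[OF N]])
   from lin_mhom[OF this fdG[OF M]] show ?thesis by (simp add: G_def transport_def)
  qed
  show "mor G M N (\<lambda>x\<in>carrier M. f x \<oplus>\<^bsub>N\<^esub> g x) x = mor G M N f x \<oplus>\<^bsub>obj G N\<^esub> mor G M N g x"
   if "f \<in> mhom A M N" "g \<in> mhom A M N" "el G M x"
   using that(3)
   by (auto simp: ca mG[OF M] lf_add[OF F M N that(1,2)] lin_mapD(2)[OF l1[OF N]] lf_closed[OF F M N] that(1,2))
  show "mor G M N (\<lambda>x\<in>carrier M. kscale A N c (f x)) x = kscale A (obj G N) c (mor G M N f x)"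
   if "f \<in> mhom A M N" "el G M x"
   using that(2)
   by (auto simp: ca mG[OF M] lf_ks[OF F M N that(1)] lin_map_ks[OF l1[OF N]] lf_closed[OF F M N] that(1))
  assume L: "fd L"
  show "mor G L N (compose (carrier L) g f) x = mor G M N g (mor G L M f x)"
   if "f \<in> mhom A L M" "g \<in> mhom A M N" "el G L x"
   using that(3)
   by (auto simp: ca mG[OF M] mG[OF L] lf_comp[OF F L M N that(1,2)] lf_closed[OF F L M] that(1))
 qed
 have "nat_iso A G F"
 proof (rule nat_isoI[OF Glin F])
  show "ntr G F iv"
   by (rule ntrI[OF l2]) (auto simp: ca mG iv lf_closed[OF F])
  show "ntr F G \<phi>"
   by (rule ntrI[OF l1]) (auto simp: mG)
 qed (auto simp: ca iv)
 then show ?thesis using Glin by blast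
qed

section \<open>The regular module and the actions it induces\<close>

definition regular :: "('a, 'a) module" where
 "regular = \<lparr> carrier = carrier A, monoid.mult = undefined, one = undefined, zero = \<zero>,
   ring.add = ring.add A, module.smult = monoid.mult A \<rparr>"

lemma regular_simps:
 "carrier regular = carrier A" "\<zero>\<^bsub>regular\<^esub> = \<zero>" "x \<oplus>\<^bsub>regular\<^esub> y = x \<oplus> y"
 "a \<odot>\<^bsub>regular\<^esub> x = a \<otimes> x"
 by (simp_all add: regular_def)

lemma regular_fdmod: "regular \<in> fdmod A"
proof -
 have "\<exists>y\<in>carrier A. y \<oplus> x = \<zero>" if "x \<in> carrier A" for x
  using l_neg[OF that] a_inv_closed[OF that] by (rule bexI)
 then have "abelian_group regular"
  by (intro abelian_groupI) (simp_all add: regular_simps a_ac)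
 then have lm: "left_module A regular"
  using A_ring by (auto simp: left_module_def left_module_axioms_def regular_simps l_distr r_distr m_assoc)
 obtain S where S: "finite S" "S \<subseteq> carrier A" "carrier A \<subseteq> add_span A {c \<odot> s | c s. s \<in> S}"
  using fin_gen by blast
 have "kscale A regular c s = c \<odot> s" if "s \<in> S" for c s
  using that S by (auto simp: kscale_def regular_simps sc_mult)
 then have "{kscale A regular c s | c s. s \<in> S} = {c \<odot> s | c s. s \<in> S}"
  by (intro Collect_cong ex_cong1) auto
 moreover have "x \<in> add_span regular U" if "x \<in> add_span A U" for x U
  using that
  by (induction rule: add_span.induct)
   (use add_span.zero[of regular U] add_span.add[of _ U _ regular] in \<open>auto simp: regular_simps\<close>)
 ultimately have "carrier regular \<subseteq> kspan regular S"
  using S(3) by (auto simp: kspan_def regular_simps)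
 then show ?thesis by (intro fdmodI[OF lm S(1)]) (use S in \<open>auto simp: regular_simps\<close>)
qed

text \<open>An endofunctor in \<open>D' A\<close> can be evaluated only on modules of sequences, so
  the regular module needs a copy \<open>PA\<close> of that kind; \<open>jA\<close> and
  \<open>jinv\<close> identify the two.\<close>

definition jA :: "'a \<Rightarrow> nat \<Rightarrow> 'k" where "jA = (SOME \<phi>. inj_on \<phi> (carrier A))"
definition jinv :: "(nat \<Rightarrow> 'k) \<Rightarrow> 'a" where "jinv = inv_into (carrier A) jA"
definition PA :: "('a, 'k) mod_k" where "PA = transport jA regular"

lemma jA_inj: "inj_on jA (carrier A)"
 unfolding jA_def using someI_ex[OF fdmod_inj[OF regular_fdmod]] by (simp add: regular_simps)

lemma jA_inj': "inj_on jA (carrier regular)"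
 using jA_inj by (simp add: regular_simps)

lemma PA_fdmod: "PA \<in> fdmod A"
 unfolding PA_def by (rule transport_fdmod[OF regular_fdmod jA_inj'])

lemma carrier_PA: "carrier PA = jA ` carrier A"
 by (simp add: PA_def transport_def regular_simps)

lemma jA_closed: "a \<in> carrier A \<Longrightarrow> jA a \<in> carrier PA"
 by (simp add: carrier_PA)

lemma jinv_jA: "a \<in> carrier A \<Longrightarrow> jinv (jA a) = a"
 by (simp add: jinv_def jA_inj)

lemma jinv_closed: "x \<in> carrier PA \<Longrightarrow> jinv x \<in> carrier A"
 by (auto simp: carrier_PA jinv_jA)

lemma jA_jinv: "x \<in> carrier PA \<Longrightarrow> jA (jinv x) = x"
 by (auto simp: carrier_PA jinv_jA)

lemma jA_add: "a \<in> carrier A \<Longrightarrow> b \<in> carrier A \<Longrightarrow> jA a \<oplus>\<^bsub>PA\<^esub> jA b = jA (a \<oplus> b)"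
 unfolding PA_def using transport_simps(3)[OF jA_inj'] by (simp add: regular_simps)

lemma jA_smult: "b \<in> carrier A \<Longrightarrow> a \<odot>\<^bsub>PA\<^esub> jA b = jA (a \<otimes> b)"
 unfolding PA_def using transport_simps(4)[OF jA_inj'] by (simp add: regular_simps)

lemma jA_zero: "\<zero>\<^bsub>PA\<^esub> = jA \<zero>"
 unfolding PA_def by (simp add: transport_def regular_simps)

lemma jinv_add: "x \<in> carrier PA \<Longrightarrow> y \<in> carrier PA \<Longrightarrow> jinv (x \<oplus>\<^bsub>PA\<^esub> y) = jinv x \<oplus> jinv y"
 by (auto simp: carrier_PA jinv_jA jA_add)

lemma jinv_smult: "a \<in> carrier A \<Longrightarrow> x \<in> carrier PA \<Longrightarrow> jinv (a \<odot>\<^bsub>PA\<^esub> x) = a \<otimes> jinv x"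
 by (auto simp: carrier_PA jinv_jA jA_smult)

definition rmap :: "('a, 'k) mod_k \<Rightarrow> (nat \<Rightarrow> 'k) \<Rightarrow> (nat \<Rightarrow> 'k) \<Rightarrow> (nat \<Rightarrow> 'k)" where
 "rmap M m = (\<lambda>x\<in>carrier PA. jinv x \<odot>\<^bsub>M\<^esub> m)"

text \<open>An element \<open>m\<close> of \<open>M\<close> is a homomorphism from the regular module to \<open>M\<close>; applying \<open>G\<close> to it gives
 \<open>\<lambda>u. act G M m u\<close>, which is \<open>u \<otimes> m\<close> for a tensor functor \<open>G\<close>.\<close>

definition act :: "('a, nat \<Rightarrow> 'k, 'w) mod_functor \<Rightarrow> ('a, 'k) mod_k \<Rightarrow> (nat \<Rightarrow> 'k) \<Rightarrow> 'w \<Rightarrow> 'w" where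
 "act G M m u = mor G PA M (rmap M m) u"

text \<open>Right multiplication by \<open>a\<close> is an endomorphism of the regular module;
  applying \<open>G\<close> to it makes \<open>obj G PA\<close> a right module. Together with the
  left action this recovers \<open>B\<close> from a functor that tensors with
  \<open>B\<close>.\<close>

definition rt :: "('a, nat \<Rightarrow> 'k, 'w) mod_functor \<Rightarrow> 'w \<Rightarrow> 'a \<Rightarrow> 'w" where
 "rt G u a = act G PA (jA a) u"

lemma rmap_mhom: "fd M \<Longrightarrow> m \<in> carrier M \<Longrightarrow> rmap M m \<in> mhom A PA M"
 unfolding rmap_def
 by (rule lin_mhom[OF _ PA_fdmod], rule lin_mapI)
  (auto simp: jinv_closed m_closed jinv_add m_add_left jinv_smult m_mult)

lemma rmap_apply: "x \<in> carrier PA \<Longrightarrow> rmap M m x = jinv x \<odot>\<^bsub>M\<^esub> m"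
 by (simp add: rmap_def)

lemma rmap_one: "rmap PA (jA \<one>) = (\<lambda>x\<in>carrier PA. x)"
 by (auto simp: rmap_def jA_smult jinv_closed jA_jinv)

lemma rmap_comp:
 assumes "fd M" "f \<in> mhom A M N" "m \<in> carrier M"
 shows "compose (carrier PA) f (rmap M m) = rmap N (f m)"
 using lin_mapD(3)[OF mhom_lin[OF assms(2)]] assms(3)
 by (auto simp: compose_def rmap_def jinv_closed)

lemma rmap_smult:
 assumes "fd M" "a \<in> carrier A" "m \<in> carrier M"
 shows "rmap M (a \<odot>\<^bsub>M\<^esub> m) = compose (carrier PA) (rmap M m) (rmap PA (jA a))"
 by (auto simp: compose_def rmap_def jinv_closed m_mult[OF assms(1)] assms m_closed[OF PA_fdmod] jA_closed
   jinv_smult jinv_jA)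

context
 fixes G :: "('a, nat \<Rightarrow> 'k, 'w) mod_functor"
 assumes G: "lin G"
begin

lemma act_closed: "fd M \<Longrightarrow> m \<in> carrier M \<Longrightarrow> el G PA u \<Longrightarrow> act G M m u \<in> carrier (obj G M)"
 unfolding act_def by (intro lf_closed[OF G PA_fdmod] rmap_mhom)

lemma act_add_right: "fd M \<Longrightarrow> m \<in> carrier M \<Longrightarrow> el G PA u \<Longrightarrow> el G PA v \<Longrightarrow>
  act G M m (u \<oplus>\<^bsub>obj G PA\<^esub> v) = act G M m u \<oplus>\<^bsub>obj G M\<^esub> act G M m v"
 unfolding act_def by (intro lin_mapD(2)[OF lf_lin[OF G PA_fdmod]] rmap_mhom)

lemma act_smult: "fd M \<Longrightarrow> m \<in> carrier M \<Longrightarrow> el G PA u \<Longrightarrow> a \<in> carrier A \<Longrightarrow>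
  act G M m (a \<odot>\<^bsub>obj G PA\<^esub> u) = a \<odot>\<^bsub>obj G M\<^esub> act G M m u"
 unfolding act_def by (intro lin_mapD(3)[OF lf_lin[OF G PA_fdmod]] rmap_mhom)

lemma act_add_left:
 assumes "fd M" "m \<in> carrier M" "n \<in> carrier M" "el G PA u"
 shows "act G M (m \<oplus>\<^bsub>M\<^esub> n) u = act G M m u \<oplus>\<^bsub>obj G M\<^esub> act G M n u"
proof -
 have "rmap M (m \<oplus>\<^bsub>M\<^esub> n) = (\<lambda>x\<in>carrier PA. rmap M m x \<oplus>\<^bsub>M\<^esub> rmap M n x)"
  using assms by (auto simp: rmap_def m_add_right jinv_closed)
 then show ?thesis unfolding act_def
  using lf_add[OF G PA_fdmod assms(1) rmap_mhom rmap_mhom] assms by simp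
qed

lemma act_ks_left:
 assumes "fd M" "m \<in> carrier M" "el G PA u"
 shows "act G M (kscale A M c m) u = kscale A (obj G M) c (act G M m u)"
proof -
 have "rmap M (kscale A M c m) = (\<lambda>x\<in>carrier PA. kscale A M c (rmap M m x))"
  using assms by (auto simp: rmap_def ks_comm jinv_closed)
 then show ?thesis unfolding act_def
  using lf_ks[OF G PA_fdmod assms(1) rmap_mhom] assms by simp
qed

lemma act_mor:
 assumes "fd M" "fd N" "f \<in> mhom A M N" "m \<in> carrier M" "el G PA u"
 shows "mor G M N f (act G M m u) = act G N (f m) u"
 unfolding act_def
 using lf_comp[OF G PA_fdmod assms(1,2) rmap_mhom assms(3,5)] assms
 by (simp add: rmap_comp)

text \<open>Balancedness \<open>u \<otimes> a m = u a \<otimes> m\<close>: the homomorphism of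
  \<open>a m\<close> is that of \<open>m\<close> preceded by right multiplication by
  \<open>a\<close>.\<close>

lemma act_smult_left:
 assumes "fd M" "a \<in> carrier A" "m \<in> carrier M" "el G PA u"
 shows "act G M (a \<odot>\<^bsub>M\<^esub> m) u = act G M m (rt G u a)"
 unfolding act_def rt_def rmap_smult[OF assms(1-3)]
 by (intro lf_comp[OF G PA_fdmod PA_fdmod] rmap_mhom PA_fdmod assms jA_closed)

lemma rt_closed: "el G PA u \<Longrightarrow> a \<in> carrier A \<Longrightarrow> rt G u a \<in> carrier (obj G PA)"
 unfolding rt_def by (intro act_closed PA_fdmod jA_closed)

lemma rt_one: "el G PA u \<Longrightarrow> rt G u \<one> = u"
 unfolding rt_def act_def rmap_one by (rule lf_id[OF G PA_fdmod])

lemma rt_mult: "el G PA u \<Longrightarrow> a \<in> carrier A \<Longrightarrow> b \<in> carrier A \<Longrightarrow>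
  rt G u (a \<otimes> b) = rt G (rt G u a) b"
 using act_smult_left[OF PA_fdmod, of a "jA b" u] by (simp add: rt_def[of G _ b] jA_closed jA_smult)
  (simp add: rt_def)

lemma rt_add: "el G PA u \<Longrightarrow> a \<in> carrier A \<Longrightarrow> b \<in> carrier A \<Longrightarrow>
  rt G u (a \<oplus> b) = rt G u a \<oplus>\<^bsub>obj G PA\<^esub> rt G u b"
 unfolding rt_def by (simp add: act_add_left PA_fdmod jA_closed flip: jA_add)

lemma rt_add_left: "el G PA u \<Longrightarrow> el G PA v \<Longrightarrow> a \<in> carrier A \<Longrightarrow>
  rt G (u \<oplus>\<^bsub>obj G PA\<^esub> v) a = rt G u a \<oplus>\<^bsub>obj G PA\<^esub> rt G v a"
 unfolding rt_def by (intro act_add_right PA_fdmod jA_closed)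

lemma rt_smult: "el G PA u \<Longrightarrow> a \<in> carrier A \<Longrightarrow> b \<in> carrier A \<Longrightarrow>
  rt G (b \<odot>\<^bsub>obj G PA\<^esub> u) a = b \<odot>\<^bsub>obj G PA\<^esub> rt G u a"
 unfolding rt_def by (intro act_smult PA_fdmod jA_closed)

lemma rt_ks: "el G PA u \<Longrightarrow> a \<in> carrier A \<Longrightarrow>
  rt G u (c \<odot> a) = kscale A (obj G PA) c (rt G u a)"
proof -
 assume a: "el G PA u" "a \<in> carrier A"
 have "jA (c \<odot> a) = kscale A PA c (jA a)" using a by (simp add: kscale_def jA_smult sc_mult)
 then show ?thesis unfolding rt_def using a by (simp add: act_ks_left PA_fdmod jA_closed)
qed

lemma act_one: "fd M \<Longrightarrow> el G PA u \<Longrightarrow> act G PA (jA \<one>) u = u"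
 using rt_one by (simp add: rt_def)

end

lemma ntr_act:
 assumes "ntr G K \<eta>" "fd M" "m \<in> carrier M" "el G PA u"
 shows "\<eta> M (act G M m u) = act K M m (\<eta> PA u)"
 unfolding act_def using assms by (intro ntr_nat PA_fdmod rmap_mhom)

lemma ntr_rt:
 assumes "ntr G K \<eta>" "el G PA u" "a \<in> carrier A"
 shows "\<eta> PA (rt G u a) = rt K (\<eta> PA u) a"
 unfolding rt_def using assms by (intro ntr_act PA_fdmod jA_closed)

end

section \<open>Tensor functors of finite-dimensional bimodules\<close>

lemma add_hom_comp: "add_hom L M f \<Longrightarrow> add_hom M N g \<Longrightarrow> add_hom L N (\<lambda>x. g (f x))"
 by (rule add_homI) (simp_all add: add_homD)

lemma add_hom_plus:
 assumes "abelian_group N" "add_hom M N f" "add_hom M N g"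
 shows "add_hom M N (\<lambda>x. f x \<oplus>\<^bsub>N\<^esub> g x)"
proof -
 interpret N: abelian_group N by fact
 show ?thesis
  by (rule add_homI) (simp_all add: add_homD[OF assms(2)] add_homD[OF assms(3)] N.a_ac)
qed

lemma add_hom_id: "add_hom M M (\<lambda>x. x)"
 by (simp add: add_hom_def)

lemma balanced_mapD:
 assumes "balanced_map R M N L \<beta>"
 shows "x \<in> carrier M \<Longrightarrow> y \<in> carrier N \<Longrightarrow> \<beta> x y \<in> carrier L"
  and "x \<in> carrier M \<Longrightarrow> x' \<in> carrier M \<Longrightarrow> y \<in> carrier N \<Longrightarrow>
   \<beta> (x \<oplus>\<^bsub>M\<^esub> x') y = \<beta> x y \<oplus>\<^bsub>L\<^esub> \<beta> x' y"
  and "x \<in> carrier M \<Longrightarrow> y \<in> carrier N \<Longrightarrow> y' \<in> carrier N \<Longrightarrow>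
   \<beta> x (y \<oplus>\<^bsub>N\<^esub> y') = \<beta> x y \<oplus>\<^bsub>L\<^esub> \<beta> x y'"
  and "x \<in> carrier M \<Longrightarrow> r \<in> carrier R \<Longrightarrow> y \<in> carrier N \<Longrightarrow>
   \<beta> (rsmult M x r) y = \<beta> x (r \<odot>\<^bsub>N\<^esub> y)"
 using assms unfolding balanced_map_def by blast+

context kalg
begin

text \<open>Two nested inductions over the spans. It shows that products of generators of the
  factors span a tensor product, which gives finite dimension.\<close>

lemma bilinear_span:
 assumes L: "abelian_group L" and ab: "abelian_group M" "abelian_group N"
  and U: "U \<subseteq> carrier M" and V: "V \<subseteq> carrier N"
  and \<beta>: "balanced_map R M N L \<beta>"
  and W: "W \<subseteq> carrier L" "\<And>x y. x \<in> U \<Longrightarrow> y \<in> V \<Longrightarrow> \<beta> x y \<in> add_span L W"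
  and x: "x \<in> add_span M U" and y: "y \<in> add_span N V"
 shows "\<beta> x y \<in> add_span L W"
proof -
 interpret L: abelian_group L by fact
 note b = balanced_mapD[OF \<beta>]
 note Mc = abelian_group.add_span_closed[OF ab(1) _ U]
 note Nc = abelian_group.add_span_closed[OF ab(2) _ V]
 have l: "add_hom M L (\<lambda>x. \<beta> x n)" if "n \<in> carrier N" for n
  by (rule add_homI) (use that b in auto)
 have r: "add_hom N L (\<lambda>y. \<beta> m y)" if "m \<in> carrier M" for m
  by (rule add_homI) (use that b in auto)
 have 1: "\<beta> x y \<in> add_span L W" if "x \<in> U" for x
  using y
 proof (induction rule: add_span.induct)
  case zero
  have "x \<in> carrier M" using that U by auto
  then show ?case using add_hom_zero[OF ab(2) L r] add_span.zero[of L] by simp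
 next
  case (add y z)
  have "x \<in> carrier M" "y \<in> carrier N" "z \<in> carrier N" using that U V add Nc by auto
  then show ?case using b(3) L.add_span_add[OF W(2)[OF that add(1)] add(3) W(1)] by simp
 qed
 show ?thesis
  using x
 proof (induction rule: add_span.induct)
  case zero
  then show ?case using add_hom_zero[OF ab(1) L l] Nc[OF y] add_span.zero[of L] by simp
 next
  case (add x z)
  have "x \<in> carrier M" "z \<in> carrier M" using U add Mc by auto
  then show ?case using b(2) L.add_span_add[OF 1[OF add(1)] add(3) W(1)] Nc[OF y] by simp
 qed
qed

text \<open>The last two clauses serve the tensor functor: scalars acting equally from both sides
  make it linear over the field, and a finite spanning set makes it preserve finite
  dimension.\<close>

definition bimod :: "('a, 'b, 'a) bimodule \<Rightarrow> bool" where
 "bimod B \<longleftrightarrow> left_module A B \<and>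
   (\<forall>x\<in>carrier B. \<forall>r\<in>carrier A. rsmult B x r \<in> carrier B) \<and>
   (\<forall>a\<in>carrier A. \<forall>x\<in>carrier B. \<forall>r\<in>carrier A. rsmult B (a \<odot>\<^bsub>B\<^esub> x) r = a \<odot>\<^bsub>B\<^esub> rsmult B x r) \<and>
   (\<forall>x\<in>carrier B. \<forall>c. rsmult B x (sc c) = sc c \<odot>\<^bsub>B\<^esub> x) \<and>
   (\<exists>S. finite S \<and> S \<subseteq> carrier B \<and> carrier B \<subseteq> add_span B {sc c \<odot>\<^bsub>B\<^esub> s | c s. s \<in> S})"

context
 fixes B :: "('a, 'b, 'a) bimodule"
 assumes B: "bimod B"
begin

lemma bimod_left: "left_module A B"
 using B by (simp add: bimod_def)

interpretation B: left_module A B by (rule bimod_left)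

lemma bimod_r_closed: "x \<in> carrier B \<Longrightarrow> r \<in> carrier A \<Longrightarrow> rsmult B x r \<in> carrier B"
 using B by (simp add: bimod_def)

lemma bimod_compat: "a \<in> carrier A \<Longrightarrow> x \<in> carrier B \<Longrightarrow> r \<in> carrier A \<Longrightarrow>
  rsmult B (a \<odot>\<^bsub>B\<^esub> x) r = a \<odot>\<^bsub>B\<^esub> rsmult B x r"
 using B by (simp add: bimod_def)

lemma bimod_central: "x \<in> carrier B \<Longrightarrow> rsmult B x (sc c) = sc c \<odot>\<^bsub>B\<^esub> x"
 using B by (simp add: bimod_def)

lemma bimod_setup: "fd M \<Longrightarrow> tensor_setup A B M"
 by (rule tensor_setup.intro) (auto simp: m_closed bimod_r_closed m_ab B.M_abelian)

context
 fixes M :: "('a, 'u) module"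
 assumes M: "fd M"
begin

interpretation T: tensor_setup A B M by (rule bimod_setup[OF M])

lemma
 assumes "a \<in> carrier A"
 shows tensor_smult_hom: "add_hom (tensor A B M) (tensor A B M) (\<lambda>z. a \<odot>\<^bsub>tensor A B M\<^esub> z)"
  and tensor_smult_pt: "x \<in> carrier B \<Longrightarrow> m \<in> carrier M \<Longrightarrow>
   a \<odot>\<^bsub>tensor A B M\<^esub> pure_tensor A B M x m = pure_tensor A B M (a \<odot>\<^bsub>B\<^esub> x) m"
proof -
 have b: "balanced_map A B M T.T (\<lambda>x y. T.pt (fst ((\<lambda>(x, y). (a \<odot>\<^bsub>B\<^esub> x, y)) (x, y))) (snd ((\<lambda>(x, y). (a \<odot>\<^bsub>B\<^esub> x, y)) (x, y))))"
  by (rule balanced_mapI)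
   (auto simp: assms B.lsmult_closed T.pt_closed B.lsmult_r_distr T.pt_add_left T.pt_add_right
    T.pt_balanced simp flip: bimod_compat)
 have s: "a \<odot>\<^bsub>T.T\<^esub> z = tensor_map A B M (\<lambda>(x, y). (a \<odot>\<^bsub>B\<^esub> x, y)) z" for z
  by (simp add: tensor_def)
 note tm = tensor_map_add_hom[OF T.tensor_setup_axioms T.tensor_setup_axioms b]
 show "add_hom T.T T.T (\<lambda>z. a \<odot>\<^bsub>T.T\<^esub> z)"
  unfolding s by (rule tm(1)) (auto simp: assms B.lsmult_closed)
 show "a \<odot>\<^bsub>T.T\<^esub> T.pt x m = T.pt (a \<odot>\<^bsub>B\<^esub> x) m" if "x \<in> carrier B" "m \<in> carrier M"
  unfolding s using that by (subst tm(2)) (auto simp: assms B.lsmult_closed)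
qed

lemma tensor_lmod: "left_module A (tensor A B M)"
proof -
 note c = add_homD(1)[OF tensor_smult_hom]
 note eqI = T.tensor_hom_eq[OF T.abelian_group_tensor]
 have "left_module_axioms A T.T"
 proof
  fix a z assume a: "a \<in> carrier A" "z \<in> carrier T.T"
  show "a \<odot>\<^bsub>T.T\<^esub> z \<in> carrier T.T" by (rule c[OF a])
  show "a \<odot>\<^bsub>T.T\<^esub> (z \<oplus>\<^bsub>T.T\<^esub> w) = a \<odot>\<^bsub>T.T\<^esub> z \<oplus>\<^bsub>T.T\<^esub> a \<odot>\<^bsub>T.T\<^esub> w" if "w \<in> carrier T.T" for w
   by (rule add_homD(2)[OF tensor_smult_hom[OF a(1)] a(2) that])
  fix b assume b: "b \<in> carrier A"
  show "(a \<oplus> b) \<odot>\<^bsub>T.T\<^esub> z = a \<odot>\<^bsub>T.T\<^esub> z \<oplus>\<^bsub>T.T\<^esub> b \<odot>\<^bsub>T.T\<^esub> z"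
   by (rule eqI[OF _ add_hom_plus[OF T.abelian_group_tensor] _ a(2)])
    (use a b in \<open>auto simp: tensor_smult_hom tensor_smult_pt B.lsmult_l_distr T.pt_add_left B.lsmult_closed\<close>)
  show "(a \<otimes> b) \<odot>\<^bsub>T.T\<^esub> z = a \<odot>\<^bsub>T.T\<^esub> (b \<odot>\<^bsub>T.T\<^esub> z)"
   by (rule eqI[OF _ add_hom_comp[OF tensor_smult_hom[OF b] tensor_smult_hom[OF a(1)]] _ a(2)])
    (use a b in \<open>auto simp: tensor_smult_hom tensor_smult_pt B.lsmult_assoc B.lsmult_closed\<close>)
 next
  fix z assume z: "z \<in> carrier T.T"
  show "\<one> \<odot>\<^bsub>T.T\<^esub> z = z"
   by (rule eqI[OF _ add_hom_id _ z]) (auto simp: tensor_smult_hom tensor_smult_pt B.lsmult_one)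
 qed
 then show ?thesis using A_ring T.abelian_group_tensor by (simp add: left_module_def)
qed

lemma tensor_fdmod: "tensor A B M \<in> fdmod A"
proof -
 obtain S where S: "finite S" "S \<subseteq> carrier B" "carrier B \<subseteq> add_span B {sc c \<odot>\<^bsub>B\<^esub> s | c s. s \<in> S}"
  using B unfolding bimod_def by (elim conjE exE)
 obtain S' where S': "finite S'" "S' \<subseteq> carrier M" "carrier M \<subseteq> kspan M S'"
  by (rule fdmod_kspan[OF M])
 let ?P = "(\<lambda>(s, t). T.pt s t) ` (S \<times> S')"
 have P: "?P \<subseteq> carrier T.T" using S S' by (auto intro!: T.pt_closed)
 have W: "{kscale A T.T c s | c s. s \<in> ?P} \<subseteq> carrier T.T"
  by (rule kscale_set_closed[OF tensor_lmod P])
 have pt: "T.pt x m \<in> kspan T.T ?P" if "x \<in> carrier B" "m \<in> carrier M" for x m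
  unfolding kspan_def
 proof (rule bilinear_span[OF T.abelian_group_tensor B.M_abelian m_ab[OF M] _ _ T.pt_balanced_map W])
  show "{sc c \<odot>\<^bsub>B\<^esub> s | c s. s \<in> S} \<subseteq> carrier B" using S sc_closed B.lsmult_closed by auto
  show "{kscale A M c s | c s. s \<in> S'} \<subseteq> carrier M" by (rule kscale_set_closed[OF fdmod_lmod[OF M] S'(2)])
  show "x \<in> add_span B {sc c \<odot>\<^bsub>B\<^esub> s | c s. s \<in> S}" using S that by auto
  show "m \<in> add_span M {kscale A M c s | c s. s \<in> S'}" using S' that by (auto simp: kspan_def)
  fix y n assume "y \<in> {sc c \<odot>\<^bsub>B\<^esub> s | c s. s \<in> S}" "n \<in> {kscale A M c s | c s. s \<in> S'}"
  then obtain c s d t where *: "y = sc c \<odot>\<^bsub>B\<^esub> s" "s \<in> S" "n = kscale A M d t" "t \<in> S'" by blast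
  then have st: "s \<in> carrier B" "t \<in> carrier M" using S S' by auto
  \<comment> \<open>The scalar of the right factor crosses the tensor sign as a right action and
    becomes a left action by centrality, so that a single scalar in front remains.\<close>
  have "T.pt y n = T.pt (rsmult B y (sc d)) t"
   using * st sc_closed by (simp add: kscale_def T.pt_balanced B.lsmult_closed)
  also have "rsmult B y (sc d) = sc (d * c) \<odot>\<^bsub>B\<^esub> s"
   using * st sc_closed by (simp add: bimod_central B.lsmult_closed sc_times B.lsmult_assoc)
  also have "T.pt (sc (d * c) \<odot>\<^bsub>B\<^esub> s) t = kscale A T.T (d * c) (T.pt s t)"
   using st sc_closed by (simp add: kscale_def tensor_smult_pt)
  finally have "T.pt y n \<in> {kscale A T.T c s | c s. s \<in> ?P}" using * by blast
  then show "T.pt y n \<in> add_span T.T {kscale A T.T c s | c s. s \<in> ?P}"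
   by (rule T.T.add_span_incl[OF _ W])
 qed
 have "z \<in> kspan T.T ?P" if "z \<in> carrier T.T" for z
  using T.tensor_generated[OF that]
 proof (induction rule: add_span.induct)
  case zero
  then show ?case by (simp add: kspan_def add_span.zero)
 next
  case (add x y)
  then have "x \<in> kspan T.T ?P" using pt by auto
  then show ?case using T.T.add_span_add[OF _ _ W] add(3) by (simp add: kspan_def)
 qed
 then show ?thesis
  by (intro fdmodI[OF tensor_lmod _ P]) (use S(1) S'(1) in auto)
qed

end

lemma
 fixes M N :: "('a, 'u) module"
 assumes M: "fd M" and N: "fd N" and f: "f \<in> mhom A M N"
 shows tensor_mor_pt: "x \<in> carrier B \<Longrightarrow> m \<in> carrier M \<Longrightarrow>
   mor (tensor_functor A B) M N f (pure_tensor A B M x m) = pure_tensor A B N x (f m)"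
  and tensor_mor_mhom: "mor (tensor_functor A B) M N f \<in> mhom A (tensor A B M) (tensor A B N)"
proof -
 interpret TM: tensor_setup A B M by (rule bimod_setup[OF M])
 interpret TN: tensor_setup A B N by (rule bimod_setup[OF N])
 note f = lin_mapD[OF mhom_lin[OF f]]
 have b: "balanced_map A B M TN.T (\<lambda>x y. TN.pt (fst ((\<lambda>(x, y). (x, f y)) (x, y))) (snd ((\<lambda>(x, y). (x, f y)) (x, y))))"
  by (rule balanced_mapI)
   (auto simp: f TN.pt_closed TN.pt_add_left TN.pt_add_right TN.pt_balanced)
 note tm = tensor_map_add_hom[OF TN.tensor_setup_axioms TM.tensor_setup_axioms b]
 have h: "add_hom TM.T TN.T (tensor_map A B N (\<lambda>(x, y). (x, f y)))"
  by (rule tm(1)) (auto simp: f)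
 have p: "tensor_map A B N (\<lambda>(x, y). (x, f y)) (TM.pt x m) = TN.pt x (f m)"
  if "x \<in> carrier B" "m \<in> carrier M" for x m
  using that by (subst tm(2)) (auto simp: f)
 show "mor (tensor_functor A B) M N f (TM.pt x m) = TN.pt x (f m)"
  if "x \<in> carrier B" "m \<in> carrier M"
  using p[OF that] TM.pt_closed[OF that] by (simp add: tensor_functor_def)
 have l: "lin_map TM.T TN.T (tensor_map A B N (\<lambda>(x, y). (x, f y)))"
 proof (rule lin_mapI)
  show "tensor_map A B N (\<lambda>(x, y). (x, f y)) (a \<odot>\<^bsub>TM.T\<^esub> z) = a \<odot>\<^bsub>TN.T\<^esub> tensor_map A B N (\<lambda>(x, y). (x, f y)) z"
   if "a \<in> carrier A" "z \<in> carrier TM.T" for a z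
  proof (rule TM.tensor_hom_eq[OF TN.abelian_group_tensor add_hom_comp[OF tensor_smult_hom[OF M that(1)] h]
     add_hom_comp[OF h tensor_smult_hom[OF N that(1)]] _ that(2)])
   fix x y assume xy: "x \<in> carrier B" "y \<in> carrier M"
   then have "a \<odot>\<^bsub>B\<^esub> x \<in> carrier B" using that B.lsmult_closed by simp
   then show "tensor_map A B N (\<lambda>(x, y). (x, f y)) (a \<odot>\<^bsub>TM.T\<^esub> TM.pt x y) =
     a \<odot>\<^bsub>TN.T\<^esub> tensor_map A B N (\<lambda>(x, y). (x, f y)) (TM.pt x y)"
    using xy that(1) f(1) p by (simp add: tensor_smult_pt[OF M] tensor_smult_pt[OF N])
  qed
 qed (use add_homD[OF h] in auto)
 show "mor (tensor_functor A B) M N f \<in> mhom A TM.T TN.T"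
  using lin_mhom[OF l tensor_fdmod[OF M]] by (simp add: tensor_functor_def)
qed

lemma tensor_functor_lin: "(tensor_functor A B :: ('a, 'u, ('b \<times> 'u \<Rightarrow>\<^sub>0 int) set) mod_functor) \<in> lin_functors A"
proof (rule lin_functorsI)
 have obj: "obj (tensor_functor A B) M = tensor A B M" for M :: "('a, 'u) module"
  by (simp add: tensor_functor_def)
 let ?m = "mor (tensor_functor A B) :: ('a, 'u) module \<Rightarrow> ('a, 'u) module \<Rightarrow> _"
 fix L M N :: "('a, 'u) module" and f g z c
 assume M: "fd M"
 interpret TM: tensor_setup A B M by (rule bimod_setup[OF M])
 show "obj (tensor_functor A B) M \<in> fdmod A" by (simp add: obj tensor_fdmod[OF M])
 have idM: "(\<lambda>x\<in>carrier M. x) \<in> mhom A M M" by (rule lin_mhom[OF lin_mapI M]) auto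
 show "?m M M (\<lambda>x\<in>carrier M. x) z = z" if "z \<in> carrier (obj (tensor_functor A B) M)"
  by (rule TM.tensor_hom_eq[OF TM.abelian_group_tensor lin_mapD(4)[OF mhom_lin[OF tensor_mor_mhom[OF M M idM]]] add_hom_id])
   (use that in \<open>auto simp: obj tensor_mor_pt[OF M M idM]\<close>)
 assume N: "fd N"
 interpret TN: tensor_setup A B N by (rule bimod_setup[OF N])
 have h: "add_hom TM.T TN.T (?m M N f)" if "f \<in> mhom A M N" for f
  by (rule lin_mapD(4)[OF mhom_lin[OF tensor_mor_mhom[OF M N that]]])
 show "?m M N f \<in> mhom A (obj (tensor_functor A B) M) (obj (tensor_functor A B) N)" if "f \<in> mhom A M N"
  unfolding obj by (rule tensor_mor_mhom[OF M N that])
 show "?m M N (\<lambda>x\<in>carrier M. f x \<oplus>\<^bsub>N\<^esub> g x) z = ?m M N f z \<oplus>\<^bsub>obj (tensor_functor A B) N\<^esub> ?m M N g z"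
  if fg: "f \<in> mhom A M N" "g \<in> mhom A M N" and z: "z \<in> carrier (obj (tensor_functor A B) M)"
 proof -
  have s: "(\<lambda>x\<in>carrier M. f x \<oplus>\<^bsub>N\<^esub> g x) \<in> mhom A M N"
  proof (rule lin_mhom[OF _ M], rule lin_mapI)
   show "f (a \<odot>\<^bsub>M\<^esub> x) \<oplus>\<^bsub>N\<^esub> g (a \<odot>\<^bsub>M\<^esub> x) = a \<odot>\<^bsub>N\<^esub> (f x \<oplus>\<^bsub>N\<^esub> g x)"
    if "a \<in> carrier A" "x \<in> carrier M" for a x
    using that lin_mapD[OF mhom_lin[OF fg(1)]] lin_mapD[OF mhom_lin[OF fg(2)]]
    by (simp add: m_add_right[OF N])
  qed (use add_homD[OF add_hom_plus[OF m_ab[OF N] lin_mapD(4)[OF mhom_lin[OF fg(1)]] lin_mapD(4)[OF mhom_lin[OF fg(2)]]]] in auto)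
  show ?thesis
   unfolding obj
   by (rule TM.tensor_hom_eq[OF TN.abelian_group_tensor h[OF s]
      add_hom_plus[OF TN.abelian_group_tensor h[OF fg(1)] h[OF fg(2)]]])
    (use z lin_mapD(1)[OF mhom_lin[OF fg(1)]] lin_mapD(1)[OF mhom_lin[OF fg(2)]] in
     \<open>auto simp: obj tensor_mor_pt[OF M N s] tensor_mor_pt[OF M N fg(1)] tensor_mor_pt[OF M N fg(2)] TN.pt_add_right\<close>)
 qed
 show "?m M N (\<lambda>x\<in>carrier M. kscale A N c (f x)) z = kscale A (obj (tensor_functor A B) N) c (?m M N f z)"
  if f: "f \<in> mhom A M N" and z: "z \<in> carrier (obj (tensor_functor A B) M)"
 proof -
  note fc = lin_mapD[OF mhom_lin[OF f]]
  have s: "(\<lambda>x\<in>carrier M. kscale A N c (f x)) \<in> mhom A M N"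
   by (rule lin_mhom[OF _ M], rule lin_mapI) (auto simp: fc ks_closed[OF N] ks_add_right[OF N] ks_comm[OF N])
  have k: "TN.pt x (kscale A N c (f m)) = kscale A TN.T c (TN.pt x (f m))" if "x \<in> carrier B" "m \<in> carrier M" for x m
   using that fc TN.pt_balanced[OF that(1) sc_closed, of "f m" c, symmetric]
   by (simp add: kscale_def tensor_smult_pt[OF N] sc_closed bimod_central)
  show ?thesis
   unfolding obj kscale_def[of _ TN.T]
   by (rule TM.tensor_hom_eq[OF TN.abelian_group_tensor h[OF s]
      add_hom_comp[OF h[OF f] tensor_smult_hom[OF N sc_closed]]])
    (use z in \<open>auto simp: obj tensor_mor_pt[OF M N s] tensor_mor_pt[OF M N f] k kscale_def[of _ TN.T]\<close>)
 qed
 assume L: "fd L"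
 interpret TL: tensor_setup A B L by (rule bimod_setup[OF L])
 show "?m L N (compose (carrier L) g f) z = ?m M N g (?m L M f z)"
  if f: "f \<in> mhom A L M" and g: "g \<in> mhom A M N" and z: "z \<in> carrier (obj (tensor_functor A B) L)"
  by (rule TL.tensor_hom_eq[OF TN.abelian_group_tensor lin_mapD(4)[OF mhom_lin[OF tensor_mor_mhom[OF L N mhom_comp[OF L f g]]]]
     add_hom_comp[OF lin_mapD(4)[OF mhom_lin[OF tensor_mor_mhom[OF L M f]]] h[OF g]]])
   (use z in \<open>auto simp: obj tensor_mor_pt[OF L N mhom_comp[OF L f g]] tensor_mor_pt[OF L M f] tensor_mor_pt[OF M N g]
    lin_mapD(1)[OF mhom_lin[OF f]] compose_eq\<close>)
qed

end

text \<open>\<open>rep G B u\<close> says that \<open>G\<close> behaves like \<open>B \<otimes>\<^sub>A -\<close>, with \<open>u b\<close> in the role of \<open>b \<otimes> 1\<close>.\<close>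

definition rep :: "('a, 'k) endo_k \<Rightarrow> ('a, 'b, 'a) bimodule \<Rightarrow> ('b \<Rightarrow> nat \<Rightarrow> 'k) \<Rightarrow> bool" where
 "rep G B u \<longleftrightarrow> G \<in> lin_functors A \<and>
   (\<forall>b\<in>carrier B. u b \<in> carrier (obj G PA)) \<and>
   (\<forall>b\<in>carrier B. \<forall>b'\<in>carrier B. u (b \<oplus>\<^bsub>B\<^esub> b') = u b \<oplus>\<^bsub>obj G PA\<^esub> u b') \<and>
   (\<forall>b\<in>carrier B. \<forall>a\<in>carrier A. u (a \<odot>\<^bsub>B\<^esub> b) = a \<odot>\<^bsub>obj G PA\<^esub> u b) \<and>
   (\<forall>b\<in>carrier B. \<forall>a\<in>carrier A. u (rsmult B b a) = rt G (u b) a) \<and>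
   (\<forall>M\<in>fdmod A. carrier (obj G M) \<subseteq> add_span (obj G M) {act G M m (u b) | m b. m \<in> carrier M \<and> b \<in> carrier B}) \<and>
   (\<forall>N\<in>fdmod A. \<forall>L :: ('a, 'k) mod_k. \<forall>\<beta>. abelian_group L \<longrightarrow> balanced_map A B N L \<beta> \<longrightarrow>
    (\<exists>h. add_hom (obj G N) L h \<and> (\<forall>b\<in>carrier B. \<forall>n\<in>carrier N. h (act G N n (u b)) = \<beta> b n)))"

text \<open>Moves the universal property of the tensor product to an endofunctor isomorphic to it.
  Later arguments about \<open>G\<close> use \<open>rep\<close> in place of the isomorphism.\<close>

lemma rep_exists:
 assumes B: "bimod B" and G: "lin G" and iso: "nat_iso A G (tensor_functor A B)"
 shows "\<exists>u. rep G B u"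
proof -
 let ?T = "tensor_functor A B"
 note Tl = tensor_functor_lin[OF B]
 interpret B: left_module A B by (rule bimod_left[OF B])
 obtain \<eta> \<theta> where e: "ntr G ?T \<eta>" "ntr ?T G \<theta>"
  "\<And>M x. fd M \<Longrightarrow> el G M x \<Longrightarrow> \<theta> M (\<eta> M x) = x"
  "\<And>M y. fd M \<Longrightarrow> y \<in> carrier (obj ?T M) \<Longrightarrow> \<eta> M (\<theta> M y) = y"
  by (rule nat_isoD[OF iso]) blast
 have obj: "obj ?T M = tensor A B M" for M :: "('a, 'k) mod_k"
  by (simp add: tensor_functor_def)
 note ts = bimod_setup[OF B]
 interpret P: tensor_setup A B PA by (rule ts[OF PA_fdmod])
 define u where "u b = \<theta> PA (P.pt b (jA \<one>))" for b
 note one = jA_closed[OF one_closed]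
 have ptc: "pure_tensor A B M b m \<in> carrier (obj ?T M)" if "fd M" "b \<in> carrier B" "m \<in> carrier M"
  for M :: "('a, 'k) mod_k" and b m
  unfolding obj by (rule tensor_setup.pt_closed[OF ts[OF that(1)] that(2,3)])
 have uc: "u b \<in> carrier (obj G PA)" if "b \<in> carrier B" for b
  unfolding u_def by (rule ntr_closed[OF e(2) PA_fdmod ptc[OF PA_fdmod that one]])
 \<comment> \<open>The elementary tensor of \<open>b\<close> and \<open>m\<close> corresponds to
   \<open>act G M m (u b)\<close>, since \<open>m\<close> is the image of the unit under its
   homomorphism from \<open>PA\<close>.\<close>
 have actu: "act G M m (u b) = \<theta> M (pure_tensor A B M b m)" if "fd M" "m \<in> carrier M" "b \<in> carrier B" for M m b
 proof -
  have "act G M m (u b) = \<theta> M (act ?T M m (P.pt b (jA \<one>)))"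
   unfolding u_def by (rule ntr_act[OF e(2) that(1,2) ptc[OF PA_fdmod that(3) one], symmetric])
  also have "act ?T M m (P.pt b (jA \<one>)) = pure_tensor A B M b (rmap M m (jA \<one>))"
   unfolding act_def by (rule tensor_mor_pt[OF B PA_fdmod that(1) rmap_mhom[OF that(1,2)] that(3) one])
  also have "rmap M m (jA \<one>) = m"
   using that by (simp add: rmap_apply one jinv_jA m_one)
  finally show ?thesis .
 qed
 have "rep G B u"
  unfolding rep_def
 proof (intro conjI ballI allI impI)
  fix b assume b: "b \<in> carrier B"
  show "u b \<in> carrier (obj G PA)" by (rule uc[OF b])
  show "u (b \<oplus>\<^bsub>B\<^esub> b') = u b \<oplus>\<^bsub>obj G PA\<^esub> u b'" if "b' \<in> carrier B" for b'
   unfolding u_def P.pt_add_left[OF b that one]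
   using ntr_add[OF e(2) PA_fdmod ptc[OF PA_fdmod b one] ptc[OF PA_fdmod that one]] by (simp add: obj)
  fix a assume a: "a \<in> carrier A"
  show "u (a \<odot>\<^bsub>B\<^esub> b) = a \<odot>\<^bsub>obj G PA\<^esub> u b"
   unfolding u_def tensor_smult_pt[OF B PA_fdmod a b one, symmetric]
   using ntr_smult[OF e(2) PA_fdmod a ptc[OF PA_fdmod b one]] by (simp add: obj)
  show "u (rsmult B b a) = rt G (u b) a"
  proof -
   have "rt G (u b) a = \<theta> PA (P.pt b (jA a))"
    unfolding rt_def by (rule actu[OF PA_fdmod jA_closed[OF a] b])
   then show ?thesis
    unfolding u_def P.pt_balanced[OF b a one] using a by (simp add: jA_smult)
  qed
 next
  fix M :: "('a, 'k) mod_k" assume M: "fd M"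
  interpret TM: tensor_setup A B M by (rule ts[OF M])
  show "carrier (obj G M) \<subseteq> add_span (obj G M) {act G M m (u b) | m b. m \<in> carrier M \<and> b \<in> carrier B}"
  proof
   fix y assume y: "el G M y"
   have "\<theta> M z \<in> add_span (obj G M) {act G M m (u b) | m b. m \<in> carrier M \<and> b \<in> carrier B}"
    if "z \<in> add_span TM.T {TM.pt x m | x m. x \<in> carrier B \<and> m \<in> carrier M}" for z
    using that
   proof (induction rule: add_span.induct)
    case zero
    have "\<theta> M \<zero>\<^bsub>TM.T\<^esub> = \<zero>\<^bsub>obj G M\<^esub>"
     using lin_map_zero[OF lf_obj[OF Tl M] lf_obj[OF G M] ntr_lin[OF e(2) M]] by (simp add: obj)
    then show ?case by (simp add: add_span.zero)
   next
    case (add x z)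
    then obtain b m where bm: "x = TM.pt b m" "b \<in> carrier B" "m \<in> carrier M" by blast
    have z: "z \<in> carrier TM.T" by (rule TM.T.add_span_closed[OF add(2)]) (auto simp: TM.pt_closed)
    have "\<theta> M (x \<oplus>\<^bsub>TM.T\<^esub> z) = act G M m (u b) \<oplus>\<^bsub>obj G M\<^esub> \<theta> M z"
     using ntr_add[OF e(2) M, of x z] z bm TM.pt_closed by (simp add: obj actu M)
    moreover have "act G M m (u b) \<in> {act G M m (u b) | m b. m \<in> carrier M \<and> b \<in> carrier B}"
     using bm by blast
    ultimately show ?case using add_span.add[OF _ add(3)] by simp
   qed
   from this[OF TM.tensor_generated[OF ntr_closed[OF e(1) M y, unfolded obj]]]
   show "y \<in> add_span (obj G M) {act G M m (u b) | m b. m \<in> carrier M \<and> b \<in> carrier B}"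
    by (simp only: e(3)[OF M y])
  qed
  fix L :: "('a, 'k) mod_k" and \<beta> assume L: "abelian_group L" "balanced_map A B M L \<beta>"
  obtain h where h: "add_hom TM.T L h" "\<And>x y. x \<in> carrier B \<Longrightarrow> y \<in> carrier M \<Longrightarrow> h (TM.pt x y) = \<beta> x y"
   by (rule TM.tensor_lift[OF L]) blast
  have "add_hom (obj G M) L (\<lambda>y. h (\<eta> M y))"
   by (rule add_hom_comp[OF _ h(1)]) (use lin_mapD(4)[OF ntr_lin[OF e(1) M]] in \<open>simp add: obj\<close>)
  moreover have "h (\<eta> M (act G M n (u b))) = \<beta> b n" if "b \<in> carrier B" "n \<in> carrier M" for b n
   using that M e(4)[OF M ptc[OF M that]] by (simp add: actu h(2))
  ultimately show "\<exists>h. add_hom (obj G M) L h \<and> (\<forall>b\<in>carrier B. \<forall>n\<in>carrier M. h (act G M n (u b)) = \<beta> b n)"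
   by blast
 qed (rule G)
 then show ?thesis by (rule exI[of "rep G B"])
qed

lemma repD:
 assumes "rep G B u"
 shows "lin G"
  and "b \<in> carrier B \<Longrightarrow> u b \<in> carrier (obj G PA)"
  and "b \<in> carrier B \<Longrightarrow> b' \<in> carrier B \<Longrightarrow> u (b \<oplus>\<^bsub>B\<^esub> b') = u b \<oplus>\<^bsub>obj G PA\<^esub> u b'"
  and "b \<in> carrier B \<Longrightarrow> a \<in> carrier A \<Longrightarrow> u (a \<odot>\<^bsub>B\<^esub> b) = a \<odot>\<^bsub>obj G PA\<^esub> u b"
  and "b \<in> carrier B \<Longrightarrow> a \<in> carrier A \<Longrightarrow> u (rsmult B b a) = rt G (u b) a"
  and "fd M \<Longrightarrow> el G M x \<Longrightarrow>
   x \<in> add_span (obj G M) {act G M m (u b) | m b. m \<in> carrier M \<and> b \<in> carrier B}"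
proof -
 note r = assms[unfolded rep_def]
 show "lin G" by (rule r[THEN conjunct1])
 note r = r[THEN conjunct2]
 show "b \<in> carrier B \<Longrightarrow> u b \<in> carrier (obj G PA)" by (rule r[THEN conjunct1, THEN bspec])
 note r = r[THEN conjunct2]
 show "b \<in> carrier B \<Longrightarrow> b' \<in> carrier B \<Longrightarrow> u (b \<oplus>\<^bsub>B\<^esub> b') = u b \<oplus>\<^bsub>obj G PA\<^esub> u b'"
  by (rule r[THEN conjunct1, THEN bspec, THEN bspec])
 note r = r[THEN conjunct2]
 show "b \<in> carrier B \<Longrightarrow> a \<in> carrier A \<Longrightarrow> u (a \<odot>\<^bsub>B\<^esub> b) = a \<odot>\<^bsub>obj G PA\<^esub> u b"
  by (rule r[THEN conjunct1, THEN bspec, THEN bspec])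
 note r = r[THEN conjunct2]
 show "b \<in> carrier B \<Longrightarrow> a \<in> carrier A \<Longrightarrow> u (rsmult B b a) = rt G (u b) a"
  by (rule r[THEN conjunct1, THEN bspec, THEN bspec])
 note r = r[THEN conjunct2]
 show "fd M \<Longrightarrow> el G M x \<Longrightarrow>
   x \<in> add_span (obj G M) {act G M m (u b) | m b. m \<in> carrier M \<and> b \<in> carrier B}"
  by (rule r[THEN conjunct1, THEN bspec, THEN subsetD])
qed

lemma rep_lift:
 fixes L :: "('a, 'k) mod_k"
 assumes "rep G B u" "fd N" "abelian_group L" "balanced_map A B N L \<beta>"
 obtains h where "add_hom (obj G N) L h"
  "\<And>b n. b \<in> carrier B \<Longrightarrow> n \<in> carrier N \<Longrightarrow> h (act G N n (u b)) = \<beta> b n"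
proof -
 have "\<exists>h. add_hom (obj G N) L h \<and> (\<forall>b\<in>carrier B. \<forall>n\<in>carrier N. h (act G N n (u b)) = \<beta> b n)"
  using assms unfolding rep_def by simp
 then show thesis using that by (elim exE conjE) simp
qed

lemma ntr_of_generators:
 fixes G :: "('a, 'u, 'v) mod_functor" and K :: "('a, 'u, 'w) mod_functor"
 assumes G: "lin G" and K: "lin K"
  and h: "\<And>M. fd M \<Longrightarrow> add_hom (obj G M) (obj K M) (h M)"
  and gen: "\<And>M x. fd M \<Longrightarrow> el G M x \<Longrightarrow> x \<in> add_span (obj G M) (U M)"
  and U: "\<And>M x. fd M \<Longrightarrow> x \<in> U M \<Longrightarrow> el G M x"
  and lin: "\<And>M a x. fd M \<Longrightarrow> a \<in> carrier A \<Longrightarrow> x \<in> U M \<Longrightarrow> h M (a \<odot>\<^bsub>obj G M\<^esub> x) = a \<odot>\<^bsub>obj K M\<^esub> h M x"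
  and nat: "\<And>M N f x. fd M \<Longrightarrow> fd N \<Longrightarrow> f \<in> mhom A M N \<Longrightarrow> x \<in> U M \<Longrightarrow>
   h N (mor G M N f x) = mor K M N f (h M x)"
 shows "ntr G K h"
proof (rule ntrI)
 fix M :: "('a, 'u) module" assume M: "fd M"
 note GM = lf_obj[OF G M] and KM = lf_obj[OF K M]
 have Us: "U M \<subseteq> carrier (obj G M)" using U M by blast
 show "lin_map (obj G M) (obj K M) (h M)"
 proof (rule lin_mapI)
  fix a x assume a: "a \<in> carrier A" "el G M x"
  show "h M (a \<odot>\<^bsub>obj G M\<^esub> x) = a \<odot>\<^bsub>obj K M\<^esub> h M x"
   by (rule add_hom_eq_on_span[OF m_ab[OF GM] m_ab[OF KM]
      add_hom_comp[OF left_module.add_hom_lsmult[OF fdmod_lmod[OF GM] a(1)] h[OF M]]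
      add_hom_comp[OF h[OF M] left_module.add_hom_lsmult[OF fdmod_lmod[OF KM] a(1)]] Us lin[OF M a(1)] gen[OF M a(2)]])
 qed (use add_homD[OF h[OF M]] in auto)
 fix N :: "('a, 'u) module" and f x assume N: "fd N" and f: "f \<in> mhom A M N" and x: "el G M x"
 show "h N (mor G M N f x) = mor K M N f (h M x)"
  by (rule add_hom_eq_on_span[OF m_ab[OF GM] m_ab[OF lf_obj[OF K N]]
     add_hom_comp[OF lin_mapD(4)[OF lf_lin[OF G M N f]] h[OF N]]
     add_hom_comp[OF h[OF M] lin_mapD(4)[OF lf_lin[OF K M N f]]] Us nat[OF M N f] gen[OF M x]])
qed

lemma m_kscale: "fd M \<Longrightarrow> a \<in> carrier A \<Longrightarrow> x \<in> carrier M \<Longrightarrow>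
  (c \<odot> a) \<odot>\<^bsub>M\<^esub> x = kscale A M c (a \<odot>\<^bsub>M\<^esub> x)"
 using m_mult[of M "sc c" a x] by (simp add: kscale_def sc_closed sc_mult)

text \<open>Balanced over the field and not over \<open>A\<close>: these maps correspond to additive
  maps out of \<open>A \<otimes> N\<close> taken over the field, which forget the
  \<open>A\<close>-structure of \<open>N\<close>.\<close>

definition kbal :: "('a, 'k) mod_k \<Rightarrow> ('a, 'k) mod_k \<Rightarrow> ('a \<Rightarrow> (nat \<Rightarrow> 'k) \<Rightarrow> (nat \<Rightarrow> 'k)) \<Rightarrow> bool" where
 "kbal N L \<beta> \<longleftrightarrow>
   (\<forall>a\<in>carrier A. \<forall>n\<in>carrier N. \<beta> a n \<in> carrier L) \<and>
   (\<forall>a\<in>carrier A. \<forall>b\<in>carrier A. \<forall>n\<in>carrier N. \<beta> (a \<oplus> b) n = \<beta> a n \<oplus>\<^bsub>L\<^esub> \<beta> b n) \<and>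
   (\<forall>a\<in>carrier A. \<forall>n\<in>carrier N. \<forall>n'\<in>carrier N. \<beta> a (n \<oplus>\<^bsub>N\<^esub> n') = \<beta> a n \<oplus>\<^bsub>L\<^esub> \<beta> a n') \<and>
   (\<forall>a\<in>carrier A. \<forall>n\<in>carrier N. \<forall>c. \<beta> (c \<odot> a) n = \<beta> a (kscale A N c n))"

lemma kbalD:
 assumes "kbal N L \<beta>"
 shows "a \<in> carrier A \<Longrightarrow> n \<in> carrier N \<Longrightarrow> \<beta> a n \<in> carrier L"
  and "a \<in> carrier A \<Longrightarrow> b \<in> carrier A \<Longrightarrow> n \<in> carrier N \<Longrightarrow> \<beta> (a \<oplus> b) n = \<beta> a n \<oplus>\<^bsub>L\<^esub> \<beta> b n"
  and "a \<in> carrier A \<Longrightarrow> n \<in> carrier N \<Longrightarrow> n' \<in> carrier N \<Longrightarrow> \<beta> a (n \<oplus>\<^bsub>N\<^esub> n') = \<beta> a n \<oplus>\<^bsub>L\<^esub> \<beta> a n'"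
  and "a \<in> carrier A \<Longrightarrow> n \<in> carrier N \<Longrightarrow> \<beta> (c \<odot> a) n = \<beta> a (kscale A N c n)"
 using assms by (simp_all add: kbal_def)

text \<open>\<open>repF G e f w\<close> says that \<open>G\<close> behaves like \<open>A e \<otimes>\<^sub>k f A \<otimes>\<^sub>A -\<close>, with \<open>w\<close> in the role of
 \<open>e \<otimes> f \<otimes> 1\<close>.\<close>

definition repF :: "('a, 'k) endo_k \<Rightarrow> 'a \<Rightarrow> 'a \<Rightarrow> (nat \<Rightarrow> 'k) \<Rightarrow> bool" where
 "repF G e f w \<longleftrightarrow> G \<in> lin_functors A \<and> el G PA w \<and>
   e \<odot>\<^bsub>obj G PA\<^esub> w = w \<and> rt G w f = w \<and>
   (\<forall>M\<in>fdmod A. carrier (obj G M) \<subseteq>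
    add_span (obj G M) {a \<odot>\<^bsub>obj G M\<^esub> act G M m w | a m. a \<in> carrier A \<and> m \<in> carrier M}) \<and>
   (\<forall>N\<in>fdmod A. \<forall>L :: ('a, 'k) mod_k. \<forall>\<beta>. abelian_group L \<longrightarrow> kbal N L \<beta> \<longrightarrow>
    (\<exists>h. add_hom (obj G N) L h \<and>
     (\<forall>a\<in>carrier A. \<forall>n\<in>carrier N. h (a \<odot>\<^bsub>obj G N\<^esub> act G N n w) = \<beta> (a \<otimes> e) (f \<odot>\<^bsub>N\<^esub> n))))"

lemma repFD:
 assumes "repF G e f w"
 shows "lin G" and "el G PA w" and "e \<odot>\<^bsub>obj G PA\<^esub> w = w" and "rt G w f = w"
  and "fd M \<Longrightarrow> el G M x \<Longrightarrow>
   x \<in> add_span (obj G M) {a \<odot>\<^bsub>obj G M\<^esub> act G M m w | a m. a \<in> carrier A \<and> m \<in> carrier M}"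
proof -
 note r = assms[unfolded repF_def]
 show "lin G" by (rule r[THEN conjunct1])
 note r = r[THEN conjunct2]
 show "el G PA w" by (rule r[THEN conjunct1])
 note r = r[THEN conjunct2]
 show "e \<odot>\<^bsub>obj G PA\<^esub> w = w" by (rule r[THEN conjunct1])
 note r = r[THEN conjunct2]
 show "rt G w f = w" by (rule r[THEN conjunct1])
 note r = r[THEN conjunct2]
 show "fd M \<Longrightarrow> el G M x \<Longrightarrow>
   x \<in> add_span (obj G M) {a \<odot>\<^bsub>obj G M\<^esub> act G M m w | a m. a \<in> carrier A \<and> m \<in> carrier M}"
  by (rule r[THEN conjunct1, THEN bspec, THEN subsetD])
qed

lemma repF_lift:
 fixes L :: "('a, 'k) mod_k"
 assumes "repF G e f w" "fd N" "abelian_group L" "kbal N L \<beta>"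
 obtains h where "add_hom (obj G N) L h"
  "\<And>a n. a \<in> carrier A \<Longrightarrow> n \<in> carrier N \<Longrightarrow> h (a \<odot>\<^bsub>obj G N\<^esub> act G N n w) = \<beta> (a \<otimes> e) (f \<odot>\<^bsub>N\<^esub> n)"
proof -
 have "\<exists>h. add_hom (obj G N) L h \<and>
   (\<forall>a\<in>carrier A. \<forall>n\<in>carrier N. h (a \<odot>\<^bsub>obj G N\<^esub> act G N n w) = \<beta> (a \<otimes> e) (f \<odot>\<^bsub>N\<^esub> n))"
  using assms unfolding repF_def by simp
 then show thesis using that by (elim exE conjE) simp
qed

definition klin :: "('a, 'u) module \<Rightarrow> ('a, 'w) module \<Rightarrow> ('u \<Rightarrow> 'w) \<Rightarrow> bool" where
 "klin M N f \<longleftrightarrow> add_hom M N f \<and> (\<forall>c. \<forall>x\<in>carrier M. f (kscale A M c x) = kscale A N c (f x))"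

lemma lin_map_klin: "lin_map M N f \<Longrightarrow> klin M N f"
 by (simp add: klin_def lin_mapD(4) lin_map_ks)

lemma repF_gen_closed:
 "repF G e f w \<Longrightarrow> fd M \<Longrightarrow> {a \<odot>\<^bsub>obj G M\<^esub> act G M m w | a m. a \<in> carrier A \<and> m \<in> carrier M} \<subseteq> carrier (obj G M)"
 using m_closed[OF lf_obj[OF repFD(1)]] act_closed[OF repFD(1) _ _ repFD(2)] by blast

lemma repF_hom_eq:
 assumes G: "repF G e f w" and N: "abelian_group N" and M: "fd M"
  and h: "add_hom (obj G M) N g" "add_hom (obj G M) N h"
  and eq: "\<And>a m. a \<in> carrier A \<Longrightarrow> m \<in> carrier M \<Longrightarrow> g (a \<odot>\<^bsub>obj G M\<^esub> act G M m w) = h (a \<odot>\<^bsub>obj G M\<^esub> act G M m w)"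
  and x: "el G M x"
 shows "g x = h x"
 by (rule add_hom_eq_on_span[OF m_ab[OF lf_obj[OF repFD(1)[OF G] M]] N h repF_gen_closed[OF G M] _ repFD(5)[OF G M x]])
  (use eq in blast)

text \<open>A functor of the form \<open>A e \<otimes> f A \<otimes> _\<close> is defined on \<open>k\<close>-linear maps as well.\<close>

lemma repF_klin:
 fixes K :: "('a, 'k) endo_k"
 assumes G: "repF G e f w" and ef: "e \<in> carrier A" "f \<in> carrier A"
  and K: "lin K" and w': "el K PA w'" "e \<odot>\<^bsub>obj K PA\<^esub> w' = w'"
  and N: "fd N" and N': "fd N'" and s: "klin N N' sg"
 obtains h where "lin_map (obj G N) (obj K N') h"
  "\<And>a n. a \<in> carrier A \<Longrightarrow> n \<in> carrier N \<Longrightarrow>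
   h (a \<odot>\<^bsub>obj G N\<^esub> act G N n w) = a \<odot>\<^bsub>obj K N'\<^esub> act K N' (sg (f \<odot>\<^bsub>N\<^esub> n)) w'"
proof -
 note GN = lf_obj[OF repFD(1)[OF G] N] and KN' = lf_obj[OF K N']
 have sh: "add_hom N N' sg" and sk: "\<And>c x. x \<in> carrier N \<Longrightarrow> sg (kscale A N c x) = kscale A N' c (sg x)"
  using s by (simp_all add: klin_def)
 note sD = add_homD[OF sh]
 have ac: "act K N' (sg n) w' \<in> carrier (obj K N')" if "n \<in> carrier N" for n by (rule act_closed[OF K N' sD(1)[OF that] w'(1)])
 \<comment> \<open>Nothing here asks \<open>sg\<close> to commute with \<open>A\<close>: the first
   variable carries the whole left action, and the second one enters through sums and scalars
   only.\<close>
 have "kbal N (obj K N') (\<lambda>y n. y \<odot>\<^bsub>obj K N'\<^esub> act K N' (sg n) w')"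
  unfolding kbal_def
  by (simp add: ac m_closed[OF KN'] m_add_left[OF KN'] sD act_add_left[OF K N' _ _ w'(1)] m_add_right[OF KN']
    act_closed[OF K N' _ w'(1)] sk act_ks_left[OF K N' _ w'(1)] m_kscale[OF KN'] ks_comm[OF KN'])
 then obtain h where h: "add_hom (obj G N) (obj K N') h"
  "\<And>a n. a \<in> carrier A \<Longrightarrow> n \<in> carrier N \<Longrightarrow>
   h (a \<odot>\<^bsub>obj G N\<^esub> act G N n w) = (a \<otimes> e) \<odot>\<^bsub>obj K N'\<^esub> act K N' (sg (f \<odot>\<^bsub>N\<^esub> n)) w'"
  by (rule repF_lift[OF G N m_ab[OF KN']]) blast
 have h2: "h (a \<odot>\<^bsub>obj G N\<^esub> act G N n w) = a \<odot>\<^bsub>obj K N'\<^esub> act K N' (sg (f \<odot>\<^bsub>N\<^esub> n)) w'"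
  if "a \<in> carrier A" "n \<in> carrier N" for a n
  using h(2)[OF that] m_mult[OF KN' that(1) ef(1) ac[OF m_closed[OF N ef(2) that(2)]]]
   act_smult[OF K N' sD(1)[OF m_closed[OF N ef(2) that(2)]] w'(1) ef(1)] w'(2) by simp
 have "lin_map (obj G N) (obj K N') h"
 proof (rule lin_mapI)
  fix a x assume a: "a \<in> carrier A" and x: "el G N x"
  show "h (a \<odot>\<^bsub>obj G N\<^esub> x) = a \<odot>\<^bsub>obj K N'\<^esub> h x"
  proof (rule repF_hom_eq[OF G m_ab[OF KN'] N _ _ _ x])
   show "add_hom (obj G N) (obj K N') (\<lambda>x. h (a \<odot>\<^bsub>obj G N\<^esub> x))"
    by (rule add_hom_comp[OF left_module.add_hom_lsmult[OF fdmod_lmod[OF GN] a] h(1)])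
   show "add_hom (obj G N) (obj K N') (\<lambda>x. a \<odot>\<^bsub>obj K N'\<^esub> h x)"
    by (rule add_hom_comp[OF h(1) left_module.add_hom_lsmult[OF fdmod_lmod[OF KN'] a]])
   fix b n assume b: "b \<in> carrier A" and n: "n \<in> carrier N"
   have "h (a \<odot>\<^bsub>obj G N\<^esub> (b \<odot>\<^bsub>obj G N\<^esub> act G N n w)) = h ((a \<otimes> b) \<odot>\<^bsub>obj G N\<^esub> act G N n w)"
    by (simp only: m_mult[OF GN a b act_closed[OF repFD(1)[OF G] N n repFD(2)[OF G]]])
   then show "h (a \<odot>\<^bsub>obj G N\<^esub> (b \<odot>\<^bsub>obj G N\<^esub> act G N n w)) = a \<odot>\<^bsub>obj K N'\<^esub> h (b \<odot>\<^bsub>obj G N\<^esub> act G N n w)"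
    using h2 a b n m_mult[OF KN' a b ac[OF m_closed[OF N ef(2) n]]] by simp
  qed
 qed (use add_homD[OF h(1)] in auto)
 then show thesis using h2 by (rule that)
qed

text \<open>A Yoneda statement: \<open>w\<close> is universal among the elements fixed by
  \<open>e\<close> on the left and by \<open>f\<close> on the right. The components come from
  \<open>repF_klin\<close> for the identity map, where \<open>f\<close> is absorbed because it fixes
  \<open>w'\<close>.\<close>

lemma repF_ntr:
 fixes K :: "('a, 'k) endo_k"
 assumes r: "repF G e f w" and ef: "e \<in> carrier A" "f \<in> carrier A"
  and K: "lin K" and w': "el K PA w'"
  and e: "e \<odot>\<^bsub>obj K PA\<^esub> w' = w'" and f: "rt K w' f = w'"
 obtains \<eta> where "ntr G K \<eta>" "\<eta> PA w = w'"
proof -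
 note G = repFD(1)[OF r] and w = repFD(2)[OF r]
 have "\<exists>h. lin_map (obj G M) (obj K M) h \<and> (\<forall>a\<in>carrier A. \<forall>m\<in>carrier M.
   h (a \<odot>\<^bsub>obj G M\<^esub> act G M m w) = a \<odot>\<^bsub>obj K M\<^esub> act K M m w')" if M: "fd M" for M
 proof -
  have "klin M M (\<lambda>x. x)" by (simp add: klin_def add_hom_def)
  then obtain h where "lin_map (obj G M) (obj K M) h"
   "\<And>a m. a \<in> carrier A \<Longrightarrow> m \<in> carrier M \<Longrightarrow>
    h (a \<odot>\<^bsub>obj G M\<^esub> act G M m w) = a \<odot>\<^bsub>obj K M\<^esub> act K M (f \<odot>\<^bsub>M\<^esub> m) w'"
   by (rule repF_klin[OF r ef K w' e M M]) blast
  then show ?thesis using act_smult_left[OF K M ef(2) _ w'] f by (intro exI[of _ h]) simp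
 qed
 then have "\<forall>M\<in>fdmod A. \<exists>h. lin_map (obj G M) (obj K M) h \<and> (\<forall>a\<in>carrier A. \<forall>m\<in>carrier M.
   h (a \<odot>\<^bsub>obj G M\<^esub> act G M m w) = a \<odot>\<^bsub>obj K M\<^esub> act K M m w')" by (rule ballI)
 from bchoice[OF this] obtain h where h': "\<forall>M\<in>fdmod A. lin_map (obj G M) (obj K M) (h M) \<and>
   (\<forall>a\<in>carrier A. \<forall>m\<in>carrier M.
    h M (a \<odot>\<^bsub>obj G M\<^esub> act G M m w) = a \<odot>\<^bsub>obj K M\<^esub> act K M m w')" by (elim exE)
 have hl: "\<And>M. fd M \<Longrightarrow> lin_map (obj G M) (obj K M) (h M)"
  and h: "\<And>M a m. fd M \<Longrightarrow> a \<in> carrier A \<Longrightarrow> m \<in> carrier M \<Longrightarrow>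
   h M (a \<odot>\<^bsub>obj G M\<^esub> act G M m w) = a \<odot>\<^bsub>obj K M\<^esub> act K M m w'"
  using h' by simp_all
 have "ntr G K h"
 proof (rule ntrI[OF hl])
  fix M N :: "('a, 'k) mod_k" and g x
  assume M: "fd M" and N: "fd N" and g: "g \<in> mhom A M N" and x: "el G M x"
  note Gg = lf_lin[OF G M N g] and Kg = lf_lin[OF K M N g]
  show "h N (mor G M N g x) = mor K M N g (h M x)"
  proof (rule repF_hom_eq[OF r m_ab[OF lf_obj[OF K N]] M _ _ _ x])
   show "add_hom (obj G M) (obj K N) (\<lambda>x. h N (mor G M N g x))" by (intro lin_mapD(4) lin_map_comp[OF Gg hl[OF N]])
   show "add_hom (obj G M) (obj K N) (\<lambda>x. mor K M N g (h M x))" by (intro lin_mapD(4) lin_map_comp[OF hl[OF M] Kg])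
   fix a m assume a: "a \<in> carrier A" and m: "m \<in> carrier M"
   show "h N (mor G M N g (a \<odot>\<^bsub>obj G M\<^esub> act G M m w)) = mor K M N g (h M (a \<odot>\<^bsub>obj G M\<^esub> act G M m w))"
    using h[OF M a m] h[OF N a lin_mapD(1)[OF mhom_lin[OF g] m]] lin_mapD(3)[OF Gg a act_closed[OF G M m w]]
     lin_mapD(3)[OF Kg a act_closed[OF K M m w']] act_mor[OF G M N g m w] act_mor[OF K M N g m w'] by simp
  qed
 qed
 moreover have "h PA w = w'"
  using h[OF PA_fdmod one_closed jA_closed[OF one_closed]] act_one[OF G PA_fdmod w] act_one[OF K PA_fdmod w']
  by (simp add: m_one[OF lf_obj[OF G PA_fdmod] w] m_one[OF lf_obj[OF K PA_fdmod] w'])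
 ultimately show thesis by (rule that)
qed

section \<open>The bimodules \<open>A e \<otimes> f A\<close> over the field\<close>

definition SA where "SA e = (\<lambda>a. a \<otimes> e) ` carrier A"
definition TA where "TA f = (\<lambda>a. f \<otimes> a) ` carrier A"

abbreviation kring :: "'k ring" where "kring \<equiv> ring_of_type_algebra"

abbreviation S1 :: "'a \<Rightarrow> ('a, 'a, 'k) bimodule" where
 "S1 e \<equiv> sub_bimod A (SA e) (monoid.mult A) (\<lambda>x c. c \<odot> x)"
abbreviation T1 :: "'a \<Rightarrow> ('k, 'a, 'a) bimodule" where
 "T1 f \<equiv> sub_bimod A (TA f) (module.smult A) (monoid.mult A)"

abbreviation OB where "OB e f \<equiv> outer_bimod A (SA e) (TA f)"

lemma sub_bimod_simps:
 "carrier (sub_bimod A S l r) = S" "\<zero>\<^bsub>sub_bimod A S l r\<^esub> = \<zero>"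
 "x \<oplus>\<^bsub>sub_bimod A S l r\<^esub> y = x \<oplus> y"
 "a \<odot>\<^bsub>sub_bimod A S l r\<^esub> x = l a x" "rsmult (sub_bimod A S l r) x b = r x b"
 by (simp_all add: sub_bimod_def)

lemma sub_bimod_abelian:
 assumes "S \<subseteq> carrier A" "\<zero> \<in> S" "\<And>x y. x \<in> S \<Longrightarrow> y \<in> S \<Longrightarrow> x \<oplus> y \<in> S"
  and "\<And>x. x \<in> S \<Longrightarrow> \<ominus> x \<in> S"
 shows "abelian_group (sub_bimod A S l r)"
proof (rule abelian_groupI, unfold sub_bimod_simps)
 fix x assume x: "x \<in> S"
 have "\<ominus> x \<oplus> x = \<zero>" using x assms(1) by (intro l_neg) auto
 then show "\<exists>y\<in>S. y \<oplus> x = \<zero>" using assms(4)[OF x] by blast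
qed (use assms in \<open>simp_all add: subset_iff a_ac\<close>)

lemma abelian_group_cong:
 assumes "abelian_group M" "carrier N = carrier M" "ring.zero N = ring.zero M" "ring.add N = ring.add M"
 shows "abelian_group N"
proof -
 interpret M: abelian_group M by fact
 show ?thesis
 proof (rule abelian_groupI, unfold assms(2-4))
  show "\<exists>y\<in>carrier M. y \<oplus>\<^bsub>M\<^esub> x = \<zero>\<^bsub>M\<^esub>" if "x \<in> carrier M" for x
   using M.l_neg[OF that] M.a_inv_closed[OF that] by (rule bexI)
 qed (simp_all add: M.a_ac)
qed

lemma add_span_cong:
 assumes "x \<in> add_span M U" "ring.zero N = ring.zero M" "ring.add N = ring.add M"
 shows "x \<in> add_span N U"
 using assms(1)
proof (induction rule: add_span.induct)
 case zero
 show ?case using add_span.zero[of N U] assms by simp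
next
 case (add x y)
 show ?case using add_span.add[OF add(1,3)] assms by simp
qed

lemma add_span_image:
 assumes "abelian_group M" "abelian_group N" "add_hom M N g" "U \<subseteq> carrier M" "x \<in> add_span M U"
  and "\<And>x. x \<in> U \<Longrightarrow> g x \<in> V"
 shows "g x \<in> add_span N V"
 using assms(5)
proof (induction rule: add_span.induct)
 case zero
 show ?case by (simp add: add_hom_zero[OF assms(1-3)] add_span.zero)
next
 case (add x y)
 have "x \<in> carrier M" "y \<in> carrier M"
  using add assms(4) abelian_group.add_span_closed[OF assms(1) add(2) assms(4)] by auto
 then show ?case
  using add_span.add[OF assms(6)[OF add(1)] add(3)] by (simp add: add_homD(2)[OF assms(3)])
qed

lemma outer_simps:
 "carrier (OB e f) = carrier (tensor kring (S1 e) (T1 f))"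
 "ring.zero (OB e f) = ring.zero (tensor kring (S1 e) (T1 f))"
 "ring.add (OB e f) = ring.add (tensor kring (S1 e) (T1 f))"
 "a \<odot>\<^bsub>OB e f\<^esub> Z = tensor_map kring (S1 e) (T1 f) (\<lambda>(x, y). (a \<otimes> x, y)) Z"
 "rsmult (OB e f) Z b = tensor_map kring (S1 e) (T1 f) (\<lambda>(x, y). (x, y \<otimes> b)) Z"
 by (simp_all add: outer_bimod_def tensor_bimod_def tensor_def module.defs sub_bimod_simps)

context
 fixes e f :: 'a
 assumes e: "e \<in> carrier A" "e \<otimes> e = e" and f: "f \<in> carrier A" "f \<otimes> f = f"
begin

lemma SA_iff: "x \<in> SA e \<longleftrightarrow> x \<in> carrier A \<and> x \<otimes> e = x"
 unfolding SA_def using e by (auto simp: m_assoc image_iff intro!: bexI[of _ x])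

lemma TA_iff: "x \<in> TA f \<longleftrightarrow> x \<in> carrier A \<and> f \<otimes> x = x"
 unfolding TA_def using f by (auto simp: m_assoc[symmetric] image_iff intro!: bexI[of _ x])

lemma outer_setup: "tensor_setup kring (S1 e) (T1 f)"
proof (rule tensor_setup.intro, unfold sub_bimod_simps)
 show "abelian_group (S1 e)"
  by (rule sub_bimod_abelian) (auto simp: SA_iff l_distr e l_minus)
 show "abelian_group (T1 f)"
  by (rule sub_bimod_abelian) (auto simp: TA_iff r_distr f r_minus)
qed (auto simp: SA_iff TA_iff ksmult_closed ksmult_mult_left ksmult_mult_right e f)

interpretation O: tensor_setup kring "S1 e" "T1 f" by (rule outer_setup)

abbreviation ptK where "ptK \<equiv> pure_tensor kring (S1 e) (T1 f)"

lemma kring_carrier: "c \<in> carrier kring"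
 by (simp add: ring_of_type_algebra_def)

lemma outer_abelian: "abelian_group (OB e f)"
 by (rule abelian_group_cong[OF O.abelian_group_tensor outer_simps(1-3)])

lemma add_hom_outer: "add_hom (OB e f) (OB e f) h \<longleftrightarrow> add_hom O.T O.T h"
 by (simp add: add_hom_def outer_simps)

lemma ptK_closed: "x \<in> SA e \<Longrightarrow> y \<in> TA f \<Longrightarrow> ptK x y \<in> carrier (OB e f)"
 unfolding outer_simps by (rule O.pt_closed) (simp_all add: sub_bimod_simps)

lemma ptK_balanced: "x \<in> SA e \<Longrightarrow> y \<in> TA f \<Longrightarrow> ptK (c \<odot> x) y = ptK x (c \<odot> y)"
 using O.pt_balanced[OF _ kring_carrier, of x y c] by (simp add: sub_bimod_simps)

lemma
 assumes "a \<in> carrier A"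
 shows outer_l_hom: "add_hom (OB e f) (OB e f) (\<lambda>z. a \<odot>\<^bsub>OB e f\<^esub> z)"
  and outer_l_pt: "x \<in> SA e \<Longrightarrow> y \<in> TA f \<Longrightarrow> a \<odot>\<^bsub>OB e f\<^esub> ptK x y = ptK (a \<otimes> x) y"
  and outer_r_hom: "add_hom (OB e f) (OB e f) (\<lambda>z. rsmult (OB e f) z a)"
  and outer_r_pt: "x \<in> SA e \<Longrightarrow> y \<in> TA f \<Longrightarrow> rsmult (OB e f) (ptK x y) a = ptK x (y \<otimes> a)"
proof -
 have l: "a \<otimes> x \<in> SA e" if "x \<in> SA e" for x using that assms e by (simp add: SA_iff m_assoc)
 have r: "y \<otimes> a \<in> TA f" if "y \<in> TA f" for y
  using that assms f by (simp add: TA_iff m_assoc[symmetric])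
 note pl = O.pt_add_left[unfolded sub_bimod_simps] and pr = O.pt_add_right[unfolded sub_bimod_simps]
 note pc = O.pt_closed[unfolded sub_bimod_simps]
 have bl: "balanced_map kring (S1 e) (T1 f) O.T (\<lambda>x y. O.pt (fst ((\<lambda>(x, y). (a \<otimes> x, y)) (x, y))) (snd ((\<lambda>(x, y). (a \<otimes> x, y)) (x, y))))"
  by (rule balanced_mapI, unfold sub_bimod_simps)
   (use l assms in \<open>auto simp: pc pl pr r_distr SA_iff[THEN iffD1, THEN conjunct1] ptK_balanced ksmult_mult_right\<close>)
 have br: "balanced_map kring (S1 e) (T1 f) O.T (\<lambda>x y. O.pt (fst ((\<lambda>(x, y). (x, y \<otimes> a)) (x, y))) (snd ((\<lambda>(x, y). (x, y \<otimes> a)) (x, y))))"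
  by (rule balanced_mapI, unfold sub_bimod_simps)
   (use r assms in \<open>auto simp: pc pl pr l_distr TA_iff[THEN iffD1, THEN conjunct1] ptK_balanced ksmult_mult_left\<close>)
 note tl = tensor_map_add_hom[OF outer_setup outer_setup bl, unfolded sub_bimod_simps]
 note tr = tensor_map_add_hom[OF outer_setup outer_setup br, unfolded sub_bimod_simps]
 show "add_hom (OB e f) (OB e f) (\<lambda>z. a \<odot>\<^bsub>OB e f\<^esub> z)"
  unfolding add_hom_outer outer_simps by (rule tl(1)) (auto simp: l)
 show "a \<odot>\<^bsub>OB e f\<^esub> ptK x y = ptK (a \<otimes> x) y" if "x \<in> SA e" "y \<in> TA f"
  unfolding outer_simps using that by (subst tl(2)) (auto simp: l)
 show "add_hom (OB e f) (OB e f) (\<lambda>z. rsmult (OB e f) z a)"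
  unfolding add_hom_outer outer_simps by (rule tr(1)) (auto simp: r)
 show "rsmult (OB e f) (ptK x y) a = ptK x (y \<otimes> a)" if "x \<in> SA e" "y \<in> TA f"
  unfolding outer_simps using that by (subst tr(2)) (auto simp: r)
qed

lemma SA_mult: "a \<in> carrier A \<Longrightarrow> x \<in> SA e \<Longrightarrow> a \<otimes> x \<in> SA e"
 using e by (simp add: SA_iff m_assoc)

lemma TA_mult: "a \<in> carrier A \<Longrightarrow> y \<in> TA f \<Longrightarrow> y \<otimes> a \<in> TA f"
 using f by (simp add: TA_iff m_assoc[symmetric])

lemma outer_eqI:
 assumes "add_hom (OB e f) (OB e f) g" "add_hom (OB e f) (OB e f) h"
  and "\<And>x y. x \<in> SA e \<Longrightarrow> y \<in> TA f \<Longrightarrow> g (ptK x y) = h (ptK x y)" "Z \<in> carrier (OB e f)"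
 shows "g Z = h Z"
 by (rule O.tensor_hom_eq[OF O.abelian_group_tensor])
  (use assms in \<open>simp_all add: add_hom_outer outer_simps sub_bimod_simps\<close>)

lemma outer_lmod: "left_module A (OB e f)"
proof -
 note o = outer_abelian
 have pl: "ptK (x \<oplus> x') y = ptK x y \<oplus>\<^bsub>OB e f\<^esub> ptK x' y" if "x \<in> SA e" "x' \<in> SA e" "y \<in> TA f" for x x' y
  using O.pt_add_left[of x x' y] that by (simp add: outer_simps sub_bimod_simps)
 have "left_module_axioms A (OB e f)"
 proof
  fix a z assume a: "a \<in> carrier A" "z \<in> carrier (OB e f)"
  show "a \<odot>\<^bsub>OB e f\<^esub> z \<in> carrier (OB e f)" by (rule add_homD(1)[OF outer_l_hom[OF a(1)] a(2)])
  show "a \<odot>\<^bsub>OB e f\<^esub> (z \<oplus>\<^bsub>OB e f\<^esub> w) = a \<odot>\<^bsub>OB e f\<^esub> z \<oplus>\<^bsub>OB e f\<^esub> a \<odot>\<^bsub>OB e f\<^esub> w"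
   if "w \<in> carrier (OB e f)" for w
   by (rule add_homD(2)[OF outer_l_hom[OF a(1)] a(2) that])
  fix b assume b: "b \<in> carrier A"
  show "(a \<oplus> b) \<odot>\<^bsub>OB e f\<^esub> z = a \<odot>\<^bsub>OB e f\<^esub> z \<oplus>\<^bsub>OB e f\<^esub> b \<odot>\<^bsub>OB e f\<^esub> z"
   by (rule outer_eqI[OF outer_l_hom add_hom_plus[OF o outer_l_hom[OF a(1)] outer_l_hom[OF b]] _ a(2)])
    (use a b SA_mult in \<open>auto simp: outer_l_pt l_distr pl SA_iff[THEN iffD1, THEN conjunct1]\<close>)
  show "(a \<otimes> b) \<odot>\<^bsub>OB e f\<^esub> z = a \<odot>\<^bsub>OB e f\<^esub> (b \<odot>\<^bsub>OB e f\<^esub> z)"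
   by (rule outer_eqI[OF outer_l_hom add_hom_comp[OF outer_l_hom[OF b] outer_l_hom[OF a(1)]] _ a(2)])
    (use a b SA_mult in \<open>auto simp: outer_l_pt m_assoc SA_iff[THEN iffD1, THEN conjunct1]\<close>)
 next
  fix z assume z: "z \<in> carrier (OB e f)"
  show "\<one> \<odot>\<^bsub>OB e f\<^esub> z = z"
   by (rule outer_eqI[OF outer_l_hom add_hom_id _ z])
    (auto simp: outer_l_pt SA_iff[THEN iffD1, THEN conjunct1])
 qed
 then show ?thesis using A_ring o by (simp add: left_module_def)
qed

lemma outer_bimod: "bimod (OB e f)"
 unfolding bimod_def
proof (intro conjI ballI allI)
 show "left_module A (OB e f)" by (rule outer_lmod)
 show "rsmult (OB e f) z r \<in> carrier (OB e f)" if "z \<in> carrier (OB e f)" "r \<in> carrier A" for z r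
  by (rule add_homD(1)[OF outer_r_hom[OF that(2)] that(1)])
 show "rsmult (OB e f) (a \<odot>\<^bsub>OB e f\<^esub> z) r = a \<odot>\<^bsub>OB e f\<^esub> rsmult (OB e f) z r"
  if "a \<in> carrier A" "z \<in> carrier (OB e f)" "r \<in> carrier A" for a z r
  by (rule outer_eqI[OF add_hom_comp[OF outer_l_hom[OF that(1)] outer_r_hom[OF that(3)]]
     add_hom_comp[OF outer_r_hom[OF that(3)] outer_l_hom[OF that(1)]] _ that(2)])
   (use that SA_mult TA_mult in \<open>simp add: outer_l_pt outer_r_pt\<close>)
 show "rsmult (OB e f) z (sc c) = sc c \<odot>\<^bsub>OB e f\<^esub> z" if "z \<in> carrier (OB e f)" for z c
  by (rule outer_eqI[OF outer_r_hom[OF sc_closed] outer_l_hom[OF sc_closed] _ that])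
   (simp add: outer_l_pt outer_r_pt sc_closed sc_mult mult_sc ptK_balanced SA_iff[THEN iffD1, THEN conjunct1]
    TA_iff[THEN iffD1, THEN conjunct1])
 obtain S where S: "finite S" "S \<subseteq> carrier A" "carrier A \<subseteq> add_span A {c \<odot> s | c s. s \<in> S}"
  using fin_gen by (elim exE conjE)
 let ?P = "(\<lambda>(s, t). ptK (s \<otimes> e) (f \<otimes> t)) ` (S \<times> S)"
 let ?W = "{sc c \<odot>\<^bsub>OB e f\<^esub> s | c s. s \<in> ?P}"
 let ?U = "{c \<odot> s | c s. s \<in> S}"
 have U: "?U \<subseteq> carrier A" using S by (auto simp: ksmult_closed)
 have Se: "s \<otimes> e \<in> SA e" "f \<otimes> s \<in> TA f" if "s \<in> S" for s
  using that S(2) by (auto simp: SA_def TA_def)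
 have P: "?P \<subseteq> carrier (OB e f)" using Se by (auto intro!: ptK_closed)
 have W: "?W \<subseteq> carrier (OB e f)" using P add_homD(1)[OF outer_l_hom[OF sc_closed]] by blast
 have g1: "add_hom A (S1 e) (\<lambda>a. a \<otimes> e)" by (rule add_homI) (auto simp: sub_bimod_simps SA_def l_distr e)
 have g2: "add_hom A (T1 f) (\<lambda>a. f \<otimes> a)" by (rule add_homI) (auto simp: sub_bimod_simps TA_def r_distr f)
 let ?U1 = "(\<lambda>a. a \<otimes> e) ` ?U" and ?U2 = "(\<lambda>a. f \<otimes> a) ` ?U"
 have pt: "ptK x y \<in> add_span O.T ?W" if xy: "x \<in> SA e" "y \<in> TA f" for x y
 proof (rule bilinear_span[OF O.abelian_group_tensor O.M O.N _ _ O.pt_balanced_map, of ?U1 ?U2])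
  show "?U1 \<subseteq> carrier (S1 e)" "?U2 \<subseteq> carrier (T1 f)"
   using U by (auto simp: sub_bimod_simps SA_def TA_def)
  show "?W \<subseteq> carrier O.T" using W by (simp add: outer_simps)
  have x: "x \<in> carrier A" "x \<otimes> e = x" and y: "y \<in> carrier A" "f \<otimes> y = y"
   using xy by (auto simp: SA_iff TA_iff)
  show "x \<in> add_span (S1 e) ?U1"
   using add_span_image[OF A_abelian O.M g1 U, of x ?U1] S(3) x by auto
  show "y \<in> add_span (T1 f) ?U2"
   using add_span_image[OF A_abelian O.N g2 U, of y ?U2] S(3) y by auto
  fix x' y' assume "x' \<in> ?U1" "y' \<in> ?U2"
  then obtain c s d t where *: "x' = (c \<odot> s) \<otimes> e" "s \<in> S" "y' = f \<otimes> (d \<odot> t)" "t \<in> S" by blast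
  have st: "s \<in> carrier A" "t \<in> carrier A" using * S by auto
  have 1: "x' = c \<odot> (s \<otimes> e)" "y' = d \<odot> (f \<otimes> t)"
   using * st e f by (simp_all add: ksmult_mult_left ksmult_mult_right)
  have x'S: "x' \<in> SA e" using *(1) st by (auto simp: SA_def ksmult_closed)
  have "ptK x' y' = ptK (d \<odot> x') (f \<otimes> t)"
   unfolding 1(2) using ptK_balanced[OF x'S Se(2)[OF *(4)]] by simp
  also have "d \<odot> x' = sc (d * c) \<otimes> (s \<otimes> e)"
   unfolding 1(1) using st e by (simp add: sc_mult flip: ksmult_assoc)
  also have "ptK (sc (d * c) \<otimes> (s \<otimes> e)) (f \<otimes> t) = sc (d * c) \<odot>\<^bsub>OB e f\<^esub> ptK (s \<otimes> e) (f \<otimes> t)"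
   by (rule outer_l_pt[OF sc_closed Se(1)[OF *(2)] Se(2)[OF *(4)], symmetric])
  finally have "ptK x' y' \<in> ?W" using *(2,4) by blast
  then show "ptK x' y' \<in> add_span O.T ?W"
   by (rule O.T.add_span_incl) (use W in \<open>simp add: outer_simps\<close>)
 qed
 have "z \<in> add_span (OB e f) ?W" if z: "z \<in> carrier (OB e f)" for z
 proof -
  have "z \<in> add_span O.T {O.pt x y | x y. x \<in> carrier (S1 e) \<and> y \<in> carrier (T1 f)}"
   by (rule O.tensor_generated) (use z in \<open>simp add: outer_simps\<close>)
  then have "z \<in> add_span O.T ?W"
  proof (induction rule: add_span.induct)
   case zero
   show ?case by (rule add_span.zero)
  next
   case (add x y)
   then have "x \<in> add_span O.T ?W" using pt by (auto simp: sub_bimod_simps)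
   then show ?case by (rule O.T.add_span_add[OF _ add(3)]) (use W in \<open>simp add: outer_simps\<close>)
  qed
  then show ?thesis by (rule add_span_cong) (simp_all add: outer_simps)
 qed
 then have "carrier (OB e f) \<subseteq> add_span (OB e f) ?W" by (rule subsetI)
 moreover have "finite ?P" using S(1) by simp
 ultimately have "finite ?P \<and> ?P \<subseteq> carrier (OB e f) \<and> carrier (OB e f) \<subseteq> add_span (OB e f) ?W"
  using P by (intro conjI)
 then show "\<exists>S. finite S \<and> S \<subseteq> carrier (OB e f) \<and> carrier (OB e f) \<subseteq> add_span (OB e f) {sc c \<odot>\<^bsub>OB e f\<^esub> s | c s. s \<in> S}"
  by (rule exI[of _ ?P])
qed

text \<open>The universal element is the image of \<open>e \<otimes> f\<close>. Its universal
  property is obtained in two stages: for fixed \<open>n\<close>, the map \<open>\<beta>\<close>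
  induces \<open>x \<otimes> y \<mapsto> \<beta> x (y n)\<close> on
  \<open>A e \<otimes> f A\<close>; with \<open>n\<close> varying, these maps are balanced over
  \<open>A\<close>, so the outer tensor product can be lifted from as well.\<close>

lemma repF_exists:
 fixes G :: "('a, 'k) endo_k"
 assumes G: "lin G" and iso: "nat_iso A G (tensor_functor A (OB e f))"
 shows "\<exists>w. repF G e f w"
proof -
 obtain u where u: "rep G (OB e f) u" using rep_exists[OF outer_bimod G iso] by (elim exE)
 note r = repD[OF u]
 have eS: "e \<in> SA e" and fT: "f \<in> TA f" using e f by (auto simp: SA_iff TA_iff)
 define w where "w = u (ptK e f)"
 note GP = lf_obj[OF G PA_fdmod]
 have w: "el G PA w" unfolding w_def by (rule r(2)[OF ptK_closed[OF eS fT]])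
 \<comment> \<open>\<open>x \<otimes> y = x (e \<otimes> f) y\<close>, so the single element
   \<open>w\<close> generates everything.\<close>
 have upt: "u (ptK x y) = x \<odot>\<^bsub>obj G PA\<^esub> rt G w y" if "x \<in> SA e" "y \<in> TA f" for x y
 proof -
  have xy: "x \<in> carrier A" "x \<otimes> e = x" "y \<in> carrier A" "f \<otimes> y = y" using that by (auto simp: SA_iff TA_iff)
  have "ptK x y = x \<odot>\<^bsub>OB e f\<^esub> rsmult (OB e f) (ptK e f) y"
   using xy that eS fT by (simp add: outer_r_pt outer_l_pt)
  then show ?thesis
   unfolding w_def using xy r(4,5) ptK_closed[OF eS fT] add_homD(1)[OF outer_r_hom[OF xy(3)] ptK_closed[OF eS fT]] by simp
 qed
 have "repF G e f w"
  unfolding repF_def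
 proof (intro conjI ballI allI impI)
  have "e \<odot>\<^bsub>OB e f\<^esub> ptK e f = ptK e f" "rsmult (OB e f) (ptK e f) f = ptK e f"
   using e f eS fT by (simp_all add: outer_l_pt outer_r_pt)
  then show "e \<odot>\<^bsub>obj G PA\<^esub> w = w" "rt G w f = w"
   unfolding w_def using r(4)[OF ptK_closed[OF eS fT] e(1)] r(5)[OF ptK_closed[OF eS fT] f(1)] by simp_all
  fix M :: "('a, 'k) mod_k" assume M: "fd M"
  let ?U = "{a \<odot>\<^bsub>obj G M\<^esub> act G M m w | a m. a \<in> carrier A \<and> m \<in> carrier M}"
  note GM = lf_obj[OF G M]
  have Uc: "?U \<subseteq> carrier (obj G M)" by (auto simp: m_closed[OF GM] act_closed[OF G M _ w])
  interpret GM: abelian_group "obj G M" by (rule m_ab[OF GM])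
  show "carrier (obj G M) \<subseteq> add_span (obj G M) ?U"
  proof
   have 1: "act G M m (u b) \<in> add_span (obj G M) ?U" if m: "m \<in> carrier M" and b: "b \<in> carrier (OB e f)" for m b
   proof -
    have gh: "add_hom O.T (obj G M) (\<lambda>b. act G M m (u b))"
     by (rule add_homI)
      (use r(2,3) act_closed[OF G M m] act_add_right[OF G M m] in \<open>simp_all add: outer_simps\<close>)
    show ?thesis
    proof (rule add_span_image[OF O.abelian_group_tensor m_ab[OF GM] gh _ O.tensor_generated])
     show "{O.pt x y | x y. x \<in> carrier (S1 e) \<and> y \<in> carrier (T1 f)} \<subseteq> carrier O.T" using O.pt_closed by blast
     show "b \<in> carrier O.T" using b by (simp add: outer_simps)
     fix z assume "z \<in> {O.pt x y | x y. x \<in> carrier (S1 e) \<and> y \<in> carrier (T1 f)}"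
     then obtain x y where z: "z = ptK x y" "x \<in> SA e" "y \<in> TA f" by (auto simp: sub_bimod_simps)
     have xy: "x \<in> carrier A" "y \<in> carrier A" using z by (auto simp: SA_iff TA_iff)
     have "act G M m (u z) = x \<odot>\<^bsub>obj G M\<^esub> act G M (y \<odot>\<^bsub>M\<^esub> m) w"
      unfolding z(1) upt[OF z(2,3)] act_smult[OF G M m rt_closed[OF G w xy(2)] xy(1)]
      by (simp add: act_smult_left[OF G M xy(2) m w])
     then show "act G M m (u z) \<in> ?U" using xy m_closed[OF M xy(2) m] by blast
    qed
   qed
   fix x assume "el G M x"
   from r(6)[OF M this] show "x \<in> add_span (obj G M) ?U"
   proof (induction rule: add_span.induct)
    case zero
    show ?case by (rule add_span.zero)
   next
    case (add x y)
    then have "x \<in> add_span (obj G M) ?U" using 1 by auto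
    then show ?case by (rule GM.add_span_add[OF _ add(3) Uc])
   qed
  qed
  fix L :: "('a, 'k) mod_k" and \<beta> assume L: "abelian_group L" and b: "kbal M L \<beta>"
  interpret L: abelian_group L by fact
  note bd = kbalD[OF b]
  have "\<exists>h. add_hom O.T L h \<and> (\<forall>x\<in>SA e. \<forall>y\<in>TA f. h (ptK x y) = \<beta> x (y \<odot>\<^bsub>M\<^esub> n))" if n: "n \<in> carrier M" for n
  proof -
   have "balanced_map kring (S1 e) (T1 f) L (\<lambda>x y. \<beta> x (y \<odot>\<^bsub>M\<^esub> n))"
    by (rule balanced_mapI, unfold sub_bimod_simps)
     (simp_all add: SA_iff TA_iff bd n m_closed[OF M] m_add_left[OF M] m_kscale[OF M])
   then obtain h where "add_hom O.T L h" "\<And>x y. x \<in> carrier (S1 e) \<Longrightarrow> y \<in> carrier (T1 f) \<Longrightarrow> h (ptK x y) = \<beta> x (y \<odot>\<^bsub>M\<^esub> n)"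
    by (rule O.tensor_lift[OF L]) blast
   then show ?thesis by (intro exI[of _ h]) (simp add: sub_bimod_simps)
  qed
  then have "\<forall>n\<in>carrier M. \<exists>h. add_hom O.T L h \<and> (\<forall>x\<in>SA e. \<forall>y\<in>TA f. h (ptK x y) = \<beta> x (y \<odot>\<^bsub>M\<^esub> n))"
   by (rule ballI)
  from bchoice[OF this] obtain h where h': "\<forall>n\<in>carrier M. add_hom O.T L (h n) \<and>
    (\<forall>x\<in>SA e. \<forall>y\<in>TA f. h n (ptK x y) = \<beta> x (y \<odot>\<^bsub>M\<^esub> n))" by (elim exE)
  have h: "\<And>n. n \<in> carrier M \<Longrightarrow> add_hom O.T L (h n)"
   "\<And>n x y. n \<in> carrier M \<Longrightarrow> x \<in> SA e \<Longrightarrow> y \<in> TA f \<Longrightarrow> h n (ptK x y) = \<beta> x (y \<odot>\<^bsub>M\<^esub> n)"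
   using h' by simp_all
  have "balanced_map A (OB e f) M L (\<lambda>b n. h n b)"
  proof (rule balanced_mapI)
   fix b n assume bn: "b \<in> carrier (OB e f)" "n \<in> carrier M"
   then have bT: "b \<in> carrier O.T" by (simp add: outer_simps)
   show "h n b \<in> carrier L" by (rule add_homD(1)[OF h(1)[OF bn(2)] bT])
   show "h n (b \<oplus>\<^bsub>OB e f\<^esub> b') = h n b \<oplus>\<^bsub>L\<^esub> h n b'" if "b' \<in> carrier (OB e f)" for b'
    using add_homD(2)[OF h(1)[OF bn(2)] bT, of b'] that by (simp add: outer_simps)
   show "h (n \<oplus>\<^bsub>M\<^esub> n') b = h n b \<oplus>\<^bsub>L\<^esub> h n' b" if n': "n' \<in> carrier M" for n'
    by (rule O.tensor_hom_eq[OF L h(1) add_hom_plus[OF L h(1) h(1)] _ bT])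
     (use bn n' in \<open>auto simp: sub_bimod_simps h(2) m_add_closed[OF M] m_add_right[OF M] SA_iff TA_iff bd m_closed[OF M]\<close>)
   fix a assume a: "a \<in> carrier A"
   show "h n (rsmult (OB e f) b a) = h (a \<odot>\<^bsub>M\<^esub> n) b"
    by (rule O.tensor_hom_eq[OF L add_hom_comp[OF _ h(1)] h(1) _ bT])
     (use bn a outer_r_hom[OF a] TA_mult[OF a] in \<open>auto simp: sub_bimod_simps h(2) m_closed[OF M] add_hom_outer outer_r_pt[OF a] m_mult[OF M] TA_iff\<close>)
  qed
  then obtain g where g: "add_hom (obj G M) L g"
   "\<And>b n. b \<in> carrier (OB e f) \<Longrightarrow> n \<in> carrier M \<Longrightarrow> g (act G M n (u b)) = h n b"
   by (rule rep_lift[OF u M L]) blast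
  have "g (a \<odot>\<^bsub>obj G M\<^esub> act G M n w) = \<beta> (a \<otimes> e) (f \<odot>\<^bsub>M\<^esub> n)" if an: "a \<in> carrier A" "n \<in> carrier M" for a n
  proof -
   have "a \<odot>\<^bsub>obj G M\<^esub> act G M n w = act G M n (u (ptK (a \<otimes> e) f))"
    using act_smult[OF G M an(2) w an(1)] r(4)[OF ptK_closed[OF eS fT] an(1)]
    by (simp add: outer_l_pt[OF an(1) eS fT] w_def)
   then show ?thesis
    using g(2)[OF ptK_closed[OF SA_mult[OF an(1) eS] fT] an(2)] h(2)[OF an(2) SA_mult[OF an(1) eS] fT] by simp
  qed
  then show "\<exists>h. add_hom (obj G M) L h \<and>
    (\<forall>a\<in>carrier A. \<forall>n\<in>carrier M. h (a \<odot>\<^bsub>obj G M\<^esub> act G M n w) = \<beta> (a \<otimes> e) (f \<odot>\<^bsub>M\<^esub> n))"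
   using g(1) by blast
 qed (rule G w)+
 then show ?thesis by (rule exI[of "repF G e f"])
qed

end

section \<open>Bases and generalized inverses of linear maps\<close>

definition lc :: "('a, 'u) module \<Rightarrow> 'u set \<Rightarrow> ('u \<Rightarrow> 'k) \<Rightarrow> 'u" where
 "lc M S c = finsum M (\<lambda>s. kscale A M (c s) s) S"

context
 fixes M :: "('a, 'u) module"
 assumes M: "fd M"
begin

interpretation M: abelian_group M by (rule m_ab[OF M])

lemma lc_closed: "S \<subseteq> carrier M \<Longrightarrow> lc M S c \<in> carrier M"
 unfolding lc_def by (rule M.finsum_closed) (auto simp: ks_closed[OF M] subset_iff)

lemma lc_cong: "S \<subseteq> carrier M \<Longrightarrow> (\<And>s. s \<in> S \<Longrightarrow> c s = d s) \<Longrightarrow> lc M S c = lc M S d"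
 unfolding lc_def by (rule M.add.finprod_cong') (auto simp: ks_closed[OF M] subset_iff)

lemma lc_add: "S \<subseteq> carrier M \<Longrightarrow> lc M S (\<lambda>s. c s + d s) = lc M S c \<oplus>\<^bsub>M\<^esub> lc M S d"
proof -
 assume S: "S \<subseteq> carrier M"
 have "lc M S (\<lambda>s. c s + d s) = finsum M (\<lambda>s. kscale A M (c s) s \<oplus>\<^bsub>M\<^esub> kscale A M (d s) s) S"
  unfolding lc_def by (rule M.add.finprod_cong') (use S in \<open>auto simp: ks_closed[OF M] ks_add[OF M] subset_iff\<close>)
 then show ?thesis
  unfolding lc_def using S by (simp add: M.finsum_addf ks_closed[OF M] subset_iff Pi_iff)
qed

lemma lc_scale: "finite S \<Longrightarrow> S \<subseteq> carrier M \<Longrightarrow> lc M S (\<lambda>s. r * c s) = kscale A M r (lc M S c)"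
proof -
 assume S: "finite S" "S \<subseteq> carrier M"
 have h: "add_hom M M (kscale A M r)"
  by (rule add_homI) (auto simp: ks_closed[OF M] ks_add_right[OF M])
 have "kscale A M r (lc M S c) = finsum M (\<lambda>s. kscale A M r (kscale A M (c s) s)) S"
  unfolding lc_def by (rule add_hom_finsum[OF m_ab[OF M] m_ab[OF M] h S(1)]) (use S in \<open>auto simp: ks_closed[OF M]\<close>)
 also have "\<dots> = lc M S (\<lambda>s. r * c s)"
  unfolding lc_def by (rule M.add.finprod_cong') (use S in \<open>auto simp: ks_closed[OF M] ks_mult[OF M] subset_iff\<close>)
 finally show ?thesis by simp
qed

lemma lc_remove:
 assumes S: "finite S" "S \<subseteq> carrier M" "t \<in> S" and c: "c t = 0"
 shows "lc M S c = lc M (S - {t}) c"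
proof -
 have t: "t \<in> carrier M" using S by auto
 have "finsum M (\<lambda>s. kscale A M (c s) s) (insert t (S - {t})) =
   kscale A M (c t) t \<oplus>\<^bsub>M\<^esub> finsum M (\<lambda>s. kscale A M (c s) s) (S - {t})"
  by (rule M.finsum_insert) (use S in \<open>auto simp: ks_closed[OF M]\<close>)
 moreover have "insert t (S - {t}) = S" using S by auto
 moreover have "finsum M (\<lambda>s. kscale A M (c s) s) (S - {t}) \<in> carrier M"
  by (rule M.finsum_closed) (use S in \<open>auto simp: ks_closed[OF M]\<close>)
 ultimately show ?thesis by (simp add: lc_def c ks_zero[OF M t])
qed

text \<open>A spanning set of least cardinality is independent, since a nontrivial relation would
  allow one of its members to be dropped.\<close>

lemma fd_basis:
 obtains S where "finite S" "S \<subseteq> carrier M" "\<And>x. x \<in> carrier M \<Longrightarrow> \<exists>c. x = lc M S c"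
  "\<And>c. lc M S c = \<zero>\<^bsub>M\<^esub> \<Longrightarrow> \<forall>s\<in>S. c s = 0"
proof -
 let ?P = "\<lambda>S. finite S \<and> S \<subseteq> carrier M \<and> (\<forall>x\<in>carrier M. \<exists>c. x = lc M S c)"
 have "\<exists>S. ?P S" using M unfolding fdmod_def lc_def by simp
 then obtain S0 where "?P S0" by (elim exE)
 from ex_has_least_nat[of ?P, OF this, of card]
 obtain S where SS: "?P S \<and> (\<forall>S'. ?P S' \<longrightarrow> card S \<le> card S')" by (elim exE)
 then have S: "?P S" by (rule conjunct1)
 have min: "card S \<le> card S'" if "?P S'" for S' using SS that by simp
 have "\<forall>s\<in>S. c s = 0" if c: "lc M S c = \<zero>\<^bsub>M\<^esub>" for c
 proof (rule ccontr)
  assume "\<not> (\<forall>s\<in>S. c s = 0)"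
  then obtain t where t: "t \<in> S" "c t \<noteq> 0" by blast
  have "\<exists>d. x = lc M (S - {t}) d" if x: "x \<in> carrier M" for x
  proof -
   obtain b where b: "x = lc M S b" using S x by blast
   \<comment> \<open>Adding this multiple of the relation makes the coefficient of \<open>t\<close>
     zero without changing the element.\<close>
   let ?r = "- (b t / c t)"
   have "lc M S (\<lambda>s. b s + ?r * c s) = lc M S b \<oplus>\<^bsub>M\<^esub> kscale A M ?r (lc M S c)"
    using S by (simp only: lc_add lc_scale)
   also have "kscale A M ?r (lc M S c) = \<zero>\<^bsub>M\<^esub>"
    unfolding c by (simp add: kscale_def m_zero_right[OF M sc_closed])
   finally have "lc M S (\<lambda>s. b s + ?r * c s) = x" using b x by simp
   moreover have "lc M S (\<lambda>s. b s + ?r * c s) = lc M (S - {t}) (\<lambda>s. b s + ?r * c s)"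
    using S t by (intro lc_remove) auto
   ultimately show ?thesis by metis
  qed
  then have "?P (S - {t})" using S by auto
  then have "card S \<le> card (S - {t})" by (rule min)
  then show False using card_Diff1_less[OF conjunct1[OF S] t(1)] by linarith
 qed
 moreover have "\<exists>c. x = lc M S c" if "x \<in> carrier M" for x
  using S[THEN conjunct2, THEN conjunct2, THEN bspec, OF that] .
 ultimately show thesis
  using that[OF S[THEN conjunct1] S[THEN conjunct2, THEN conjunct1]] by simp
qed

text \<open>Coordinates in a basis, padded by zeros to sequences. \<open>lM\<close> is total and
  ignores entries beyond the dimension, so that a linear map of modules becomes a linear map on the
  full space \<open>nat \<Rightarrow> 'k\<close>, where the theory of vector spaces on a type
  applies.\<close>

lemma fd_coordinates:
 obtains d :: nat and cM :: "'u \<Rightarrow> nat \<Rightarrow> 'k" and lM :: "(nat \<Rightarrow> 'k) \<Rightarrow> 'u" where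
  "\<And>x i. x \<in> carrier M \<Longrightarrow> i \<ge> d \<Longrightarrow> cM x i = 0"
  "\<And>c. lM c \<in> carrier M" "\<And>x. x \<in> carrier M \<Longrightarrow> lM (cM x) = x"
  "\<And>x y. x \<in> carrier M \<Longrightarrow> y \<in> carrier M \<Longrightarrow> cM (x \<oplus>\<^bsub>M\<^esub> y) = (\<lambda>i. cM x i + cM y i)"
  "\<And>x r. x \<in> carrier M \<Longrightarrow> cM (kscale A M r x) = (\<lambda>i. r * cM x i)"
  "\<And>c c'. lM (\<lambda>i. c i + c' i) = lM c \<oplus>\<^bsub>M\<^esub> lM c'"
  "\<And>c r. lM (\<lambda>i. r * c i) = kscale A M r (lM c)"
proof -
 obtain S where S: "finite S" "S \<subseteq> carrier M" "\<And>x. x \<in> carrier M \<Longrightarrow> \<exists>c. x = lc M S c"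
  "\<And>c. lc M S c = \<zero>\<^bsub>M\<^esub> \<Longrightarrow> \<forall>s\<in>S. c s = 0" by (rule fd_basis) blast
 obtain e where e: "bij_betw e {..<card S} S"
  using ex_bij_betw_nat_finite[OF S(1)] by (auto simp: atLeast0LessThan)
 define g where "g = inv_into {..<card S} e"
 have ge: "e (g s) = s" "g s < card S" if "s \<in> S" for s
  using that e bij_betw_inv_into_right[OF e that] bij_betwE[OF bij_betw_inv_into[OF e]] by (auto simp: g_def)
 have eg: "g (e i) = i" "e i \<in> S" if "i < card S" for i
  using that e by (auto simp: g_def bij_betw_inv_into_left bij_betw_def)
 define lM where "lM c = lc M S (\<lambda>s. c (g s))" for c :: "nat \<Rightarrow> 'k"
 have lM: "lM c \<in> carrier M" for c unfolding lM_def by (rule lc_closed[OF S(2)])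
 have lM_add: "lM (\<lambda>i. c i + c' i) = lM c \<oplus>\<^bsub>M\<^esub> lM c'" for c c'
  unfolding lM_def by (rule lc_add[OF S(2)])
 have lM_scale: "lM (\<lambda>i. r * c i) = kscale A M r (lM c)" for r c
  unfolding lM_def by (rule lc_scale[OF S(1,2)])
 have lM_inj: "c = c'" if c: "lM c = lM c'" "\<And>i. i \<ge> card S \<Longrightarrow> c i = c' i" for c c'
 proof -
  have "lM (\<lambda>i. c i + (-1) * c' i) = lM c \<oplus>\<^bsub>M\<^esub> kscale A M (-1) (lM c)"
   unfolding lM_add lM_scale c(1) ..
  also have "\<dots> = kscale A M (1 + (-1)) (lM c)"
   unfolding ks_add[OF M lM] ks_one[OF M lM] ..
  also have "\<dots> = \<zero>\<^bsub>M\<^esub>" by (simp add: ks_zero[OF M lM])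
  finally have *: "\<forall>s\<in>S. c (g s) + (-1) * c' (g s) = 0" unfolding lM_def by (rule S(4))
  have "c i = c' i" if "i < card S" for i using * eg[OF that] by force
  then show ?thesis using c(2) by (metis ext not_le)
 qed
 define cM where "cM x = (SOME c. lM c = x \<and> (\<forall>i\<ge>card S. c i = 0))" for x
 have cM: "lM (cM x) = x \<and> (\<forall>i\<ge>card S. cM x i = 0)" if x: "x \<in> carrier M" for x
 proof -
  obtain c where c: "x = lc M S c" using S(3)[OF x] by blast
  have "lM (\<lambda>i. if i < card S then c (e i) else 0) = x"
   unfolding lM_def c by (rule lc_cong[OF S(2)]) (simp add: ge)
  then have "\<exists>c. lM c = x \<and> (\<forall>i\<ge>card S. c i = 0)"
   by (intro exI[of _ "\<lambda>i. if i < card S then c (e i) else 0"]) simp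
  from someI_ex[OF this] show ?thesis unfolding cM_def .
 qed
 show thesis
 proof (rule that[of "card S" cM lM])
  show "cM x i = 0" if "x \<in> carrier M" "i \<ge> card S" for x i using cM that by blast
  show "lM (cM x) = x" if "x \<in> carrier M" for x using cM that by blast
  show "cM (x \<oplus>\<^bsub>M\<^esub> y) = (\<lambda>i. cM x i + cM y i)" if "x \<in> carrier M" "y \<in> carrier M" for x y
   by (rule lM_inj) (use that cM in \<open>auto simp: lM_add\<close>)
  show "cM (kscale A M r x) = (\<lambda>i. r * cM x i)" if "x \<in> carrier M" for x r
   by (rule lM_inj) (use that cM ks_closed[OF M] in \<open>auto simp: lM_scale\<close>)
 qed (rule lM lM_add lM_scale)+
qed

end

text \<open>On sequences, a linear right inverse of the map on its range serves as \<open>g\<close>.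
  This is where semisimplicity of vector spaces is used; an \<open>A\<close>-linear \<open>g\<close>
  need not exist.\<close>

lemma generalized_inverse:
 fixes M :: "('a, 'u) module" and N :: "('a, 'w) module"
 assumes M: "fd M" and N: "fd N" and f: "klin M N f"
 obtains g where "klin N M g" "\<And>x. x \<in> carrier M \<Longrightarrow> f (g (f x)) = f x"
proof -
 obtain d :: nat and cM :: "'u \<Rightarrow> nat \<Rightarrow> 'k" and lM :: "(nat \<Rightarrow> 'k) \<Rightarrow> 'u" where M': "\<And>x i. x \<in> carrier M \<Longrightarrow> i \<ge> d \<Longrightarrow> cM x i = (0 :: 'k)"
  "\<And>c. lM c \<in> carrier M" "\<And>x. x \<in> carrier M \<Longrightarrow> lM (cM x) = x"
  "\<And>x y. x \<in> carrier M \<Longrightarrow> y \<in> carrier M \<Longrightarrow> cM (x \<oplus>\<^bsub>M\<^esub> y) = (\<lambda>i. cM x i + cM y i)"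
  "\<And>x r. x \<in> carrier M \<Longrightarrow> cM (kscale A M r x) = (\<lambda>i. r * cM x i)"
  "\<And>c c'. lM (\<lambda>i. c i + c' i) = lM c \<oplus>\<^bsub>M\<^esub> lM c'"
  "\<And>c r. lM (\<lambda>i. r * c i) = kscale A M r (lM c)"
  by (rule fd_coordinates[OF M]) blast
 obtain d' :: nat and cN :: "'w \<Rightarrow> nat \<Rightarrow> 'k" and lN :: "(nat \<Rightarrow> 'k) \<Rightarrow> 'w" where N': "\<And>x i. x \<in> carrier N \<Longrightarrow> i \<ge> d' \<Longrightarrow> cN x i = (0 :: 'k)"
  "\<And>c. lN c \<in> carrier N" "\<And>x. x \<in> carrier N \<Longrightarrow> lN (cN x) = x"
  "\<And>x y. x \<in> carrier N \<Longrightarrow> y \<in> carrier N \<Longrightarrow> cN (x \<oplus>\<^bsub>N\<^esub> y) = (\<lambda>i. cN x i + cN y i)"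
  "\<And>x r. x \<in> carrier N \<Longrightarrow> cN (kscale A N r x) = (\<lambda>i. r * cN x i)"
  "\<And>c c'. lN (\<lambda>i. c i + c' i) = lN c \<oplus>\<^bsub>N\<^esub> lN c'"
  "\<And>c r. lN (\<lambda>i. r * c i) = kscale A N r (lN c)"
  by (rule fd_coordinates[OF N]) blast
 note fc = add_homD[OF f[unfolded klin_def, THEN conjunct1]]
 have fk: "f (kscale A M c x) = kscale A N c (f x)" if "x \<in> carrier M" for c x
  using f that by (simp add: klin_def)
 define sl :: "'k \<Rightarrow> (nat \<Rightarrow> 'k) \<Rightarrow> nat \<Rightarrow> 'k" where "sl r v = (\<lambda>i. r * v i)" for r v
 interpret V: vector_space_pair sl sl
  by unfold_locales (auto simp: sl_def fun_eq_iff algebra_simps)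
 let ?f = "\<lambda>v. cN (f (lM v))"
 have "Vector_Spaces.linear sl sl ?f"
  by unfold_locales (simp_all add: sl_def plus_fun_def M' N' fc fk)
 then obtain g where g: "Vector_Spaces.linear sl sl g" "\<forall>v\<in>range ?f. ?f (g v) = v"
  using V.linear_exists_right_inverse_on[of ?f UNIV] by auto
 interpret g: Vector_Spaces.linear sl sl g by (rule g(1))
 have ga: "g (\<lambda>i. v i + w i) = (\<lambda>i. g v i + g w i)" for v w using g.add[of v w] by (simp add: plus_fun_def)
 have gs: "g (\<lambda>i. r * v i) = (\<lambda>i. r * g v i)" for r v using g.scale[of r v] by (simp add: sl_def)
 show thesis
 proof (rule that[of "\<lambda>y. lM (g (cN y))"])
  show "klin N M (\<lambda>y. lM (g (cN y)))"
   by (auto simp: klin_def add_hom_def M' N' ga gs)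
  show "f (lM (g (cN (f x)))) = f x" if x: "x \<in> carrier M" for x
  proof -
   have "?f (g (?f (cM x))) = ?f (cM x)" using g(2) by blast
   then have "cN (f (lM (g (cN (f x))))) = cN (f x)" using x by (simp add: M')
   then have "lN (cN (f (lM (g (cN (f x)))))) = lN (cN (f x))" by simp
   then show ?thesis using x fc(1) M'(2) by (simp add: N'(3))
  qed
 qed
qed

section \<open>Direct sums and indecomposable functors\<close>

lemma ntr_plus:
 fixes F :: "('a, 'u, 'v) mod_functor" and G :: "('a, 'u, 'w) mod_functor"
 assumes "lin G" "ntr F G \<eta>" "ntr F G \<theta>"
 shows "ntr F G (\<lambda>M x. \<eta> M x \<oplus>\<^bsub>obj G M\<^esub> \<theta> M x)"
proof (rule ntrI)
 fix M :: "('a, 'u) module" assume M: "fd M"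
 note l = ntr_lin[OF assms(2) M] and l' = ntr_lin[OF assms(3) M] and GM = lf_obj[OF assms(1) M]
 interpret GM: abelian_group "obj G M" by (rule m_ab[OF GM])
 show "lin_map (obj F M) (obj G M) (\<lambda>x. \<eta> M x \<oplus>\<^bsub>obj G M\<^esub> \<theta> M x)"
  by (rule lin_mapI) (simp_all add: lin_mapD[OF l] lin_mapD[OF l'] GM.a_ac m_add_right[OF GM])
 fix N :: "('a, 'u) module" and f x assume N: "fd N" and f: "f \<in> mhom A M N" and x: "el F M x"
 show "\<eta> N (mor F M N f x) \<oplus>\<^bsub>obj G N\<^esub> \<theta> N (mor F M N f x) = mor G M N f (\<eta> M x \<oplus>\<^bsub>obj G M\<^esub> \<theta> M x)"
  using ntr_nat[OF assms(2) M N f x] ntr_nat[OF assms(3) M N f x]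
   lin_mapD(2)[OF lf_lin[OF assms(1) M N f] lin_mapD(1)[OF l x] lin_mapD(1)[OF l' x]] by simp
qed

lemma ntr_ks:
 fixes F :: "('a, 'u, 'v) mod_functor" and G :: "('a, 'u, 'w) mod_functor"
 assumes "lin G" "ntr F G \<eta>"
 shows "ntr F G (\<lambda>M x. kscale A (obj G M) c (\<eta> M x))"
proof (rule ntrI)
 fix M :: "('a, 'u) module" assume M: "fd M"
 note l = ntr_lin[OF assms(2) M] and GM = lf_obj[OF assms(1) M]
 show "lin_map (obj F M) (obj G M) (\<lambda>x. kscale A (obj G M) c (\<eta> M x))"
  by (rule lin_mapI) (simp_all add: lin_mapD[OF l] ks_closed[OF GM] ks_add_right[OF GM] ks_comm[OF GM])
 fix N :: "('a, 'u) module" and f x assume N: "fd N" and f: "f \<in> mhom A M N" and x: "el F M x"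
 show "kscale A (obj G N) c (\<eta> N (mor F M N f x)) = mor G M N f (kscale A (obj G M) c (\<eta> M x))"
  using ntr_nat[OF assms(2) M N f x] lin_map_ks[OF lf_lin[OF assms(1) M N f] lin_mapD(1)[OF l x]] by simp
qed

lemma ks_minus_one: "fd M \<Longrightarrow> x \<in> carrier M \<Longrightarrow> x \<oplus>\<^bsub>M\<^esub> kscale A M (- 1) x = \<zero>\<^bsub>M\<^esub>"
 using ks_add[of M x 1 "-1"] by (simp add: ks_one ks_zero)

lemma ntr_zero:
 fixes F :: "('a, 'u, 'v) mod_functor" and G :: "('a, 'u, 'w) mod_functor"
 assumes "lin F" "lin G"
 shows "ntr F G (\<lambda>M x. \<zero>\<^bsub>obj G M\<^esub>)"
proof (rule ntrI)
 fix M :: "('a, 'u) module" assume M: "fd M"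
 note GM = lf_obj[OF assms(2) M]
 interpret GM: abelian_group "obj G M" by (rule m_ab[OF GM])
 show "lin_map (obj F M) (obj G M) (\<lambda>x. \<zero>\<^bsub>obj G M\<^esub>)"
  by (rule lin_mapI) (simp_all add: m_zero_right[OF GM])
 fix N :: "('a, 'u) module" and f x assume N: "fd N" and f: "f \<in> mhom A M N" and x: "el F M x"
 show "\<zero>\<^bsub>obj G N\<^esub> = mor G M N f \<zero>\<^bsub>obj G M\<^esub>"
  by (rule lin_map_zero[OF GM lf_obj[OF assms(2) N] lf_lin[OF assms(2) M N f], symmetric])
qed

definition biject :: "('a, 'u, 'v) mod_functor \<Rightarrow> ('a, 'u, 'w) mod_functor
   \<Rightarrow> (('a, 'u) module \<Rightarrow> 'v \<Rightarrow> 'w) \<Rightarrow> bool" where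
 "biject F G \<eta> \<longleftrightarrow> (\<forall>M\<in>fdmod A. bij_betw (\<eta> M) (carrier (obj F M)) (carrier (obj G M)))"

lemma ntr_inverse:
 fixes F :: "('a, 'u, 'v) mod_functor" and G :: "('a, 'u, 'w) mod_functor"
 assumes F: "lin F" and G: "lin G" and \<eta>: "ntr F G \<eta>" and b: "biject F G \<eta>"
 obtains \<theta> where "ntr G F \<theta>" "\<And>M x. fd M \<Longrightarrow> el F M x \<Longrightarrow> \<theta> M (\<eta> M x) = x"
  "\<And>M y. fd M \<Longrightarrow> el G M y \<Longrightarrow> \<eta> M (\<theta> M y) = y"
proof -
 define \<theta> where "\<theta> M = inv_into (carrier (obj F M)) (\<eta> M)" for M
 have bM: "bij_betw (\<eta> M) (carrier (obj F M)) (carrier (obj G M))" if "fd M" for M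
  using b that by (simp add: biject_def)
 have 1: "\<theta> M (\<eta> M x) = x" if "fd M" "el F M x" for M x
  unfolding \<theta>_def by (rule bij_betw_inv_into_left[OF bM[OF that(1)] that(2)])
 have 2: "\<eta> M (\<theta> M y) = y" if "fd M" "el G M y" for M y
  unfolding \<theta>_def by (rule bij_betw_inv_into_right[OF bM[OF that(1)] that(2)])
 have c: "\<theta> M y \<in> carrier (obj F M)" if "fd M" "el G M y" for M y
  unfolding \<theta>_def using bij_betw_apply[OF bij_betw_inv_into[OF bM[OF that(1)]] that(2)] .
 have "ntr G F \<theta>"
 proof (rule ntrI)
  fix M :: "('a, 'u) module" assume M: "fd M"
  note FM = lf_obj[OF F M]
  show "lin_map (obj G M) (obj F M) (\<theta> M)"
  proof (rule lin_mapI)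
   fix x y assume x: "el G M x" and y: "el G M y"
   have "\<eta> M (\<theta> M x \<oplus>\<^bsub>obj F M\<^esub> \<theta> M y) = x \<oplus>\<^bsub>obj G M\<^esub> y"
    by (simp add: ntr_add[OF \<eta> M c[OF M x] c[OF M y]] 2[OF M] x y)
   then show "\<theta> M (x \<oplus>\<^bsub>obj G M\<^esub> y) = \<theta> M x \<oplus>\<^bsub>obj F M\<^esub> \<theta> M y"
    using 1[OF M m_add_closed[OF FM c[OF M x] c[OF M y]]] by simp
  next
   fix a x assume a: "a \<in> carrier A" and x: "el G M x"
   have "\<eta> M (a \<odot>\<^bsub>obj F M\<^esub> \<theta> M x) = a \<odot>\<^bsub>obj G M\<^esub> x"
    by (simp add: ntr_smult[OF \<eta> M a c[OF M x]] 2[OF M] x)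
   then show "\<theta> M (a \<odot>\<^bsub>obj G M\<^esub> x) = a \<odot>\<^bsub>obj F M\<^esub> \<theta> M x"
    using 1[OF M m_closed[OF FM a c[OF M x]]] by simp
  qed (rule c[OF M])
  fix N :: "('a, 'u) module" and f x assume N: "fd N" and f: "f \<in> mhom A M N" and x: "el G M x"
  have "\<eta> N (mor F M N f (\<theta> M x)) = mor G M N f x"
   by (simp add: ntr_nat[OF \<eta> M N f c[OF M x]] 2[OF M x])
  then show "\<theta> N (mor G M N f x) = mor F M N f (\<theta> M x)"
   using 1[OF N lf_closed[OF F M N f c[OF M x]]] by simp
 qed
 then show thesis using 1 2 by (rule that)
qed

text \<open>Retracts compose and survive composition with further functors without a complement
  being carried along. As idempotents split, being a retract agrees with being a direct summand
  (\<open>summand_retr\<close>, \<open>retr_summand\<close>).\<close>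

definition retr :: "('a, 'u, 'v) mod_functor \<Rightarrow> ('a, 'u, 'w) mod_functor \<Rightarrow> bool" where
 "retr F G \<longleftrightarrow> (\<exists>\<iota> \<pi>. ntr F G \<iota> \<and> ntr G F \<pi> \<and> (\<forall>M\<in>fdmod A. \<forall>x\<in>carrier (obj F M). \<pi> M (\<iota> M x) = x))"

lemma retrI:
 assumes "ntr F G \<iota>" "ntr G F \<pi>" "\<And>M x. fd M \<Longrightarrow> el F M x \<Longrightarrow> \<pi> M (\<iota> M x) = x"
 shows "retr F G"
 unfolding retr_def using assms by (intro exI[of _ \<iota>] exI[of _ \<pi>]) simp

lemma retrE:
 assumes "retr F G"
 obtains \<iota> \<pi> where "ntr F G \<iota>" "ntr G F \<pi>" "\<And>M x. fd M \<Longrightarrow> el F M x \<Longrightarrow> \<pi> M (\<iota> M x) = x"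
 using assms unfolding retr_def by (elim exE conjE) (rule that, assumption+, blast)

lemma retr_trans: "retr F G \<Longrightarrow> retr G H \<Longrightarrow> retr F H"
 by (elim retrE, rule retrI[OF ntr_comp ntr_comp], assumption+) (simp add: ntr_closed)

lemma retr_refl: "retr F F"
 by (rule retrI[OF ntr_id ntr_id refl])

lemma nat_iso_retr: "nat_iso A F G \<Longrightarrow> retr F G"
 by (elim nat_isoD, rule retrI, assumption+)

text \<open>The image of \<open>e\<close> as a subfunctor: the carrier shrinks and the operations
  stay, so the type is unchanged and the splitting takes place among endofunctors.\<close>

definition im_functor :: "('a, 'u) endofunctor \<Rightarrow> (('a, 'u) module \<Rightarrow> 'u \<Rightarrow> 'u) \<Rightarrow> ('a, 'u) endofunctor" where
 "im_functor F e =
  \<lparr> obj = (\<lambda>M. (obj F M)\<lparr>carrier := e M ` carrier (obj F M)\<rparr>),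
   mor = (\<lambda>M N f. restrict (mor F M N f) (e M ` carrier (obj F M))) \<rparr>"

definition idem_on :: "('a, 'u, 'v) mod_functor \<Rightarrow> (('a, 'u) module \<Rightarrow> 'v \<Rightarrow> 'v) \<Rightarrow> bool" where
 "idem_on F e \<longleftrightarrow> (\<forall>M\<in>fdmod A. \<forall>x\<in>carrier (obj F M). e M (e M x) = e M x)"

lemma idem_onD: "idem_on F e \<Longrightarrow> fd M \<Longrightarrow> el F M x \<Longrightarrow> e M (e M x) = e M x"
 by (simp add: idem_on_def)

lemma im_functor:
 fixes F :: "('a, 'u) endofunctor"
 assumes F: "lin F" and e: "ntr F F e"
  and idem: "idem_on F e"
 shows "im_functor F e \<in> lin_functors A"
  and "ntr (im_functor F e) F (\<lambda>M x. x)" and "ntr F (im_functor F e) e"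
  and "\<And>M x. fd M \<Longrightarrow> x \<in> carrier (obj (im_functor F e) M) \<Longrightarrow> e M x = x"
  and "\<zero>\<^bsub>obj (im_functor F e) M\<^esub> = \<zero>\<^bsub>obj F M\<^esub>" and "x \<oplus>\<^bsub>obj (im_functor F e) M\<^esub> y = x \<oplus>\<^bsub>obj F M\<^esub> y"
proof -
 let ?I = "im_functor F e"
 have s: "carrier (obj ?I M) = e M ` carrier (obj F M)" "ring.zero (obj ?I M) = ring.zero (obj F M)"
  "ring.add (obj ?I M) = ring.add (obj F M)" "module.smult (obj ?I M) = module.smult (obj F M)" for M
  by (simp_all add: im_functor_def)
 show "\<zero>\<^bsub>obj ?I M\<^esub> = \<zero>\<^bsub>obj F M\<^esub>" and "x \<oplus>\<^bsub>obj ?I M\<^esub> y = x \<oplus>\<^bsub>obj F M\<^esub> y" by (simp_all add: s)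
 have ks: "kscale A (obj ?I M) c x = kscale A (obj F M) c x" for M c x by (simp add: kscale_def s)
 have sub: "el F M x" if "x \<in> carrier (obj ?I M)" "fd M" for x M
  using that ntr_closed[OF e that(2)] by (auto simp: s)
 have fix_e: "e M x = x" if "fd M" "x \<in> carrier (obj ?I M)" for M x
  using that idem_onD[OF idem] by (auto simp: s)
 have eI: "e M x \<in> carrier (obj ?I M)" if "el F M x" for M x using that by (simp add: s)
 have m: "mor ?I M N f x = mor F M N f x" if "x \<in> carrier (obj ?I M)" for M N f x
  using that by (simp add: im_functor_def)
 have fd: "obj ?I M \<in> fdmod A" if M: "fd M" for M
 proof -
  note FM = lf_obj[OF F M] and el = lin_mapD[OF ntr_lin[OF e M]]
  interpret FM: abelian_group "obj F M" by (rule m_ab[OF FM])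
  have ez: "e M \<zero>\<^bsub>obj F M\<^esub> = \<zero>\<^bsub>obj F M\<^esub>" by (rule lin_map_zero[OF FM FM ntr_lin[OF e M]])
  have zI: "\<zero>\<^bsub>obj F M\<^esub> \<in> carrier (obj ?I M)" using eI[of "\<zero>\<^bsub>obj F M\<^esub>" M] ez by simp
  have aI: "x \<oplus>\<^bsub>obj F M\<^esub> y \<in> carrier (obj ?I M)" if "x \<in> carrier (obj ?I M)" "y \<in> carrier (obj ?I M)" for x y
  proof -
   have "x \<oplus>\<^bsub>obj F M\<^esub> y = e M (x \<oplus>\<^bsub>obj F M\<^esub> y)"
    using el(2)[OF sub[OF that(1) M] sub[OF that(2) M]] fix_e[OF M that(1)] fix_e[OF M that(2)] by simp
   also have "\<dots> \<in> carrier (obj ?I M)" by (rule eI) (simp add: sub[OF _ M] that)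
   finally show ?thesis .
  qed
  have sI: "a \<odot>\<^bsub>obj F M\<^esub> x \<in> carrier (obj ?I M)" if "a \<in> carrier A" "x \<in> carrier (obj ?I M)" for a x
  proof -
   have "a \<odot>\<^bsub>obj F M\<^esub> x = e M (a \<odot>\<^bsub>obj F M\<^esub> x)"
    using el(3)[OF that(1) sub[OF that(2) M]] fix_e[OF M that(2)] by simp
   also have "\<dots> \<in> carrier (obj ?I M)" by (rule eI[OF m_closed[OF FM that(1) sub[OF that(2) M]]])
   finally show ?thesis .
  qed
  have ab: "abelian_group (obj ?I M)"
  proof (rule abelian_groupI, unfold s(2,3))
   fix x assume x: "x \<in> carrier (obj ?I M)"
   have "kscale A (obj F M) (- 1) x \<oplus>\<^bsub>obj F M\<^esub> x = \<zero>\<^bsub>obj F M\<^esub>"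
    using ks_minus_one[OF FM sub[OF x M]] by (simp add: FM.a_comm ks_closed[OF FM] sub[OF x M])
   moreover have "kscale A (obj F M) (- 1) x \<in> carrier (obj ?I M)"
    unfolding kscale_def by (rule sI[OF sc_closed x])
   ultimately show "\<exists>y\<in>carrier (obj ?I M). y \<oplus>\<^bsub>obj F M\<^esub> x = \<zero>\<^bsub>obj F M\<^esub>" by (rule bexI)
  qed (simp_all add: aI zI sub[OF _ M] FM.a_ac)
  have lm: "left_module A (obj ?I M)"
   using A_ring ab
   by (auto simp: left_module_def left_module_axioms_def s(2-4) sI sub[OF _ M] m_add_left[OF FM] m_add_right[OF FM]
     m_mult[OF FM] m_one[OF FM] simp del: s(1))
  obtain S where S: "finite S" "S \<subseteq> carrier (obj F M)" "carrier (obj F M) \<subseteq> kspan (obj F M) S"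
   by (rule fdmod_kspan[OF FM])
  have eh: "add_hom (obj F M) (obj ?I M) (e M)"
   by (rule add_homI) (simp_all add: eI el(2) s(3))
  have "e M ` carrier (obj F M) \<subseteq> kspan (obj ?I M) (e M ` S)"
  proof
   fix y assume "y \<in> e M ` carrier (obj F M)"
   then obtain x where x: "y = e M x" "el F M x" by blast
   have xs: "x \<in> add_span (obj F M) {kscale A (obj F M) c s | c s. s \<in> S}"
    using S(3) x(2) by (auto simp: kspan_def)
   have "e M x \<in> add_span (obj ?I M) {kscale A (obj ?I M) c s | c s. s \<in> e M ` S}"
   proof (rule add_span_image[OF m_ab[OF FM] ab eh kscale_set_closed[OF fdmod_lmod[OF FM] S(2)] xs])
    fix z assume "z \<in> {kscale A (obj F M) c s | c s. s \<in> S}"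
    then obtain c s' where z: "z = kscale A (obj F M) c s'" "s' \<in> S" by blast
    have "e M z = kscale A (obj ?I M) c (e M s')"
     unfolding z(1) ks by (rule lin_map_ks[OF ntr_lin[OF e M]]) (use z S in auto)
    then show "e M z \<in> {kscale A (obj ?I M) c s | c s. s \<in> e M ` S}" using z(2) by blast
   qed
   then show "y \<in> kspan (obj ?I M) (e M ` S)" by (simp add: kspan_def x(1))
  qed
  then show ?thesis
   by (intro fdmodI[OF lm, of "e M ` S"]) (use S in \<open>auto simp: s(1)\<close>)
 qed
 have mcl: "mor F M N f x \<in> carrier (obj ?I N)"
  if "fd M" "fd N" "f \<in> mhom A M N" "x \<in> carrier (obj ?I M)" for M N f x
 proof -
  have "mor F M N f x = e N (mor F M N f x)"
   using ntr_nat[OF e that(1-3) sub[OF that(4,1)]] fix_e[OF that(1,4)] by simp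
  also have "\<dots> \<in> carrier (obj ?I N)" by (rule eI[OF lf_closed[OF F that(1-3) sub[OF that(4,1)]]])
  finally show ?thesis .
 qed
 show "lin ?I"
 proof (rule lin_functorsI)
  fix L M N :: "('a, 'u) module" and f g c x
  assume M: "fd M"
  show "obj ?I M \<in> fdmod A" by (rule fd[OF M])
  show "mor ?I M M (\<lambda>x\<in>carrier M. x) x = x" if "x \<in> carrier (obj ?I M)"
   using lf_id[OF F M sub[OF that M]] by (simp add: m that)
  assume N: "fd N"
  show "mor ?I M N f \<in> mhom A (obj ?I M) (obj ?I N)" if f: "f \<in> mhom A M N"
  proof -
   have "lin_map (obj ?I M) (obj ?I N) (mor F M N f)"
    by (rule lin_mapI)
     (simp_all add: mcl[OF M N f] s(3,4) lin_mapD[OF lf_lin[OF F M N f]] sub[OF _ M] del: s(1))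
   from lin_mhom[OF this fd[OF M]] show ?thesis by (simp add: im_functor_def)
  qed
  show "mor ?I M N (\<lambda>x\<in>carrier M. f x \<oplus>\<^bsub>N\<^esub> g x) x = mor ?I M N f x \<oplus>\<^bsub>obj ?I N\<^esub> mor ?I M N g x"
   if "f \<in> mhom A M N" "g \<in> mhom A M N" "x \<in> carrier (obj ?I M)"
   using lf_add[OF F M N that(1,2) sub[OF that(3) M]] by (simp add: m that(3) s(3))
  show "mor ?I M N (\<lambda>x\<in>carrier M. kscale A N c (f x)) x = kscale A (obj ?I N) c (mor ?I M N f x)"
   if "f \<in> mhom A M N" "x \<in> carrier (obj ?I M)"
   using lf_ks[OF F M N that(1) sub[OF that(2) M]] by (simp add: m that(2) ks)
  assume L: "fd L"
  show "mor ?I L N (compose (carrier L) g f) x = mor ?I M N g (mor ?I L M f x)"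
   if "f \<in> mhom A L M" "g \<in> mhom A M N" "x \<in> carrier (obj ?I L)"
   using lf_comp[OF F L M N that(1,2) sub[OF that(3) L]] mcl[OF L M that(1,3)] by (simp add: m that(3))
 qed
 show "ntr ?I F (\<lambda>M x. x)"
  by (rule ntrI, rule lin_mapI) (simp_all add: sub s(3,4) m del: s(1))
 show "ntr F ?I e"
 proof (rule ntrI)
  fix M :: "('a, 'u) module" assume M: "fd M"
  show "lin_map (obj F M) (obj ?I M) (e M)"
   by (rule lin_mapI) (simp_all add: eI s(3,4) lin_mapD[OF ntr_lin[OF e M]] del: s(1))
 qed (simp add: ntr_nat[OF e] m eI)
 show "e M x = x" if "fd M" "x \<in> carrier (obj ?I M)" for M x by (rule fix_e[OF that])
qed

lemma direct_sum2I:
 fixes F :: "('a, 'u) endofunctor"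
 assumes F: "lin F" and G: "lin G" and K: "lin K"
  and n: "ntr G F i0" "ntr F G p0" "ntr K F i1" "ntr F K p1"
  and "\<And>M x. fd M \<Longrightarrow> el G M x \<Longrightarrow> p0 M (i0 M x) = x"
  and "\<And>M x. fd M \<Longrightarrow> el K M x \<Longrightarrow> p1 M (i1 M x) = x"
  and "\<And>M x. fd M \<Longrightarrow> el K M x \<Longrightarrow> p0 M (i1 M x) = \<zero>\<^bsub>obj G M\<^esub>"
  and "\<And>M x. fd M \<Longrightarrow> el G M x \<Longrightarrow> p1 M (i0 M x) = \<zero>\<^bsub>obj K M\<^esub>"
  and "\<And>M x. fd M \<Longrightarrow> el F M x \<Longrightarrow> i0 M (p0 M x) \<oplus>\<^bsub>obj F M\<^esub> i1 M (p1 M x) = x"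
 shows "is_direct_sum A F [G, K]"
proof -
 define \<iota> where "\<iota> i M = (if i = (0 :: nat) then restrict (i0 M) (carrier (obj G M)) else restrict (i1 M) (carrier (obj K M)))" for i M
 define \<pi> where "\<pi> i M = (if i = (0 :: nat) then restrict (p0 M) (carrier (obj F M)) else restrict (p1 M) (carrier (obj F M)))" for i M
 have nt: "nat_trans A G F (\<iota> 0)" "nat_trans A F G (\<pi> 0)" "nat_trans A K F (\<iota> 1)" "nat_trans A F K (\<pi> 1)"
  unfolding \<iota>_def \<pi>_def using ntr_nat_trans[OF n(1) G] ntr_nat_trans[OF n(2) F] ntr_nat_trans[OF n(3) K] ntr_nat_trans[OF n(4) F]
  by simp_all
 note cl = ntr_closed[OF n(1)] ntr_closed[OF n(2)] ntr_closed[OF n(3)] ntr_closed[OF n(4)]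
 show ?thesis
  unfolding is_direct_sum_def
 proof (rule exI[of _ \<iota>], rule exI[of _ \<pi>], intro conjI allI ballI impI)
  fix i :: nat assume i: "i < length [G, K]"
  then have "i = 0 \<or> i = 1" by auto
  then show "nat_trans A ([G, K] ! i) F (\<iota> i)" "nat_trans A F ([G, K] ! i) (\<pi> i)" using nt by auto
 next
  fix M :: "('a, 'u) module" and i j :: nat and x
  assume M: "fd M" and ij: "i < length [G, K]" "j < length [G, K]" and x: "x \<in> carrier (obj ([G, K] ! j) M)"
  have "i = 0 \<or> i = 1" "j = 0 \<or> j = 1" using ij by auto
  then show "\<pi> i M (\<iota> j M x) = (if i = j then x else \<zero>\<^bsub>obj ([G, K] ! i) M\<^esub>)"
   using x M assms(8-11) cl by (elim disjE) (simp_all add: \<iota>_def \<pi>_def)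
 next
  fix M :: "('a, 'u) module" and x
  assume M: "fd M" and x: "el F M x"
  interpret FM: abelian_group "obj F M" by (rule m_ab[OF lf_obj[OF F M]])
  have "finsum (obj F M) (\<lambda>i. \<iota> i M (\<pi> i M x)) (insert 0 {1}) =
    \<iota> 0 M (\<pi> 0 M x) \<oplus>\<^bsub>obj F M\<^esub> finsum (obj F M) (\<lambda>i. \<iota> i M (\<pi> i M x)) {1 :: nat}"
   by (rule FM.finsum_insert) (use x M cl in \<open>auto simp: \<iota>_def \<pi>_def\<close>)
  also have "finsum (obj F M) (\<lambda>i. \<iota> i M (\<pi> i M x)) {1 :: nat} = \<iota> 1 M (\<pi> 1 M x)"
   using FM.finsum_insert[of "{}" "1 :: nat" "\<lambda>i. \<iota> i M (\<pi> i M x)"] x M cl by (simp add: \<iota>_def \<pi>_def)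
  finally show "finsum (obj F M) (\<lambda>i. \<iota> i M (\<pi> i M x)) {..<length [G, K]} = x"
   using assms(12)[OF M x] x M cl by (simp add: \<iota>_def \<pi>_def lessThan_Suc insert_commute)
 qed
qed

lemma direct_sum2E:
 fixes F :: "('a, 'u) endofunctor"
 assumes "is_direct_sum A F [G, K]"
 obtains i0 p0 i1 p1 where "ntr G F i0" "ntr F G p0" "ntr K F i1" "ntr F K p1"
  "\<And>M x. fd M \<Longrightarrow> el G M x \<Longrightarrow> p0 M (i0 M x) = x"
  "\<And>M x. fd M \<Longrightarrow> el K M x \<Longrightarrow> p1 M (i1 M x) = x"
  "\<And>M x. fd M \<Longrightarrow> el K M x \<Longrightarrow> p0 M (i1 M x) = \<zero>\<^bsub>obj G M\<^esub>"
proof -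
 obtain \<iota> \<pi> where *: "\<forall>i<length [G, K]. nat_trans A ([G, K] ! i) F (\<iota> i) \<and> nat_trans A F ([G, K] ! i) (\<pi> i)"
  "\<forall>M\<in>fdmod A. \<forall>i<length [G, K]. \<forall>j<length [G, K]. \<forall>x\<in>carrier (obj ([G, K] ! j) M).
    \<pi> i M (\<iota> j M x) = (if i = j then x else \<zero>\<^bsub>obj ([G, K] ! i) M\<^esub>)"
  using assms unfolding is_direct_sum_def by (elim exE conjE)
 have 0: "nat_trans A G F (\<iota> 0)" "nat_trans A F G (\<pi> 0)" using *(1)[rule_format, of 0] by simp_all
 have 1: "nat_trans A K F (\<iota> 1)" "nat_trans A F K (\<pi> 1)" using *(1)[rule_format, of 1] by simp_all
 show thesis
 proof (rule that[OF nat_trans_ntr[OF 0(1)] nat_trans_ntr[OF 0(2)] nat_trans_ntr[OF 1(1)] nat_trans_ntr[OF 1(2)]])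
  fix M :: "('a, 'u) module" and x assume M: "fd M"
  note r = *(2)[rule_format, OF M]
  show "\<pi> 0 M (\<iota> 0 M x) = x" if "el G M x" using r[of 0 0 x] that by simp
  show "\<pi> 1 M (\<iota> 1 M x) = x" if "el K M x" using r[of 1 1 x] that by simp
  show "\<pi> 0 M (\<iota> 1 M x) = \<zero>\<^bsub>obj G M\<^esub>" if "el K M x" using r[of 0 1 x] that by simp
 qed
qed

lemma summand_retr: "is_summand A C F G \<Longrightarrow> retr F G"
 unfolding is_summand_def by (elim bexE direct_sum2E) (rule retrI)

text \<open>The complement is \<open>1 - e\<close>, with the difference written by means of the
  scalar \<open>-1\<close>.\<close>

lemma idem_split:
 fixes F :: "('a, 'u) endofunctor"
 assumes F: "lin F" and e: "ntr F F e"
  and idem: "idem_on F e"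
 obtains e' where "ntr F F e'"
  "idem_on F e'"
  "\<And>M x. fd M \<Longrightarrow> el F M x \<Longrightarrow> e M x \<oplus>\<^bsub>obj F M\<^esub> e' M x = x"
  "\<And>M x. fd M \<Longrightarrow> el F M x \<Longrightarrow> e M (e' M x) = \<zero>\<^bsub>obj F M\<^esub>"
  "\<And>M x. fd M \<Longrightarrow> el F M x \<Longrightarrow> e' M (e M x) = \<zero>\<^bsub>obj F M\<^esub>"
proof -
 define e' where "e' M x = x \<oplus>\<^bsub>obj F M\<^esub> kscale A (obj F M) (- 1) (e M x)" for M x
 have n: "ntr F F e'" unfolding e'_def by (rule ntr_plus[OF F ntr_id ntr_ks[OF F e]])
 have 1: "e M (e' M x) = \<zero>\<^bsub>obj F M\<^esub>" "e' M (e M x) = \<zero>\<^bsub>obj F M\<^esub>" "e M x \<oplus>\<^bsub>obj F M\<^esub> e' M x = x"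
  if M: "fd M" and x: "el F M x" for M x
 proof -
  note FM = lf_obj[OF F M] and ex = ntr_closed[OF e M x]
  interpret FM: abelian_group "obj F M" by (rule m_ab[OF FM])
  show "e M (e' M x) = \<zero>\<^bsub>obj F M\<^esub>"
   unfolding e'_def using ntr_add[OF e M x ks_closed[OF FM ex]] lin_map_ks[OF ntr_lin[OF e M] ex] idem_onD[OF idem M x]
    ks_minus_one[OF FM ex] by simp
  show "e' M (e M x) = \<zero>\<^bsub>obj F M\<^esub>"
   unfolding e'_def using idem_onD[OF idem M x] ks_minus_one[OF FM ex] by simp
  have "e M x \<oplus>\<^bsub>obj F M\<^esub> e' M x = x \<oplus>\<^bsub>obj F M\<^esub> (e M x \<oplus>\<^bsub>obj F M\<^esub> kscale A (obj F M) (- 1) (e M x))"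
   unfolding e'_def by (rule FM.a_lcomm) (simp_all add: x ex ks_closed[OF FM])
  then show "e M x \<oplus>\<^bsub>obj F M\<^esub> e' M x = x" using ks_minus_one[OF FM ex] x by simp
 qed
 have "e' M (e' M x) = e' M x" if M: "fd M" and x: "el F M x" for M x
 proof -
  interpret FM: abelian_group "obj F M" by (rule m_ab[OF lf_obj[OF F M]])
  note e'x = ntr_closed[OF n M x]
  show ?thesis
   using 1(3)[OF M e'x] 1(1)[OF M x] ntr_closed[OF n M e'x] by simp
 qed
 then have 2: "idem_on F e'" by (simp add: idem_on_def)
 show thesis by (rule that[OF n 2 1(3) 1(1) 1(2)])
qed

text \<open>\<open>G\<close> may be any splitting of \<open>e\<close>: a given retract of
  \<open>F\<close> thereby acquires a complement, and the image of \<open>e\<close> gives the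
  decomposition of \<open>F\<close> along \<open>e\<close> and \<open>1 - e\<close>.\<close>

lemma split_direct_sum:
 fixes F :: "('a, 'u) endofunctor"
 assumes F: "lin F" and e: "ntr F F e" and e': "ntr F F e'"
  and i': "idem_on F e'"
  and s: "\<And>M x. fd M \<Longrightarrow> el F M x \<Longrightarrow> e M x \<oplus>\<^bsub>obj F M\<^esub> e' M x = x"
  and z: "\<And>M x. fd M \<Longrightarrow> el F M x \<Longrightarrow> e M (e' M x) = \<zero>\<^bsub>obj F M\<^esub>"
   "\<And>M x. fd M \<Longrightarrow> el F M x \<Longrightarrow> e' M (e M x) = \<zero>\<^bsub>obj F M\<^esub>"
  and G: "lin G" and \<iota>: "ntr G F \<iota>" and \<pi>: "ntr F G \<pi>"
  and pi: "\<And>M x. fd M \<Longrightarrow> el G M x \<Longrightarrow> \<pi> M (\<iota> M x) = x"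
  and ip: "\<And>M x. fd M \<Longrightarrow> el F M x \<Longrightarrow> \<iota> M (\<pi> M x) = e M x"
 shows "is_direct_sum A F [G, im_functor F e']"
proof (rule direct_sum2I[OF F G im_functor(1)[OF F e' i'] \<iota> \<pi> im_functor(2)[OF F e' i'] im_functor(3)[OF F e' i'] pi])
 note im = im_functor[OF F e' i']
 fix M :: "('a, 'u) module" and x assume M: "fd M"
 show "e' M x = x" if "x \<in> carrier (obj (im_functor F e') M)" by (rule im(4)[OF M that])
 show "\<pi> M x = \<zero>\<^bsub>obj G M\<^esub>" if x: "x \<in> carrier (obj (im_functor F e') M)"
 proof -
  have xF: "el F M x" by (rule ntr_closed[OF im(2) M x])
  have "\<iota> M (\<pi> M x) = \<zero>\<^bsub>obj F M\<^esub>" using ip[OF M xF] z(1)[OF M xF] im(4)[OF M x] by simp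
  then have "\<pi> M (\<iota> M (\<pi> M x)) = \<zero>\<^bsub>obj G M\<^esub>"
   using lin_map_zero[OF lf_obj[OF F M] lf_obj[OF G M] ntr_lin[OF \<pi> M]] by simp
  then show ?thesis using pi[OF M ntr_closed[OF \<pi> M xF]] by simp
 qed
 show "e' M (\<iota> M x) = \<zero>\<^bsub>obj (im_functor F e') M\<^esub>" if x: "el G M x"
  using z(2)[OF M ntr_closed[OF \<iota> M x]] ip[OF M ntr_closed[OF \<iota> M x]] pi[OF M x] by (simp add: im(5))
 show "\<iota> M (\<pi> M x) \<oplus>\<^bsub>obj F M\<^esub> e' M x = x" if x: "el F M x"
  using ip[OF M x] s[OF M x] by simp
qed

lemma retr_summand:
 fixes F :: "('a, 'u) endofunctor"
 assumes F: "lin F" and G: "lin G" and r: "retr G F"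
 obtains K where "lin K" "retr K F" "is_direct_sum A F [G, K]"
proof -
 obtain \<iota> \<pi> where ip: "ntr G F \<iota>" "ntr F G \<pi>" "\<And>M x. fd M \<Longrightarrow> el G M x \<Longrightarrow> \<pi> M (\<iota> M x) = x"
  by (rule retrE[OF r]) blast
 let ?e = "\<lambda>M x. \<iota> M (\<pi> M x)"
 have e: "ntr F F ?e" by (rule ntr_comp[OF ip(2,1)])
 have i: "idem_on F ?e"
  unfolding idem_on_def using ip(3)[OF _ ntr_closed[OF ip(2)]] by simp
 obtain e' where e': "ntr F F e'"
  "idem_on F e'"
  "\<And>M x. fd M \<Longrightarrow> el F M x \<Longrightarrow> ?e M x \<oplus>\<^bsub>obj F M\<^esub> e' M x = x"
  "\<And>M x. fd M \<Longrightarrow> el F M x \<Longrightarrow> ?e M (e' M x) = \<zero>\<^bsub>obj F M\<^esub>"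
  "\<And>M x. fd M \<Longrightarrow> el F M x \<Longrightarrow> e' M (?e M x) = \<zero>\<^bsub>obj F M\<^esub>"
  by (rule idem_split[OF F e i]) blast+
 note im = im_functor[OF F e'(1,2)]
 show thesis
  by (rule that[OF im(1) retrI[OF im(2,3,4)] split_direct_sum[OF F e e'(1) e'(2-5) G ip(1,2,3) refl]])
qed

definition nonzero :: "('a, 'u, 'v) mod_functor \<Rightarrow> bool" where
 "nonzero F \<longleftrightarrow> (\<exists>M\<in>fdmod A. \<exists>x\<in>carrier (obj F M). x \<noteq> \<zero>\<^bsub>obj F M\<^esub>)"

lemma nonzero_iff: "lin F \<Longrightarrow> nonzero F \<longleftrightarrow> \<not> zero_functor A F"
 unfolding nonzero_def zero_functor_def using m_zero_closed[OF lf_obj] by blast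

definition idempotents_trivial :: "('a, 'u) endofunctor \<Rightarrow> bool" where
 "idempotents_trivial F \<longleftrightarrow> F \<in> lin_functors A \<and> nonzero F \<and>
   (\<forall>e. ntr F F e \<and> idem_on F e \<longrightarrow>
    (\<forall>M\<in>fdmod A. \<forall>x\<in>carrier (obj F M). e M x = \<zero>\<^bsub>obj F M\<^esub>) \<or>
    (\<forall>M\<in>fdmod A. \<forall>x\<in>carrier (obj F M). e M x = x))"

text \<open>\<open>thru C F F' \<eta>\<close>: \<open>\<eta>\<close> is a finite sum of natural transformations that factor through functors in \<open>C\<close>.\<close>

inductive thru :: "('a, 'u) endofunctor set \<Rightarrow> ('a, 'u) endofunctor \<Rightarrow> ('a, 'u) endofunctor
  \<Rightarrow> (('a, 'u) module \<Rightarrow> 'u \<Rightarrow> 'u) \<Rightarrow> bool" for C F F' where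
 zero: "(\<And>M x. fd M \<Longrightarrow> el F M x \<Longrightarrow> \<eta> M x = \<zero>\<^bsub>obj F' M\<^esub>) \<Longrightarrow> thru C F F' \<eta>"
| step: "H \<in> C \<Longrightarrow> ntr F H \<alpha> \<Longrightarrow> ntr H F' \<beta> \<Longrightarrow> thru C F F' \<theta> \<Longrightarrow>
  (\<And>M x. fd M \<Longrightarrow> el F M x \<Longrightarrow> \<eta> M x = \<beta> M (\<alpha> M x) \<oplus>\<^bsub>obj F' M\<^esub> \<theta> M x) \<Longrightarrow> thru C F F' \<eta>"

lemma thru_ntr:
 fixes F F' :: "('a, 'u) endofunctor"
 assumes "thru C F F' \<eta>" "lin F" "lin F'"
 shows "ntr F F' \<eta>"
proof -
 have cong: "ntr F F' \<eta>" if "ntr F F' \<eta>'" "\<And>M x. fd M \<Longrightarrow> el F M x \<Longrightarrow> \<eta> M x = \<eta>' M x" for \<eta> \<eta>'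
 proof (rule ntrI)
  fix M :: "('a, 'u) module" assume M: "fd M"
  note FM = lf_obj[OF assms(2) M]
  show "lin_map (obj F M) (obj F' M) (\<eta> M)"
   by (rule lin_mapI) (simp_all add: that(2)[OF M] lin_mapD[OF ntr_lin[OF that(1) M]] m_add_closed[OF FM] m_closed[OF FM])
 qed (simp add: that(2) ntr_nat[OF that(1)] lf_closed[OF assms(2)])
 show ?thesis
  using assms(1)
 proof (induction rule: thru.induct)
  case (zero \<eta>)
  show ?case by (rule cong[OF ntr_zero[OF assms(2,3)] zero])
 next
  case (step H \<alpha> \<beta> \<theta> \<eta>)
  show ?case by (rule cong[OF ntr_plus[OF assms(3) ntr_comp[OF step(2,3)] step(6)] step(5)])
 qed
qed

lemma thru_cong:
 assumes "thru C F F' \<eta>" "\<And>M x. fd M \<Longrightarrow> el F M x \<Longrightarrow> \<theta> M x = \<eta> M x"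
 shows "thru C F F' \<theta>"
 using assms(1)
proof (cases rule: thru.cases)
 case zero
 show ?thesis by (rule thru.zero) (simp add: assms(2) zero)
next
 case (step H \<alpha> \<beta> \<zeta>)
 show ?thesis by (rule thru.step[OF step(1-4)]) (simp add: assms(2) step(5))
qed

lemma thru_single:
 assumes "lin F'" "H \<in> C" "ntr F H \<alpha>" "ntr H F' \<beta>"
 shows "thru C F F' (\<lambda>M x. \<beta> M (\<alpha> M x))"
proof (rule thru.step[OF assms(2-4) thru.zero])
 fix M x assume M: "fd M" and x: "el F M x"
 interpret I: abelian_group "obj F' M" by (rule m_ab[OF lf_obj[OF assms(1) M]])
 show "\<beta> M (\<alpha> M x) = \<beta> M (\<alpha> M x) \<oplus>\<^bsub>obj F' M\<^esub> \<zero>\<^bsub>obj F' M\<^esub>"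
  using ntr_closed[OF assms(4) M ntr_closed[OF assms(3) M x]] by simp
qed simp

lemma thru_plus:
 fixes F F' :: "('a, 'u) endofunctor"
 assumes F: "lin F" and F': "lin F'"
  and "thru C F F' \<eta>" "thru C F F' \<theta>"
 shows "thru C F F' (\<lambda>M x. \<eta> M x \<oplus>\<^bsub>obj F' M\<^esub> \<theta> M x)"
 using assms(3)
proof (induction rule: thru.induct)
 case (zero \<eta>)
 show ?case
 proof (rule thru_cong[OF assms(4)])
  fix M :: "('a, 'u) module" and x assume M: "fd M" and x: "el F M x"
  interpret I: abelian_group "obj F' M" by (rule m_ab[OF lf_obj[OF F' M]])
  show "\<eta> M x \<oplus>\<^bsub>obj F' M\<^esub> \<theta> M x = \<theta> M x"
   using ntr_closed[OF thru_ntr[OF assms(4) F F'] M x] by (simp add: zero M x)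
 qed
next
 case (step H \<alpha> \<beta> \<zeta> \<eta>)
 show ?case
 proof (rule thru.step[OF step(1-3) step(6)])
  fix M :: "('a, 'u) module" and x assume M: "fd M" and x: "el F M x"
  interpret I: abelian_group "obj F' M" by (rule m_ab[OF lf_obj[OF F' M]])
  show "\<eta> M x \<oplus>\<^bsub>obj F' M\<^esub> \<theta> M x = \<beta> M (\<alpha> M x) \<oplus>\<^bsub>obj F' M\<^esub> (\<zeta> M x \<oplus>\<^bsub>obj F' M\<^esub> \<theta> M x)"
   using ntr_closed[OF thru_ntr[OF assms(4) F F'] M x] ntr_closed[OF thru_ntr[OF step(4) F F'] M x]
    ntr_closed[OF ntr_comp[OF step(2,3)] M x] by (simp add: step(5)[OF M x] I.a_assoc)
 qed
qed

lemma thru_comp: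
 fixes F F' G G' :: "('a, 'u) endofunctor"
 assumes G': "lin G'" and F: "lin F" and F': "lin F'"
  and t: "thru C F F' \<eta>" and \<gamma>: "ntr G F \<gamma>" and \<delta>: "ntr F' G' \<delta>"
 shows "thru C G G' (\<lambda>M x. \<delta> M (\<eta> M (\<gamma> M x)))"
 using t
proof (induction rule: thru.induct)
 case (zero \<eta>)
 show ?case
  by (rule thru.zero)
   (simp add: zero ntr_closed[OF \<gamma>] lin_map_zero[OF lf_obj[OF F'] lf_obj[OF G'] ntr_lin[OF \<delta>]])
next
 case (step H \<alpha> \<beta> \<theta> \<eta>)
 show ?case
 proof (rule thru.step[OF step(1) ntr_comp[OF \<gamma> step(2)] ntr_comp[OF step(3) \<delta>] step(6)])
  fix M :: "('a, 'u) module" and x assume M: "fd M" and x: "el G M x"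
  note gx = ntr_closed[OF \<gamma> M x]
  show "\<delta> M (\<eta> M (\<gamma> M x)) = \<delta> M (\<beta> M (\<alpha> M (\<gamma> M x))) \<oplus>\<^bsub>obj G' M\<^esub> \<delta> M (\<theta> M (\<gamma> M x))"
   unfolding step(5)[OF M gx]
   by (rule ntr_add[OF \<delta> M ntr_closed[OF ntr_comp[OF step(2,3)] M gx] ntr_closed[OF thru_ntr[OF step(4) F F'] M gx]])
 qed
qed

text \<open>Refinement: the decomposed identity of each intermediate functor is inserted between the
  two maps of a summand.\<close>

lemma thru_trans:
 fixes F F' :: "('a, 'u) endofunctor"
 assumes F: "lin F" and F': "lin F'" and C: "C \<subseteq> lin_functors A"
  and t: "thru C F F' \<eta>" and CD: "\<And>H. H \<in> C \<Longrightarrow> thru C' H H (\<lambda>M x. x)"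
 shows "thru C' F F' \<eta>"
 using t
proof (induction rule: thru.induct)
 case (zero \<eta>)
 show ?case by (rule thru.zero[OF zero])
next
 case (step H \<alpha> \<beta> \<theta> \<eta>)
 have H: "lin H" using step C by auto
 show ?case
  by (rule thru_cong[OF thru_plus[OF F F' thru_comp[OF F' H H CD[OF step(1)] step(2,3)] step(6)] step(5)])
qed

lemma whisker_right:
 fixes F F' K :: "('a, 'u) endofunctor"
 assumes K: "lin K" and \<eta>: "ntr F F' \<eta>"
 shows "ntr (F \<circ>\<^sub>F K) (F' \<circ>\<^sub>F K) (\<lambda>M. \<eta> (obj K M))"
 by (rule ntrI)
  (auto simp: functor_comp_def intro!: ntr_lin[OF \<eta>] ntr_nat[OF \<eta>] lf_obj[OF K] lf_mor[OF K])

lemma thru_whisker_right: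
 fixes F F' K :: "('a, 'u) endofunctor"
 assumes K: "lin K" and t: "thru C F F' \<eta>"
 shows "thru ((\<lambda>H. H \<circ>\<^sub>F K) ` C) (F \<circ>\<^sub>F K) (F' \<circ>\<^sub>F K) (\<lambda>M. \<eta> (obj K M))"
 using t
proof (induction rule: thru.induct)
 case (zero \<eta>)
 show ?case by (rule thru.zero) (simp add: functor_comp_def zero lf_obj[OF K])
next
 case (step H \<alpha> \<beta> \<theta> \<eta>)
 show ?case
  by (rule thru.step[OF imageI[OF step(1)] whisker_right[OF K step(2)] whisker_right[OF K step(3)] step(6)])
   (simp add: functor_comp_def step(5) lf_obj[OF K])
qed

text \<open>Horizontal composition of \<open>K\<close> with \<open>\<eta>\<close>. The component is
  restricted first, since the functor laws speak about \<open>mor K\<close> on the extensional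
  members of \<open>mhom\<close>.\<close>

definition wl :: "('a, 'u) endofunctor \<Rightarrow> ('a, 'u) endofunctor \<Rightarrow> ('a, 'u) endofunctor
  \<Rightarrow> (('a, 'u) module \<Rightarrow> 'u \<Rightarrow> 'u) \<Rightarrow> (('a, 'u) module \<Rightarrow> 'u \<Rightarrow> 'u)" where
 "wl K F F' \<eta> M = mor K (obj F M) (obj F' M) (restrict (\<eta> M) (carrier (obj F M)))"

lemma ntr_restrict_mhom:
 "lin F \<Longrightarrow> ntr F F' \<eta> \<Longrightarrow> fd M \<Longrightarrow> restrict (\<eta> M) (carrier (obj F M)) \<in> mhom A (obj F M) (obj F' M)"
 by (rule lin_mhom[OF ntr_lin lf_obj])

context
 fixes K F F' :: "('a, 'u) endofunctor"
 assumes K: "lin K" and F: "lin F" and F': "lin F'"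
begin

lemma wl_ntr:
 assumes \<eta>: "ntr F F' \<eta>"
 shows "ntr (K \<circ>\<^sub>F F) (K \<circ>\<^sub>F F') (wl K F F' \<eta>)"
proof (rule ntrI, unfold functor_comp_def mod_functor.simps wl_def)
 fix M :: "('a, 'u) module" assume M: "fd M"
 note r = ntr_restrict_mhom[OF F \<eta>]
 note FM = lf_obj[OF F M] and FM' = lf_obj[OF F' M]
 show "lin_map (obj K (obj F M)) (obj K (obj F' M)) (mor K (obj F M) (obj F' M) (restrict (\<eta> M) (carrier (obj F M))))"
  by (rule lf_lin[OF K FM FM' r[OF M]])
 fix N :: "('a, 'u) module" and f x assume N: "fd N" and f: "f \<in> mhom A M N" and x: "x \<in> carrier (obj K (obj F M))"
 note FN = lf_obj[OF F N] and FN' = lf_obj[OF F' N]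
 have "compose (carrier (obj F M)) (restrict (\<eta> N) (carrier (obj F N))) (mor F M N f) =
   compose (carrier (obj F M)) (mor F' M N f) (restrict (\<eta> M) (carrier (obj F M)))"
  using ntr_nat[OF \<eta> M N f] lf_closed[OF F M N f] by (auto simp: compose_def)
 then show "mor K (obj F N) (obj F' N) (restrict (\<eta> N) (carrier (obj F N))) (mor K (obj F M) (obj F N) (mor F M N f) x) =
   mor K (obj F' M) (obj F' N) (mor F' M N f) (mor K (obj F M) (obj F' M) (restrict (\<eta> M) (carrier (obj F M))) x)"
  using lf_comp[OF K FM FN FN' lf_mor[OF F M N f] r[OF N] x] lf_comp[OF K FM FM' FN' r[OF M] lf_mor[OF F' M N f] x] by simp
qed

end

lemma wl_cong:
 assumes "\<And>x. el F M x \<Longrightarrow> \<eta> M x = \<theta> M x"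
 shows "wl K F F' \<eta> M = wl K F F' \<theta> M"
 unfolding wl_def using assms by (simp cong: restrict_cong)

lemma wl_comp:
 fixes K F F' F'' :: "('a, 'u) endofunctor"
 assumes K: "lin K" and F: "lin F" and F': "lin F'" and F'': "lin F''"
  and \<eta>: "ntr F F' \<eta>" and \<theta>: "ntr F' F'' \<theta>" and M: "fd M" and x: "x \<in> carrier (obj K (obj F M))"
 shows "wl K F F'' (\<lambda>M x. \<theta> M (\<eta> M x)) M x = wl K F' F'' \<theta> M (wl K F F' \<eta> M x)"
proof -
 have "restrict (\<lambda>x. \<theta> M (\<eta> M x)) (carrier (obj F M)) =
   compose (carrier (obj F M)) (restrict (\<theta> M) (carrier (obj F' M))) (restrict (\<eta> M) (carrier (obj F M)))"
  using ntr_closed[OF \<eta> M] by (auto simp: compose_def)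
 then show ?thesis
  unfolding wl_def
  using lf_comp[OF K lf_obj[OF F M] lf_obj[OF F' M] lf_obj[OF F'' M] ntr_restrict_mhom[OF F \<eta> M] ntr_restrict_mhom[OF F' \<theta> M] x]
  by simp
qed

lemma wl_id:
 fixes K F :: "('a, 'u) endofunctor"
 assumes K: "lin K" and F: "lin F" and M: "fd M" and x: "x \<in> carrier (obj K (obj F M))"
 shows "wl K F F (\<lambda>M x. x) M x = x"
 unfolding wl_def by (rule lf_id[OF K lf_obj[OF F M] x])

lemma thru_whisker_left:
 fixes F F' K :: "('a, 'u) endofunctor"
 assumes K: "lin K" and F: "lin F" and F': "lin F'"
  and C: "C \<subseteq> lin_functors A" and t: "thru C F F' \<eta>"
 shows "thru ((\<lambda>H. K \<circ>\<^sub>F H) ` C) (K \<circ>\<^sub>F F) (K \<circ>\<^sub>F F') (wl K F F' \<eta>)"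
 using t
proof (induction rule: thru.induct)
 case (zero \<eta>)
 show ?case
 proof (rule thru.zero)
  fix M :: "('a, 'u) module" and x assume M: "fd M" and x: "x \<in> carrier (obj (K \<circ>\<^sub>F F) M)"
  note FM = lf_obj[OF F M] and FM' = lf_obj[OF F' M]
  let ?z = "\<lambda>x\<in>carrier (obj F M). \<zero>\<^bsub>obj F' M\<^esub>"
  have xc: "x \<in> carrier (obj K (obj F M))" using x by (simp add: functor_comp_def)
  have z: "?z \<in> mhom A (obj F M) (obj F' M)"
   by (rule ntr_restrict_mhom[OF F ntr_zero[OF F F'] M])
  \<comment> \<open>That \<open>K\<close> preserves zero maps follows from compatibility with
    scalars, by reading the zero map as \<open>0\<close> times itself.\<close>
  have zk: "?z = (\<lambda>x\<in>carrier (obj F M). kscale A (obj F' M) 0 (?z x))"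
   using ks_zero[OF FM' m_zero_closed[OF FM']] by auto
  have "mor K (obj F M) (obj F' M) ?z x = \<zero>\<^bsub>obj K (obj F' M)\<^esub>"
   using trans[OF arg_cong[OF zk, of "\<lambda>f. mor K (obj F M) (obj F' M) f x"] lf_ks[OF K FM FM' z xc, of 0]]
    ks_zero[OF lf_obj[OF K FM'] lf_closed[OF K FM FM' z xc]] by (rule trans)
  moreover have "wl K F F' \<eta> M = wl K F F' (\<lambda>M x. \<zero>\<^bsub>obj F' M\<^esub>) M" by (rule wl_cong) (rule zero[OF M])
  ultimately show "wl K F F' \<eta> M x = \<zero>\<^bsub>obj (K \<circ>\<^sub>F F') M\<^esub>" by (simp add: wl_def functor_comp_def)
 qed
next
 case (step H \<alpha> \<beta> \<theta> \<eta>)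
 have H: "lin H" using step C by auto
 show ?case
 proof (rule thru.step[OF imageI[OF step(1)] wl_ntr[OF K F H step(2)] wl_ntr[OF K H F' step(3)] step(6)])
  fix M :: "('a, 'u) module" and x assume M: "fd M" and x: "x \<in> carrier (obj (K \<circ>\<^sub>F F) M)"
  note FM = lf_obj[OF F M] and FM' = lf_obj[OF F' M]
  have xc: "x \<in> carrier (obj K (obj F M))" using x by (simp add: functor_comp_def)
  note c = ntr_comp[OF step(2,3)] and th = thru_ntr[OF step(4) F F']
  have "wl K F F' \<eta> M = wl K F F' (\<lambda>M x. \<beta> M (\<alpha> M x) \<oplus>\<^bsub>obj F' M\<^esub> \<theta> M x) M" by (rule wl_cong) (rule step(5)[OF M])
  moreover have "(\<lambda>x\<in>carrier (obj F M). \<beta> M (\<alpha> M x) \<oplus>\<^bsub>obj F' M\<^esub> \<theta> M x) =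
    (\<lambda>x\<in>carrier (obj F M). restrict (\<lambda>x. \<beta> M (\<alpha> M x)) (carrier (obj F M)) x \<oplus>\<^bsub>obj F' M\<^esub> restrict (\<theta> M) (carrier (obj F M)) x)"
   by auto
  ultimately have "wl K F F' \<eta> M x = wl K F F' (\<lambda>M x. \<beta> M (\<alpha> M x)) M x \<oplus>\<^bsub>obj K (obj F' M)\<^esub> wl K F F' \<theta> M x"
   using lf_add[OF K FM FM' ntr_restrict_mhom[OF F c M] ntr_restrict_mhom[OF F th M] xc]
   by (simp add: wl_def)
  then show "wl K F F' \<eta> M x = wl K H F' \<beta> M (wl K F H \<alpha> M x) \<oplus>\<^bsub>obj (K \<circ>\<^sub>F F') M\<^esub> wl K F F' \<theta> M x"
   by (simp add: wl_comp[OF K F H F' step(2,3) M xc] functor_comp_def)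
 qed
qed

lemma retr_whisker_left:
 fixes F F' K :: "('a, 'u) endofunctor"
 assumes K: "lin K" and F: "lin F" and F': "lin F'" and r: "retr F F'"
 shows "retr (K \<circ>\<^sub>F F) (K \<circ>\<^sub>F F')"
proof -
 obtain \<iota> \<pi> where ip: "ntr F F' \<iota>" "ntr F' F \<pi>" "\<And>M x. fd M \<Longrightarrow> el F M x \<Longrightarrow> \<pi> M (\<iota> M x) = x"
  by (rule retrE[OF r]) blast
 show ?thesis
 proof (rule retrI[OF wl_ntr[OF K F F' ip(1)] wl_ntr[OF K F' F ip(2)]])
  fix M :: "('a, 'u) module" and x assume M: "fd M" and x: "x \<in> carrier (obj (K \<circ>\<^sub>F F) M)"
  have xc: "x \<in> carrier (obj K (obj F M))" using x by (simp add: functor_comp_def)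
  have "wl K F F (\<lambda>M x. \<pi> M (\<iota> M x)) M = wl K F F (\<lambda>M x. x) M" by (rule wl_cong) (rule ip(3)[OF M])
  then show "wl K F' F \<pi> M (wl K F F' \<iota> M x) = x"
   using wl_comp[OF K F F' F ip(1,2) M xc] wl_id[OF K F M xc] by simp
 qed
qed

lemma retr_whisker_right:
 fixes F F' K :: "('a, 'u) endofunctor"
 assumes K: "lin K" and r: "retr F F'"
 shows "retr (F \<circ>\<^sub>F K) (F' \<circ>\<^sub>F K)"
proof -
 obtain \<iota> \<pi> where ip: "ntr F F' \<iota>" "ntr F' F \<pi>" "\<And>M x. fd M \<Longrightarrow> el F M x \<Longrightarrow> \<pi> M (\<iota> M x) = x"
  by (rule retrE[OF r]) blast
 show ?thesis
  by (rule retrI[OF whisker_right[OF K ip(1)] whisker_right[OF K ip(2)]])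
   (simp add: functor_comp_def ip(3) lf_obj[OF K])
qed

text \<open>Takes the role of a local endomorphism ring: a scalar is either zero or invertible, so a
  sum of noninvertible endomorphisms is noninvertible.\<close>

definition brick :: "('a, 'u) endofunctor \<Rightarrow> bool" where
 "brick F \<longleftrightarrow> F \<in> lin_functors A \<and> nonzero F \<and>
   (\<forall>\<eta>. ntr F F \<eta> \<longrightarrow> (\<exists>c. \<forall>M\<in>fdmod A. \<forall>x\<in>carrier (obj F M). \<eta> M x = kscale A (obj F M) c x))"

lemma ks_eq_self:
 fixes M :: "('a, 'u) module"
 assumes M: "fd M" and x: "x \<in> carrier M" "x \<noteq> \<zero>\<^bsub>M\<^esub>" and c: "kscale A M c x = x"
 shows "c = 1"
proof (rule ccontr)
 assume "c \<noteq> 1"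
 interpret I: abelian_group M by (rule m_ab[OF M])
 have "kscale A M (c - 1) x = kscale A M c x \<oplus>\<^bsub>M\<^esub> kscale A M (- 1) x"
  using ks_add[OF M x(1), of c "- 1"] by simp
 then have z: "kscale A M (c - 1) x = \<zero>\<^bsub>M\<^esub>" using c ks_minus_one[OF M x(1)] by simp
 have "x = kscale A M (inverse (c - 1) * (c - 1)) x" using \<open>c \<noteq> 1\<close> ks_one[OF M x(1)] by simp
 also have "\<dots> = \<zero>\<^bsub>M\<^esub>"
  unfolding ks_mult[OF M x(1)] z by (simp add: kscale_def m_zero_right[OF M sc_closed])
 finally show False using x(2) by simp
qed

lemma brickD:
 assumes "brick H" "ntr H H \<eta>"
 obtains c where "\<And>M x. fd M \<Longrightarrow> el H M x \<Longrightarrow> \<eta> M x = kscale A (obj H M) c x"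
 using assms unfolding brick_def by blast

text \<open>Each summand of \<open>\<eta>\<close> is a scalar \<open>c\<close>. For \<open>c\<close>
  nonzero, dividing by it would exhibit \<open>G\<close> as a retract of the functor in the middle;
  hence all these scalars vanish.\<close>

lemma thru_brick:
 fixes G :: "('a, 'u) endofunctor"
 assumes G: "brick G" and t: "thru C G G \<eta>" and no: "\<forall>H\<in>C. \<not> retr G H" and M: "fd M" and x: "el G M x"
 shows "\<eta> M x = \<zero>\<^bsub>obj G M\<^esub>"
proof -
 have Gl: "lin G" using G by (simp add: brick_def)
 interpret I: abelian_group "obj G M" by (rule m_ab[OF lf_obj[OF Gl M]])
 show ?thesis
  using t
 proof (induction rule: thru.induct)
  case (zero \<eta>)
  then show ?case using M x by blast
 next
  case (step H \<alpha> \<beta> \<theta> \<eta>)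
  obtain c where c: "\<And>M x. fd M \<Longrightarrow> el G M x \<Longrightarrow> \<beta> M (\<alpha> M x) = kscale A (obj G M) c x"
   by (rule brickD[OF G ntr_comp[OF step(2,3)]]) blast
  have "c = 0"
  proof (rule ccontr)
   assume "c \<noteq> 0"
   then have "retr G H"
    by (intro retrI[OF step(2) ntr_ks[OF Gl step(3), of "inverse c"]])
     (simp add: c ks_one[OF lf_obj[OF Gl]] flip: ks_mult[OF lf_obj[OF Gl]])
   then show False using no step(1) by blast
  qed
  then show ?case using step(5)[OF M x] step(6) c[OF M x] ks_zero[OF lf_obj[OF Gl M] x] by simp
 qed
qed

text \<open>If \<open>\<alpha>' \<beta>\<close> is a nonzero scalar, then \<open>\<beta> \<alpha>'\<close> is a multiple of an idempotent.  Otherwise it is zero,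
 so \<open>w = \<beta> \<alpha>' x\<close> satisfies \<open>w = \<theta> \<chi> w\<close> and the summand \<open>\<beta> \<alpha>\<close> can be dropped after a change of \<open>\<chi>\<close>.\<close>

lemma thru_bricks:
 fixes F :: "('a, 'u) endofunctor"
 assumes F: "idempotents_trivial F" and C: "\<And>H. H \<in> C \<Longrightarrow> brick H" and t: "thru C F F \<eta>" and \<chi>: "ntr F F \<chi>"
  and e: "\<forall>M\<in>fdmod A. \<forall>x\<in>carrier (obj F M). \<eta> M (\<chi> M x) = x"
 shows "\<exists>H\<in>C. retr F H"
 using t \<chi> e
proof (induction arbitrary: \<chi> rule: thru.induct)
 have Fl: "lin F" using F by (simp add: idempotents_trivial_def)
 {
  case (zero \<eta>)
  obtain M x where x: "fd M" "el F M x" "x \<noteq> \<zero>\<^bsub>obj F M\<^esub>"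
   using F unfolding idempotents_trivial_def nonzero_def by blast
  then show ?case using zero ntr_closed[OF zero(2) x(1,2)] by force
 next
  case (step H \<alpha> \<beta> \<theta> \<eta>)
  note n = thru_ntr[OF step(4) Fl Fl]
  let ?a = "\<lambda>M x. \<alpha> M (\<chi> M x)" and ?w = "\<lambda>M x. \<beta> M (\<alpha> M (\<chi> M x))"
  note an = ntr_comp[OF step(7) step(2)]
  note wn = ntr_comp[OF an step(3)]
  have Hb: "brick H" and Hl: "lin H" using C[OF step(1)] by (simp_all add: brick_def)
  obtain c where c: "\<And>M y. fd M \<Longrightarrow> el H M y \<Longrightarrow> ?a M (\<beta> M y) = kscale A (obj H M) c y"
   by (rule brickD[OF Hb ntr_comp[OF step(3) an]]) blast
  have sum: "x = ?w M x \<oplus>\<^bsub>obj F M\<^esub> \<theta> M (\<chi> M x)" if "fd M" "el F M x" for M x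
   using step(5)[OF that(1) ntr_closed[OF step(7) that]] step(8) that by simp
  show ?case
  proof (cases "c = 0")
   case True
   \<comment> \<open>With \<open>w\<close> for \<open>?w M x\<close>, the equations
     \<open>x = w + \<theta> (\<chi> x)\<close> and \<open>w = \<theta> (\<chi> w)\<close> combine
     to \<open>x = \<theta> (\<chi> (w + x))\<close>.\<close>
   let ?x = "\<lambda>M x. \<chi> M (?w M x \<oplus>\<^bsub>obj F M\<^esub> x)"
   have "\<forall>M\<in>fdmod A. \<forall>x\<in>carrier (obj F M). \<theta> M (?x M x) = x"
   proof (intro ballI)
    fix M :: "('a, 'u) module" and x assume M: "fd M" and x: "el F M x"
    interpret I: abelian_group "obj F M" by (rule m_ab[OF lf_obj[OF Fl M]])
    note w = ntr_closed[OF wn M x] and a = ntr_closed[OF an M x]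
    have "?a M (?w M x) = \<zero>\<^bsub>obj H M\<^esub>" using c[OF M a] True ks_zero[OF lf_obj[OF Hl M] a] by simp
    then have "?w M (?w M x) = \<zero>\<^bsub>obj F M\<^esub>"
     using lin_map_zero[OF lf_obj[OF Hl M] lf_obj[OF Fl M] ntr_lin[OF step(3) M]] by simp
    then have "?w M x = \<theta> M (\<chi> M (?w M x))" using sum[OF M w] ntr_closed[OF n M ntr_closed[OF step(7) M w]] by simp
    then show "\<theta> M (?x M x) = x"
     using sum[OF M x] ntr_add[OF step(7) M w x] ntr_add[OF n M ntr_closed[OF step(7) M w] ntr_closed[OF step(7) M x]] by simp
   qed
   then show ?thesis by (rule step(6)[OF ntr_comp[OF ntr_plus[OF Fl wn ntr_id] step(7)]])
  next
   case False
   \<comment> \<open>Division by \<open>c\<close> makes \<open>?b\<close> a right inverse of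
     \<open>?a\<close>, and hence \<open>?b\<close> after \<open>?a\<close> an idempotent of
     \<open>F\<close>.\<close>
   let ?b = "\<lambda>M x. kscale A (obj F M) (inverse c) (\<beta> M x)"
   note bn = ntr_ks[OF Fl step(3), of "inverse c"]
   note en = ntr_comp[OF an bn]
   have ab: "?a M (?b M y) = y" if M: "fd M" and y: "el H M y" for M y
    using lin_map_ks[OF ntr_lin[OF an M] ntr_closed[OF step(3) M y], of "inverse c"] c[OF M y] False ks_one[OF lf_obj[OF Hl M] y]
    by (simp flip: ks_mult[OF lf_obj[OF Hl M] y])
   have "idem_on F (\<lambda>M x. ?b M (?a M x))" unfolding idem_on_def using ab ntr_closed[OF an] by simp
   then have "(\<forall>M\<in>fdmod A. \<forall>x\<in>carrier (obj F M). ?b M (?a M x) = \<zero>\<^bsub>obj F M\<^esub>) \<or> (\<forall>M\<in>fdmod A. \<forall>x\<in>carrier (obj F M). ?b M (?a M x) = x)"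
    using F en unfolding idempotents_trivial_def by blast
   then show ?thesis
   proof
    \<comment> \<open>A zero idempotent would force \<open>?b\<close>, and with it the identity of
      the nonzero functor \<open>H\<close>, to vanish.\<close>
    assume z: "\<forall>M\<in>fdmod A. \<forall>x\<in>carrier (obj F M). ?b M (?a M x) = \<zero>\<^bsub>obj F M\<^esub>"
    obtain M y where y: "fd M" "el H M y" "y \<noteq> \<zero>\<^bsub>obj H M\<^esub>" using Hb unfolding brick_def nonzero_def by blast
    have "?b M y = \<zero>\<^bsub>obj F M\<^esub>" using z ntr_closed[OF bn y(1,2)] y(1) ab[OF y(1,2)] by force
    then have "y = ?a M \<zero>\<^bsub>obj F M\<^esub>" using ab[OF y(1,2)] by simp
    then show ?thesis using y lin_map_zero[OF lf_obj[OF Fl y(1)] lf_obj[OF Hl y(1)] ntr_lin[OF an y(1)]] by simp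
   next
    assume "\<forall>M\<in>fdmod A. \<forall>x\<in>carrier (obj F M). ?b M (?a M x) = x"
    then have "retr F H" by (intro retrI[OF an bn]) blast
    then show ?thesis using step(1) by blast
   qed
  qed
 }
qed

text \<open>The scalar by which \<open>\<iota>\<close> after \<open>\<pi>\<close> acts fixes the
  image of a nonzero element, so it is \<open>1\<close> and the retraction is an
  isomorphism.\<close>

lemma retr_brick:
 fixes F H :: "('a, 'u) endofunctor"
 assumes F: "lin F" "nonzero F" and H: "brick H" and r: "retr F H"
 shows "nat_iso A F H"
proof -
 have Hl: "lin H" using H by (simp add: brick_def)
 obtain \<iota> \<pi> where ip: "ntr F H \<iota>" "ntr H F \<pi>" "\<And>M x. fd M \<Longrightarrow> el F M x \<Longrightarrow> \<pi> M (\<iota> M x) = x"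
  by (rule retrE[OF r]) blast
 obtain c where c: "\<And>M x. fd M \<Longrightarrow> el H M x \<Longrightarrow> \<iota> M (\<pi> M x) = kscale A (obj H M) c x"
  using H ntr_comp[OF ip(2,1)] unfolding brick_def by blast
 obtain M x where x: "fd M" "el F M x" "x \<noteq> \<zero>\<^bsub>obj F M\<^esub>"
  using F(2) unfolding nonzero_def by blast
 have ix: "\<iota> M x \<in> carrier (obj H M)" by (rule ntr_closed[OF ip(1) x(1,2)])
 have "\<iota> M x \<noteq> \<zero>\<^bsub>obj H M\<^esub>"
  using ip(3)[OF x(1,2)] x(3) lin_map_zero[OF lf_obj[OF Hl x(1)] lf_obj[OF F(1) x(1)] ntr_lin[OF ip(2) x(1)]] by auto
 moreover have "kscale A (obj H M) c (\<iota> M x) = \<iota> M x"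
  using c[OF x(1) ix] ip(3)[OF x(1,2)] by simp
 ultimately have "c = 1" by (intro ks_eq_self[OF lf_obj[OF Hl x(1)] ix])
 then have e: "\<iota> M (\<pi> M y) = y" if "fd M" "el H M y" for M y
  using c[OF that] ks_one[OF lf_obj[OF Hl that(1)] that(2)] by simp
 show ?thesis by (rule nat_isoI[OF F(1) Hl ip e])
qed

lemma direct_sum_singleton:
 fixes G :: "('a, 'u) endofunctor"
 assumes G: "lin G"
 shows "is_direct_sum A G [G]"
 unfolding is_direct_sum_def
proof (rule exI[of _ "\<lambda>_ M. restrict (\<lambda>x. x) (carrier (obj G M))"], rule exI[of _ "\<lambda>_ M. restrict (\<lambda>x. x) (carrier (obj G M))"],
  intro conjI allI impI ballI)
 fix i assume i: "i < length [G]"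
 show "nat_trans A ([G] ! i) G (\<lambda>M. \<lambda>x\<in>carrier (obj G M). x)" "nat_trans A G ([G] ! i) (\<lambda>M. \<lambda>x\<in>carrier (obj G M). x)"
  using ntr_nat_trans[OF ntr_id G] i by simp_all
next
 fix M :: "('a, 'u) module" and x assume M: "fd M" and x: "el G M x"
 interpret I: abelian_group "obj G M" by (rule m_ab[OF lf_obj[OF G M]])
 show "finsum (obj G M) (\<lambda>i. (\<lambda>x\<in>carrier (obj G M). x) ((\<lambda>x\<in>carrier (obj G M). x) x)) {..<length [G]} = x"
  using I.finsum_insert[of "{}" 0 "\<lambda>_. x"] x by (simp add: lessThan_Suc)
qed auto

lemma direct_sum_thru:
 fixes H :: "('a, 'u) endofunctor"
 assumes H: "lin H" and s: "is_direct_sum A H Fs"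
 shows "thru (set Fs) H H (\<lambda>M x. x)"
proof -
 obtain \<iota> \<pi> where *: "\<forall>i<length Fs. nat_trans A (Fs ! i) H (\<iota> i) \<and> nat_trans A H (Fs ! i) (\<pi> i)"
  "\<forall>M\<in>fdmod A. \<forall>x\<in>carrier (obj H M). finsum (obj H M) (\<lambda>i. \<iota> i M (\<pi> i M x)) {..<length Fs} = x"
  using s unfolding is_direct_sum_def by (elim exE conjE)
 have n: "ntr (Fs ! i) H (\<iota> i)" "ntr H (Fs ! i) (\<pi> i)" if "i < length Fs" for i
  using *(1) that nat_trans_ntr by blast+
 have "thru (set Fs) H H (\<lambda>M x. finsum (obj H M) (\<lambda>i. \<iota> i M (\<pi> i M x)) {..<m})" if "m \<le> length Fs" for m
  using that
 proof (induction m)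
  case 0
  show ?case
  proof (rule thru.zero)
   fix M :: "('a, 'u) module" and x assume M: "fd M"
   interpret I: abelian_group "obj H M" by (rule m_ab[OF lf_obj[OF H M]])
   show "finsum (obj H M) (\<lambda>i. \<iota> i M (\<pi> i M x)) {..<0} = \<zero>\<^bsub>obj H M\<^esub>" by simp
  qed
 next
  case (Suc m)
  then have m: "m < length Fs" by simp
  show ?case
  proof (rule thru.step[OF nth_mem[OF m] n(2)[OF m] n(1)[OF m] Suc.IH])
   show "m \<le> length Fs" using m by simp
   fix M :: "('a, 'u) module" and x assume M: "fd M" and x: "el H M x"
   interpret I: abelian_group "obj H M" by (rule m_ab[OF lf_obj[OF H M]])
   have c: "\<iota> i M (\<pi> i M x) \<in> carrier (obj H M)" if "i < Suc m" for i
    using that m ntr_closed[OF n(1) M ntr_closed[OF n(2) M x], of i] by simp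
   show "finsum (obj H M) (\<lambda>i. \<iota> i M (\<pi> i M x)) {..<Suc m} =
     \<iota> m M (\<pi> m M x) \<oplus>\<^bsub>obj H M\<^esub> finsum (obj H M) (\<lambda>i. \<iota> i M (\<pi> i M x)) {..<m}"
    unfolding lessThan_Suc by (rule I.finsum_insert) (use c in auto)
  qed
 qed
 from thru_cong[OF this[OF order_refl]] show ?thesis using *(2) by simp
qed

section \<open>The additive closure that defines \<open>D' A\<close>\<close>

definition gens :: "('a, 'k) endo_k set" where
 "gens = {G \<in> lin_functors A. nat_iso A G (tensor_functor A (outer_bimod A (carrier A) (carrier A)))} \<union>
   {G \<in> lin_functors A. \<exists>I. ideal I A \<and> nat_iso A G (Dp A I)}"

lemma D'_eq: "D' A = additive_closure A gens"
 by (simp add: D'_def gens_def)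

lemma gens_lin: "gens \<subseteq> lin_functors A"
 by (auto simp: gens_def)

lemma D_lin: "F \<in> D' A \<Longrightarrow> lin F"
 by (simp add: D'_eq additive_closure_def)

text \<open>The identity of a direct sum is the sum of the maps \<open>\<iota> i\<close> after
  \<open>\<pi> i\<close>; for a summand \<open>F\<close> it is sandwiched between the inclusion of
  \<open>F\<close> and the projection onto it.\<close>

lemma D_thru:
 assumes "F \<in> D' A"
 shows "thru gens F F (\<lambda>M x. x)"
proof -
 obtain Fs H where h: "set Fs \<subseteq> gens" "lin H" "is_direct_sum A H Fs" "is_summand A (lin_functors A) F H"
  using assms unfolding D'_eq additive_closure_def by blast
 have mono: "thru gens H H \<eta>" if "thru (set Fs) H H \<eta>" for \<eta>
  using that
 proof (induction rule: thru.induct)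
  case (zero \<eta>)
  show ?case by (rule thru.zero[OF zero])
 next
  case (step H' \<alpha> \<beta> \<theta> \<eta>)
  show ?case by (rule thru.step[OF _ step(2,3,6,5)]) (use step(1) h(1) in auto)
 qed
 obtain \<iota> \<pi> where ip: "ntr F H \<iota>" "ntr H F \<pi>" "\<And>M x. fd M \<Longrightarrow> el F M x \<Longrightarrow> \<pi> M (\<iota> M x) = x"
  by (rule retrE[OF summand_retr[OF h(4)]]) blast
 show ?thesis
  by (rule thru_cong[OF thru_comp[OF D_lin[OF assms] h(2,2) mono[OF direct_sum_thru[OF h(2,3)]] ip(1,2)]])
   (simp add: ip(3))
qed

lemma D_retr:
 assumes F: "lin F" and G: "G \<in> D' A" and r: "retr F G"
 shows "F \<in> D' A"
proof -
 obtain Fs H where h: "set Fs \<subseteq> gens" "lin H" "is_direct_sum A H Fs" "is_summand A (lin_functors A) G H"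
  using G unfolding D'_eq additive_closure_def by blast
 obtain K where "lin K" "is_direct_sum A H [F, K]"
  by (rule retr_summand[OF h(2) F retr_trans[OF r summand_retr[OF h(4)]]])
 then have "is_summand A (lin_functors A) F H" unfolding is_summand_def by blast
 then show ?thesis using h(1-3) F unfolding D'_eq additive_closure_def by blast
qed

lemma gens_D: "G \<in> gens \<Longrightarrow> G \<in> D' A"
proof -
 assume G: "G \<in> gens"
 then have Gl: "lin G" using gens_lin by auto
 obtain K where "lin K" "is_direct_sum A G [G, K]" by (rule retr_summand[OF Gl Gl retr_refl])
 then have "is_summand A (lin_functors A) G G" unfolding is_summand_def by blast
 moreover have "set [G] \<subseteq> gens" using G by simp
 ultimately show ?thesis
  using Gl direct_sum_singleton[OF Gl] unfolding D'_eq additive_closure_def by blast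
qed

text \<open>The complement obtained by splitting is itself a retract of \<open>G\<close>, so closure
  of \<open>D' A\<close> under retracts puts it where \<open>is_summand\<close> asks for it.\<close>

lemma summand_D:
 assumes F: "lin F" and G: "G \<in> D' A" and r: "retr F G"
 shows "is_summand A (D' A) F G"
proof -
 obtain K where K: "lin K" "retr K G" "is_direct_sum A G [F, K]" by (rule retr_summand[OF D_lin[OF G] F r])
 then show ?thesis unfolding is_summand_def using D_retr[OF K(1) G K(2)] by blast
qed

lemma im_retr:
 fixes F :: "('a, 'u) endofunctor"
 assumes "lin F" "ntr F F e" "idem_on F e"
 shows "retr (im_functor F e) F"
 by (rule retrI[OF im_functor(2)[OF assms] im_functor(3)[OF assms]]) (rule im_functor(4)[OF assms])

lemma indecomposable_trivial:
 assumes "indecomposable_in A (D' A) F"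
 shows "idempotents_trivial F"
 unfolding idempotents_trivial_def
proof (intro conjI allI impI)
 have FD: "F \<in> D' A" and nz: "\<not> zero_functor A F" using assms by (simp_all add: indecomposable_in_def)
 show Fl: "lin F" by (rule D_lin[OF FD])
 show "nonzero F" using nz nonzero_iff[OF Fl] by simp
 fix e assume "ntr F F e \<and> idem_on F e"
 then have e: "ntr F F e" "idem_on F e" by simp_all
 obtain e' where e': "ntr F F e'" "idem_on F e'"
  "\<And>M x. fd M \<Longrightarrow> el F M x \<Longrightarrow> e M x \<oplus>\<^bsub>obj F M\<^esub> e' M x = x"
  "\<And>M x. fd M \<Longrightarrow> el F M x \<Longrightarrow> e M (e' M x) = \<zero>\<^bsub>obj F M\<^esub>"
  "\<And>M x. fd M \<Longrightarrow> el F M x \<Longrightarrow> e' M (e M x) = \<zero>\<^bsub>obj F M\<^esub>"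
  by (rule idem_split[OF Fl e]) blast+
 note im = im_functor[OF Fl e] and im' = im_functor[OF Fl e'(1,2)]
 have "is_direct_sum A F [im_functor F e, im_functor F e']"
  by (rule split_direct_sum[OF Fl e(1) e'(1,2) e'(3-5) im(1,2,3,4) refl])
 moreover have "im_functor F e \<in> D' A" by (rule D_retr[OF im(1) FD im_retr[OF Fl e]])
 moreover have "im_functor F e' \<in> D' A" by (rule D_retr[OF im'(1) FD im_retr[OF Fl e'(1,2)]])
 ultimately have "zero_functor A (im_functor F e) \<or> zero_functor A (im_functor F e')"
  using assms by (simp add: indecomposable_in_def)
 then show "(\<forall>M\<in>fdmod A. \<forall>x\<in>carrier (obj F M). e M x = \<zero>\<^bsub>obj F M\<^esub>) \<or>
   (\<forall>M\<in>fdmod A. \<forall>x\<in>carrier (obj F M). e M x = x)"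
 proof
  assume z: "zero_functor A (im_functor F e)"
  have "e M x = \<zero>\<^bsub>obj F M\<^esub>" if "fd M" "el F M x" for M x
   using ntr_closed[OF im(3) that] z that(1) by (simp add: zero_functor_def im(5))
  then show ?thesis by blast
 next
  assume z: "zero_functor A (im_functor F e')"
  have "e M x = x" if M: "fd M" and x: "el F M x" for M x
  proof -
   interpret I: abelian_group "obj F M" by (rule m_ab[OF lf_obj[OF Fl M]])
   have "e' M x = \<zero>\<^bsub>obj F M\<^esub>" using ntr_closed[OF im'(3) M x] z M by (simp add: zero_functor_def im'(5))
   then show ?thesis using e'(3)[OF M x] ntr_closed[OF e(1) M x] by simp
  qed
  then show ?thesis by blast
 qed
qed

text \<open>In a decomposition into two nonzero parts, the first idempotent would be a scalar that
  fixes the first part and kills the second.\<close>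

lemma brick_indecomposable:
 assumes FD: "F \<in> D' A" and b: "brick F"
 shows "indecomposable_in A (D' A) F"
 unfolding indecomposable_in_def
proof (intro conjI ballI impI FD)
 have Fl: "lin F" and nz: "nonzero F" using b by (simp_all add: brick_def)
 show "\<not> zero_functor A F" using nz nonzero_iff[OF Fl] by simp
 fix F1 F2 assume D: "F1 \<in> D' A" "F2 \<in> D' A" and s: "is_direct_sum A F [F1, F2]"
 obtain i0 p0 i1 p1 where h: "ntr F1 F i0" "ntr F F1 p0" "ntr F2 F i1" "ntr F F2 p1"
  "\<And>M x. fd M \<Longrightarrow> x \<in> carrier (obj F1 M) \<Longrightarrow> p0 M (i0 M x) = x"
  "\<And>M x. fd M \<Longrightarrow> x \<in> carrier (obj F2 M) \<Longrightarrow> p1 M (i1 M x) = x"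
  "\<And>M x. fd M \<Longrightarrow> x \<in> carrier (obj F2 M) \<Longrightarrow> p0 M (i1 M x) = \<zero>\<^bsub>obj F1 M\<^esub>"
  by (rule direct_sum2E[OF s]) blast
 obtain c where c: "\<And>M x. fd M \<Longrightarrow> el F M x \<Longrightarrow> i0 M (p0 M x) = kscale A (obj F M) c x"
  using b ntr_comp[OF h(2,1)] unfolding brick_def by blast
 show "zero_functor A F1 \<or> zero_functor A F2"
 proof (rule ccontr)
  assume "\<not> ?thesis"
  then have "nonzero F1" "nonzero F2" using nonzero_iff[OF D_lin[OF D(1)]] nonzero_iff[OF D_lin[OF D(2)]] by simp_all
  then obtain M x N y where x: "fd M" "x \<in> carrier (obj F1 M)" "x \<noteq> \<zero>\<^bsub>obj F1 M\<^esub>"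
   and y: "fd N" "y \<in> carrier (obj F2 N)" "y \<noteq> \<zero>\<^bsub>obj F2 N\<^esub>"
   unfolding nonzero_def by blast
  note ix = ntr_closed[OF h(1) x(1,2)] and iy = ntr_closed[OF h(3) y(1,2)]
  have "i0 M x \<noteq> \<zero>\<^bsub>obj F M\<^esub>"
   using h(5)[OF x(1,2)] x(3) lin_map_zero[OF lf_obj[OF Fl x(1)] lf_obj[OF D_lin[OF D(1)] x(1)] ntr_lin[OF h(2) x(1)]] by auto
  moreover have "kscale A (obj F M) c (i0 M x) = i0 M x" using c[OF x(1) ix] h(5)[OF x(1,2)] by simp
  ultimately have "c = 1" by (intro ks_eq_self[OF lf_obj[OF Fl x(1)] ix])
  then have "i1 N y = i0 N (p0 N (i1 N y))" using c[OF y(1) iy] ks_one[OF lf_obj[OF Fl y(1)] iy] by simp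
  also have "\<dots> = \<zero>\<^bsub>obj F N\<^esub>"
   using h(7)[OF y(1,2)] lin_map_zero[OF lf_obj[OF D_lin[OF D(1)] y(1)] lf_obj[OF Fl y(1)] ntr_lin[OF h(1) y(1)]] by simp
  finally show False
   using h(6)[OF y(1,2)] y(3) lin_map_zero[OF lf_obj[OF Fl y(1)] lf_obj[OF D_lin[OF D(2)] y(1)] ntr_lin[OF h(4) y(1)]] by simp
 qed
qed

lemma thru_sum:
 fixes F F' :: "('a, 'u) endofunctor"
 assumes F: "lin F" and F': "lin F'" and T: "finite T"
  and t: "\<And>s. s \<in> T \<Longrightarrow> thru C F F' (\<eta> s)"
 shows "thru C F F' (\<lambda>M x. finsum (obj F' M) (\<lambda>s. \<eta> s M x) T)"
 using T t
proof (induction T)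
 case empty
 show ?case
 proof (rule thru.zero)
  fix M :: "('a, 'u) module" and x assume M: "fd M"
  interpret I: abelian_group "obj F' M" by (rule m_ab[OF lf_obj[OF F' M]])
  show "finsum (obj F' M) (\<lambda>s. \<eta> s M x) {} = \<zero>\<^bsub>obj F' M\<^esub>" by simp
 qed
next
 case (insert s T)
 have "thru C F F' (\<lambda>M x. finsum (obj F' M) (\<lambda>s. \<eta> s M x) T)" using insert by simp
 from thru_plus[OF F F' insert(4)[OF insertI1] this] show ?case
 proof (rule thru_cong)
  fix M :: "('a, 'u) module" and x assume M: "fd M" and x: "el F M x"
  interpret I: abelian_group "obj F' M" by (rule m_ab[OF lf_obj[OF F' M]])
  show "finsum (obj F' M) (\<lambda>s. \<eta> s M x) (insert s T) = \<eta> s M x \<oplus>\<^bsub>obj F' M\<^esub> finsum (obj F' M) (\<lambda>s. \<eta> s M x) T"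
   by (rule I.finsum_insert) (use insert ntr_closed[OF thru_ntr[OF insert(4) F F'] M x] in auto)
 qed
qed

definition IdF :: "('a, 'u) endofunctor" where
 "IdF = \<lparr> obj = (\<lambda>M. M), mor = (\<lambda>M N f. f) \<rparr>"

lemma IdF_lin: "(IdF :: ('a, 'u) endofunctor) \<in> lin_functors A"
 by (rule lin_functorsI) (auto simp: IdF_def compose_eq)

lemma comp_IdF: "F \<circ>\<^sub>F IdF = F" "IdF \<circ>\<^sub>F F = F"
 by (simp_all add: functor_comp_def IdF_def)

end

section \<open>Incidence algebras and thin functors\<close>

text \<open>The path algebra of a tree quiver is the incidence algebra of the poset of vertices: \<open>Lam\<close>
 consists of the pairs \<open>(a, b)\<close> such that there is a path from \<open>b\<close> to \<open>a\<close>, and \<open>E a b\<close> is this path.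
 The axiom \<open>Lam_chain\<close> says that all intervals are chains.\<close>

locale inc_alg = kalg A for A :: "('k::field, 'a) module" (structure) +
 fixes V :: "'v set" and Lam :: "('v \<times> 'v) set" and E :: "'v \<Rightarrow> 'v \<Rightarrow> 'a" and cf :: "'a \<Rightarrow> 'v \<Rightarrow> 'v \<Rightarrow> 'k"
 assumes fin_V: "finite V"
  and Lam_V: "(a, b) \<in> Lam \<Longrightarrow> a \<in> V \<and> b \<in> V"
  and Lam_refl: "a \<in> V \<Longrightarrow> (a, a) \<in> Lam"
  and Lam_antisym: "(a, b) \<in> Lam \<Longrightarrow> (b, a) \<in> Lam \<Longrightarrow> a = b"
  and Lam_trans: "(a, b) \<in> Lam \<Longrightarrow> (b, c) \<in> Lam \<Longrightarrow> (a, c) \<in> Lam"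
  and Lam_chain: "(a, c) \<in> Lam \<Longrightarrow> (a, d) \<in> Lam \<Longrightarrow> (c, b) \<in> Lam \<Longrightarrow> (d, b) \<in> Lam \<Longrightarrow>
   (c, d) \<in> Lam \<or> (d, c) \<in> Lam"
  and E_closed: "(a, b) \<in> Lam \<Longrightarrow> E a b \<in> carrier A"
  and E_mult: "(a, b) \<in> Lam \<Longrightarrow> (b, c) \<in> Lam \<Longrightarrow> E a b \<otimes> E b c = E a c"
  and E_mult0: "(a, b) \<in> Lam \<Longrightarrow> (c, d) \<in> Lam \<Longrightarrow> b \<noteq> c \<Longrightarrow> E a b \<otimes> E c d = \<zero>"
  and one_E: "\<one> = finsum A (\<lambda>v. E v v) V"
  and A_span: "carrier A \<subseteq> add_span A {c \<odot> E a b | c a b. (a, b) \<in> Lam}"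
  and cf_add: "x \<in> carrier A \<Longrightarrow> y \<in> carrier A \<Longrightarrow> cf (x \<oplus> y) a b = cf x a b + cf y a b"
  and cf_ks: "x \<in> carrier A \<Longrightarrow> cf (r \<odot> x) a b = r * cf x a b"
  and cf_E: "(a, b) \<in> Lam \<Longrightarrow> cf (E a b) a' b' = (if a = a' \<and> b = b' then 1 else 0)"
begin

abbreviation Basis where "Basis \<equiv> {c \<odot> E a b | c a b. (a, b) \<in> Lam}"

lemma Basis_closed: "Basis \<subseteq> carrier A"
 using ksmult_closed E_closed by auto

lemma Ev_closed: "v \<in> V \<Longrightarrow> E v v \<in> carrier A"
 by (rule E_closed[OF Lam_refl])

lemma fin_Lam: "finite Lam"
 by (rule finite_subset[OF _ finite_cartesian_product[OF fin_V fin_V]]) (use Lam_V in auto)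

lemma cf_zero: "cf \<zero> a b = 0"
 using cf_ks[of "\<zero>" 0 a b] by (simp add: ksmult_zero)

lemma E_nonzero: "(a, b) \<in> Lam \<Longrightarrow> E a b \<noteq> \<zero>"
 using cf_E[of a b a b] cf_zero[of a b] by auto

text \<open>There is at most one path between two vertices, so every corner has dimension at most
  one and is read off by one coefficient.\<close>

lemma corner:
 assumes x: "x \<in> carrier A" and ab: "a \<in> V" "b \<in> V"
 shows "E a a \<otimes> (x \<otimes> E b b) = (if (a, b) \<in> Lam then cf x a b \<odot> E a b else \<zero>)"
proof -
 have "x \<in> add_span A Basis" using x A_span by blast
 then show ?thesis
 proof (induction rule: add_span.induct)
  case zero
  show ?case using ab by (simp add: Ev_closed cf_zero ksmult_zero E_closed)
 next
  case (add y z)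
  obtain c p q where y: "y = c \<odot> E p q" "(p, q) \<in> Lam" using add by blast
  have pq: "p \<in> V" "q \<in> V" using Lam_V y by auto
  have yc: "y \<in> carrier A" using y by (simp add: ksmult_closed E_closed)
  have zc: "z \<in> carrier A" by (rule add_span_closed[OF add(2) Basis_closed])
  have 1: "E a a \<otimes> (y \<otimes> E b b) = (if (a, b) \<in> Lam then cf y a b \<odot> E a b else \<zero>)"
  proof -
   have "E a a \<otimes> (y \<otimes> E b b) = c \<odot> (E a a \<otimes> (E p q \<otimes> E b b))"
    using y ab by (simp add: ksmult_mult_left ksmult_mult_right E_closed Lam_refl)
   also have "E p q \<otimes> E b b = (if q = b then E p q else \<zero>)"
    using y(2) ab E_mult[OF y(2) Lam_refl] E_mult0[OF y(2) Lam_refl] pq by auto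
   also have "E a a \<otimes> (if q = b then E p q else \<zero>) = (if q = b \<and> p = a then E p q else \<zero>)"
    using y(2) ab pq E_mult[OF Lam_refl y(2)] E_mult0[OF Lam_refl y(2), of a] by (auto simp: Ev_closed)
   finally show ?thesis
    using y by (auto simp: cf_ks cf_E E_closed ksmult_zero ksmult_zero_right)
  qed
  have "E a a \<otimes> ((y \<oplus> z) \<otimes> E b b) = E a a \<otimes> (y \<otimes> E b b) \<oplus> E a a \<otimes> (z \<otimes> E b b)"
   using yc zc ab by (simp add: l_distr r_distr Ev_closed)
  then show ?case
   unfolding 1 add(3) by (simp add: cf_add[OF yc zc] ksmult_l_distr E_closed)
 qed
qed

lemma unit_decomp_left:
 assumes x: "x \<in> carrier A"
 shows "x = finsum A (\<lambda>v. E v v \<otimes> x) V"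
 using finsum_ldistr[OF fin_V x, of "\<lambda>v. E v v"] x by (simp add: Ev_closed one_E[symmetric])

lemma unit_decomp_right:
 assumes x: "x \<in> carrier A"
 shows "x = finsum A (\<lambda>v. x \<otimes> E v v) V"
 using finsum_rdistr[OF fin_V x, of "\<lambda>v. E v v"] x by (simp add: Ev_closed one_E[symmetric])

lemma m_unit_decomp:
 assumes M: "fd M" and x: "x \<in> carrier M"
 shows "x = finsum M (\<lambda>v. E v v \<odot>\<^bsub>M\<^esub> x) V"
 using add_hom_finsum[OF A_abelian m_ab[OF M] left_module.add_hom_lsmult_left[OF fdmod_lmod[OF M] x] fin_V, of "\<lambda>v. E v v"]
  m_one[OF M x] by (simp add: Ev_closed one_E[symmetric])

lemma rt_unit_decomp:
 fixes G :: "('a, nat \<Rightarrow> 'k, 'w) mod_functor"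
 assumes G: "lin G" and x: "el G PA x"
 shows "x = finsum (obj G PA) (\<lambda>v. rt G x (E v v)) V"
proof -
 have h: "add_hom A (obj G PA) (\<lambda>a. rt G x a)"
  by (rule add_homI) (simp_all add: rt_closed[OF G x] rt_add[OF G x])
 show ?thesis
  using add_hom_finsum[OF A_abelian m_ab[OF lf_obj[OF G PA_fdmod]] h fin_V, of "\<lambda>v. E v v"] rt_one[OF G x]
  by (simp add: Ev_closed one_E[symmetric])
qed

text \<open>Up-closed for the order in which \<open>(a, b)\<close> lies below
  \<open>(a', b')\<close> when the path \<open>E a' a\<close> on the left and the path
  \<open>E b b'\<close> on the right carry the basis element at \<open>(a, b)\<close> to the one at
  \<open>(a', b')\<close>.\<close>

definition filt :: "('v \<times> 'v) set \<Rightarrow> bool" where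
 "filt S \<longleftrightarrow> S \<subseteq> V \<times> V \<and> (\<forall>a b a' b'. (a, b) \<in> S \<longrightarrow> (a', a) \<in> Lam \<longrightarrow> (b, b') \<in> Lam \<longrightarrow> (a', b') \<in> S)"

lemma filtD:
 assumes "filt S" "(a, b) \<in> S"
 shows "a \<in> V" "b \<in> V" and "(a', a) \<in> Lam \<Longrightarrow> (a', b) \<in> S" and "(b, b') \<in> Lam \<Longrightarrow> (a, b') \<in> S"
  and "(a', a) \<in> Lam \<Longrightarrow> (b, b') \<in> Lam \<Longrightarrow> (a', b') \<in> S"
 using assms Lam_refl unfolding filt_def by blast+

definition up :: "'v \<Rightarrow> 'v \<Rightarrow> ('v \<times> 'v) set" where
 "up i j = {(a, b). (a, i) \<in> Lam \<and> (j, b) \<in> Lam}"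

lemma up_filt: "filt (up i j)"
 unfolding filt_def up_def using Lam_V Lam_trans by blast

text \<open>Nonempty, open and connected in the topology on pairs of vertices whose open sets are
  the up-closed ones.\<close>

definition conn :: "('v \<times> 'v) set \<Rightarrow> bool" where
 "conn S \<longleftrightarrow> filt S \<and> S \<noteq> {} \<and> (\<forall>Sa Sb. filt Sa \<longrightarrow> filt Sb \<longrightarrow> Sa \<union> Sb = S \<longrightarrow> Sa \<inter> Sb = {} \<longrightarrow> Sa = {} \<or> Sb = {})"

lemma up_self: "i \<in> V \<Longrightarrow> j \<in> V \<Longrightarrow> (i, j) \<in> up i j"
 by (simp add: up_def Lam_refl)

lemma up_subset: "filt S \<Longrightarrow> (i, j) \<in> S \<Longrightarrow> up i j \<subseteq> S"
 using filtD(5)[of S i j] by (auto simp: up_def)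

lemma up_conn: "i \<in> V \<Longrightarrow> j \<in> V \<Longrightarrow> conn (up i j)"
proof -
 assume ij: "i \<in> V" "j \<in> V"
 have "Sa = {} \<or> Sb = {}" if f: "filt Sa" "filt Sb" and u: "Sa \<union> Sb = up i j" and d: "Sa \<inter> Sb = {}" for Sa Sb
 proof (cases "(i, j) \<in> Sa")
  case True
  then have "Sb \<subseteq> Sa" using up_subset[OF f(1) True] u by auto
  then show ?thesis using d by auto
 next
  case False
  then have "(i, j) \<in> Sb" using u up_self[OF ij] by auto
  then have "Sa \<subseteq> Sb" using up_subset[OF f(2)] u by auto
  then show ?thesis using d by auto
 qed
 moreover have "up i j \<noteq> {}" using up_self[OF ij] by auto
 ultimately show ?thesis unfolding conn_def using up_filt[of i j] by simp
qed

lemma up_inj: "i \<in> V \<Longrightarrow> j \<in> V \<Longrightarrow> i' \<in> V \<Longrightarrow> j' \<in> V \<Longrightarrow> up i j = up i' j' \<Longrightarrow> i = i' \<and> j = j'"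
 using up_self[of i j] up_self[of i' j'] Lam_antisym by (auto simp: up_def)

text \<open>The images of the basis under a bimodule homomorphism into \<open>obj K PA\<close>. The
  cases \<open>a' = a\<close> and \<open>b' = b\<close> force \<open>t a b\<close> into its corner,
  from which the vanishing of the remaining products follows (\<open>tfam_left0\<close>,
  \<open>tfam_right0\<close>).\<close>

definition tfam :: "('a, 'k) endo_k \<Rightarrow> ('v \<times> 'v) set \<Rightarrow> ('v \<Rightarrow> 'v \<Rightarrow> nat \<Rightarrow> 'k) \<Rightarrow> bool" where
 "tfam K S t \<longleftrightarrow> (\<forall>a b. (a, b) \<in> S \<longrightarrow> t a b \<in> carrier (obj K PA) \<and>
   (\<forall>a'. (a', a) \<in> Lam \<longrightarrow> E a' a \<odot>\<^bsub>obj K PA\<^esub> t a b = t a' b) \<and>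
   (\<forall>b'. (b, b') \<in> Lam \<longrightarrow> rt K (t a b) (E b b') = t a b'))"

lemma tfamD:
 assumes "tfam K S t" "(a, b) \<in> S"
 shows "t a b \<in> carrier (obj K PA)" and "(a', a) \<in> Lam \<Longrightarrow> E a' a \<odot>\<^bsub>obj K PA\<^esub> t a b = t a' b"
  and "(b, b') \<in> Lam \<Longrightarrow> rt K (t a b) (E b b') = t a b'"
 using assms by (auto simp: tfam_def)

lemma tfam_left0:
 assumes K: "lin K" and S: "filt S" and t: "tfam K S t" and ab: "(a, b) \<in> S" and cd: "(c, d) \<in> Lam" "d \<noteq> a"
 shows "E c d \<odot>\<^bsub>obj K PA\<^esub> t a b = \<zero>\<^bsub>obj K PA\<^esub>"
proof -
 note aV = filtD(1)[OF S ab] and KP = lf_obj[OF K PA_fdmod]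
 have "E c d \<odot>\<^bsub>obj K PA\<^esub> t a b = E c d \<odot>\<^bsub>obj K PA\<^esub> (E a a \<odot>\<^bsub>obj K PA\<^esub> t a b)"
  using tfamD(2)[OF t ab Lam_refl[OF aV]] by simp
 also have "\<dots> = (E c d \<otimes> E a a) \<odot>\<^bsub>obj K PA\<^esub> t a b"
  by (rule m_mult[OF KP E_closed[OF cd(1)] Ev_closed[OF aV] tfamD(1)[OF t ab], symmetric])
 also have "\<dots> = \<zero>\<^bsub>obj K PA\<^esub>"
  unfolding E_mult0[OF cd(1) Lam_refl[OF aV] cd(2)] by (rule m_zero_left[OF KP tfamD(1)[OF t ab]])
 finally show ?thesis .
qed

lemma rt_zero:
 fixes K :: "('a, nat \<Rightarrow> 'k, 'w) mod_functor"
 assumes K: "lin K" and x: "el K PA x"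
 shows "rt K x \<zero> = \<zero>\<^bsub>obj K PA\<^esub>"
 using rt_ks[OF K x zero_closed, of 0] ks_zero[OF lf_obj[OF K PA_fdmod] rt_closed[OF K x zero_closed]]
 by (simp add: ksmult_zero)

lemma tfam_right0:
 assumes K: "lin K" and S: "filt S" and t: "tfam K S t" and ab: "(a, b) \<in> S" and cd: "(c, d) \<in> Lam" "c \<noteq> b"
 shows "rt K (t a b) (E c d) = \<zero>\<^bsub>obj K PA\<^esub>"
proof -
 note bV = filtD(2)[OF S ab]
 have "rt K (t a b) (E c d) = rt K (rt K (t a b) (E b b)) (E c d)"
  using tfamD(3)[OF t ab Lam_refl[OF bV]] by simp
 also have "\<dots> = rt K (t a b) (E b b \<otimes> E c d)"
  by (rule rt_mult[OF K tfamD(1)[OF t ab] Ev_closed[OF bV] E_closed[OF cd(1)], symmetric])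
 also have "\<dots> = \<zero>\<^bsub>obj K PA\<^esub>"
  unfolding E_mult0[OF Lam_refl[OF bV] cd(1) cd(2)[symmetric]] by (rule rt_zero[OF K tfamD(1)[OF t ab]])
 finally show ?thesis .
qed

text \<open>\<open>thin G S u\<close> says that \<open>G\<close> behaves like tensoring with the bimodule with basis \<open>S\<close>, with \<open>u a b\<close> in
 the role of \<open>(a, b) \<otimes> 1\<close>.\<close>

definition thin :: "('a, 'k) endo_k \<Rightarrow> ('v \<times> 'v) set \<Rightarrow> ('v \<Rightarrow> 'v \<Rightarrow> nat \<Rightarrow> 'k) \<Rightarrow> bool" where
 "thin G S u \<longleftrightarrow> G \<in> lin_functors A \<and> filt S \<and> tfam G S u \<and> (\<forall>a b. (a, b) \<in> S \<longrightarrow> u a b \<noteq> \<zero>\<^bsub>obj G PA\<^esub>) \<and>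
   (\<forall>M\<in>fdmod A. carrier (obj G M) \<subseteq> add_span (obj G M) {act G M m (u a b) | m a b. m \<in> carrier M \<and> (a, b) \<in> S}) \<and>
   (\<forall>K t. lin K \<longrightarrow> tfam K S t \<longrightarrow> (\<exists>\<eta>. ntr G K \<eta> \<and> (\<forall>a b. (a, b) \<in> S \<longrightarrow> \<eta> PA (u a b) = t a b)))"

lemma thinD:
 assumes "thin G S u"
 shows "lin G" and "filt S" and "tfam G S u" and "(a, b) \<in> S \<Longrightarrow> u a b \<noteq> \<zero>\<^bsub>obj G PA\<^esub>"
  and "fd M \<Longrightarrow> el G M x \<Longrightarrow>
   x \<in> add_span (obj G M) {act G M m (u a b) | m a b. m \<in> carrier M \<and> (a, b) \<in> S}"
 using assms unfolding thin_def by blast+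

lemma thin_univ:
 assumes "thin G S u" "lin K" "tfam K S t"
 obtains \<eta> where "ntr G K \<eta>" "\<And>a b. (a, b) \<in> S \<Longrightarrow> \<eta> PA (u a b) = t a b"
proof -
 have "\<exists>\<eta>. ntr G K \<eta> \<and> (\<forall>a b. (a, b) \<in> S \<longrightarrow> \<eta> PA (u a b) = t a b)"
  using assms unfolding thin_def by blast
 then show thesis using that by blast
qed

lemma thin_gen_closed:
 assumes "thin G S u" "fd M"
 shows "{act G M m (u a b) | m a b. m \<in> carrier M \<and> (a, b) \<in> S} \<subseteq> carrier (obj G M)"
 using act_closed[OF thinD(1)[OF assms(1)] assms(2)] tfamD(1)[OF thinD(3)[OF assms(1)]] by auto

lemma thin_hom_eq:
 assumes G: "thin G S u" and N: "abelian_group N" and M: "fd M"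
  and h: "add_hom (obj G M) N g" "add_hom (obj G M) N h"
  and eq: "\<And>m a b. m \<in> carrier M \<Longrightarrow> (a, b) \<in> S \<Longrightarrow> g (act G M m (u a b)) = h (act G M m (u a b))"
  and x: "el G M x"
 shows "g x = h x"
 by (rule add_hom_eq_on_span[OF m_ab[OF lf_obj[OF thinD(1)[OF G] M]] N h thin_gen_closed[OF G M] _ thinD(5)[OF G M x]])
  (use eq in blast)

lemma thin_ntr_eq:
 assumes G: "thin G S u" and K: "lin K" and n: "ntr G K \<eta>" "ntr G K \<theta>"
  and eq: "\<And>a b. (a, b) \<in> S \<Longrightarrow> \<eta> PA (u a b) = \<theta> PA (u a b)"
  and M: "fd M" and x: "el G M x"
 shows "\<eta> M x = \<theta> M x"
proof (rule thin_hom_eq[OF G m_ab[OF lf_obj[OF K M]] M lin_mapD(4)[OF ntr_lin[OF n(1) M]] lin_mapD(4)[OF ntr_lin[OF n(2) M]] _ x])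
 fix m a b assume m: "m \<in> carrier M" and ab: "(a, b) \<in> S"
 note uc = tfamD(1)[OF thinD(3)[OF G] ab]
 show "\<eta> M (act G M m (u a b)) = \<theta> M (act G M m (u a b))"
  using ntr_act[OF n(1) M m uc] ntr_act[OF n(2) M m uc] eq[OF ab] by simp
qed

lemma thin_unique:
 assumes G: "thin G S u" and G': "thin G' S u'"
 shows "nat_iso A G G'"
proof -
 obtain \<eta> where e: "ntr G G' \<eta>" "\<And>a b. (a, b) \<in> S \<Longrightarrow> \<eta> PA (u a b) = u' a b"
  by (rule thin_univ[OF G thinD(1,3)[OF G']]) blast
 obtain \<theta> where t: "ntr G' G \<theta>" "\<And>a b. (a, b) \<in> S \<Longrightarrow> \<theta> PA (u' a b) = u a b"
  by (rule thin_univ[OF G' thinD(1,3)[OF G]]) blast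
 show ?thesis
 proof (rule nat_isoI[OF thinD(1)[OF G] thinD(1)[OF G'] e(1) t(1)])
  show "\<theta> M (\<eta> M x) = x" if "fd M" "el G M x" for M x
   by (rule thin_ntr_eq[OF G thinD(1)[OF G] ntr_comp[OF e(1) t(1)] ntr_id _ that]) (simp add: e(2) t(2))
  show "\<eta> M (\<theta> M x) = x" if "fd M" "el G' M x" for M x
   by (rule thin_ntr_eq[OF G' thinD(1)[OF G'] ntr_comp[OF t(1) e(1)] ntr_id _ that]) (simp add: e(2) t(2))
 qed
qed

text \<open>A generator is \<open>u c d\<close> times some \<open>w\<close> in \<open>A\<close>; the
  projections keep only the coefficient \<open>cf w d b\<close>, and only if \<open>c = a\<close>.
  So the corner is at most a line, which later makes endomorphisms scalar on each
  \<open>u a b\<close>.\<close>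

lemma thin_corner:
 assumes G: "thin G S u" and x: "el G PA x" and ab: "a \<in> V" "b \<in> V"
 shows "\<exists>c. E a a \<odot>\<^bsub>obj G PA\<^esub> rt G x (E b b) = (if (a, b) \<in> S then kscale A (obj G PA) c (u a b) else \<zero>\<^bsub>obj G PA\<^esub>)"
proof -
 note Gl = thinD(1)[OF G] and S = thinD(2)[OF G] and t = thinD(3)[OF G]
 note GP = lf_obj[OF Gl PA_fdmod]
 interpret I: abelian_group "obj G PA" by (rule m_ab[OF GP])
 note Ea = Ev_closed[OF ab(1)] and Eb = Ev_closed[OF ab(2)]
 let ?U = "{act G PA m (u a b) | m a b. m \<in> carrier PA \<and> (a, b) \<in> S}"
 show ?thesis
  using thinD(5)[OF G PA_fdmod x]
 proof (induction rule: add_span.induct)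
  case zero
  have "rt G \<zero>\<^bsub>obj G PA\<^esub> (E b b) = \<zero>\<^bsub>obj G PA\<^esub>"
   using add_hom_zero[OF m_ab[OF GP] m_ab[OF GP], of "\<lambda>x. rt G x (E b b)"] rt_closed[OF Gl _ Eb] rt_add_left[OF Gl _ _ Eb]
   by (simp add: add_hom_def)
  then show ?case
   using m_zero_right[OF GP Ea] ks_zero[OF GP tfamD(1)[OF t, of a b]] by (intro exI[of _ 0]) simp
 next
  case (add y z)
  have yc: "el G PA y" using add(1) thin_gen_closed[OF G PA_fdmod] by blast
  have zc: "el G PA z" by (rule I.add_span_closed[OF add(2) thin_gen_closed[OF G PA_fdmod]])
  obtain m c d where y: "y = act G PA m (u c d)" "m \<in> carrier PA" "(c, d) \<in> S" using add(1) by blast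
  obtain w where w: "w \<in> carrier A" "m = jA w" using y(2) by (auto simp: carrier_PA)
  note uc = tfamD(1)[OF t y(3)] and cV = filtD(1)[OF S y(3)] and dV = filtD(2)[OF S y(3)]
  note wEb = m_closed[OF regular_fdmod]
  have "\<exists>r. E a a \<odot>\<^bsub>obj G PA\<^esub> rt G y (E b b) = (if (a, b) \<in> S then kscale A (obj G PA) r (u a b) else \<zero>\<^bsub>obj G PA\<^esub>)"
  proof -
   have "rt G y (E b b) = rt G (rt G (rt G (u c d) (E d d)) w) (E b b)"
    using tfamD(3)[OF t y(3) Lam_refl[OF dV]] by (simp add: y(1) w(2) rt_def)
   also have "\<dots> = rt G (u c d) (E d d \<otimes> (w \<otimes> E b b))"
    using uc w Eb Ev_closed[OF dV] by (simp add: rt_mult[OF Gl] rt_closed[OF Gl])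
   also have "\<dots> = (if (d, b) \<in> Lam then kscale A (obj G PA) (cf w d b) (u c b) else \<zero>\<^bsub>obj G PA\<^esub>)"
    unfolding corner[OF w(1) dV ab(2)]
    using rt_ks[OF Gl uc E_closed, of d b "cf w d b"] rt_zero[OF Gl uc] tfamD(3)[OF t y(3), of b] by simp
   finally have r: "rt G y (E b b) = (if (d, b) \<in> Lam then kscale A (obj G PA) (cf w d b) (u c b) else \<zero>\<^bsub>obj G PA\<^esub>)" .
   show ?thesis
   proof (cases "(d, b) \<in> Lam \<and> c = a")
    case True
    then have abS: "(a, b) \<in> S" using filtD(4)[OF S y(3), of b] by simp
    have "E a a \<odot>\<^bsub>obj G PA\<^esub> rt G y (E b b) = kscale A (obj G PA) (cf w d b) (u a b)"
     using True r ks_comm[OF GP tfamD(1)[OF t abS] Ea] tfamD(2)[OF t abS Lam_refl[OF ab(1)]] by simp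
    then show ?thesis using abS by auto
   next
    case False
    have "E a a \<odot>\<^bsub>obj G PA\<^esub> rt G y (E b b) = \<zero>\<^bsub>obj G PA\<^esub>"
    proof (cases "(d, b) \<in> Lam")
     case True
     then have cbS: "(c, b) \<in> S" using filtD(4)[OF S y(3), of b] by simp
     have "E a a \<odot>\<^bsub>obj G PA\<^esub> u c b = \<zero>\<^bsub>obj G PA\<^esub>"
      by (rule tfam_left0[OF Gl S t cbS Lam_refl[OF ab(1)]]) (use False True in auto)
     then show ?thesis
      using True r ks_comm[OF GP tfamD(1)[OF t cbS] Ea] by (simp add: kscale_def m_zero_right[OF GP sc_closed])
    next
     case False
     then show ?thesis using r m_zero_right[OF GP Ea] by simp
    qed
    then show ?thesis using ks_zero[OF GP tfamD(1)[OF t, of a b]] by (intro exI[of _ 0]) simp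
   qed
  qed
  then obtain r where r: "E a a \<odot>\<^bsub>obj G PA\<^esub> rt G y (E b b) = (if (a, b) \<in> S then kscale A (obj G PA) r (u a b) else \<zero>\<^bsub>obj G PA\<^esub>)" ..
  obtain s where s: "E a a \<odot>\<^bsub>obj G PA\<^esub> rt G z (E b b) = (if (a, b) \<in> S then kscale A (obj G PA) s (u a b) else \<zero>\<^bsub>obj G PA\<^esub>)"
   using add(3) ..
  have "E a a \<odot>\<^bsub>obj G PA\<^esub> rt G (y \<oplus>\<^bsub>obj G PA\<^esub> z) (E b b) =
    E a a \<odot>\<^bsub>obj G PA\<^esub> rt G y (E b b) \<oplus>\<^bsub>obj G PA\<^esub> E a a \<odot>\<^bsub>obj G PA\<^esub> rt G z (E b b)"
   using rt_add_left[OF Gl yc zc Eb] m_add_right[OF GP Ea rt_closed[OF Gl yc Eb] rt_closed[OF Gl zc Eb]] by simp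
  then show ?case unfolding r s using ks_add[OF GP tfamD(1)[OF t, of a b], of r s] by (intro exI[of _ "r + s"]) simp
 qed
qed

lemma ks_inj:
 fixes M :: "('a, 'u) module"
 assumes M: "fd M" and x: "x \<in> carrier M" "x \<noteq> \<zero>\<^bsub>M\<^esub>" and c: "kscale A M c x = kscale A M d x"
 shows "c = d"
proof -
 have "kscale A M (1 + c - d) x = kscale A M 1 x"
 proof -
  have "kscale A M (1 + (c + - d)) x = kscale A M 1 x \<oplus>\<^bsub>M\<^esub> (kscale A M c x \<oplus>\<^bsub>M\<^esub> kscale A M (- d) x)"
   by (simp only: ks_add[OF M x(1)])
  also have "kscale A M c x \<oplus>\<^bsub>M\<^esub> kscale A M (- d) x = kscale A M (d + - d) x"
   unfolding ks_add[OF M x(1), of d "- d"] c ..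
  also have "\<dots> = \<zero>\<^bsub>M\<^esub>" by (simp add: ks_zero[OF M x(1)])
  finally show ?thesis
   using abelian_monoid.r_zero[OF abelian_group.axioms(1)[OF m_ab[OF M]] ks_closed[OF M x(1)]] by (simp add: algebra_simps)
 qed
 then have "1 + c - d = 1" using ks_eq_self[OF M x] ks_one[OF M x(1)] by simp
 then show ?thesis by simp
qed

text \<open>An endomorphism respects corners, so it scales each \<open>u a b\<close> by some
  \<open>c a b\<close>. Compatibility with paths makes \<open>c\<close> constant along the order, so
  its level sets are up-closed, and connectedness leaves a single value.\<close>

lemma brick_thin:
 assumes G: "thin G S u" and S: "conn S"
 shows "brick G"
proof -
 note Gl = thinD(1)[OF G] and Sf = thinD(2)[OF G] and t = thinD(3)[OF G]
 note GP = lf_obj[OF Gl PA_fdmod]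
 obtain a0 b0 where s0: "(a0, b0) \<in> S" using S unfolding conn_def by auto
 have nz: "nonzero G" unfolding nonzero_def using PA_fdmod tfamD(1)[OF t s0] thinD(4)[OF G s0] by blast
 have "\<exists>c. \<forall>M\<in>fdmod A. \<forall>x\<in>carrier (obj G M). \<eta> M x = kscale A (obj G M) c x" if n: "ntr G G \<eta>" for \<eta>
 proof -
  have "\<exists>c. \<eta> PA (u a b) = kscale A (obj G PA) c (u a b)" if ab: "(a, b) \<in> S" for a b
  proof -
   note aV = filtD(1)[OF Sf ab] and bV = filtD(2)[OF Sf ab] and uc = tfamD(1)[OF t ab]
   have "\<eta> PA (u a b) = \<eta> PA (E a a \<odot>\<^bsub>obj G PA\<^esub> rt G (u a b) (E b b))"
    using tfamD(3)[OF t ab Lam_refl[OF bV]] tfamD(2)[OF t ab Lam_refl[OF aV]] by simp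
   also have "\<dots> = E a a \<odot>\<^bsub>obj G PA\<^esub> rt G (\<eta> PA (u a b)) (E b b)"
    using ntr_smult[OF n PA_fdmod Ev_closed[OF aV] rt_closed[OF Gl uc Ev_closed[OF bV]]] ntr_rt[OF n uc Ev_closed[OF bV]] by simp
   finally show ?thesis using thin_corner[OF G ntr_closed[OF n PA_fdmod uc] aV bV] ab by auto
  qed
  then obtain c where c: "\<And>a b. (a, b) \<in> S \<Longrightarrow> \<eta> PA (u a b) = kscale A (obj G PA) (c a b) (u a b)" by metis
  have cl: "c a' b = c a b" if ab: "(a, b) \<in> S" and l: "(a', a) \<in> Lam" for a a' b
  proof -
   note ab' = filtD(3)[OF Sf ab l] and uc = tfamD(1)[OF t ab]
   have "\<eta> PA (u a' b) = E a' a \<odot>\<^bsub>obj G PA\<^esub> \<eta> PA (u a b)"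
    using ntr_smult[OF n PA_fdmod E_closed[OF l] uc] tfamD(2)[OF t ab l] by simp
   also have "\<dots> = kscale A (obj G PA) (c a b) (u a' b)"
    using c[OF ab] ks_comm[OF GP uc E_closed[OF l]] tfamD(2)[OF t ab l] by simp
   finally show ?thesis using c[OF ab'] ks_inj[OF GP tfamD(1)[OF t ab'] thinD(4)[OF G ab']] by simp
  qed
  have cr: "c a b' = c a b" if ab: "(a, b) \<in> S" and l: "(b, b') \<in> Lam" for a b b'
  proof -
   note ab' = filtD(4)[OF Sf ab l] and uc = tfamD(1)[OF t ab]
   have "\<eta> PA (u a b') = rt G (\<eta> PA (u a b)) (E b b')"
    using ntr_rt[OF n uc E_closed[OF l]] tfamD(3)[OF t ab l] by simp
   also have "\<dots> = kscale A (obj G PA) (c a b) (u a b')"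
    using c[OF ab] rt_smult[OF Gl uc E_closed[OF l] sc_closed] tfamD(3)[OF t ab l] by (simp add: kscale_def)
   finally show ?thesis using c[OF ab'] ks_inj[OF GP tfamD(1)[OF t ab'] thinD(4)[OF G ab']] by simp
  qed
  let ?Sa = "{(a, b) \<in> S. c a b = c a0 b0}" and ?Sb = "{(a, b) \<in> S. c a b \<noteq> c a0 b0}"
  have inv: "c a' b' = c a b" "(a', b') \<in> S" if "(a, b) \<in> S" "(a', a) \<in> Lam" "(b, b') \<in> Lam" for a b a' b'
   using cl[OF that(1,2)] cr[OF filtD(3)[OF Sf that(1,2)] that(3)] filtD(5)[OF Sf that] by simp_all
  have "filt ?Sa" "filt ?Sb"
   unfolding filt_def using inv filtD(1,2)[OF Sf] by auto
  moreover have "?Sa \<union> ?Sb = S" "?Sa \<inter> ?Sb = {}" by auto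
  ultimately have "?Sa = {} \<or> ?Sb = {}" using S unfolding conn_def by blast
  then have cc: "c a b = c a0 b0" if "(a, b) \<in> S" for a b using s0 that by blast
  have "\<eta> M x = kscale A (obj G M) (c a0 b0) x" if M: "fd M" and x: "el G M x" for M x
   by (rule thin_ntr_eq[OF G Gl n ntr_ks[OF Gl ntr_id] _ M x]) (simp add: c cc)
  then show ?thesis by blast
 qed
 then show ?thesis using Gl nz by (simp add: brick_def)
qed

text \<open>Both parts being up-closed means that no path leads from one to the other, so sending
  one part to zero respects the actions. Inclusions and projections then come from the universal
  properties.\<close>

lemma thin_decompose:
 assumes G: "thin G S u" and G1: "thin G1 Sa u1" and G2: "thin G2 Sb u2"
  and S: "Sa \<union> Sb = S" "Sa \<inter> Sb = {}"
 shows "thru {G1, G2} G G (\<lambda>M x. x)"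
proof -
 note Gl = thinD(1)[OF G] and Sf = thinD(2)[OF G] and t = thinD(3)[OF G]
 have zK: "E a b \<odot>\<^bsub>obj K PA\<^esub> \<zero>\<^bsub>obj K PA\<^esub> = \<zero>\<^bsub>obj K PA\<^esub>" "rt K \<zero>\<^bsub>obj K PA\<^esub> (E a b) = \<zero>\<^bsub>obj K PA\<^esub>"
  if K: "lin K" and ab: "(a, b) \<in> Lam" for K :: "('a, 'k) endo_k" and a b
 proof -
  note KP = lf_obj[OF K PA_fdmod]
  show "E a b \<odot>\<^bsub>obj K PA\<^esub> \<zero>\<^bsub>obj K PA\<^esub> = \<zero>\<^bsub>obj K PA\<^esub>" by (rule m_zero_right[OF KP E_closed[OF ab]])
  show "rt K \<zero>\<^bsub>obj K PA\<^esub> (E a b) = \<zero>\<^bsub>obj K PA\<^esub>"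
   using add_hom_zero[OF m_ab[OF KP] m_ab[OF KP], of "\<lambda>x. rt K x (E a b)"] rt_closed[OF K _ E_closed[OF ab]]
    rt_add_left[OF K _ _ E_closed[OF ab]] by (simp add: add_hom_def)
 qed
 have proj: "tfam K S (\<lambda>a b. if (a, b) \<in> S' then u' a b else \<zero>\<^bsub>obj K PA\<^esub>)"
  if K: "thin K S' u'" and d: "filt S''" "S' \<union> S'' = S" "S' \<inter> S'' = {}" for K S' S'' u'
  unfolding tfam_def
 proof (intro allI impI conjI)
  note Kl = thinD(1)[OF K] and S' = thinD(2)[OF K] and t' = thinD(3)[OF K]
  fix a b assume ab: "(a, b) \<in> S"
  show "(if (a, b) \<in> S' then u' a b else \<zero>\<^bsub>obj K PA\<^esub>) \<in> carrier (obj K PA)"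
   using tfamD(1)[OF t'] m_zero_closed[OF lf_obj[OF Kl PA_fdmod]] by simp
  show "E a' a \<odot>\<^bsub>obj K PA\<^esub> (if (a, b) \<in> S' then u' a b else \<zero>\<^bsub>obj K PA\<^esub>) = (if (a', b) \<in> S' then u' a' b else \<zero>\<^bsub>obj K PA\<^esub>)"
   if l: "(a', a) \<in> Lam" for a'
  proof (cases "(a, b) \<in> S'")
   case True
   then show ?thesis using filtD(3)[OF S' True l] tfamD(2)[OF t' True l] by simp
  next
   case False
   then have "(a, b) \<in> S''" using ab d(2) by blast
   then have "(a', b) \<notin> S'" using filtD(3)[OF d(1) _ l] d(3) by blast
   then show ?thesis using False zK(1)[OF Kl l] by simp
  qed
  show "rt K (if (a, b) \<in> S' then u' a b else \<zero>\<^bsub>obj K PA\<^esub>) (E b b') = (if (a, b') \<in> S' then u' a b' else \<zero>\<^bsub>obj K PA\<^esub>)"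
   if l: "(b, b') \<in> Lam" for b'
  proof (cases "(a, b) \<in> S'")
   case True
   then show ?thesis using filtD(4)[OF S' True l] tfamD(3)[OF t' True l] by simp
  next
   case False
   then have "(a, b) \<in> S''" using ab d(2) by blast
   then have "(a, b') \<notin> S'" using filtD(4)[OF d(1) _ l] d(3) by blast
   then show ?thesis using False zK(2)[OF Kl l] by simp
  qed
 qed
 have incl: "tfam G S' u" if "S' \<subseteq> S" for S' using t that by (auto simp: tfam_def)
 note G1l = thinD(1)[OF G1] and G2l = thinD(1)[OF G2]
 obtain p1 where p1: "ntr G G1 p1" "\<And>a b. (a, b) \<in> S \<Longrightarrow> p1 PA (u a b) = (if (a, b) \<in> Sa then u1 a b else \<zero>\<^bsub>obj G1 PA\<^esub>)"
  by (rule thin_univ[OF G G1l proj[OF G1 thinD(2)[OF G2] S]]) blast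
 obtain p2 where p2: "ntr G G2 p2" "\<And>a b. (a, b) \<in> S \<Longrightarrow> p2 PA (u a b) = (if (a, b) \<in> Sb then u2 a b else \<zero>\<^bsub>obj G2 PA\<^esub>)"
  by (rule thin_univ[OF G G2l proj[OF G2 thinD(2)[OF G1]]]) (use S in blast)+
 obtain i1 where i1: "ntr G1 G i1" "\<And>a b. (a, b) \<in> Sa \<Longrightarrow> i1 PA (u1 a b) = u a b"
  by (rule thin_univ[OF G1 Gl incl]) (use S in blast)+
 obtain i2 where i2: "ntr G2 G i2" "\<And>a b. (a, b) \<in> Sb \<Longrightarrow> i2 PA (u2 a b) = u a b"
  by (rule thin_univ[OF G2 Gl incl]) (use S in blast)+
 note c1 = ntr_comp[OF p1(1) i1(1)] and c2 = ntr_comp[OF p2(1) i2(1)]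
 have "thru {G1, G2} G G (\<lambda>M x. i1 M (p1 M x) \<oplus>\<^bsub>obj G M\<^esub> i2 M (p2 M x))"
  by (rule thru_plus[OF Gl Gl thru_single[OF Gl _ p1(1) i1(1)] thru_single[OF Gl _ p2(1) i2(1)]]) simp_all
 then show ?thesis
 proof (rule thru_cong)
  fix M :: "('a, 'k) mod_k" and x assume M: "fd M" and x: "el G M x"
  show "x = i1 M (p1 M x) \<oplus>\<^bsub>obj G M\<^esub> i2 M (p2 M x)"
  proof (rule thin_ntr_eq[OF G Gl ntr_id ntr_plus[OF Gl c1 c2] _ M x])
   fix a b assume ab: "(a, b) \<in> S"
   interpret I: abelian_group "obj G PA" by (rule m_ab[OF lf_obj[OF Gl PA_fdmod]])
   have z1: "i1 PA \<zero>\<^bsub>obj G1 PA\<^esub> = \<zero>\<^bsub>obj G PA\<^esub>"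
    by (rule lin_map_zero[OF lf_obj[OF G1l PA_fdmod] lf_obj[OF Gl PA_fdmod] ntr_lin[OF i1(1) PA_fdmod]])
   have z2: "i2 PA \<zero>\<^bsub>obj G2 PA\<^esub> = \<zero>\<^bsub>obj G PA\<^esub>"
    by (rule lin_map_zero[OF lf_obj[OF G2l PA_fdmod] lf_obj[OF Gl PA_fdmod] ntr_lin[OF i2(1) PA_fdmod]])
   have "(a, b) \<in> Sa \<and> (a, b) \<notin> Sb \<or> (a, b) \<in> Sb \<and> (a, b) \<notin> Sa" using ab S by blast
   then show "u a b = i1 PA (p1 PA (u a b)) \<oplus>\<^bsub>obj G PA\<^esub> i2 PA (p2 PA (u a b))"
    using p1(2)[OF ab] p2(2)[OF ab] i1(2)[of a b] i2(2)[of a b] z1 z2 tfamD(1)[OF t ab] by auto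
  qed
 qed
qed

end

context kalg
begin

text \<open>Yoneda for bimodules: \<open>h\<close> is a bimodule homomorphism into
  \<open>obj K PA\<close>, and the components send \<open>b \<otimes> m\<close> to
  \<open>act K M m (h b)\<close>.\<close>

lemma rep_ntr:
 fixes K :: "('a, 'k) endo_k"
 assumes r: "rep G B u" and B: "bimod B" and K: "lin K"
  and hc: "\<And>b. b \<in> carrier B \<Longrightarrow> h b \<in> carrier (obj K PA)"
  and ha: "\<And>b b'. b \<in> carrier B \<Longrightarrow> b' \<in> carrier B \<Longrightarrow> h (b \<oplus>\<^bsub>B\<^esub> b') = h b \<oplus>\<^bsub>obj K PA\<^esub> h b'"
  and hl: "\<And>a b. a \<in> carrier A \<Longrightarrow> b \<in> carrier B \<Longrightarrow> h (a \<odot>\<^bsub>B\<^esub> b) = a \<odot>\<^bsub>obj K PA\<^esub> h b"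
  and hr: "\<And>a b. a \<in> carrier A \<Longrightarrow> b \<in> carrier B \<Longrightarrow> h (rsmult B b a) = rt K (h b) a"
 obtains \<eta> where "ntr G K \<eta>" "\<And>b. b \<in> carrier B \<Longrightarrow> \<eta> PA (u b) = h b"
proof -
 note rd = repD[OF r]
 note G = rd(1)
 interpret B: left_module A B by (rule bimod_left[OF B])
 have "\<exists>g. add_hom (obj G M) (obj K M) g \<and> (\<forall>b\<in>carrier B. \<forall>m\<in>carrier M. g (act G M m (u b)) = act K M m (h b))"
  if M: "fd M" for M
 proof -
  have "balanced_map A B M (obj K M) (\<lambda>b m. act K M m (h b))"
   by (rule balanced_mapI)
    (simp_all add: act_closed[OF K M] hc ha hr act_add_right[OF K M] act_add_left[OF K M] act_smult_left[OF K M])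
  then obtain g where "add_hom (obj G M) (obj K M) g"
   "\<And>b m. b \<in> carrier B \<Longrightarrow> m \<in> carrier M \<Longrightarrow> g (act G M m (u b)) = act K M m (h b)"
   by (rule rep_lift[OF r M m_ab[OF lf_obj[OF K M]]]) blast
  then show ?thesis by (intro exI[of _ g]) simp
 qed
 then have "\<forall>M\<in>fdmod A. \<exists>g. add_hom (obj G M) (obj K M) g \<and>
   (\<forall>b\<in>carrier B. \<forall>m\<in>carrier M. g (act G M m (u b)) = act K M m (h b))" by (rule ballI)
 from bchoice[OF this] obtain g where g': "\<forall>M\<in>fdmod A. add_hom (obj G M) (obj K M) (g M) \<and>
   (\<forall>b\<in>carrier B. \<forall>m\<in>carrier M. g M (act G M m (u b)) = act K M m (h b))" by (elim exE)
 have g: "\<And>M. fd M \<Longrightarrow> add_hom (obj G M) (obj K M) (g M)"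
  "\<And>M b m. fd M \<Longrightarrow> b \<in> carrier B \<Longrightarrow> m \<in> carrier M \<Longrightarrow> g M (act G M m (u b)) = act K M m (h b)"
  using g' by simp_all
 let ?U = "\<lambda>M. {act G M m (u b) | m b. m \<in> carrier M \<and> b \<in> carrier B}"
 have "ntr G K g"
 proof (rule ntr_of_generators[OF G K g(1), of ?U])
  fix M :: "('a, 'k) mod_k" assume M: "fd M"
  show "x \<in> add_span (obj G M) (?U M)" if "el G M x" for x by (rule rd(6)[OF M that])
  show "el G M x" if "x \<in> ?U M" for x using that act_closed[OF G M] rd(2) by auto
  show "g M (a \<odot>\<^bsub>obj G M\<^esub> x) = a \<odot>\<^bsub>obj K M\<^esub> g M x" if a: "a \<in> carrier A" and x: "x \<in> ?U M" for a x
  proof -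
   obtain m b where x: "x = act G M m (u b)" "m \<in> carrier M" "b \<in> carrier B" using x by blast
   have "a \<odot>\<^bsub>obj G M\<^esub> x = act G M m (u (a \<odot>\<^bsub>B\<^esub> b))"
    unfolding x(1) rd(4)[OF x(3) a] by (rule act_smult[OF G M x(2) rd(2)[OF x(3)] a, symmetric])
   then show ?thesis
    using x g(2)[OF M B.lsmult_closed[OF a x(3)] x(2)] g(2)[OF M x(3,2)] hl[OF a x(3)] act_smult[OF K M x(2) hc[OF x(3)] a]
    by simp
  qed
  fix N :: "('a, 'k) mod_k" and f x assume N: "fd N" and f: "f \<in> mhom A M N" and x: "x \<in> ?U M"
  obtain m b where x: "x = act G M m (u b)" "m \<in> carrier M" "b \<in> carrier B" using x by blast
  have fm: "f m \<in> carrier N" by (rule lin_mapD(1)[OF mhom_lin[OF f] x(2)])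
  show "g N (mor G M N f x) = mor K M N f (g M x)"
   using act_mor[OF G M N f x(2) rd(2)[OF x(3)]] act_mor[OF K M N f x(2) hc[OF x(3)]] g(2)[OF M x(3,2)] g(2)[OF N x(3) fm]
   by (simp add: x(1))
 qed
 moreover have "g PA (u b) = h b" if "b \<in> carrier B" for b
  using g(2)[OF PA_fdmod that jA_closed[OF one_closed]] act_one[OF G PA_fdmod rd(2)[OF that]] act_one[OF K PA_fdmod hc[OF that]]
  by simp
 ultimately show thesis by (rule that)
qed

lemma ideal_bimod_simps:
 "carrier (ideal_bimod A I) = I" "\<zero>\<^bsub>ideal_bimod A I\<^esub> = \<zero>" "x \<oplus>\<^bsub>ideal_bimod A I\<^esub> y = x \<oplus> y"
 "a \<odot>\<^bsub>ideal_bimod A I\<^esub> x = a \<otimes> x" "rsmult (ideal_bimod A I) x b = x \<otimes> b"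
 by (simp_all add: ideal_bimod_def sub_bimod_simps)

end

section \<open>Ideals and up-closed sets\<close>

context inc_alg
begin

text \<open>\<open>SI\<close> and \<open>IS\<close> translate between ideals and up-closed subsets
  of \<open>Lam\<close> and are inverse to each other (\<open>SI_IS\<close>,
  \<open>IS_SI\<close>).\<close>

definition SI :: "'a set \<Rightarrow> ('v \<times> 'v) set" where
 "SI I = {(a, b) \<in> Lam. E a b \<in> I}"

definition IS :: "('v \<times> 'v) set \<Rightarrow> 'a set" where
 "IS S = add_span A {c \<odot> E a b | c a b. (a, b) \<in> S}"

lemma SI_sub: "SI I \<subseteq> Lam"
 by (auto simp: SI_def)

context
 fixes I
 assumes I: "ideal I A"
begin

interpretation I: ideal I A by (rule I)

lemma ideal_carrier: "x \<in> I \<Longrightarrow> x \<in> carrier A"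
 by (rule I.Icarr)

lemma ideal_ks: "x \<in> I \<Longrightarrow> c \<odot> x \<in> I"
 using I.I_l_closed[of x "sc c"] by (simp add: sc_closed sc_mult ideal_carrier)

lemma SI_filt: "filt (SI I)"
 unfolding filt_def SI_def
proof (intro conjI allI impI)
 show "{(a, b) \<in> Lam. E a b \<in> I} \<subseteq> V \<times> V" using Lam_V by auto
 fix a b a' b' assume ab: "(a, b) \<in> {(a, b) \<in> Lam. E a b \<in> I}" and l: "(a', a) \<in> Lam" "(b, b') \<in> Lam"
 have ab: "(a, b) \<in> Lam" "E a b \<in> I" using ab by auto
 have "E a' a \<otimes> E a b \<otimes> E b b' \<in> I"
  by (intro I.I_r_closed I.I_l_closed ab E_closed l)
 then show "(a', b') \<in> {(a, b) \<in> Lam. E a b \<in> I}"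
  using E_mult[OF l(1) ab(1)] E_mult[OF Lam_trans[OF l(1) ab(1)] l(2)] Lam_trans[OF Lam_trans[OF l(1) ab(1)] l(2)] by simp
qed

text \<open>Cutting out a corner and dividing by the coefficient stays inside the ideal; this is why
  ideals are generated by paths.\<close>

lemma ideal_corner:
 assumes x: "x \<in> I" and ab: "(a, b) \<in> Lam" and c: "cf x a b \<noteq> 0"
 shows "(a, b) \<in> SI I"
proof -
 have V: "a \<in> V" "b \<in> V" using Lam_V ab by auto
 have "E a a \<otimes> (x \<otimes> E b b) \<in> I" by (intro I.I_r_closed I.I_l_closed x Ev_closed V)
 then have "cf x a b \<odot> E a b \<in> I" using corner[OF ideal_carrier[OF x] V] ab by simp
 then have "inverse (cf x a b) \<odot> (cf x a b \<odot> E a b) \<in> I" by (rule ideal_ks)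
 then have "E a b \<in> I" using c E_closed[OF ab] by (simp add: ksmult_one flip: ksmult_assoc)
 then show ?thesis using ab by (simp add: SI_def)
qed

lemma ideal_span:
 assumes x: "x \<in> I"
 shows "x \<in> add_span A {c \<odot> E a b | c a b. (a, b) \<in> SI I}"
proof -
 let ?U = "{c \<odot> E a b | c a b. (a, b) \<in> SI I}"
 have U: "?U \<subseteq> carrier A" by (auto simp: SI_def E_closed ksmult_closed)
 note xc = ideal_carrier[OF x]
 have 1: "E a a \<otimes> x \<otimes> E b b \<in> add_span A ?U" if "a \<in> V" "b \<in> V" for a b
 proof -
  have e: "E a a \<otimes> x \<otimes> E b b = (if (a, b) \<in> Lam then cf x a b \<odot> E a b else \<zero>)"
   using corner[OF xc that] that xc by (simp add: m_assoc Ev_closed)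
  show ?thesis
  proof (cases "(a, b) \<in> Lam \<and> cf x a b \<noteq> 0")
   case True
   then have "cf x a b \<odot> E a b \<in> ?U" using ideal_corner[OF x] by blast
   then show ?thesis using True add_span_incl[OF _ U] by (simp add: e)
  next
   case False
   then show ?thesis unfolding e using add_span.zero[of A] by (auto simp: ksmult_zero E_closed)
  qed
 qed
 have "E a a \<otimes> x \<in> add_span A ?U" if a: "a \<in> V" for a
 proof -
  have "finsum A (\<lambda>b. E a a \<otimes> x \<otimes> E b b) V \<in> add_span A ?U"
   by (rule add_span_finsum[OF fin_V U 1[OF a]])
  then show ?thesis using unit_decomp_right[of "E a a \<otimes> x"] a xc by (simp add: Ev_closed)
 qed
 then have "finsum A (\<lambda>a. E a a \<otimes> x) V \<in> add_span A ?U" by (intro add_span_finsum[OF fin_V U])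
 then show ?thesis using unit_decomp_left[OF xc] by simp
qed

lemma ideal_bimod: "bimod (ideal_bimod A I)"
 unfolding bimod_def ideal_bimod_simps
proof (intro conjI ballI allI)
 have ab: "abelian_group (ideal_bimod A I)"
  unfolding ideal_bimod_def by (rule sub_bimod_abelian) (auto simp: I.Icarr I.a_inv_closed)
 show "left_module A (ideal_bimod A I)"
  using A_ring ab
  by (simp add: left_module_def left_module_axioms_def ideal_bimod_simps I.I_l_closed I.Icarr l_distr r_distr m_assoc)
 show "x \<otimes> r \<in> I" if "x \<in> I" "r \<in> carrier A" for x r by (rule I.I_r_closed[OF that])
 show "a \<otimes> x \<otimes> r = a \<otimes> (x \<otimes> r)" if "a \<in> carrier A" "x \<in> I" "r \<in> carrier A" for a x r
  by (rule m_assoc) (simp_all add: that I.Icarr)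
 show "x \<otimes> sc c = sc c \<otimes> x" if "x \<in> I" for x c by (rule sc_central[OF I.Icarr[OF that]])
 let ?S = "(\<lambda>(a, b). E a b) ` SI I"
 have "finite ?S" by (rule finite_imageI[OF finite_subset[OF SI_sub fin_Lam]])
 moreover have "?S \<subseteq> I" by (auto simp: SI_def)
 moreover have "I \<subseteq> add_span (ideal_bimod A I) {sc c \<otimes> s | c s. s \<in> ?S}"
 proof
  fix x assume "x \<in> I"
  from ideal_span[OF this] have "x \<in> add_span (ideal_bimod A I) {c \<odot> E a b | c a b. (a, b) \<in> SI I}"
   by (rule add_span_cong) (simp_all add: ideal_bimod_def sub_bimod_def)
  then show "x \<in> add_span (ideal_bimod A I) {sc c \<otimes> s | c s. s \<in> ?S}"
  proof (rule add_span_mono, intro subsetI)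
   fix y assume "y \<in> {c \<odot> E a b | c a b. (a, b) \<in> SI I}"
   then obtain c a b where y: "y = c \<odot> E a b" "(a, b) \<in> SI I" by blast
   have "(a, b) \<in> Lam" using y SI_sub by auto
   then have "y = sc c \<otimes> E a b" using y by (simp add: sc_mult E_closed)
   moreover have "E a b \<in> ?S" using y by force
   ultimately show "y \<in> {sc c \<otimes> s | c s. s \<in> ?S}" by blast
  qed
 qed
 ultimately show "\<exists>S. finite S \<and> S \<subseteq> I \<and> I \<subseteq> add_span (ideal_bimod A I) {sc c \<otimes> s | c s. s \<in> S}"
  by (intro exI[of _ ?S]) simp
qed

lemma thin_of_ideal:
 assumes G: "lin G" and iso: "nat_iso A G (Dp A I)"
 shows "\<exists>u. thin G (SI I) u"
proof -
 obtain w where w: "rep G (ideal_bimod A I) w"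
  using rep_exists[OF ideal_bimod G iso[unfolded Dp_def]] by (elim exE)
 note r = repD[OF w, unfolded ideal_bimod_simps]
 note GP = lf_obj[OF G PA_fdmod]
 define u where "u a b = w (E a b)" for a b
 have EI: "E a b \<in> I" "(a, b) \<in> Lam" if "(a, b) \<in> SI I" for a b using that by (auto simp: SI_def)
 have t: "tfam G (SI I) u"
  unfolding tfam_def u_def
 proof (intro allI impI conjI)
  fix a b assume ab: "(a, b) \<in> SI I"
  show "w (E a b) \<in> carrier (obj G PA)" by (rule r(2)[OF EI(1)[OF ab]])
  show "E a' a \<odot>\<^bsub>obj G PA\<^esub> w (E a b) = w (E a' b)" if "(a', a) \<in> Lam" for a'
   using r(4)[OF EI(1)[OF ab] E_closed[OF that]] E_mult[OF that EI(2)[OF ab]] by simp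
  show "rt G (w (E a b)) (E b b') = w (E a b')" if "(b, b') \<in> Lam" for b'
   using r(5)[OF EI(1)[OF ab] E_closed[OF that]] E_mult[OF EI(2)[OF ab] that] by simp
 qed
 have wks: "w (c \<odot> x) = kscale A (obj G PA) c (w x)" if "x \<in> I" for c x
  using r(4)[OF that sc_closed, of c] by (simp add: kscale_def sc_mult ideal_carrier[OF that])
 have "thin G (SI I) u"
  unfolding thin_def
 proof (intro conjI allI impI ballI)
  show "lin G" "filt (SI I)" "tfam G (SI I) u" by (rule G, rule SI_filt, rule t)
  fix a b assume ab: "(a, b) \<in> SI I"
  show "u a b \<noteq> \<zero>\<^bsub>obj G PA\<^esub>"
  proof
   assume z: "u a b = \<zero>\<^bsub>obj G PA\<^esub>"
   \<comment> \<open>Multiplication \<open>x \<otimes> n \<mapsto> x n\<close> into the regular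
     module takes \<open>u a b\<close> to the path itself and so detects that it is nonzero.\<close>
   have "balanced_map A (ideal_bimod A I) PA PA (\<lambda>x n. jA (x \<otimes> jinv n))"
    by (rule balanced_mapI, unfold ideal_bimod_simps)
     (simp_all add: ideal_carrier jinv_closed jA_closed l_distr r_distr jinv_add jinv_smult m_assoc flip: jA_add)
   then obtain h where h: "add_hom (obj G PA) PA h"
    "\<And>x n. x \<in> carrier (ideal_bimod A I) \<Longrightarrow> n \<in> carrier PA \<Longrightarrow> h (act G PA n (w x)) = jA (x \<otimes> jinv n)"
    by (rule rep_lift[OF w PA_fdmod m_ab[OF PA_fdmod]]) blast
   have "h (w (E a b)) = jA (E a b)"
    using h(2)[of "E a b" "jA \<one>"] act_one[OF G PA_fdmod r(2)[OF EI(1)[OF ab]]] EI[OF ab]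
    by (simp add: ideal_bimod_simps jA_closed jinv_jA E_closed)
   moreover have "h \<zero>\<^bsub>obj G PA\<^esub> = \<zero>\<^bsub>PA\<^esub>" by (rule add_hom_zero[OF m_ab[OF GP] m_ab[OF PA_fdmod] h(1)])
   ultimately have "jA (E a b) = jA \<zero>" using z by (simp add: u_def jA_zero)
   then have "E a b = \<zero>" using inj_onD[OF jA_inj] E_closed[OF EI(2)[OF ab]] by simp
   then show False using E_nonzero[OF EI(2)[OF ab]] by simp
  qed
 next
  fix M :: "('a, 'k) mod_k" assume M: "fd M"
  let ?U = "{act G M m (u a b) | m a b. m \<in> carrier M \<and> (a, b) \<in> SI I}"
  interpret GM: abelian_group "obj G M" by (rule m_ab[OF lf_obj[OF G M]])
  have Uc: "?U \<subseteq> carrier (obj G M)" using act_closed[OF G M] tfamD(1)[OF t] by auto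
  have 1: "act G M m (w x) \<in> add_span (obj G M) ?U" if m: "m \<in> carrier M" and x: "x \<in> I" for m x
  proof -
   have "x \<in> add_span (ideal_bimod A I) {c \<odot> E a b | c a b. (a, b) \<in> SI I}"
    by (rule add_span_cong[OF ideal_span[OF x]]) (simp_all add: ideal_bimod_def sub_bimod_def)
   moreover have "add_hom (ideal_bimod A I) (obj G M) (\<lambda>x. act G M m (w x))"
    by (rule add_homI) (simp_all add: ideal_bimod_simps act_closed[OF G M m] r(2,3) act_add_right[OF G M m])
   moreover have "{c \<odot> E a b | c a b. (a, b) \<in> SI I} \<subseteq> carrier (ideal_bimod A I)"
    using EI ideal_ks by (auto simp: ideal_bimod_simps)
   moreover have "act G M m (w x) \<in> ?U" if "x \<in> {c \<odot> E a b | c a b. (a, b) \<in> SI I}" for x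
   proof -
    obtain c a b where x: "x = c \<odot> E a b" "(a, b) \<in> SI I" using \<open>x \<in> {c \<odot> E a b | c a b. (a, b) \<in> SI I}\<close> by blast
    have "act G M m (w x) = act G M (kscale A M c m) (u a b)"
     using act_ks_left[OF G M m tfamD(1)[OF t x(2)], of c] act_smult[OF G M m tfamD(1)[OF t x(2)] sc_closed, of c]
     by (simp add: x(1) wks[OF EI(1)[OF x(2)]] u_def kscale_def)
    then show ?thesis using x(2) ks_closed[OF M m] by blast
   qed
   ultimately show ?thesis
    by (intro add_span_image[OF left_module.M_abelian[OF bimod_left[OF ideal_bimod]] m_ab[OF lf_obj[OF G M]], of "\<lambda>x. act G M m (w x)"])
  qed
  show "carrier (obj G M) \<subseteq> add_span (obj G M) ?U"
  proof
   fix x assume "el G M x"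
   from r(6)[OF M this] show "x \<in> add_span (obj G M) ?U"
   proof (induction rule: add_span.induct)
    case zero
    show ?case by (rule add_span.zero)
   next
    case (add x y)
    then have "x \<in> add_span (obj G M) ?U" using 1 by auto
    then show ?case by (rule GM.add_span_add[OF _ add(3) Uc])
   qed
  qed
 next
  fix K s assume K: "lin K" and s: "tfam K (SI I) s"
  note KP = lf_obj[OF K PA_fdmod]
  interpret KP: abelian_group "obj K PA" by (rule m_ab[OF KP])
  note fin = finite_subset[OF SI_sub[of I] fin_Lam]
  have sc': "s a b \<in> carrier (obj K PA)" if "(a, b) \<in> SI I" for a b by (rule tfamD(1)[OF s that])
  \<comment> \<open>The linear extension of the family \<open>s\<close>, made explicit by the
    coefficients \<open>cf\<close>. That it respects both actions is then checked on products of
    basis elements only.\<close>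
  define h where "h x = finsum (obj K PA) (\<lambda>(a, b). kscale A (obj K PA) (cf x a b) (s a b)) (SI I)" for x
  have hterm: "(\<lambda>(a, b). kscale A (obj K PA) (cf x a b) (s a b)) \<in> SI I \<rightarrow> carrier (obj K PA)" for x
   using ks_closed[OF KP] sc' by auto
  have hc: "h x \<in> carrier (obj K PA)" for x unfolding h_def by (rule KP.finsum_closed[OF hterm])
  have ha: "h (x \<oplus> y) = h x \<oplus>\<^bsub>obj K PA\<^esub> h y" if xy: "x \<in> carrier A" "y \<in> carrier A" for x y
  proof -
   have "h (x \<oplus> y) = finsum (obj K PA) (\<lambda>p. (\<lambda>(a, b). kscale A (obj K PA) (cf x a b) (s a b)) p \<oplus>\<^bsub>obj K PA\<^esub>
     (\<lambda>(a, b). kscale A (obj K PA) (cf y a b) (s a b)) p) (SI I)"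
    unfolding h_def by (rule KP.add.finprod_cong') (auto simp: cf_add[OF xy] ks_add[OF KP sc'] ks_closed[OF KP sc'])
   then show ?thesis unfolding h_def by (simp only: KP.finsum_addf[OF hterm hterm])
  qed
  have hE: "h (c \<odot> E a b) = kscale A (obj K PA) c (s a b)" if ab: "(a, b) \<in> SI I" for c a b
  proof -
   have "h (c \<odot> E a b) = finsum (obj K PA) (\<lambda>p. if (a, b) = p then kscale A (obj K PA) c (s a b) else \<zero>\<^bsub>obj K PA\<^esub>) (SI I)"
    unfolding h_def
    by (rule KP.add.finprod_cong')
     (auto simp: cf_ks E_closed[OF EI(2)[OF ab]] cf_E[OF EI(2)[OF ab]] ks_zero[OF KP sc'] ks_closed[OF KP sc'] ab)
   also have "\<dots> = kscale A (obj K PA) c (s a b)"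
    using KP.finsum_singleton[OF ab fin, of "\<lambda>_. kscale A (obj K PA) c (s a b)"] ks_closed[OF KP sc'[OF ab]] by simp
   finally show ?thesis .
  qed
  have hah: "add_hom A (obj K PA) h" by (rule add_homI) (simp_all add: hc ha)
  have hz: "h \<zero> = \<zero>\<^bsub>obj K PA\<^esub>" by (rule add_hom_zero[OF A_abelian m_ab[OF KP] hah])
  let ?U = "{c \<odot> E a b | c a b. (a, b) \<in> SI I}"
  have U: "?U \<subseteq> carrier A" using E_closed ksmult_closed EI by auto
  have hl: "h (y \<otimes> x) = y \<odot>\<^bsub>obj K PA\<^esub> h x" if y: "y \<in> carrier A" and x: "x \<in> I" for x y
  proof -
   have yB: "y \<in> add_span A Basis" using y A_span by blast
   note xs = ideal_span[OF x] and xc = ideal_carrier[OF x]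
   show ?thesis
   proof (rule add_hom_eq_on_span[OF A_abelian m_ab[OF KP] _ _ Basis_closed _ yB])
    show "add_hom A (obj K PA) (\<lambda>y. h (y \<otimes> x))" by (rule add_homI) (simp_all add: hc ha l_distr xc)
    show "add_hom A (obj K PA) (\<lambda>y. y \<odot>\<^bsub>obj K PA\<^esub> h x)"
     by (rule add_homI) (simp_all add: m_closed[OF KP] hc m_add_left[OF KP])
    fix y assume "y \<in> Basis"
    then obtain c p q where y: "y = c \<odot> E p q" "(p, q) \<in> Lam" by blast
    have yc: "y \<in> carrier A" using y Basis_closed by blast
    show "h (y \<otimes> x) = y \<odot>\<^bsub>obj K PA\<^esub> h x"
    proof (rule add_hom_eq_on_span[OF A_abelian m_ab[OF KP] _ _ U _ xs])
     show "add_hom A (obj K PA) (\<lambda>x. h (y \<otimes> x))" by (rule add_homI) (simp_all add: hc ha r_distr yc)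
     show "add_hom A (obj K PA) (\<lambda>x. y \<odot>\<^bsub>obj K PA\<^esub> h x)"
      by (rule add_hom_comp[OF hah left_module.add_hom_lsmult[OF fdmod_lmod[OF KP] yc]])
     fix x assume "x \<in> ?U"
     then obtain d a b where x: "x = d \<odot> E a b" "(a, b) \<in> SI I" by blast
     note ab = EI(2)[OF x(2)]
     have l: "y \<otimes> x = (c * d) \<odot> (E p q \<otimes> E a b)"
     proof -
      have Ec: "E p q \<otimes> E a b \<in> carrier A" using y ab by (simp add: E_closed)
      show ?thesis using y x ab ksmult_assoc[OF Ec, of c d] ksmult_assoc[OF Ec, of d c]
       by (simp add: ksmult_mult_left ksmult_mult_right E_closed ksmult_closed mult.commute)
     qed
     have r: "y \<odot>\<^bsub>obj K PA\<^esub> h x = kscale A (obj K PA) (c * d) (E p q \<odot>\<^bsub>obj K PA\<^esub> s a b)"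
      using y x hE[OF x(2)] m_kscale[OF KP E_closed[OF y(2)] ks_closed[OF KP sc'[OF x(2)]], of c d]
       ks_comm[OF KP sc'[OF x(2)] E_closed[OF y(2)]] ks_mult[OF KP m_closed[OF KP E_closed[OF y(2)] sc'[OF x(2)]]] by simp
     show "h (y \<otimes> x) = y \<odot>\<^bsub>obj K PA\<^esub> h x"
     proof (cases "q = a")
      case True
      then have "(p, b) \<in> SI I" using filtD(3)[OF SI_filt x(2)] y(2) by simp
      then show ?thesis unfolding l r using True E_mult[OF y(2), of b] ab hE tfamD(2)[OF s x(2), of p] y(2) by simp
     next
      case False
      then show ?thesis
       unfolding l r E_mult0[OF y(2) ab False] tfam_left0[OF K SI_filt s x(2) y(2) False]
       by (simp add: ksmult_zero_right hz kscale_def m_zero_right[OF KP sc_closed])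
     qed
    qed
   qed
  qed
  have hr: "h (x \<otimes> y) = rt K (h x) y" if y: "y \<in> carrier A" and x: "x \<in> I" for x y
  proof -
   have yB: "y \<in> add_span A Basis" using y A_span by blast
   note xs = ideal_span[OF x] and xc = ideal_carrier[OF x]
   show ?thesis
   proof (rule add_hom_eq_on_span[OF A_abelian m_ab[OF KP] _ _ Basis_closed _ yB])
    show "add_hom A (obj K PA) (\<lambda>y. h (x \<otimes> y))" by (rule add_homI) (simp_all add: hc ha r_distr xc)
    show "add_hom A (obj K PA) (\<lambda>y. rt K (h x) y)"
     by (rule add_homI) (simp_all add: rt_closed[OF K] hc rt_add[OF K])
    fix y assume "y \<in> Basis"
    then obtain c p q where y: "y = c \<odot> E p q" "(p, q) \<in> Lam" by blast
    have yc: "y \<in> carrier A" using y Basis_closed by blast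
    show "h (x \<otimes> y) = rt K (h x) y"
    proof (rule add_hom_eq_on_span[OF A_abelian m_ab[OF KP] _ _ U _ xs])
     show "add_hom A (obj K PA) (\<lambda>x. h (x \<otimes> y))" by (rule add_homI) (simp_all add: hc ha l_distr yc)
     show "add_hom A (obj K PA) (\<lambda>x. rt K (h x) y)"
      by (rule add_homI) (simp_all add: rt_closed[OF K] hc ha rt_add_left[OF K] yc)
     fix x assume "x \<in> ?U"
     then obtain d a b where x: "x = d \<odot> E a b" "(a, b) \<in> SI I" by blast
     note ab = EI(2)[OF x(2)] and sab = sc'[OF x(2)]
     have l: "x \<otimes> y = (d * c) \<odot> (E a b \<otimes> E p q)"
     proof -
      have Ec: "E a b \<otimes> E p q \<in> carrier A" using y ab by (simp add: E_closed)
      show ?thesis using y x ab ksmult_assoc[OF Ec, of c d] ksmult_assoc[OF Ec, of d c]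
       by (simp add: ksmult_mult_left ksmult_mult_right E_closed ksmult_closed mult.commute)
     qed
     have r: "rt K (h x) y = kscale A (obj K PA) (d * c) (rt K (s a b) (E p q))"
     proof -
      have "rt K (h x) y = rt K (sc d \<odot>\<^bsub>obj K PA\<^esub> s a b) (c \<odot> E p q)"
       by (simp add: x(1) hE[OF x(2)] y(1) kscale_def)
      also have "\<dots> = sc d \<odot>\<^bsub>obj K PA\<^esub> rt K (s a b) (c \<odot> E p q)"
       by (rule rt_smult[OF K sab ksmult_closed[OF E_closed[OF y(2)]] sc_closed])
      also have "rt K (s a b) (c \<odot> E p q) = kscale A (obj K PA) c (rt K (s a b) (E p q))"
       by (rule rt_ks[OF K sab E_closed[OF y(2)]])
      finally show ?thesis
       using ks_mult[OF KP rt_closed[OF K sab E_closed[OF y(2)]], of d c] by (simp add: kscale_def)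
     qed
     show "h (x \<otimes> y) = rt K (h x) y"
     proof (cases "b = p")
      case True
      then have "(a, q) \<in> SI I" using filtD(4)[OF SI_filt x(2)] y(2) by simp
      then show ?thesis unfolding l r using True E_mult[OF ab, of q] hE tfamD(3)[OF s x(2), of q] y(2) by simp
     next
      case False
      then show ?thesis
       unfolding l r E_mult0[OF ab y(2) False] tfam_right0[OF K SI_filt s x(2) y(2) False[symmetric]]
       by (simp add: ksmult_zero_right hz kscale_def m_zero_right[OF KP sc_closed])
     qed
    qed
   qed
  qed
  obtain \<eta> where "ntr G K \<eta>" "\<And>b. b \<in> carrier (ideal_bimod A I) \<Longrightarrow> \<eta> PA (w b) = h b"
   by (rule rep_ntr[OF w ideal_bimod K, of h]) (simp_all add: ideal_bimod_simps hc ha hl hr ideal_carrier)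
  then show "\<exists>\<eta>. ntr G K \<eta> \<and> (\<forall>a b. (a, b) \<in> SI I \<longrightarrow> \<eta> PA (u a b) = s a b)"
   using hE[of _ _ 1] EI
   by (intro exI[of _ \<eta>]) (simp add: ideal_bimod_simps u_def ksmult_one E_closed ks_one[OF KP sc'])
 qed
 then show ?thesis by (rule exI[of "thin G (SI I)"])
qed

end

end

lemma add_span_span:
 assumes M: "abelian_group M" and x: "x \<in> add_span M U" and U: "U \<subseteq> add_span M Y" and Y: "Y \<subseteq> carrier M"
 shows "x \<in> add_span M Y"
 using x
proof (induction rule: add_span.induct)
 case zero
 show ?case by (rule add_span.zero)
next
 case (add x y)
 interpret M: abelian_group M by (rule M)
 show ?case by (rule M.add_span_add[OF _ add(3) Y]) (use add(1) U in blast)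
qed

context inc_alg
begin

lemma IS_gens: "S \<subseteq> Lam \<Longrightarrow> {c \<odot> E a b | c a b. (a, b) \<in> S} \<subseteq> carrier A"
 using E_closed ksmult_closed by auto

lemma IS_closed: "S \<subseteq> Lam \<Longrightarrow> x \<in> IS S \<Longrightarrow> x \<in> carrier A"
 unfolding IS_def by (rule add_span_closed[OF _ IS_gens])

lemma IS_add: "S \<subseteq> Lam \<Longrightarrow> x \<in> IS S \<Longrightarrow> y \<in> IS S \<Longrightarrow> x \<oplus> y \<in> IS S"
 unfolding IS_def by (rule add_span_add[OF _ _ IS_gens])

lemma IS_E:
 assumes S: "S \<subseteq> Lam" and ab: "(a, b) \<in> S"
 shows "E a b \<in> IS S"
proof -
 have "(a, b) \<in> Lam" using S ab by blast
 then have "E a b = 1 \<odot> E a b" by (simp add: ksmult_one E_closed)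
 then have "E a b \<in> {c \<odot> E a b | c a b. (a, b) \<in> S}" using ab by blast
 then show ?thesis unfolding IS_def by (rule add_span_incl[OF _ IS_gens[OF S]])
qed

lemma IS_cf:
 assumes S: "S \<subseteq> Lam" and x: "x \<in> IS S" and c: "cf x a b \<noteq> 0"
 shows "(a, b) \<in> S"
 using x c unfolding IS_def
proof (induction rule: add_span.induct)
 case zero
 then show ?case by (simp add: cf_zero)
next
 case (add x y)
 obtain d p q where x: "x = d \<odot> E p q" "(p, q) \<in> S" using add by blast
 have pq: "(p, q) \<in> Lam" using x S by blast
 have "cf (x \<oplus> y) a b = d * (if p = a \<and> q = b then 1 else 0) + cf y a b"
  using cf_add[of x y a b] add_span_closed[OF add(2) IS_gens[OF S]] by (simp add: x(1) cf_ks cf_E pq E_closed ksmult_closed)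
 then show ?case using add x by (auto split: if_splits)
qed

lemma ks_minus: "x \<in> carrier A \<Longrightarrow> \<ominus> (c \<odot> x) = (- c) \<odot> x"
 using ksmult_l_distr[of x "- c" c] by (intro minus_equality) (simp_all add: ksmult_closed ksmult_zero)

lemma IS_image:
 assumes S: "S \<subseteq> Lam" and g: "add_hom A A g" and x: "x \<in> IS S"
  and u: "\<And>c a b. (a, b) \<in> S \<Longrightarrow> g (c \<odot> E a b) \<in> IS S"
 shows "g x \<in> IS S"
proof -
 have "g x \<in> add_span A (IS S)"
  by (rule add_span_image[OF A_abelian A_abelian g IS_gens[OF S] x[unfolded IS_def]]) (use u in auto)
 then show ?thesis unfolding IS_def by (rule add_span_span[OF A_abelian _ _ IS_gens[OF S]]) simp
qed

lemma Basis_induct [consumes 1, case_names zero add]: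
 assumes "y \<in> carrier A" and "P \<zero>"
  and "\<And>c p q y. (p, q) \<in> Lam \<Longrightarrow> y \<in> carrier A \<Longrightarrow> P y \<Longrightarrow> P (c \<odot> E p q \<oplus> y)"
 shows "P y"
proof -
 have "y \<in> add_span A Basis" using assms(1) A_span by blast
 then show ?thesis
  by (induction rule: add_span.induct) (use assms add_span_closed[OF _ Basis_closed] in auto)
qed

lemma IS_ideal:
 assumes S: "filt S" "S \<subseteq> Lam"
 shows "ideal (IS S) A"
proof (rule idealI[OF A_ring])
 have gen: "c \<odot> E a b \<in> IS S" if "(a, b) \<in> S" for c a b
  unfolding IS_def by (rule add_span_incl[OF _ IS_gens[OF S(2)]]) (use that in blast)
 have z: "\<zero> \<in> IS S" unfolding IS_def by (rule add_span.zero)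
 note cl = IS_closed[OF S(2)]
 show "subgroup (IS S) (add_monoid A)"
 proof (rule subgroup.intro)
  show "IS S \<subseteq> carrier (add_monoid A)" using cl by auto
  show "x \<otimes>\<^bsub>add_monoid A\<^esub> y \<in> IS S" if "x \<in> IS S" "y \<in> IS S" for x y using IS_add[OF S(2) that] by simp
  show "\<one>\<^bsub>add_monoid A\<^esub> \<in> IS S" using z by simp
  have "\<ominus> x \<in> IS S" if x: "x \<in> IS S" for x
  proof (rule IS_image[OF S(2) _ x])
   show "add_hom A A (\<lambda>x. \<ominus> x)" by (rule add_homI) (simp_all add: minus_add)
   show "\<ominus> (c \<odot> E a b) \<in> IS S" if "(a, b) \<in> S" for c a b
    using gen[OF that] ks_minus[OF E_closed] that S(2) by auto
  qed
  then show "inv\<^bsub>add_monoid A\<^esub> x \<in> IS S" if "x \<in> IS S" for x using that by (simp add: a_inv_def)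
 qed
 have prod: "(c \<odot> E p q) \<otimes> (d \<odot> E a b) \<in> IS S"
  if l: "(p, q) \<in> Lam" "(a, b) \<in> Lam" and m: "q = a \<Longrightarrow> (p, b) \<in> S" for c d p q a b
 proof -
  have "(c \<odot> E p q) \<otimes> (d \<odot> E a b) = d \<odot> (c \<odot> (E p q \<otimes> E a b))"
   using l by (simp add: ksmult_mult_left ksmult_mult_right E_closed ksmult_closed)
  also have "\<dots> \<in> IS S"
  proof (cases "q = a")
   case True
   have "(p, b) \<in> Lam" using m[OF True] S(2) by blast
   then show ?thesis
    using gen[OF m[OF True], of "d * c"] l by (simp add: True E_mult ksmult_assoc E_closed)
  next
   case False
   then show ?thesis using E_mult0[OF l False] z by (simp add: ksmult_zero_right)
  qed
  finally show ?thesis .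
 qed
 fix x y assume x: "x \<in> IS S" and y: "y \<in> carrier A"
 show "y \<otimes> x \<in> IS S"
  using y
 proof (induction rule: Basis_induct)
  case zero
  show ?case using z cl[OF x] by simp
 next
  case (add c p q y)
  note Ec = ksmult_closed[OF E_closed[OF add(1)], of c]
  have "(c \<odot> E p q) \<otimes> x \<in> IS S"
  proof (rule IS_image[OF S(2) _ x])
   show "add_hom A A (\<lambda>x. (c \<odot> E p q) \<otimes> x)" by (rule add_homI) (simp_all add: Ec r_distr)
   fix d a b assume ab: "(a, b) \<in> S"
   have "(a, b) \<in> Lam" using ab S(2) by blast
   then show "(c \<odot> E p q) \<otimes> (d \<odot> E a b) \<in> IS S"
    by (rule prod[OF add(1)]) (use filtD(3)[OF S(1) ab] add(1) in simp)
  qed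
  then show ?case using IS_add[OF S(2) _ add(3)] add(2) Ec cl[OF x] by (simp add: l_distr)
 qed
 show "x \<otimes> y \<in> IS S"
  using y
 proof (induction rule: Basis_induct)
  case zero
  show ?case using z cl[OF x] by simp
 next
  case (add c p q y)
  note Ec = ksmult_closed[OF E_closed[OF add(1)], of c]
  have "x \<otimes> (c \<odot> E p q) \<in> IS S"
  proof (rule IS_image[OF S(2) _ x])
   show "add_hom A A (\<lambda>x. x \<otimes> (c \<odot> E p q))" by (rule add_homI) (simp_all add: Ec l_distr)
   fix d a b assume ab: "(a, b) \<in> S"
   have "(a, b) \<in> Lam" using ab S(2) by blast
   then show "(d \<odot> E a b) \<otimes> (c \<odot> E p q) \<in> IS S"
    by (rule prod[OF _ add(1)]) (use filtD(4)[OF S(1) ab] add(1) in simp)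
  qed
  then show ?case using IS_add[OF S(2) _ add(3)] add(2) Ec cl[OF x] by (simp add: r_distr)
 qed
qed

lemma SI_IS:
 assumes S: "filt S" "S \<subseteq> Lam"
 shows "SI (IS S) = S"
proof (intro equalityI subrelI)
 fix a b assume "(a, b) \<in> SI (IS S)"
 then have ab: "(a, b) \<in> Lam" "E a b \<in> IS S" by (simp_all add: SI_def)
 show "(a, b) \<in> S" by (rule IS_cf[OF S(2) ab(2)]) (simp add: cf_E ab)
next
 fix a b assume "(a, b) \<in> S"
 then show "(a, b) \<in> SI (IS S)" using IS_E[OF S(2)] S(2) by (simp add: SI_def subset_iff)
qed

lemma ideal_zero_iff:
 assumes I: "ideal I A"
 shows "I = {\<zero>} \<longleftrightarrow> SI I = {}"
proof
 assume "SI I = {}"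
 then have "x = \<zero>" if "x \<in> I" for x
  using ideal_span[OF I that] by (auto elim: add_span.cases)
 then show "I = {\<zero>}" using additive_subgroup.zero_closed[OF ideal.axioms(1)[OF I]] by blast
qed (auto simp: SI_def E_nonzero)

lemma subbimodule_ideal:
 assumes I: "ideal I A" and N: "subbimodule A (ideal_bimod A I) N"
 shows "ideal N A" and "N \<subseteq> I"
proof -
 interpret N: additive_subgroup N "ideal_bimod A I" using N by (simp add: subbimodule_def)
 interpret I: ideal I A by (rule I)
 interpret B: abelian_group "ideal_bimod A I" by (rule left_module.M_abelian[OF bimod_left[OF ideal_bimod[OF I]]])
 show NI: "N \<subseteq> I" using N.a_subset by (simp add: ideal_bimod_simps)
 \<comment> \<open>Inverses in the record \<open>ideal_bimod A I\<close> are a different term from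
   inverses in \<open>A\<close>; the product with the scalar \<open>-1\<close> lies in
   \<open>N\<close> and equals the latter.\<close>
 have minus: "\<ominus> x \<in> N" if "x \<in> N" for x
 proof -
  have "sc (- 1) \<otimes> x \<in> N" using N that by (simp add: subbimodule_def ideal_bimod_simps sc_closed)
  then show ?thesis using that NI I.a_subset ks_minus[of x 1] by (auto simp: sc_mult ksmult_one subset_iff)
 qed
 show "ideal N A"
 proof (rule idealI[OF A_ring])
  show "subgroup N (add_monoid A)"
   by (rule subgroup.intro)
    (use N.a_closed N.zero_closed NI I.a_subset minus in \<open>auto simp: ideal_bimod_simps a_inv_def[symmetric]\<close>)
 qed (use N in \<open>simp_all add: subbimodule_def ideal_bimod_simps\<close>)
qed

lemma ideal_subbimodule:
 assumes I: "ideal I A" and N: "ideal N A" "N \<subseteq> I"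
 shows "subbimodule A (ideal_bimod A I) N"
proof -
 interpret N: ideal N A by (rule N)
 interpret B: abelian_group "ideal_bimod A I" by (rule left_module.M_abelian[OF bimod_left[OF ideal_bimod[OF I]]])
 have B: "\<ominus>\<^bsub>ideal_bimod A I\<^esub> x \<in> N" if "x \<in> N" for x
 proof -
  have "\<ominus>\<^bsub>ideal_bimod A I\<^esub> x = \<ominus> x"
   by (rule B.minus_equality) (use that N in \<open>auto simp: ideal_bimod_simps l_neg N.Icarr\<close>)
  then show ?thesis using that by simp
 qed
 have "subgroup N (add_monoid (ideal_bimod A I))"
  by (rule subgroup.intro) (use B[unfolded a_inv_def] N in \<open>simp_all add: ideal_bimod_simps\<close>)
 then show ?thesis
  by (simp add: subbimodule_def additive_subgroup_def ideal_bimod_simps N.I_l_closed N.I_r_closed)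
qed

text \<open>Splittings of \<open>I\<close> into two subbimodules match splittings of
  \<open>SI I\<close> into two disjoint up-closed sets. If a path is a sum \<open>x + y\<close> from
  the two parts, one of \<open>x\<close> and \<open>y\<close> has a nonzero coefficient there, so
  the path already lies in that part.\<close>

lemma indecomposable_ideal_iff: "indecomposable_ideal A I \<longleftrightarrow> ideal I A \<and> conn (SI I)"
proof -
 have sum: "N1 <+>\<^bsub>ideal_bimod A I\<^esub> N2 = {x \<oplus> y | x y. x \<in> N1 \<and> y \<in> N2}" for I N1 N2
  by (auto simp: set_add_def set_mult_def ideal_bimod_simps)
 have "conn (SI I)" if I: "ideal I A" and ind: "indecomposable_bimodule A (ideal_bimod A I)"
 proof -
  note d = ind[unfolded indecomposable_bimodule_def ideal_bimod_simps sum]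
  have "Sa = {} \<or> Sb = {}" if f: "filt Sa" "filt Sb" and S: "Sa \<union> Sb = SI I" "Sa \<inter> Sb = {}" for Sa Sb
  proof -
   have L: "Sa \<subseteq> Lam" "Sb \<subseteq> Lam" using S SI_sub by blast+
   note id = IS_ideal[OF f(1) L(1)] IS_ideal[OF f(2) L(2)]
   interpret I: ideal I A by (rule I)
   have sub: "IS T \<subseteq> I" if "T \<subseteq> SI I" for T
   proof
    fix x assume "x \<in> IS T"
    then show "x \<in> I"
     unfolding IS_def by (induction rule: add_span.induct) (use that in \<open>auto simp: SI_def intro!: ideal_ks[OF I]\<close>)
   qed
   have "{x \<oplus> y | x y. x \<in> IS Sa \<and> y \<in> IS Sb} = I"
   proof (intro equalityI subsetI)
    fix z assume "z \<in> I"
    from ideal_span[OF I this] show "z \<in> {x \<oplus> y | x y. x \<in> IS Sa \<and> y \<in> IS Sb}"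
    proof (induction rule: add_span.induct)
     case zero
     then show ?case using add_span.zero[of A] by (force simp: IS_def)
    next
     case (add z z')
     obtain x y where xy: "z' = x \<oplus> y" "x \<in> IS Sa" "y \<in> IS Sb" using add(3) by blast
     obtain c a b where z: "z = c \<odot> E a b" "(a, b) \<in> SI I" using add(1) by blast
     note c = IS_closed[OF L(1) xy(2)] IS_closed[OF L(2) xy(3)]
     have zc: "z \<in> carrier A" using z by (auto simp: SI_def E_closed ksmult_closed)
     show ?case
     proof (cases "(a, b) \<in> Sa")
      case True
      then have "z \<oplus> x \<in> IS Sa"
       using IS_add[OF L(1) ideal_ks[OF id(1) IS_E[OF L(1)]] xy(2)] z(1) by simp
      moreover have "z \<oplus> z' = (z \<oplus> x) \<oplus> y" using zc c xy(1) by (simp add: a_assoc)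
      ultimately show ?thesis using xy(3) by blast
     next
      case False
      then have "(a, b) \<in> Sb" using z(2) S(1) by blast
      then have "z \<oplus> y \<in> IS Sb"
       using IS_add[OF L(2) ideal_ks[OF id(2) IS_E[OF L(2)]] xy(3)] z(1) by simp
      moreover have "z \<oplus> z' = x \<oplus> (z \<oplus> y)" using zc c xy(1) by (simp add: a_lcomm)
      ultimately show ?thesis using xy(2) by blast
     qed
    qed
   qed (use sub[of Sa] sub[of Sb] S I.a_closed in auto)
   moreover have "IS Sa \<inter> IS Sb = {\<zero>}"
   proof -
    have "SI (IS Sa \<inter> IS Sb) = {}" using SI_IS[OF f(1) L(1)] SI_IS[OF f(2) L(2)] S(2) by (auto simp: SI_def)
    then show ?thesis using ideal_zero_iff[OF i_intersect[OF id]] by simp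
   qed
   moreover have "subbimodule A (ideal_bimod A I) (IS Sa)" "subbimodule A (ideal_bimod A I) (IS Sb)"
    using ideal_subbimodule[OF I id(1)] ideal_subbimodule[OF I id(2)] sub S(1) by auto
   ultimately have "IS Sa = {\<zero>} \<or> IS Sb = {\<zero>}" using d by blast
   then show ?thesis using ideal_zero_iff[OF id(1)] ideal_zero_iff[OF id(2)] SI_IS[OF f(1) L(1)] SI_IS[OF f(2) L(2)] by auto
  qed
  then show ?thesis using SI_filt[OF I] ideal_zero_iff[OF I] d unfolding conn_def by blast
 qed
 moreover have "indecomposable_bimodule A (ideal_bimod A I)" if I: "ideal I A" and c: "conn (SI I)"
  unfolding indecomposable_bimodule_def ideal_bimod_simps sum
 proof (intro conjI allI impI)
  show "I \<noteq> {\<zero>}" using c ideal_zero_iff[OF I] unfolding conn_def by blast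
  fix N1 N2 assume "subbimodule A (ideal_bimod A I) N1 \<and> subbimodule A (ideal_bimod A I) N2 \<and>
   {x \<oplus> y | x y. x \<in> N1 \<and> y \<in> N2} = I \<and> N1 \<inter> N2 = {\<zero>}"
  then have N: "subbimodule A (ideal_bimod A I) N1" "subbimodule A (ideal_bimod A I) N2"
   and s: "{x \<oplus> y | x y. x \<in> N1 \<and> y \<in> N2} = I" and i: "N1 \<inter> N2 = {\<zero>}" by auto
  note id = subbimodule_ideal[OF I N(1)] subbimodule_ideal[OF I N(2)]
  have "SI N1 \<union> SI N2 = SI I"
  proof (intro equalityI subsetI)
   fix p assume "p \<in> SI I"
   then obtain a b where p: "p = (a, b)" "(a, b) \<in> Lam" "E a b \<in> I" by (auto simp: SI_def)
   obtain x y where xy: "E a b = x \<oplus> y" "x \<in> N1" "y \<in> N2" using p(3) s by blast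
   have "cf x a b + cf y a b = 1"
    using cf_E[OF p(2), of a b] cf_add[of x y a b] xy ideal_carrier[OF id(1)] ideal_carrier[OF id(3)] by simp
   then have "cf x a b \<noteq> 0 \<or> cf y a b \<noteq> 0" by auto
   then show "p \<in> SI N1 \<union> SI N2"
    using ideal_corner[OF id(1) xy(2) p(2)] ideal_corner[OF id(3) xy(3) p(2)] p(1) by blast
  qed (use id(2,4) in \<open>auto simp: SI_def\<close>)
  moreover have "SI N1 \<inter> SI N2 = {}" using i E_nonzero by (auto simp: SI_def)
  ultimately have "SI N1 = {} \<or> SI N2 = {}" using c SI_filt[OF id(1)] SI_filt[OF id(3)] unfolding conn_def by blast
  then show "N1 = {\<zero>} \<or> N2 = {\<zero>}" using ideal_zero_iff[OF id(1)] ideal_zero_iff[OF id(3)] by blast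
 qed
 ultimately show ?thesis unfolding indecomposable_ideal_def by blast
qed

lemma thin_exists:
 assumes S: "filt S" "S \<subseteq> Lam"
 shows "\<exists>G u. thin G S u \<and> nat_iso A G (Dp A (IS S))"
proof -
 note I = IS_ideal[OF S]
 obtain G :: "('a, 'k) endo_k" where G: "lin G" "nat_iso A G (Dp A (IS S))"
  using functor_transport[OF tensor_functor_lin[OF ideal_bimod[OF I]]] unfolding Dp_def by (elim exE conjE)
 then show ?thesis using thin_of_ideal[OF I G] SI_IS[OF S] by auto
qed

lemma thin_iso:
 assumes H: "thin H S u" and F: "lin F" and iso: "nat_iso A F H"
 shows "\<exists>u. thin F S u"
proof -
 obtain \<eta> \<theta> where e: "ntr F H \<eta>" "ntr H F \<theta>" "\<And>M x. fd M \<Longrightarrow> el F M x \<Longrightarrow> \<theta> M (\<eta> M x) = x"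
  "\<And>M x. fd M \<Longrightarrow> el H M x \<Longrightarrow> \<eta> M (\<theta> M x) = x" by (rule nat_isoD[OF iso]) blast
 note Hl = thinD(1)[OF H] and t = thinD(3)[OF H]
 let ?u = "\<lambda>a b. \<theta> PA (u a b)"
 have inv: "\<eta> PA (?u a b) = u a b" if "(a, b) \<in> S" for a b by (rule e(4)[OF PA_fdmod tfamD(1)[OF t that]])
 have push: "tfam K S (\<lambda>a b. \<phi> PA (u a b))" if n: "ntr H K \<phi>" for K \<phi>
  unfolding tfam_def
 proof (intro allI impI conjI)
  fix a b assume ab: "(a, b) \<in> S"
  note uc = tfamD(1)[OF t ab]
  show "\<phi> PA (u a b) \<in> carrier (obj K PA)" by (rule ntr_closed[OF n PA_fdmod uc])
  show "E a' a \<odot>\<^bsub>obj K PA\<^esub> \<phi> PA (u a b) = \<phi> PA (u a' b)" if "(a', a) \<in> Lam" for a'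
   using ntr_smult[OF n PA_fdmod E_closed[OF that] uc] tfamD(2)[OF t ab that] by simp
  show "rt K (\<phi> PA (u a b)) (E b b') = \<phi> PA (u a b')" if "(b, b') \<in> Lam" for b'
   using ntr_rt[OF n uc E_closed[OF that]] tfamD(3)[OF t ab that] by simp
 qed
 have "thin F S ?u"
  unfolding thin_def
 proof (intro conjI allI impI ballI)
  show "lin F" "filt S" "tfam F S ?u" by (rule F, rule thinD(2)[OF H], rule push[OF e(2)])
  show "?u a b \<noteq> \<zero>\<^bsub>obj F PA\<^esub>" if "(a, b) \<in> S" for a b
   using inv[OF that] thinD(4)[OF H that]
    lin_map_zero[OF lf_obj[OF F PA_fdmod] lf_obj[OF Hl PA_fdmod] ntr_lin[OF e(1) PA_fdmod]] by auto
 next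
  fix M :: "('a, 'k) mod_k" assume M: "fd M"
  show "carrier (obj F M) \<subseteq> add_span (obj F M) {act F M m (?u a b) | m a b. m \<in> carrier M \<and> (a, b) \<in> S}"
  proof
   fix x assume x: "el F M x"
   have "\<theta> M (\<eta> M x) \<in> add_span (obj F M) {act F M m (?u a b) | m a b. m \<in> carrier M \<and> (a, b) \<in> S}"
    by (rule add_span_image[OF m_ab[OF lf_obj[OF Hl M]] m_ab[OF lf_obj[OF F M]] lin_mapD(4)[OF ntr_lin[OF e(2) M]]
       thin_gen_closed[OF H M] thinD(5)[OF H M ntr_closed[OF e(1) M x]]])
     (use ntr_act[OF e(2) M _ tfamD(1)[OF t]] in blast)
   then show "x \<in> add_span (obj F M) {act F M m (?u a b) | m a b. m \<in> carrier M \<and> (a, b) \<in> S}" using e(3)[OF M x] by simp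
  qed
 next
  fix K s assume K: "lin K" and s: "tfam K S s"
  obtain \<zeta> where z: "ntr H K \<zeta>" "\<And>a b. (a, b) \<in> S \<Longrightarrow> \<zeta> PA (u a b) = s a b" by (rule thin_univ[OF H K s]) blast
  then show "\<exists>\<zeta>. ntr F K \<zeta> \<and> (\<forall>a b. (a, b) \<in> S \<longrightarrow> \<zeta> PA (?u a b) = s a b)"
   using ntr_comp[OF e(1) z(1)] inv by (intro exI[of _ "\<lambda>M x. \<zeta> M (\<eta> M x)"]) simp
 qed
 then show ?thesis by (rule exI[of "thin F S"])
qed

end

context kalg
begin

lemma rt_zero_left: "lin K \<Longrightarrow> a \<in> carrier A \<Longrightarrow> rt K \<zero>\<^bsub>obj K PA\<^esub> a = \<zero>\<^bsub>obj K PA\<^esub>"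
 for K :: "('a, 'k) endo_k"
 using add_hom_zero[OF m_ab[OF lf_obj[OF _ PA_fdmod]] m_ab[OF lf_obj[OF _ PA_fdmod]], of K K "\<lambda>x. rt K x a"]
  rt_closed[of K] rt_add_left[of K] by (simp add: add_hom_def)

lemma act_zero_left:
 fixes K :: "('a, 'k) endo_k"
 assumes K: "lin K" and M: "fd M" and u: "el K PA u"
 shows "act K M \<zero>\<^bsub>M\<^esub> u = \<zero>\<^bsub>obj K M\<^esub>"
 using act_ks_left[OF K M m_zero_closed[OF M] u, of 0] ks_zero[OF M m_zero_closed[OF M]]
  ks_zero[OF lf_obj[OF K M] act_closed[OF K M m_zero_closed[OF M] u]] by simp

lemma add_hom_act: "lin G \<Longrightarrow> fd M \<Longrightarrow> el G PA u \<Longrightarrow> add_hom M (obj G M) (\<lambda>m. act G M m u)"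
 for G :: "('a, 'k) endo_k"
 by (rule add_homI) (simp_all add: act_closed act_add_left)

lemma comp_obj: "obj (H \<circ>\<^sub>F F) M = obj H (obj F M)"
 by (simp add: functor_comp_def)

text \<open>Associativity \<open>(u \<otimes> m) \<otimes> n = u \<otimes> (m \<otimes> n)\<close>
  on elements; it lets composites be computed without a product of bimodules.\<close>

lemma act_comp:
 fixes G H :: "('a, 'k) endo_k"
 assumes G: "lin G" and H: "lin H" and N: "fd N" and n: "n \<in> carrier N"
  and m: "el H PA m" and u: "el G PA u"
 shows "act (G \<circ>\<^sub>F H) N n (act G (obj H PA) m u) = act G (obj H N) (act H N n m) u"
 using act_mor[OF G lf_obj[OF H PA_fdmod] lf_obj[OF H N] lf_mor[OF H PA_fdmod N rmap_mhom[OF N n]] m u]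
 by (simp add: act_def functor_comp_def)

lemma repF_ntr_eq:
 fixes K :: "('a, 'k) endo_k"
 assumes G: "repF G e f w" and K: "lin K" and n: "ntr G K \<eta>" "ntr G K \<theta>" and eq: "\<eta> PA w = \<theta> PA w"
  and M: "fd M" and x: "el G M x"
 shows "\<eta> M x = \<theta> M x"
proof (rule repF_hom_eq[OF G m_ab[OF lf_obj[OF K M]] M lin_mapD(4)[OF ntr_lin[OF n(1) M]] lin_mapD(4)[OF ntr_lin[OF n(2) M]] _ x])
 note Gl = repFD(1)[OF G] and wc = repFD(2)[OF G]
 fix a m assume a: "a \<in> carrier A" and m: "m \<in> carrier M"
 show "\<eta> M (a \<odot>\<^bsub>obj G M\<^esub> act G M m w) = \<theta> M (a \<odot>\<^bsub>obj G M\<^esub> act G M m w)"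
  using ntr_smult[OF n(1) M a act_closed[OF Gl M m wc]] ntr_smult[OF n(2) M a act_closed[OF Gl M m wc]]
   ntr_act[OF n(1) M m wc] ntr_act[OF n(2) M m wc] eq by simp
qed

end

section \<open>The functors \<open>F\<^sub>i\<^sub>j\<close> as thin functors\<close>

context inc_alg
begin

text \<open>On \<open>A e\<^sub>i \<otimes> e\<^sub>j N\<close> this is the coefficient of
  \<open>E a i\<close> in the first factor, tensored with the identity. It tells elements of
  \<open>obj G N\<close> apart; nonvanishing (\<open>repF_nonzero\<close>) and the products in
  \<open>F_comp\<close> rest on it.\<close>

lemma repF_coordinate:
 assumes G: "repF G (E i i) (E j j) w" and ij: "i \<in> V" "j \<in> V" and N: "fd N" and a: "a \<in> V"
 obtains h where "add_hom (obj G N) N h"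
  "\<And>y n. y \<in> carrier A \<Longrightarrow> n \<in> carrier N \<Longrightarrow>
   h (y \<odot>\<^bsub>obj G N\<^esub> act G N n w) = kscale A N (cf (y \<otimes> E i i) a i) (E j j \<odot>\<^bsub>N\<^esub> n)"
proof -
 have "kbal N N (\<lambda>y n. kscale A N (cf y a i) n)"
  unfolding kbal_def
  by (simp add: ks_closed[OF N] cf_add ks_add[OF N] ks_add_right[OF N] cf_ks ks_mult[OF N] flip: ks_mult[OF N])
   (simp add: mult.commute)
 then show thesis by (rule repF_lift[OF G N m_ab[OF N]]) (rule that)
qed

lemma repF_nonzero:
 assumes G: "repF G (E i i) (E j j) w" and ij: "i \<in> V" "j \<in> V" and N: "fd N" and n: "n \<in> carrier N"
  and a: "(a, i) \<in> Lam" and z: "E a i \<odot>\<^bsub>obj G N\<^esub> act G N n w = \<zero>\<^bsub>obj G N\<^esub>"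
 shows "E j j \<odot>\<^bsub>N\<^esub> n = \<zero>\<^bsub>N\<^esub>"
proof -
 have aV: "a \<in> V" using Lam_V[OF a] by simp
 obtain h where h: "add_hom (obj G N) N h"
  "\<And>y n. y \<in> carrier A \<Longrightarrow> n \<in> carrier N \<Longrightarrow>
   h (y \<odot>\<^bsub>obj G N\<^esub> act G N n w) = kscale A N (cf (y \<otimes> E i i) a i) (E j j \<odot>\<^bsub>N\<^esub> n)"
  by (rule repF_coordinate[OF G ij N aV]) blast
 have "h (E a i \<odot>\<^bsub>obj G N\<^esub> act G N n w) = E j j \<odot>\<^bsub>N\<^esub> n"
  using h(2)[OF E_closed[OF a] n] a ij m_closed[OF N Ev_closed[OF ij(2)] n]
  by (simp add: E_mult[OF a Lam_refl] cf_E ks_one[OF N])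
 then show ?thesis using add_hom_zero[OF m_ab[OF lf_obj[OF repFD(1)[OF G] N]] m_ab[OF N] h(1)] by (simp add: z)
qed

text \<open>\<open>A e\<^sub>i\<close> has the basis of paths \<open>E a i\<close>, and
  \<open>e\<^sub>j A\<close> that of paths \<open>E j b\<close>.\<close>

lemma thin_up:
 assumes G: "repF G (E i i) (E j j) w" and ij: "i \<in> V" "j \<in> V"
 shows "thin G (up i j) (\<lambda>a b. E a i \<odot>\<^bsub>obj G PA\<^esub> rt G w (E j b))"
proof -
 note Gl = repFD(1)[OF G] and wc = repFD(2)[OF G]
 note GP = lf_obj[OF Gl PA_fdmod]
 let ?u = "\<lambda>a b. E a i \<odot>\<^bsub>obj G PA\<^esub> rt G w (E j b)"
 have up: "(a, i) \<in> Lam" "(j, b) \<in> Lam" if "(a, b) \<in> up i j" for a b using that by (auto simp: up_def)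
 have rc: "rt G w (E j b) \<in> carrier (obj G PA)" if "(j, b) \<in> Lam" for b by (rule rt_closed[OF Gl wc E_closed[OF that]])
 have t: "tfam G (up i j) ?u"
  unfolding tfam_def
 proof (intro allI impI conjI)
  fix a b assume "(a, b) \<in> up i j"
  note l = up[OF this]
  show "?u a b \<in> carrier (obj G PA)" by (rule m_closed[OF GP E_closed[OF l(1)] rc[OF l(2)]])
  show "E a' a \<odot>\<^bsub>obj G PA\<^esub> ?u a b = ?u a' b" if "(a', a) \<in> Lam" for a'
   using m_mult[OF GP E_closed[OF that] E_closed[OF l(1)] rc[OF l(2)]] E_mult[OF that l(1)] by simp
  show "rt G (?u a b) (E b b') = ?u a b'" if "(b, b') \<in> Lam" for b'
   using rt_smult[OF Gl rc[OF l(2)] E_closed[OF that] E_closed[OF l(1)]] rt_mult[OF Gl wc E_closed[OF l(2)] E_closed[OF that]]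
    E_mult[OF l(2) that] by simp
 qed
 have u_ij: "act G M m (?u a j) = E a i \<odot>\<^bsub>obj G M\<^esub> act G M m w"
  if "fd M" "m \<in> carrier M" "(a, i) \<in> Lam" for M m a
  using act_smult[OF Gl that(1,2) wc E_closed[OF that(3)]] repFD(4)[OF G] by simp
 show ?thesis
  unfolding thin_def
 proof (intro conjI allI impI ballI)
  show "lin G" "filt (up i j)" "tfam G (up i j) ?u" by (rule Gl, rule up_filt, rule t)
  fix a b assume "(a, b) \<in> up i j"
  note l = up[OF this]
  show "?u a b \<noteq> \<zero>\<^bsub>obj G PA\<^esub>"
  proof
   assume "?u a b = \<zero>\<^bsub>obj G PA\<^esub>"
   then have "E j j \<odot>\<^bsub>PA\<^esub> jA (E j b) = \<zero>\<^bsub>PA\<^esub>"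
    using repF_nonzero[OF G ij PA_fdmod jA_closed[OF E_closed[OF l(2)]] l(1)] by (simp add: rt_def)
   then have "jA (E j b) = jA \<zero>"
    using jA_smult[OF E_closed[OF l(2)], of "E j j"] E_mult[OF Lam_refl[OF ij(2)] l(2)] by (simp add: jA_zero)
   then have "E j b = \<zero>" using inj_onD[OF jA_inj] E_closed[OF l(2)] by simp
   then show False using E_nonzero[OF l(2)] by simp
  qed
 next
  fix M :: "('a, 'k) mod_k" assume M: "fd M"
  note GM = lf_obj[OF Gl M]
  let ?U = "{act G M m (?u a b) | m a b. m \<in> carrier M \<and> (a, b) \<in> up i j}"
  have U: "?U \<subseteq> carrier (obj G M)" using act_closed[OF Gl M] tfamD(1)[OF t] by blast
  interpret GM: abelian_group "obj G M" by (rule m_ab[OF GM])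
  have 1: "y \<odot>\<^bsub>obj G M\<^esub> act G M m w \<in> add_span (obj G M) ?U" if y: "y \<in> carrier A" and m: "m \<in> carrier M" for y m
   using y
  proof (induction rule: Basis_induct)
   case zero
   show ?case using m_zero_left[OF GM act_closed[OF Gl M m wc]] add_span.zero[of "obj G M"] by simp
  next
   case (add c p q y)
   note ac = act_closed[OF Gl M m wc]
   have "(c \<odot> E p q) \<odot>\<^bsub>obj G M\<^esub> act G M m w \<in> add_span (obj G M) ?U"
   proof (cases "q = i")
    case True
    have pi: "(p, i) \<in> Lam" using add(1) True by simp
    have "(c \<odot> E p q) \<odot>\<^bsub>obj G M\<^esub> act G M m w = act G M (kscale A M c m) (?u p j)"
     using m_kscale[OF GM E_closed[OF pi] ac] u_ij[OF M ks_closed[OF M m] pi, of c] act_ks_left[OF Gl M m wc, of c]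
      ks_comm[OF GM ac E_closed[OF pi], of c] True by simp
    moreover have "(p, j) \<in> up i j" using pi Lam_refl[OF ij(2)] by (simp add: up_def)
    ultimately have "(c \<odot> E p q) \<odot>\<^bsub>obj G M\<^esub> act G M m w \<in> ?U" using ks_closed[OF M m] by blast
    then show ?thesis by (rule GM.add_span_incl[OF _ U])
   next
    case False
    have "act G M m w = E i i \<odot>\<^bsub>obj G M\<^esub> act G M m w"
     using act_smult[OF Gl M m wc Ev_closed[OF ij(1)]] repFD(3)[OF G] by simp
    then have "E p q \<odot>\<^bsub>obj G M\<^esub> act G M m w = (E p q \<otimes> E i i) \<odot>\<^bsub>obj G M\<^esub> act G M m w"
     using m_mult[OF GM E_closed[OF add(1)] Ev_closed[OF ij(1)] ac] by simp
    then have "E p q \<odot>\<^bsub>obj G M\<^esub> act G M m w = \<zero>\<^bsub>obj G M\<^esub>"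
     using E_mult0[OF add(1) Lam_refl[OF ij(1)] False] m_zero_left[OF GM ac] by simp
    then have "(c \<odot> E p q) \<odot>\<^bsub>obj G M\<^esub> act G M m w = \<zero>\<^bsub>obj G M\<^esub>"
     using m_kscale[OF GM E_closed[OF add(1)] ac] m_zero_right[OF GM sc_closed] by (simp add: kscale_def)
    then show ?thesis using add_span.zero[of "obj G M"] by simp
   qed
   then show ?case
    using GM.add_span_add[OF _ add(3) U] m_add_left[OF GM ksmult_closed[OF E_closed[OF add(1)]] add(2) ac] by simp
  qed
  show "carrier (obj G M) \<subseteq> add_span (obj G M) ?U"
  proof
   fix x assume "el G M x"
   from repFD(5)[OF G M this] show "x \<in> add_span (obj G M) ?U"
    by (rule add_span_span[OF m_ab[OF GM] _ _ U]) (use 1 in blast)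
  qed
 next
  fix K s assume K: "lin K" and s: "tfam K (up i j) s"
  note self = up_self[OF ij]
  obtain \<eta> where n: "ntr G K \<eta>" "\<eta> PA w = s i j"
   by (rule repF_ntr[OF G Ev_closed[OF ij(1)] Ev_closed[OF ij(2)] K tfamD(1)[OF s self]])
    (simp_all add: tfamD(2,3)[OF s self] Lam_refl ij)
  have "\<eta> PA (?u a b) = s a b" if ab: "(a, b) \<in> up i j" for a b
  proof -
   note l = up[OF ab]
   have ib: "(i, b) \<in> up i j" using l Lam_refl[OF ij(1)] by (simp add: up_def)
   show ?thesis
    using ntr_smult[OF n(1) PA_fdmod E_closed[OF l(1)] rc[OF l(2)]] ntr_rt[OF n(1) wc E_closed[OF l(2)]]
     n(2) tfamD(3)[OF s self l(2)] tfamD(2)[OF s ib l(1)] by simp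
  qed
  then show "\<exists>\<eta>. ntr G K \<eta> \<and> (\<forall>a b. (a, b) \<in> up i j \<longrightarrow> \<eta> PA (?u a b) = s a b)" using n(1) by blast
 qed
qed

lemma E_idem: "i \<in> V \<Longrightarrow> E i i \<otimes> E i i = E i i"
 by (rule E_mult) (simp_all add: Lam_refl)

lemma F_exists:
 assumes ij: "i \<in> V" "j \<in> V"
 shows "\<exists>G w. repF G (E i i) (E j j) w \<and> nat_iso A G (tensor_functor A (OB (E i i) (E j j)))"
proof -
 note e = Ev_closed[OF ij(1)] E_idem[OF ij(1)] Ev_closed[OF ij(2)] E_idem[OF ij(2)]
 obtain G :: "('a, 'k) endo_k" where G: "lin G" "nat_iso A G (tensor_functor A (OB (E i i) (E j j)))"
  using functor_transport[OF tensor_functor_lin[OF outer_bimod[OF e]]] by (elim exE conjE)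
 then show ?thesis using repF_exists[OF e G] by blast
qed

text \<open>The candidates for indecomposable \<open>1\<close>-morphisms. By
  \<open>indecomposable_TC\<close> and \<open>TC_indecomposable\<close> they are exactly the
  indecomposable ones.\<close>

definition TC :: "('a, 'k) endo_k set" where
 "TC = {H. \<exists>S u. thin H S u \<and> (conn S \<and> S \<subseteq> Lam \<or> (\<exists>i\<in>V. \<exists>j\<in>V. S = up i j))}"

lemma TC_lin: "TC \<subseteq> lin_functors A"
 unfolding TC_def using thinD(1) by blast

text \<open>Vertex idempotents on both sides split \<open>A \<otimes> A\<close>: the universal
  element \<open>w\<close> is the sum of its components \<open>?x i j\<close>, and endomorphisms
  that agree on \<open>w\<close> are equal. The maps belonging to one pair \<open>i\<close>,
  \<open>j\<close> also give the retraction.\<close>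

lemma full_thru:
 assumes G: "repF G \<one> \<one> w"
 shows "thru TC G G (\<lambda>M x. x)"
  and "i \<in> V \<Longrightarrow> j \<in> V \<Longrightarrow> repF H (E i i) (E j j) v \<Longrightarrow> retr H G"
proof -
 note Gl = repFD(1)[OF G] and wc = repFD(2)[OF G]
 note GP = lf_obj[OF Gl PA_fdmod]
 interpret GP: abelian_group "obj G PA" by (rule m_ab[OF GP])
 let ?x = "\<lambda>i j. E i i \<odot>\<^bsub>obj G PA\<^esub> rt G w (E j j)"
 have rc: "rt G w (E j j) \<in> carrier (obj G PA)" if "j \<in> V" for j by (rule rt_closed[OF Gl wc Ev_closed[OF that]])
 have xc: "?x i j \<in> carrier (obj G PA)" if "i \<in> V" "j \<in> V" for i j by (rule m_closed[OF GP Ev_closed[OF that(1)] rc[OF that(2)]])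
 have maps: "\<exists>\<alpha> \<beta>. ntr G H \<alpha> \<and> ntr H G \<beta> \<and> \<alpha> PA w = v \<and> \<beta> PA v = ?x i j"
  if ij: "i \<in> V" "j \<in> V" and H: "repF H (E i i) (E j j) v" for H v i j
 proof -
  note e = Ev_closed[OF ij(1)] Ev_closed[OF ij(2)]
  have xi: "E i i \<odot>\<^bsub>obj G PA\<^esub> ?x i j = ?x i j" "rt G (?x i j) (E j j) = ?x i j"
   using m_mult[OF GP e(1) e(1) rc[OF ij(2)]] rt_smult[OF Gl rc[OF ij(2)] e(2) e(1)] rt_mult[OF Gl wc e(2) e(2)]
    E_idem[OF ij(1)] E_idem[OF ij(2)] by simp_all
  note vc = repFD(2)[OF H] and HP = lf_obj[OF repFD(1)[OF H] PA_fdmod]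
  obtain \<beta> where b: "ntr H G \<beta>" "\<beta> PA v = ?x i j" by (rule repF_ntr[OF H e Gl xc[OF ij] xi])
  obtain \<alpha> where a: "ntr G H \<alpha>" "\<alpha> PA w = v"
   by (rule repF_ntr[OF G one_closed one_closed repFD(1)[OF H] vc m_one[OF HP vc] rt_one[OF repFD(1)[OF H] vc]])
  show ?thesis using a b by blast
 qed
 show "retr H G" if ij: "i \<in> V" "j \<in> V" and H: "repF H (E i i) (E j j) v" for H v i j
 proof -
  note vc = repFD(2)[OF H] and Hl = repFD(1)[OF H]
  obtain \<alpha> \<beta> where m: "ntr G H \<alpha>" "ntr H G \<beta>" "\<alpha> PA w = v" "\<beta> PA v = ?x i j" using maps[OF ij H] by blast
  have "\<alpha> PA (\<beta> PA v) = v"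
   using m ntr_smult[OF m(1) PA_fdmod Ev_closed[OF ij(1)] rc[OF ij(2)]] ntr_rt[OF m(1) wc Ev_closed[OF ij(2)]]
    repFD(3,4)[OF H] by simp
  then show "retr H G"
   by (intro retrI[OF m(2,1)]) (rule repF_ntr_eq[OF H Hl ntr_comp[OF m(2,1)] ntr_id])
 qed
 have "\<exists>\<theta>. thru TC G G \<theta> \<and> \<theta> PA w = ?x i j" if ij: "i \<in> V" "j \<in> V" for i j
 proof -
  obtain H v where H: "repF H (E i i) (E j j) v" using F_exists[OF ij] by blast
  have "H \<in> TC" unfolding TC_def using thin_up[OF H ij] ij by blast
  moreover obtain \<alpha> \<beta> where "ntr G H \<alpha>" "ntr H G \<beta>" "\<alpha> PA w = v" "\<beta> PA v = ?x i j" using maps[OF ij H] by blast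
  ultimately show ?thesis using thru_single[OF Gl, of H TC G \<alpha> \<beta>] by (intro exI[of _ "\<lambda>M x. \<beta> M (\<alpha> M x)"]) simp
 qed
 then obtain \<theta> where t: "\<And>i j. i \<in> V \<Longrightarrow> j \<in> V \<Longrightarrow> thru TC G G (\<theta> i j)" "\<And>i j. i \<in> V \<Longrightarrow> j \<in> V \<Longrightarrow> \<theta> i j PA w = ?x i j"
  by metis
 let ?t = "\<lambda>M x. finsum (obj G M) (\<lambda>i. finsum (obj G M) (\<lambda>j. \<theta> i j M x) V) V"
 have tt: "thru TC G G ?t" by (intro thru_sum[OF Gl Gl fin_V] t(1))
 show "thru TC G G (\<lambda>M x. x)"
 proof (rule thru_cong[OF tt])
  have "?t PA w = finsum (obj G PA) (\<lambda>i. E i i \<odot>\<^bsub>obj G PA\<^esub> w) V"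
  proof (rule GP.add.finprod_cong')
   show "finsum (obj G PA) (\<lambda>j. \<theta> i j PA w) V = E i i \<odot>\<^bsub>obj G PA\<^esub> w" if i: "i \<in> V" for i
   proof -
    have "finsum (obj G PA) (\<lambda>j. \<theta> i j PA w) V = finsum (obj G PA) (?x i) V"
     by (rule GP.add.finprod_cong') (use t(2)[OF i] xc[OF i] in auto)
    also have "\<dots> = E i i \<odot>\<^bsub>obj G PA\<^esub> finsum (obj G PA) (\<lambda>j. rt G w (E j j)) V"
     by (rule add_hom_finsum[OF m_ab[OF GP] m_ab[OF GP] left_module.add_hom_lsmult[OF fdmod_lmod[OF GP] Ev_closed[OF i]] fin_V, symmetric])
      (use rc in auto)
    finally show ?thesis using rt_unit_decomp[OF Gl wc] by simp
   qed
  qed (use m_closed[OF GP Ev_closed wc] in auto)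
  then have e: "?t PA w = w" using m_unit_decomp[OF GP wc] by simp
  fix M :: "('a, 'k) mod_k" and x assume "fd M" "el G M x"
  then show "x = ?t M x" by (rule repF_ntr_eq[OF G Gl ntr_id thru_ntr[OF tt Gl Gl] e[symmetric]])
 qed
qed

text \<open>Induction on the size of \<open>S\<close>: a disconnected set splits into two smaller
  up-closed ones, and the empty set gives the zero functor.\<close>

lemma thin_thru:
 assumes "thin G S u" "S \<subseteq> Lam"
 shows "thru TC G G (\<lambda>M x. x)"
 using assms
proof (induction "card S" arbitrary: G S u rule: less_induct)
 case less
 note Gl = thinD(1)[OF less(2)] and Sf = thinD(2)[OF less(2)]
 have fin: "finite S" by (rule finite_subset[OF less(3) fin_Lam])
 show ?case
 proof (cases "conn S")
  case True
  then have "G \<in> TC" unfolding TC_def using less by blast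
  then show ?thesis by (rule thru_single[OF Gl _ ntr_id ntr_id])
 next
  case False
  show ?thesis
  proof (cases "S = {}")
   case True
   show ?thesis
   proof (rule thru.zero)
    fix M :: "('a, 'k) mod_k" and x assume "fd M" "el G M x"
    from thinD(5)[OF less(2) this] show "x = \<zero>\<^bsub>obj G M\<^esub>" using True by (auto elim: add_span.cases)
   qed
  next
   case False
   then obtain Sa Sb where S: "filt Sa" "filt Sb" "Sa \<union> Sb = S" "Sa \<inter> Sb = {}" "Sa \<noteq> {}" "Sb \<noteq> {}"
    using \<open>\<not> conn S\<close> Sf unfolding conn_def by blast
   have L: "Sa \<subseteq> Lam" "Sb \<subseteq> Lam" using S(3) less(3) by blast+
   have "Sa \<subset> S" "Sb \<subset> S" using S(3-6) by blast+
   then have c: "card Sa < card S" "card Sb < card S" using psubset_card_mono[OF fin] by blast+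
   obtain G1 u1 G2 u2 where H: "thin G1 Sa u1" "thin G2 Sb u2" using thin_exists[OF S(1) L(1)] thin_exists[OF S(2) L(2)] by blast
   show ?thesis
   proof (rule thru_trans[OF Gl Gl _ thin_decompose[OF less(2) H S(3,4)]])
    show "{G1, G2} \<subseteq> lin_functors A" using thinD(1)[OF H(1)] thinD(1)[OF H(2)] by simp
    show "thru TC K K (\<lambda>M x. x)" if "K \<in> {G1, G2}" for K
     using that less(1)[OF c(1) H(1) L(1)] less(1)[OF c(2) H(2) L(2)] by auto
   qed
  qed
 qed
qed

lemma OB_one: "OB \<one> \<one> = outer_bimod A (carrier A) (carrier A)"
proof -
 have "SA \<one> = carrier A" "TA \<one> = carrier A" unfolding SA_def TA_def by force+
 then show ?thesis by simp
qed

lemma gens_thru: "G \<in> gens \<Longrightarrow> thru TC G G (\<lambda>M x. x)"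
proof -
 assume "G \<in> gens"
 then consider "lin G" "nat_iso A G (tensor_functor A (OB \<one> \<one>))"
  | I where "lin G" "ideal I A" "nat_iso A G (Dp A I)" unfolding gens_def OB_one by blast
 then show ?thesis
 proof cases
  case 1
  obtain w where "repF G \<one> \<one> w" using repF_exists[OF one_closed _ one_closed _ 1] by auto
  then show ?thesis by (rule full_thru(1))
 next
  case (2 I)
  obtain u where "thin G (SI I) u" using thin_of_ideal[OF 2(2,1,3)] by blast
  then show ?thesis by (rule thin_thru[OF _ SI_sub])
 qed
qed

lemma D_thru_TC: "F \<in> D' A \<Longrightarrow> thru TC F F (\<lambda>M x. x)"
 by (rule thru_trans[OF D_lin D_lin gens_lin D_thru gens_thru])

text \<open>A principal up-set need not lie inside \<open>Lam\<close> and then comes from no ideal;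
  its functor enters \<open>D' A\<close> as a retract of the full functor
  \<open>A \<otimes> A\<close>.\<close>

lemma TC_D: "G \<in> TC \<Longrightarrow> G \<in> D' A"
proof -
 assume "G \<in> TC"
 then obtain S u where G: "thin G S u" and S: "S \<subseteq> Lam \<or> (\<exists>i\<in>V. \<exists>j\<in>V. S = up i j)" unfolding TC_def by blast
 note Gl = thinD(1)[OF G]
 show "G \<in> D' A"
 proof (cases "S \<subseteq> Lam")
  case True
  obtain H v where H: "thin H S v" "nat_iso A H (Dp A (IS S))" using thin_exists[OF thinD(2)[OF G] True] by blast
  have "H \<in> gens" unfolding gens_def using H(2) thinD(1)[OF H(1)] IS_ideal[OF thinD(2)[OF G] True] by blast
  then show ?thesis by (rule D_retr[OF Gl gens_D nat_iso_retr[OF thin_unique[OF G H(1)]]])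
 next
  case False
  then obtain i j where ij: "i \<in> V" "j \<in> V" "S = up i j" using S by blast
  obtain H v where H: "repF H (E i i) (E j j) v" using F_exists[OF ij(1,2)] by blast
  obtain K :: "('a, 'k) endo_k" where K: "lin K" "nat_iso A K (tensor_functor A (OB \<one> \<one>))"
   using functor_transport[OF tensor_functor_lin[OF outer_bimod[of "\<one>" "\<one>"]]] by auto
  then obtain w where w: "repF K \<one> \<one> w" using repF_exists[OF one_closed _ one_closed _ K] by auto
  have "K \<in> gens" unfolding gens_def using K OB_one by simp
  moreover have "retr G K"
   by (rule retr_trans[OF nat_iso_retr[OF thin_unique[OF G]] full_thru(2)[OF w ij(1,2) H]]) (use thin_up[OF H ij(1,2)] ij(3) in simp)
  ultimately show ?thesis by (intro D_retr[OF Gl gens_D])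
 qed
qed

lemma TC_brick: "G \<in> TC \<Longrightarrow> brick G"
 unfolding TC_def using brick_thin up_conn by blast

lemma indecomposable_TC:
 assumes F: "indecomposable_in A (D' A) F"
 shows "F \<in> TC"
proof -
 note tr = indecomposable_trivial[OF F]
 have FD: "F \<in> D' A" using F by (simp add: indecomposable_in_def)
 note Fl = D_lin[OF FD]
 obtain H where H: "H \<in> TC" "retr F H"
  using thru_bricks[OF tr TC_brick D_thru_TC[OF FD] ntr_id] by blast
 then obtain S u where t: "thin H S u" and S: "conn S \<and> S \<subseteq> Lam \<or> (\<exists>i\<in>V. \<exists>j\<in>V. S = up i j)" unfolding TC_def by blast
 then have "conn S" using up_conn by blast
 then have "nat_iso A F H" using retr_brick[OF Fl _ brick_thin[OF t] H(2)] tr by (simp add: idempotents_trivial_def)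
 then show ?thesis using thin_iso[OF t Fl] S unfolding TC_def by blast
qed

lemma TC_indecomposable:
 assumes "F \<in> TC"
 shows "indecomposable_in A (D' A) F"
 by (rule brick_indecomposable[OF TC_D[OF assms] TC_brick[OF assms]])

text \<open>The identity of \<open>G\<close> becomes a sum of maps through composites of
  \<open>K\<close> with members of \<open>TC\<close>. If \<open>G\<close> were a retract of none of
  these, \<open>thru_brick\<close> would make that identity zero.\<close>

lemma reduce_left:
 fixes K :: "('a, 'k) endo_k"
 assumes G: "G \<in> TC" and H: "H \<in> D' A" and K: "lin K" and r: "retr G (H \<circ>\<^sub>F K)"
 shows "\<exists>Y\<in>TC. retr G (Y \<circ>\<^sub>F K)"
proof -
 note Hl = D_lin[OF H] and Gl = subsetD[OF TC_lin G]
 obtain \<iota> \<pi> where ip: "ntr G (H \<circ>\<^sub>F K) \<iota>" "ntr (H \<circ>\<^sub>F K) G \<pi>" "\<And>M x. fd M \<Longrightarrow> el G M x \<Longrightarrow> \<pi> M (\<iota> M x) = x"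
  by (rule retrE[OF r]) blast
 note HK = functor_comp_lin[OF Hl K]
 have "thru ((\<lambda>Y. Y \<circ>\<^sub>F K) ` TC) G G (\<lambda>M x. x)"
  by (rule thru_cong[OF thru_comp[OF Gl HK HK thru_whisker_right[OF K D_thru_TC[OF H]] ip(1,2)]]) (simp add: ip(3))
 note z = thru_brick[OF TC_brick[OF G] this]
 show ?thesis using TC_brick[OF G] z unfolding brick_def nonzero_def by blast
qed

lemma reduce_right:
 fixes K :: "('a, 'k) endo_k"
 assumes G: "G \<in> TC" and H: "H \<in> D' A" and K: "lin K" and r: "retr G (K \<circ>\<^sub>F H)"
 shows "\<exists>Y\<in>TC. retr G (K \<circ>\<^sub>F Y)"
proof -
 note Hl = D_lin[OF H] and Gl = subsetD[OF TC_lin G]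
 obtain \<iota> \<pi> where ip: "ntr G (K \<circ>\<^sub>F H) \<iota>" "ntr (K \<circ>\<^sub>F H) G \<pi>" "\<And>M x. fd M \<Longrightarrow> el G M x \<Longrightarrow> \<pi> M (\<iota> M x) = x"
  by (rule retrE[OF r]) blast
 note KH = functor_comp_lin[OF K Hl]
 have "thru ((\<lambda>Y. K \<circ>\<^sub>F Y) ` TC) G G (\<lambda>M x. x)"
 proof (rule thru_cong[OF thru_comp[OF Gl KH KH thru_whisker_left[OF K Hl Hl TC_lin D_thru_TC[OF H]] ip(1,2)]])
  fix M :: "('a, 'k) mod_k" and x assume M: "fd M" and x: "el G M x"
  show "x = \<pi> M (wl K H H (\<lambda>M x. x) M (\<iota> M x))"
   using wl_id[OF K Hl M] ntr_closed[OF ip(1) M x] ip(3)[OF M x] by (simp add: comp_obj)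
 qed
 note z = thru_brick[OF TC_brick[OF G] this]
 show ?thesis using TC_brick[OF G] z unfolding brick_def nonzero_def by blast
qed

section \<open>Nonprincipal sets and summands of products\<close>

definition principal :: "('v \<times> 'v) set \<Rightarrow> bool" where
 "principal S \<longleftrightarrow> (\<exists>i\<in>V. \<exists>j\<in>V. S = up i j)"

definition mins :: "('v \<times> 'v) set \<Rightarrow> ('v \<times> 'v) set" where
 "mins S = {(i, j) \<in> S. \<forall>a b. (a, b) \<in> S \<longrightarrow> (i, j) \<in> up a b \<longrightarrow> a = i \<and> b = j}"

lemma mins_below:
 assumes f: "filt S" and ab: "(a, b) \<in> S"
 shows "\<exists>i j. (i, j) \<in> mins S \<and> (a, b) \<in> up i j"
proof -
 have SV: "a \<in> V \<and> b \<in> V" if "(a, b) \<in> S" for a b using filtD(1,2)[OF f that] by simp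
 \<comment> \<open>Passing to a smaller pair enlarges its principal up-set, so a minimal element
   below \<open>(a, b)\<close> is found by maximizing the size of that set.\<close>
 let ?P = "\<lambda>p. p \<in> S \<and> (a, b) \<in> up (fst p) (snd p)" and ?f = "\<lambda>p. card (up (fst p) (snd p))"
 have fu: "finite (up i j)" for i j
  by (rule finite_subset[OF _ finite_cartesian_product[OF fin_V fin_V]]) (use Lam_V in \<open>auto simp: up_def\<close>)
 have "\<exists>x. ?P x \<and> (\<forall>y. ?P y \<longrightarrow> ?f y \<le> ?f x)"
 proof (rule ex_has_greatest_nat[of ?P "(a, b)" ?f "Suc (card (V \<times> V))"])
  show "?P (a, b)" using ab up_self SV[OF ab] by simp
  have "up i j \<subseteq> V \<times> V" for i j using Lam_V by (auto simp: up_def)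
  then have "card (up i j) \<le> card (V \<times> V)" for i j
   by (intro card_mono) (simp_all add: fin_V)
  then show "\<forall>y. ?P y \<longrightarrow> ?f y < Suc (card (V \<times> V))" by (simp only: less_Suc_eq_le simp_thms)
 qed
 then obtain x where x: "?P x" "\<forall>y. ?P y \<longrightarrow> ?f y \<le> ?f x" by (elim exE conjE) simp
 obtain i j where xi: "x = (i, j)" by (cases x)
 have ij: "(i, j) \<in> S" "(a, b) \<in> up i j" using x(1) xi by simp_all
 have max: "card (up c d) \<le> card (up i j)" if "(c, d) \<in> S" "(a, b) \<in> up c d" for c d
  using x(2)[rule_format, of "(c, d)"] that xi by simp
 have "c = i \<and> d = j" if cd: "(c, d) \<in> S" "(i, j) \<in> up c d" for c d
 proof -
  have sub: "up i j \<subseteq> up c d" by (rule up_subset[OF up_filt cd(2)])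
  have "card (up c d) \<le> card (up i j)" by (rule max[OF cd(1)]) (use sub ij(2) in blast)
  then have "up i j = up c d" by (rule card_seteq[OF fu sub])
  then show ?thesis using up_inj[of i j c d] SV[OF cd(1)] SV[OF ij(1)] by simp
 qed
 then show ?thesis using ij unfolding mins_def by blast
qed

text \<open>Two distinct minimal elements of \<open>S\<close> with a common upper bound; all four vertices lie in one
 interval, which is a chain.\<close>

lemma nonprincipal_pair:
 assumes c: "conn S" and L: "S \<subseteq> Lam" and np: "\<not> principal S"
 obtains i j i' j' where "(i, j) \<in> S" "(i', j') \<in> S" "(i', i) \<in> Lam" "(j', j) \<in> Lam" "(i, j') \<notin> S"
proof -
 have f: "filt S" and ne: "S \<noteq> {}" using c by (auto simp: conn_def)
 have SV: "a \<in> V \<and> b \<in> V" if "(a, b) \<in> S" for a b using filtD(1,2)[OF f that] by simp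
 define mn where "mn i j \<longleftrightarrow> (i, j) \<in> mins S" for i j
 have mn: "mn i j \<longleftrightarrow> (i, j) \<in> S \<and> (\<forall>a b. (a, b) \<in> S \<longrightarrow> (i, j) \<in> up a b \<longrightarrow> a = i \<and> b = j)" for i j
  by (simp add: mn_def mins_def)
 have below: "\<exists>i j. mn i j \<and> (a, b) \<in> up i j" if "(a, b) \<in> S" for a b
  using mins_below[OF f that] by (simp add: mn_def)
 obtain p q where pq: "mn p q" using ne below by (metis all_not_in_conv surj_pair)
 have pqS: "(p, q) \<in> S" using pq by (simp add: mn)
 \<comment> \<open>Everything above some minimal element other than \<open>(p, q)\<close>. Together
   with \<open>up p q\<close> it covers \<open>S\<close>; as \<open>S\<close> is connected the two
   overlap, and a point of the overlap is the common upper bound \<open>(a, b)\<close>.\<close>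
 let ?B = "{(a, b). \<exists>i j. mn i j \<and> (i, j) \<noteq> (p, q) \<and> (a, b) \<in> up i j}"
 have sub: "up i j \<subseteq> S" if "mn i j" for i j using up_subset[OF f] that by (simp add: mn)
 have "filt ?B"
  unfolding filt_def
 proof (intro conjI allI impI)
  show "?B \<subseteq> V \<times> V" using sub SV by fast
  fix a b a' b' assume "(a, b) \<in> ?B" and l: "(a', a) \<in> Lam" "(b, b') \<in> Lam"
  then obtain i j where "mn i j" "(i, j) \<noteq> (p, q)" "(a, b) \<in> up i j" by blast
  then show "(a', b') \<in> ?B" using filtD(5)[OF up_filt, of a b i j a' b'] l by blast
 qed
 moreover have B: "up p q \<union> ?B = S" using below sub[OF pq] sub by fast
 moreover have "up p q \<noteq> {}" using up_self SV[OF pqS] by blast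
 moreover have "?B \<noteq> {}"
 proof
  assume e: "?B = {}"
  have "S = up p q" using B unfolding e by blast
  then show False using np SV[OF pqS] unfolding principal_def by blast
 qed
 ultimately have "up p q \<inter> ?B \<noteq> {}" using c up_filt unfolding conn_def by blast
 then obtain i' j' a b where q: "mn i' j'" "(i', j') \<noteq> (p, q)" "(a, b) \<in> up p q" "(a, b) \<in> up i' j'" by blast
 \<comment> \<open>Once the first vertices are ordered, minimality decides the order of the second
   ones: \<open>(j, j')\<close> in \<open>Lam\<close> would put \<open>(i', j')\<close> above
   \<open>(i, j)\<close>. Likewise \<open>(i, j')\<close> in \<open>S\<close> would lie below the
   minimal element \<open>(i, j)\<close>.\<close>
 have fin: "(j', j) \<in> Lam \<and> (i, j') \<notin> S"
  if m: "mn i j" "mn i' j'" and n: "(i, j) \<noteq> (i', j')" and l: "(i', i) \<in> Lam" and jj: "(j, j') \<in> Lam \<or> (j', j) \<in> Lam" for i j i' j'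
 proof -
  have nu: "(i', j') \<notin> up i j" using m n unfolding mn by blast
  then have 1: "(j', j) \<in> Lam" using l jj by (auto simp: up_def)
  have "(i, j') \<notin> S"
  proof
   assume ij': "(i, j') \<in> S"
   have "(i, j) \<in> up i j'" using 1 Lam_refl SV[OF ij'] by (simp add: up_def)
   then have "j' = j" using m(1) ij' unfolding mn by blast
   moreover have "(j, j) \<in> Lam" using m(1) SV Lam_refl unfolding mn by blast
   ultimately show False using nu l by (simp add: up_def)
  qed
  then show ?thesis using 1 by simp
 qed
 have iS: "(i', j') \<in> S" using q(1) by (simp add: mn)
 have l: "(a, p) \<in> Lam" "(q, b) \<in> Lam" "(a, i') \<in> Lam" "(j', b) \<in> Lam" "(p, q) \<in> Lam" "(i', j') \<in> Lam"
  using q(3,4) pqS iS L by (auto simp: up_def)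
 have ii: "(p, i') \<in> Lam \<or> (i', p) \<in> Lam"
  by (rule Lam_chain[OF l(1,3) Lam_trans[OF l(5,2)] Lam_trans[OF l(6,4)]])
 have jj: "(q, j') \<in> Lam \<or> (j', q) \<in> Lam"
  by (rule Lam_chain[OF Lam_trans[OF l(1,5)] Lam_trans[OF l(3,6)] l(2,4)])
 from ii show thesis
 proof
  assume "(i', p) \<in> Lam"
  then show thesis using that[OF pqS iS] fin[OF pq q(1) q(2)[symmetric] _ jj] by blast
 next
  assume "(p, i') \<in> Lam"
  then show thesis using that[OF iS pqS] fin[OF q(1) pq q(2)] jj by blast
 qed
qed

text \<open>The images \<open>tp\<close> and \<open>tq\<close> of \<open>u i j\<close> and
  \<open>u i' j'\<close> in the composite satisfy \<open>e tp = tq z\<close> for the paths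
  \<open>e = E i' i\<close> and \<open>z = E j' j\<close>. Right multiplication by \<open>z\<close>
  acts on the composite through \<open>H\<close>, where it has a generalized inverse
  \<open>s\<close> that commutes with the left action. For \<open>y = tp s\<close> this gives
  \<open>e y z = tq z s z = tq z = e tp\<close>. Projecting to \<open>G\<close> writes the nonzero
  \<open>u i' j\<close> as \<open>e\<close>, times an element, times \<open>z\<close>, although the
  corner of \<open>G\<close> at \<open>(i, j')\<close> is zero.\<close>

lemma no_retr:
 fixes U W :: "('a, 'k) endo_k"
 assumes G: "thin G S u" and S: "conn S" "S \<subseteq> Lam" "\<not> principal S"
  and H: "repF H (E k k) (E l l) w" and kl: "k \<in> V" "l \<in> V" and U: "lin U" and W: "lin W"
 shows "\<not> retr G (U \<circ>\<^sub>F H \<circ>\<^sub>F W)"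
proof
 assume r: "retr G (U \<circ>\<^sub>F H \<circ>\<^sub>F W)"
 obtain i j i' j' where ij: "(i, j) \<in> S" and ij': "(i', j') \<in> S" and l: "(i', i) \<in> Lam" "(j', j) \<in> Lam" and no: "(i, j') \<notin> S"
  by (rule nonprincipal_pair[OF S])
 let ?Y = "U \<circ>\<^sub>F H \<circ>\<^sub>F W" and ?N = "obj W PA" and ?z = "E j' j"
 obtain \<iota> \<pi> where ip: "ntr G ?Y \<iota>" "ntr ?Y G \<pi>" "\<And>M x. fd M \<Longrightarrow> el G M x \<Longrightarrow> \<pi> M (\<iota> M x) = x"
  by (rule retrE[OF r]) blast
 note Gl = thinD(1)[OF G] and Sf = thinD(2)[OF G] and t = thinD(3)[OF G] and Hl = repFD(1)[OF H] and wc = repFD(2)[OF H]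
 note Yl = functor_comp_lin[OF functor_comp_lin[OF U Hl] W]
 note N = lf_obj[OF W PA_fdmod] and HN = lf_obj[OF Hl lf_obj[OF W PA_fdmod]]
 have YP: "obj ?Y PA = obj U (obj H ?N)" by (simp add: functor_comp_def)
 note UN = lf_obj[OF U HN]
 have iV: "i \<in> V" "j' \<in> V" using filtD[OF Sf ij] filtD[OF Sf ij'] by simp_all
 note z = E_closed[OF l(2)] and e = E_closed[OF l(1)]
 define f where "f = mor W PA PA (rmap PA (jA ?z))"
 define g where "g = mor H ?N ?N f"
 have fm: "f \<in> mhom A ?N ?N" unfolding f_def by (rule lf_mor[OF W PA_fdmod PA_fdmod rmap_mhom[OF PA_fdmod jA_closed[OF z]]])
 note fl = mhom_lin[OF fm]
 have gm: "g \<in> mhom A (obj H ?N) (obj H ?N)" unfolding g_def by (rule lf_mor[OF Hl N N fm])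
 have rtY: "rt ?Y y ?z = mor U (obj H ?N) (obj H ?N) g y" for y
  by (simp add: rt_def act_def functor_comp_def g_def f_def)
 \<comment> \<open>\<open>f\<close> is right multiplication by \<open>z\<close> on
   \<open>obj W PA\<close>. It is inverted as a mere linear map: \<open>sg\<close> need not respect
   the left action, which is harmless because \<open>H\<close> supplies its own.\<close>
 obtain sg where sg: "klin ?N ?N sg" "\<And>n. n \<in> carrier ?N \<Longrightarrow> f (sg (f n)) = f n"
  by (rule generalized_inverse[OF N N lin_map_klin[OF fl]]) blast
 note sc = add_homD(1)[OF sg(1)[unfolded klin_def, THEN conjunct1]]
 obtain h where h: "lin_map (obj H ?N) (obj H ?N) h"
  "\<And>a n. a \<in> carrier A \<Longrightarrow> n \<in> carrier ?N \<Longrightarrow>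
   h (a \<odot>\<^bsub>obj H ?N\<^esub> act H ?N n w) = a \<odot>\<^bsub>obj H ?N\<^esub> act H ?N (sg (E l l \<odot>\<^bsub>?N\<^esub> n)) w"
  by (rule repF_klin[OF H Ev_closed[OF kl(1)] Ev_closed[OF kl(2)] Hl wc repFD(3)[OF H] N N sg(1)]) blast
 let ?s = "restrict h (carrier (obj H ?N))"
 have sm: "?s \<in> mhom A (obj H ?N) (obj H ?N)" by (rule lin_mhom[OF h(1) HN])
 have gact: "g (a \<odot>\<^bsub>obj H ?N\<^esub> act H ?N n w) = a \<odot>\<^bsub>obj H ?N\<^esub> act H ?N (f n) w" if "a \<in> carrier A" "n \<in> carrier ?N" for a n
  unfolding g_def using lin_mapD(3)[OF lf_lin[OF Hl N N fm] that(1) act_closed[OF Hl N that(2) wc]] act_mor[OF Hl N N fm that(2) wc] by simp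
 \<comment> \<open>The lift \<open>h\<close> applies \<open>sg\<close> to \<open>E l l n\<close> in
   place of \<open>n\<close>, so the idempotent is moved through the \<open>A\<close>-linear
   \<open>f\<close> and in the end absorbed by \<open>w\<close>.\<close>
 have gsg: "g (h (g x)) = g x" if x: "x \<in> carrier (obj H ?N)" for x
 proof (rule repF_hom_eq[OF H m_ab[OF HN] N _ lin_mapD(4)[OF mhom_lin[OF gm]] _ x])
  show "add_hom (obj H ?N) (obj H ?N) (\<lambda>x. g (h (g x)))"
   by (intro lin_mapD(4) lin_map_comp[OF lin_map_comp[OF mhom_lin[OF gm] h(1)] mhom_lin[OF gm]])
  fix a n assume a: "a \<in> carrier A" and n: "n \<in> carrier ?N"
  note en = m_closed[OF N Ev_closed[OF kl(2)] n] and fn = lin_mapD(1)[OF fl n]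
  have ef: "E l l \<odot>\<^bsub>?N\<^esub> f n = f (E l l \<odot>\<^bsub>?N\<^esub> n)" by (rule lin_mapD(3)[OF fl Ev_closed[OF kl(2)] n, symmetric])
  have "g (h (g (a \<odot>\<^bsub>obj H ?N\<^esub> act H ?N n w))) = a \<odot>\<^bsub>obj H ?N\<^esub> act H ?N (f (sg (f (E l l \<odot>\<^bsub>?N\<^esub> n)))) w"
   using gact[OF a n] h(2)[OF a fn] gact[OF a sc[OF m_closed[OF N Ev_closed[OF kl(2)] fn]]] by (simp add: ef)
  also have "f (sg (f (E l l \<odot>\<^bsub>?N\<^esub> n))) = E l l \<odot>\<^bsub>?N\<^esub> f n" using sg(2)[OF en] ef by simp
  also have "act H ?N (E l l \<odot>\<^bsub>?N\<^esub> f n) w = act H ?N (f n) w"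
   using act_smult_left[OF Hl N Ev_closed[OF kl(2)] fn wc] repFD(4)[OF H] by simp
  finally show "g (h (g (a \<odot>\<^bsub>obj H ?N\<^esub> act H ?N n w))) = g (a \<odot>\<^bsub>obj H ?N\<^esub> act H ?N n w)" using gact[OF a n] by simp
 qed
 let ?g = "mor U (obj H ?N) (obj H ?N) g" and ?h = "mor U (obj H ?N) (obj H ?N) ?s"
 have UgU: "?g (?h (?g x)) = ?g x" if x: "x \<in> carrier (obj U (obj H ?N))" for x
 proof -
  have "compose (carrier (obj H ?N)) g (compose (carrier (obj H ?N)) ?s g) = g"
   by (rule mhom_eqI[OF mhom_comp[OF HN mhom_comp[OF HN gm sm] gm] gm])
    (use gsg lin_mapD(1)[OF mhom_lin[OF gm]] in \<open>simp add: compose_eq\<close>)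
  then show ?thesis
   using lf_comp[OF U HN HN HN mhom_comp[OF HN gm sm] gm x] lf_comp[OF U HN HN HN gm sm x] by simp
 qed
 define tp tq where "tp = \<iota> PA (u i j)" and "tq = \<iota> PA (u i' j')"
 have uc: "u i j \<in> carrier (obj G PA)" "u i' j' \<in> carrier (obj G PA)" by (rule tfamD(1)[OF t ij], rule tfamD(1)[OF t ij'])
 have tc: "tp \<in> carrier (obj ?Y PA)" "tq \<in> carrier (obj ?Y PA)" unfolding tp_def tq_def by (rule ntr_closed[OF ip(1) PA_fdmod] uc)+
 have eq: "E i' i \<odot>\<^bsub>obj ?Y PA\<^esub> tp = ?g tq"
  using ntr_smult[OF ip(1) PA_fdmod e uc(1)] ntr_rt[OF ip(1) uc(2) z] tfamD(2)[OF t ij l(1)] tfamD(3)[OF t ij' l(2)]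
  by (simp add: tp_def tq_def rtY)
 note hU = lf_lin[OF U HN HN sm] and gU = lf_lin[OF U HN HN gm]
 define y where "y = ?h tp"
 have yc: "y \<in> carrier (obj ?Y PA)" unfolding y_def YP by (rule lin_mapD(1)[OF hU]) (use tc in \<open>simp add: YP\<close>)
 have "E i' i \<odot>\<^bsub>obj ?Y PA\<^esub> rt ?Y y ?z = ?g (?h (?g tq))"
  unfolding rtY y_def eq[symmetric] YP
  using lin_mapD(3)[OF gU e lin_mapD(1)[OF hU]] lin_mapD(3)[OF hU e] tc(1) by (simp add: YP)
 then have "E i' i \<odot>\<^bsub>obj ?Y PA\<^esub> rt ?Y y ?z = E i' i \<odot>\<^bsub>obj ?Y PA\<^esub> tp"
  using UgU[of tq] tc(2) eq by (simp add: YP)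
 then have "\<pi> PA (E i' i \<odot>\<^bsub>obj ?Y PA\<^esub> rt ?Y y ?z) = \<pi> PA (E i' i \<odot>\<^bsub>obj ?Y PA\<^esub> tp)" by simp
 then have "E i' i \<odot>\<^bsub>obj G PA\<^esub> rt G (\<pi> PA y) ?z = u i' j"
  using ntr_smult[OF ip(2) PA_fdmod e rt_closed[OF Yl yc z]] ntr_smult[OF ip(2) PA_fdmod e tc(1)] ntr_rt[OF ip(2) yc z]
   ip(3)[OF PA_fdmod uc(1)] tfamD(2)[OF t ij l(1)] by (simp add: tp_def)
 \<comment> \<open>Since \<open>e = e E i i\<close> and \<open>z = E j' j' z\<close>, only the
   corner at \<open>(i, j')\<close> of the projected element contributes.\<close>
 moreover have "E i' i \<odot>\<^bsub>obj G PA\<^esub> rt G (\<pi> PA y) ?z = \<zero>\<^bsub>obj G PA\<^esub>"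
 proof -
  note p = ntr_closed[OF ip(2) PA_fdmod yc] and GP = lf_obj[OF Gl PA_fdmod]
  note pj = rt_closed[OF Gl p Ev_closed[OF iV(2)]]
  have "E i' i \<odot>\<^bsub>obj G PA\<^esub> rt G (\<pi> PA y) ?z = (E i' i \<otimes> E i i) \<odot>\<^bsub>obj G PA\<^esub> rt G (\<pi> PA y) (E j' j' \<otimes> ?z)"
   using E_mult[OF l(1) Lam_refl[OF iV(1)]] E_mult[OF Lam_refl[OF iV(2)] l(2)] by simp
  also have "\<dots> = E i' i \<odot>\<^bsub>obj G PA\<^esub> rt G (E i i \<odot>\<^bsub>obj G PA\<^esub> rt G (\<pi> PA y) (E j' j')) ?z"
   using rt_mult[OF Gl p Ev_closed[OF iV(2)] z] m_mult[OF GP e Ev_closed[OF iV(1)] rt_closed[OF Gl pj z]]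
    rt_smult[OF Gl pj z Ev_closed[OF iV(1)]] by simp
  also have "E i i \<odot>\<^bsub>obj G PA\<^esub> rt G (\<pi> PA y) (E j' j') = \<zero>\<^bsub>obj G PA\<^esub>" using thin_corner[OF G p iV] no by simp
  finally show ?thesis using rt_zero_left[OF Gl z] m_zero_right[OF GP e] by simp
 qed
 ultimately show False using thinD(4)[OF G filtD(3)[OF Sf ij l(1)]] by simp
qed

text \<open>The pairs \<open>(a, b)\<close> such that \<open>E a a B E b b\<close> is nonzero for the bimodule \<open>B\<close> representing \<open>Y\<close>.\<close>

definition supp :: "('a, 'k) endo_k \<Rightarrow> 'v \<Rightarrow> 'v \<Rightarrow> bool" where
 "supp Y a b \<longleftrightarrow> (\<exists>y\<in>carrier (obj Y PA). y \<noteq> \<zero>\<^bsub>obj Y PA\<^esub> \<and> E a a \<odot>\<^bsub>obj Y PA\<^esub> y = y \<and> rt Y y (E b b) = y)"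

lemma supp_thin:
 assumes G: "thin G S u" and ab: "a \<in> V" "b \<in> V"
 shows "supp G a b \<longleftrightarrow> (a, b) \<in> S"
proof
 assume "supp G a b"
 then obtain y where y: "el G PA y" "y \<noteq> \<zero>\<^bsub>obj G PA\<^esub>" "E a a \<odot>\<^bsub>obj G PA\<^esub> y = y" "rt G y (E b b) = y"
  unfolding supp_def by blast
 then show "(a, b) \<in> S" using thin_corner[OF G y(1) ab] by (auto split: if_splits)
next
 assume "(a, b) \<in> S"
 then show "supp G a b"
  unfolding supp_def using tfamD[OF thinD(3)[OF G], of a b] thinD(4)[OF G, of a b] Lam_refl ab by blast
qed

lemma supp_retr:
 assumes G: "lin G" and Y: "lin Y" and r: "retr G Y" and s: "supp G a b" and ab: "a \<in> V" "b \<in> V"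
 shows "supp Y a b"
proof -
 obtain \<iota> \<pi> where ip: "ntr G Y \<iota>" "ntr Y G \<pi>" "\<And>M x. fd M \<Longrightarrow> el G M x \<Longrightarrow> \<pi> M (\<iota> M x) = x"
  by (rule retrE[OF r]) blast
 obtain y where y: "el G PA y" "y \<noteq> \<zero>\<^bsub>obj G PA\<^esub>" "E a a \<odot>\<^bsub>obj G PA\<^esub> y = y" "rt G y (E b b) = y"
  using s unfolding supp_def by blast
 have "\<iota> PA y \<noteq> \<zero>\<^bsub>obj Y PA\<^esub>"
  using ip(3)[OF PA_fdmod y(1)] y(2) lin_map_zero[OF lf_obj[OF Y PA_fdmod] lf_obj[OF G PA_fdmod] ntr_lin[OF ip(2) PA_fdmod]] by auto
 then show ?thesis
  unfolding supp_def using ntr_closed[OF ip(1) PA_fdmod y(1)] ntr_smult[OF ip(1) PA_fdmod Ev_closed[OF ab(1)] y(1)]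
   ntr_rt[OF ip(1) y(1) Ev_closed[OF ab(2)]] y(3,4) by (intro bexI[of _ "\<iota> PA y"]) simp_all
qed

text \<open>A generator \<open>u p q \<otimes> n\<close> of the composite equals
  \<open>u p q \<otimes> E q q n\<close>, and its corner at \<open>(a, b)\<close> can survive only
  if \<open>p = a\<close> and \<open>E q q n E b b\<close> is nonzero. Were there no such
  \<open>q\<close>, the whole corner would vanish.\<close>

lemma supp_comp:
 assumes G: "thin G S u" and Y: "lin Y" and s: "supp (G \<circ>\<^sub>F Y) a b" and ab: "a \<in> V" "b \<in> V"
 obtains c where "(a, c) \<in> S" "supp Y c b"
proof (rule ccontr)
 assume c: "\<not> thesis"
 note ex = that
 note Gl = thinD(1)[OF G] and Sf = thinD(2)[OF G] and t = thinD(3)[OF G]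
 note N = lf_obj[OF Y PA_fdmod] and ea = Ev_closed[OF ab(1)] and eb = Ev_closed[OF ab(2)]
 let ?N = "obj Y PA" and ?F = "G \<circ>\<^sub>F Y"
 note GN = lf_obj[OF Gl N] and Fl = functor_comp_lin[OF Gl Y]
 obtain y where y: "y \<in> carrier (obj G ?N)" "y \<noteq> \<zero>\<^bsub>obj G ?N\<^esub>" "E a a \<odot>\<^bsub>obj G ?N\<^esub> y = y" "rt ?F y (E b b) = y"
  using s unfolding supp_def comp_obj by blast
 have no: "E q q \<odot>\<^bsub>?N\<^esub> rt Y n (E b b) = \<zero>\<^bsub>?N\<^esub>" if n: "n \<in> carrier ?N" and q: "(a, q) \<in> S" for n q
 proof (rule ccontr)
  assume nz: "E q q \<odot>\<^bsub>?N\<^esub> rt Y n (E b b) \<noteq> \<zero>\<^bsub>?N\<^esub>"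
  note eq = Ev_closed[OF filtD(2)[OF Sf q]] and r = rt_closed[OF Y n eb]
  have "supp Y q b"
   unfolding supp_def
   using nz m_closed[OF N eq r] m_mult[OF N eq eq r] rt_smult[OF Y r eb eq] rt_mult[OF Y n eb eb] E_idem[OF ab(2)]
    E_idem[OF filtD(2)[OF Sf q]]
   by (intro bexI[of _ "E q q \<odot>\<^bsub>?N\<^esub> rt Y n (E b b)"]) simp_all
  then show False using c ex[OF q] by blast
 qed
 have rF: "add_hom (obj G ?N) (obj G ?N) (\<lambda>x. rt ?F x (E b b))"
  using rt_closed[OF Fl _ eb] rt_add_left[OF Fl _ _ eb] by (simp add: add_hom_def comp_obj)
 have "E a a \<odot>\<^bsub>obj G ?N\<^esub> rt ?F y (E b b) = \<zero>\<^bsub>obj G ?N\<^esub>"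
 proof (rule thin_hom_eq[OF G m_ab[OF GN] N _ _ _ y(1)])
  show "add_hom (obj G ?N) (obj G ?N) (\<lambda>y. E a a \<odot>\<^bsub>obj G ?N\<^esub> rt ?F y (E b b))"
   by (rule add_hom_comp[OF rF left_module.add_hom_lsmult[OF fdmod_lmod[OF GN] ea]])
  interpret GN: abelian_group "obj G ?N" by (rule m_ab[OF GN])
  show "add_hom (obj G ?N) (obj G ?N) (\<lambda>y. \<zero>\<^bsub>obj G ?N\<^esub>)" by (simp add: add_hom_def)
  fix n p q assume n: "n \<in> carrier ?N" and pq: "(p, q) \<in> S"
  note uc = tfamD(1)[OF t pq] and V = filtD(1,2)[OF Sf pq] and r = rt_closed[OF Y n eb]
  note eq = Ev_closed[OF V(2)] and erc = m_closed[OF N Ev_closed[OF V(2)] r]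
  have "rt ?F (act G ?N n (u p q)) (E b b) = act G ?N (rt Y n (E b b)) (u p q)"
   unfolding rt_def by (rule act_comp[OF Gl Y PA_fdmod jA_closed[OF eb] n uc])
  also have "\<dots> = act G ?N (E q q \<odot>\<^bsub>?N\<^esub> rt Y n (E b b)) (u p q)"
   using act_smult_left[OF Gl N eq r uc] tfamD(3)[OF t pq Lam_refl[OF V(2)]] by simp
  finally have e: "E a a \<odot>\<^bsub>obj G ?N\<^esub> rt ?F (act G ?N n (u p q)) (E b b) =
    act G ?N (E q q \<odot>\<^bsub>?N\<^esub> rt Y n (E b b)) (E a a \<odot>\<^bsub>obj G PA\<^esub> u p q)"
   using act_smult[OF Gl N erc uc ea] by simp
  show "E a a \<odot>\<^bsub>obj G ?N\<^esub> rt ?F (act G ?N n (u p q)) (E b b) = \<zero>\<^bsub>obj G ?N\<^esub>"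
  proof (cases "p = a")
   case True
   then show ?thesis using e no[OF n] pq act_zero_left[OF Gl N m_closed[OF lf_obj[OF Gl PA_fdmod] ea uc]] by simp
  next
   case False
   then have "E a a \<odot>\<^bsub>obj G PA\<^esub> u p q = \<zero>\<^bsub>obj G PA\<^esub>" using tfam_left0[OF Gl Sf t pq Lam_refl[OF ab(1)]] by simp
   then show ?thesis
    using e act_smult[OF Gl N erc uc zero_closed] m_zero_left[OF lf_obj[OF Gl PA_fdmod] uc] m_zero_left[OF GN act_closed[OF Gl N erc uc]]
    by simp
  qed
 qed
 then show False using y by simp
qed

text \<open>The middle of \<open>A e\<^sub>i \<otimes> e\<^sub>j A e\<^sub>j \<otimes> e\<^sub>l
  A\<close> is one-dimensional, as the trivial path is the only one from \<open>j\<close> to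
  \<open>j\<close>; hence the product is a single copy of the functor of
  \<open>(i, l)\<close>.\<close>

lemma F_comp:
 assumes G: "repF G (E i i) (E j j) v" and H: "repF H (E j j) (E l l) w" and K: "repF K (E i i) (E l l) x"
  and V: "i \<in> V" "j \<in> V" "l \<in> V"
 shows "nat_iso A K (G \<circ>\<^sub>F H)"
proof -
 note Gl = repFD(1)[OF G] and Hl = repFD(1)[OF H] and Kl = repFD(1)[OF K]
 note vc = repFD(2)[OF G] and wc = repFD(2)[OF H] and xc = repFD(2)[OF K]
 note e = Ev_closed[OF V(1)] Ev_closed[OF V(2)] Ev_closed[OF V(3)]
 note GHl = functor_comp_lin[OF Gl Hl]
 let ?GH = "G \<circ>\<^sub>F H" and ?y = "act G (obj H PA) w v"
 note HP = lf_obj[OF Hl PA_fdmod]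
 have yc: "?y \<in> carrier (obj ?GH PA)" using act_closed[OF Gl HP wc vc] by (simp add: comp_obj)
 have y1: "E i i \<odot>\<^bsub>obj ?GH PA\<^esub> ?y = ?y" using act_smult[OF Gl HP wc vc e(1)] repFD(3)[OF G] by (simp add: comp_obj)
 have y2: "rt ?GH ?y (E l l) = ?y"
  using act_comp[OF Gl Hl PA_fdmod jA_closed[OF e(3)] wc vc] repFD(4)[OF H] by (simp add: rt_def)
 obtain \<eta> where n: "ntr K ?GH \<eta>" "\<eta> PA x = ?y" by (rule repF_ntr[OF K e(1) e(3) GHl yc y1 y2])
 \<comment> \<open>Inverses are constructed for each \<open>N\<close> separately and without
   naturality, because a bijective natural transformation has a natural inverse by
   \<open>ntr_inverse\<close>.\<close>
 have "\<exists>h. (\<forall>z\<in>carrier (obj K N). h (\<eta> N z) = z) \<and> (\<forall>z\<in>carrier (obj ?GH N). h z \<in> carrier (obj K N) \<and> \<eta> N (h z) = z)"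
  if N: "fd N" for N :: "('a, 'k) mod_k"
 proof -
  note HN = lf_obj[OF Hl N] and KN = lf_obj[OF Kl N]
  note GHN = lf_obj[OF Gl HN]
  \<comment> \<open>The coordinate at the trivial path of \<open>j\<close>:
    \<open>b \<otimes> m\<close> goes to the coefficient of \<open>E j j\<close> times
    \<open>E l l m\<close>. By \<open>key\<close> it undoes \<open>m \<mapsto> act H N m w\<close>
    on the part fixed by \<open>E j j\<close>.\<close>
  obtain \<phi> where p: "add_hom (obj H N) N \<phi>" "\<And>b m. b \<in> carrier A \<Longrightarrow> m \<in> carrier N \<Longrightarrow>
    \<phi> (b \<odot>\<^bsub>obj H N\<^esub> act H N m w) = kscale A N (cf (b \<otimes> E j j) j j) (E l l \<odot>\<^bsub>N\<^esub> m)"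
   by (rule repF_coordinate[OF H V(2,3) N V(2)]) blast
  note pc = add_homD(1)[OF p(1)]
  have hac: "act H N m w \<in> carrier (obj H N)" if "m \<in> carrier N" for m by (rule act_closed[OF Hl N that wc])
  have lw: "act H N (E l l \<odot>\<^bsub>N\<^esub> m) w = act H N m w" if "m \<in> carrier N" for m
   using act_smult_left[OF Hl N e(3) that wc] repFD(4)[OF H] by simp
  have lx: "act K N (E l l \<odot>\<^bsub>N\<^esub> m) x = act K N m x" if "m \<in> carrier N" for m
   using act_smult_left[OF Kl N e(3) that xc] repFD(4)[OF K] by simp
  have "klin (obj H N) N \<phi>"
   unfolding klin_def
  proof (intro conjI allI ballI)
   fix c z assume z: "el H N z"
   show "\<phi> (kscale A (obj H N) c z) = kscale A N c (\<phi> z)"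
   proof (rule repF_hom_eq[OF H m_ab[OF N] N _ _ _ z])
    show "add_hom (obj H N) N (\<lambda>z. \<phi> (kscale A (obj H N) c z))"
     by (rule add_hom_comp[OF _ p(1)]) (simp add: add_hom_def ks_closed[OF HN] ks_add_right[OF HN])
    show "add_hom (obj H N) N (\<lambda>z. kscale A N c (\<phi> z))"
     by (rule add_hom_comp[OF p(1)]) (simp add: add_hom_def ks_closed[OF N] ks_add_right[OF N])
    fix b m assume b: "b \<in> carrier A" and m: "m \<in> carrier N"
    show "\<phi> (kscale A (obj H N) c (b \<odot>\<^bsub>obj H N\<^esub> act H N m w)) = kscale A N c (\<phi> (b \<odot>\<^bsub>obj H N\<^esub> act H N m w))"
     using m_kscale[OF HN b hac[OF m], of c] p(2)[OF ksmult_closed[OF b] m, of c] p(2)[OF b m] b e m_closed[OF N e(3) m]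
     by (simp add: ksmult_mult_left cf_ks ks_mult[OF N])
   qed
  qed (rule p(1))
  note pk = this[unfolded klin_def, THEN conjunct2, rule_format]
  have key: "act H N (\<phi> (E j j \<odot>\<^bsub>obj H N\<^esub> z)) w = E j j \<odot>\<^bsub>obj H N\<^esub> z" if z: "el H N z" for z
  proof (rule repF_hom_eq[OF H m_ab[OF HN] N _ left_module.add_hom_lsmult[OF fdmod_lmod[OF HN] e(2)] _ z])
   show "add_hom (obj H N) (obj H N) (\<lambda>z. act H N (\<phi> (E j j \<odot>\<^bsub>obj H N\<^esub> z)) w)"
    by (rule add_hom_comp[OF add_hom_comp[OF left_module.add_hom_lsmult[OF fdmod_lmod[OF HN] e(2)] p(1)] add_hom_act[OF Hl N wc]])
   fix b m assume b: "b \<in> carrier A" and m: "m \<in> carrier N"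
   have c: "E j j \<otimes> (b \<otimes> E j j) = cf b j j \<odot> E j j" using corner[OF b V(2,2)] Lam_refl[OF V(2)] by simp
   have "E j j \<odot>\<^bsub>obj H N\<^esub> act H N m w = act H N m w" using act_smult[OF Hl N m wc e(2)] repFD(3)[OF H] by simp
   then have "E j j \<odot>\<^bsub>obj H N\<^esub> (b \<odot>\<^bsub>obj H N\<^esub> act H N m w) = (E j j \<otimes> (b \<otimes> E j j)) \<odot>\<^bsub>obj H N\<^esub> act H N m w"
    using m_mult[OF HN e(2) _ hac[OF m], of "b \<otimes> E j j"] m_mult[OF HN b e(2) hac[OF m]] b e(2) by simp
   also have "\<dots> = (cf b j j \<odot> E j j) \<odot>\<^bsub>obj H N\<^esub> act H N m w" by (simp add: c)
   finally have 1: "E j j \<odot>\<^bsub>obj H N\<^esub> (b \<odot>\<^bsub>obj H N\<^esub> act H N m w) = (cf b j j \<odot> E j j) \<odot>\<^bsub>obj H N\<^esub> act H N m w" .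
   have cc: "cf ((cf b j j \<odot> E j j) \<otimes> E j j) j j = cf b j j"
    using Lam_refl[OF V(2)] by (simp add: ksmult_mult_left e cf_ks E_idem[OF V(2)] cf_E)
   show "act H N (\<phi> (E j j \<odot>\<^bsub>obj H N\<^esub> (b \<odot>\<^bsub>obj H N\<^esub> act H N m w))) w = E j j \<odot>\<^bsub>obj H N\<^esub> (b \<odot>\<^bsub>obj H N\<^esub> act H N m w)"
    unfolding 1 p(2)[OF ksmult_closed[OF e(2)] m] cc
    using act_ks_left[OF Hl N m_closed[OF N e(3) m] wc] lw[OF m] m_kscale[OF HN e(2) hac[OF m]]
     \<open>E j j \<odot>\<^bsub>obj H N\<^esub> act H N m w = act H N m w\<close> by simp
  qed
  have "kbal (obj H N) (obj K N) (\<lambda>b z. b \<odot>\<^bsub>obj K N\<^esub> act K N (\<phi> z) x)"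
   unfolding kbal_def
   by (simp add: pc act_closed[OF Kl N _ xc] m_closed[OF KN] m_add_left[OF KN] add_homD(2)[OF p(1)] act_add_left[OF Kl N _ _ xc]
     m_add_right[OF KN] pk act_ks_left[OF Kl N _ xc] m_kscale[OF KN] ks_comm[OF KN])
  then obtain h where h: "add_hom (obj G (obj H N)) (obj K N) h" "\<And>b z. b \<in> carrier A \<Longrightarrow> el H N z \<Longrightarrow>
    h (b \<odot>\<^bsub>obj G (obj H N)\<^esub> act G (obj H N) z v) = (b \<otimes> E i i) \<odot>\<^bsub>obj K N\<^esub> act K N (\<phi> (E j j \<odot>\<^bsub>obj H N\<^esub> z)) x"
   by (rule repF_lift[OF G HN m_ab[OF KN]]) blast
  have ix: "E i i \<odot>\<^bsub>obj K N\<^esub> act K N m x = act K N m x" if "m \<in> carrier N" for m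
   using act_smult[OF Kl N that xc e(1)] repFD(3)[OF K] by simp
  have h2: "h (b \<odot>\<^bsub>obj G (obj H N)\<^esub> act G (obj H N) z v) = b \<odot>\<^bsub>obj K N\<^esub> act K N (\<phi> (E j j \<odot>\<^bsub>obj H N\<^esub> z)) x"
   if "b \<in> carrier A" "el H N z" for b z
   using h(2)[OF that] m_mult[OF KN that(1) e(1) act_closed[OF Kl N pc[OF m_closed[OF HN e(2) that(2)]] xc]]
    ix[OF pc[OF m_closed[OF HN e(2) that(2)]]] by simp
  have en: "\<eta> N (b \<odot>\<^bsub>obj K N\<^esub> act K N m x) = b \<odot>\<^bsub>obj G (obj H N)\<^esub> act G (obj H N) (act H N m w) v"
   if "b \<in> carrier A" "m \<in> carrier N" for b m
   using ntr_smult[OF n(1) N that(1) act_closed[OF Kl N that(2) xc]] ntr_act[OF n(1) N that(2) xc] n(2)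
    act_comp[OF Gl Hl N that(2) wc vc] by (simp add: comp_obj)
  note nh = lin_mapD(4)[OF ntr_lin[OF n(1) N], unfolded comp_obj]
  have 1: "h (\<eta> N z) = z" if z: "el K N z" for z
  proof (rule repF_hom_eq[OF K m_ab[OF KN] N add_hom_comp[OF nh h(1)] _ _ z])
   show "add_hom (obj K N) (obj K N) (\<lambda>z. z)" by (simp add: add_hom_def)
   fix b m assume b: "b \<in> carrier A" and m: "m \<in> carrier N"
   have "\<phi> (E j j \<odot>\<^bsub>obj H N\<^esub> act H N m w) = E l l \<odot>\<^bsub>N\<^esub> m"
    using p(2)[OF e(2) m] Lam_refl[OF V(2)] by (simp add: E_idem[OF V(2)] cf_E ks_one[OF N m_closed[OF N e(3) m]])
   then show "h (\<eta> N (b \<odot>\<^bsub>obj K N\<^esub> act K N m x)) = b \<odot>\<^bsub>obj K N\<^esub> act K N m x"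
    using en[OF b m] h2[OF b hac[OF m]] lx[OF m] by simp
  qed
  have 2: "\<eta> N (h z) = z" if z: "z \<in> carrier (obj G (obj H N))" for z
  proof (rule repF_hom_eq[OF G m_ab[OF GHN] HN add_hom_comp[OF h(1) nh] _ _ z])
   show "add_hom (obj G (obj H N)) (obj G (obj H N)) (\<lambda>z. z)" by (simp add: add_hom_def)
   fix b z assume b: "b \<in> carrier A" and z: "el H N z"
   have "act G (obj H N) (E j j \<odot>\<^bsub>obj H N\<^esub> z) v = act G (obj H N) z v"
    using act_smult_left[OF Gl HN e(2) z vc] repFD(4)[OF G] by simp
   then show "\<eta> N (h (b \<odot>\<^bsub>obj G (obj H N)\<^esub> act G (obj H N) z v)) = b \<odot>\<^bsub>obj G (obj H N)\<^esub> act G (obj H N) z v"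
    using h2[OF b z] en[OF b pc[OF m_closed[OF HN e(2) z]]] key[OF z] by simp
  qed
  show ?thesis using 1 2 add_homD(1)[OF h(1)] by (intro exI[of _ h]) (simp add: comp_obj)
 qed
 then have "\<forall>N\<in>fdmod A. bij_betw (\<eta> N) (carrier (obj K N)) (carrier (obj ?GH N))"
  using ntr_closed[OF n(1)] by (intro ballI) (metis (no_types, lifting) bij_betw_byWitness image_subsetI)
 then have "biject K ?GH \<eta>" unfolding biject_def .
 then obtain \<theta> where th: "ntr ?GH K \<theta>" "\<And>M x. fd M \<Longrightarrow> el K M x \<Longrightarrow> \<theta> M (\<eta> M x) = x"
  "\<And>M y. fd M \<Longrightarrow> y \<in> carrier (obj ?GH M) \<Longrightarrow> \<eta> M (\<theta> M y) = y"
  by (rule ntr_inverse[OF Kl GHl n(1)]) blast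
 show ?thesis by (rule nat_isoI[OF Kl GHl n(1) th(1)]) (simp_all add: th(2,3))
qed

end

lemma comp_assoc: "H \<circ>\<^sub>F (F \<circ>\<^sub>F K) = H \<circ>\<^sub>F F \<circ>\<^sub>F K"
 by (simp add: functor_comp_def)

context inc_alg
begin

section \<open>Cells\<close>

text \<open>The isomorphism class of the thin functors of \<open>S\<close>. Through it, questions
  about cells become questions about up-closed sets.\<close>

definition cls :: "('v \<times> 'v) set \<Rightarrow> ('a, 'k) endo_k set" where
 "cls S = {G. \<exists>u. thin G S u}"

text \<open>Principal sets inside \<open>Lam\<close> describe both an ideal generated by one path
  and some \<open>F\<^sub>i\<^sub>j\<close>; they are counted in \<open>PR\<close>. This is the
  origin of the condition \<open>card (path_gens Q I) \<noteq> 1\<close>.\<close>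

definition PS :: "('v \<times> 'v) set set" where
 "PS = {S. conn S \<and> S \<subseteq> Lam \<and> \<not> principal S}"

definition PR :: "('v \<times> 'v) set set" where
 "PR = {up i j | i j. i \<in> V \<and> j \<in> V}"

lemma up_PR: "i \<in> V \<Longrightarrow> j \<in> V \<Longrightarrow> up i j \<in> PR"
 unfolding PR_def by blast

lemma conn_PS_PR: "conn S \<and> S \<subseteq> Lam \<or> S \<in> PR \<Longrightarrow> S \<in> PS \<union> PR"
 unfolding PS_def PR_def principal_def by blast

lemma TC_cls: "G \<in> TC \<longleftrightarrow> (\<exists>S\<in>PS \<union> PR. G \<in> cls S)"
 unfolding TC_def cls_def PS_def PR_def principal_def by blast

lemma cls_TC: "S \<in> PS \<union> PR \<Longrightarrow> G \<in> cls S \<Longrightarrow> G \<in> TC"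
 using TC_cls by blast

lemma cls_D: "S \<in> PS \<union> PR \<Longrightarrow> G \<in> cls S \<Longrightarrow> G \<in> D' A"
 by (rule TC_D[OF cls_TC])

lemma cls_lin: "G \<in> cls S \<Longrightarrow> lin G"
 unfolding cls_def using thinD(1) by blast

lemma cls_repF:
 assumes "i \<in> V" "j \<in> V"
 obtains G w where "repF G (E i i) (E j j) w" "G \<in> cls (up i j)" "G \<in> D' A"
proof -
 obtain G w where G: "repF G (E i i) (E j j) w" using F_exists[OF assms] by blast
 then have c: "G \<in> cls (up i j)" unfolding cls_def using thin_up[OF G assms] by blast
 then have "G \<in> D' A" by (rule cls_D[rotated]) (use up_PR[OF assms] in simp)
 then show thesis using that G c by blast
qed

lemma cls_nonempty: "S \<in> PS \<union> PR \<Longrightarrow> \<exists>G. G \<in> cls S"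
proof -
 assume "S \<in> PS \<union> PR"
 then show ?thesis
 proof
  assume "S \<in> PS"
  then show ?thesis unfolding PS_def cls_def conn_def using thin_exists[of S] by blast
 next
  assume "S \<in> PR"
  then obtain i j where "i \<in> V" "j \<in> V" "S = up i j" unfolding PR_def by blast
  then show ?thesis using cls_repF[of i j] by metis
 qed
qed

text \<open>\<open>F\<close> may take values in another type, since \<open>Dp\<close> and
  \<open>F_proj\<close> have values in cosets and are no endofunctors themselves.\<close>

lemma iso_class_cls:
 assumes S: "S \<in> PS \<union> PR" and F: "(F :: ('a, nat \<Rightarrow> 'k, 'w) mod_functor) \<in> lin_functors A"
  and G: "G \<in> cls S" "nat_iso A G F"
 shows "iso_class A (D' A) F = cls S"
proof (intro equalityI subsetI)
 obtain u where u: "thin G S u" using G(1) unfolding cls_def by blast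
 note Gl = thinD(1)[OF u]
 {
  fix H assume "H \<in> iso_class A (D' A) F"
  then have H: "lin H" "nat_iso A H F" using D_lin by (auto simp: iso_class_def)
  have "nat_iso A H G" by (rule nat_iso_trans[OF H(1) Gl H(2) nat_iso_sym[OF G(2)]])
  from thin_iso[OF u H(1) this] show "H \<in> cls S" unfolding cls_def by simp
 next
  fix H assume H: "H \<in> cls S"
  then obtain v where v: "thin H S v" unfolding cls_def by blast
  have "nat_iso A H F" by (rule nat_iso_trans[OF thinD(1)[OF v] F thin_unique[OF v u] G(2)])
  then show "H \<in> iso_class A (D' A) F" using cls_D[OF S H] by (simp add: iso_class_def)
 }
qed

lemma nat_iso_refl: "lin G \<Longrightarrow> nat_iso A G G" for G :: "('a, 'k) endo_k"
 by (rule nat_isoI[OF _ _ ntr_id ntr_id]) simp_all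

lemma indec_classes_cls: "indec_classes A (D' A) = cls ` (PS \<union> PR)"
proof -
 have 1: "iso_class A (D' A) F = cls S" if "S \<in> PS \<union> PR" "F \<in> cls S" for F S
  by (rule iso_class_cls[OF that(1) cls_lin[OF that(2)] that(2) nat_iso_refl[OF cls_lin[OF that(2)]]])
 have "{F. indecomposable_in A (D' A) F} = TC" using indecomposable_TC TC_indecomposable by blast
 then show ?thesis
  unfolding indec_classes_def
 proof (intro equalityI subsetI)
  fix U assume "U \<in> iso_class A (D' A) ` {F. indecomposable_in A (D' A) F}"
  then obtain F where "indecomposable_in A (D' A) F" "U = iso_class A (D' A) F" by blast
  then show "U \<in> cls ` (PS \<union> PR)" using indecomposable_TC[of F] TC_cls[of F] 1[of _ F] by blast
 next
  fix U assume "U \<in> cls ` (PS \<union> PR)"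
  then obtain S where S: "S \<in> PS \<union> PR" "U = cls S" by blast
  obtain F where "F \<in> cls S" using cls_nonempty[OF S(1)] by blast
  then show "U \<in> iso_class A (D' A) ` {F. indecomposable_in A (D' A) F}"
   using TC_indecomposable[OF cls_TC[OF S(1)]] 1[OF S(1)] S(2) by blast
 qed
qed

lemma iso_class_Dp:
 assumes I: "indecomposable_ideal A I"
 shows "iso_class A (D' A) (Dp A I) = cls (SI I)"
proof -
 have I: "ideal I A" "conn (SI I)" using I by (simp_all add: indecomposable_ideal_iff)
 note Dl = tensor_functor_lin[OF ideal_bimod[OF I(1)], folded Dp_def]
 obtain G :: "('a, 'k) endo_k" where G: "lin G" "nat_iso A G (Dp A I)"
  using functor_transport[OF Dl] by (elim exE conjE)
 have "G \<in> cls (SI I)" unfolding cls_def using thin_of_ideal[OF I(1) G] by simp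
 from iso_class_cls[OF conn_PS_PR Dl this G(2)] show ?thesis by (simp add: I SI_sub)
qed

lemma iso_class_F:
 assumes "i \<in> V" "j \<in> V"
 shows "iso_class A (D' A) (tensor_functor A (OB (E i i) (E j j))) = cls (up i j)"
proof -
 note e = Ev_closed[OF assms(1)] E_idem[OF assms(1)] Ev_closed[OF assms(2)] E_idem[OF assms(2)]
 obtain G w where G: "repF G (E i i) (E j j) w" "nat_iso A G (tensor_functor A (OB (E i i) (E j j)))"
  using F_exists[OF assms] by (elim exE conjE)
 have "G \<in> cls (up i j)" unfolding cls_def using thin_up[OF G(1) assms] by blast
 then show ?thesis
  by (rule iso_class_cls[OF _ tensor_functor_lin[OF outer_bimod[OF e]] _ G(2), rotated]) (use up_PR[OF assms] in simp)
qed

text \<open>The identity is tensoring with the unit ideal; by \<open>D_retr\<close> it is enough to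
  exhibit it as a retract of that functor. It makes the preorders reflexive and the one-sided ones
  special cases of \<open>ge_J\<close>.\<close>

lemma IdF_D: "(IdF :: ('a, 'k) endo_k) \<in> D' A"
proof -
 let ?B = "ideal_bimod A (carrier A)" and ?I = "IdF :: ('a, 'k) endo_k"
 have id: "ideal (carrier A) A" by (rule oneideal)
 note B = ideal_bimod[OF id]
 obtain G :: "('a, 'k) endo_k" where G: "lin G" "nat_iso A G (tensor_functor A ?B)"
  using functor_transport[OF tensor_functor_lin[OF B]] by (elim exE conjE)
 obtain w where w: "rep G ?B w" using rep_exists[OF B G] by (elim exE)
 note r = repD[OF w, unfolded ideal_bimod_simps]
 have I: "lin ?I" by (rule IdF_lin)
 have GD: "G \<in> D' A" by (rule gens_D) (use G id in \<open>auto simp: gens_def Dp_def\<close>)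
 have act_I: "act ?I M m (jA a) = a \<odot>\<^bsub>M\<^esub> m" if "a \<in> carrier A" for M m a
  using that by (simp add: act_def IdF_def rmap_apply jA_closed jinv_jA)
 have IP: "obj ?I M = M" for M by (simp add: IdF_def)
 obtain \<pi> where p: "ntr G ?I \<pi>" "\<And>b. b \<in> carrier ?B \<Longrightarrow> \<pi> PA (w b) = jA b"
  by (rule rep_ntr[OF w B I, of jA])
   (simp_all add: ideal_bimod_simps IP jA_closed jA_add jA_smult rt_def act_I)
 let ?g = "w \<one>"
 note gc = r(2)[OF one_closed]
 have ag: "a \<odot>\<^bsub>obj G PA\<^esub> ?g = rt G ?g a" if "a \<in> carrier A" for a
  using r(4)[OF one_closed that] r(5)[OF one_closed that] that by simp
 have i: "ntr ?I G (\<lambda>M m. act G M m ?g)"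
 proof (rule ntrI)
  fix M :: "('a, 'k) mod_k" assume M: "fd M"
  show "lin_map (obj ?I M) (obj G M) (\<lambda>m. act G M m ?g)"
   unfolding IP
   by (rule lin_mapI) (simp_all add: act_closed[OF G(1) M _ gc] act_add_left[OF G(1) M _ _ gc] act_smult_left[OF G(1) M _ _ gc]
     ag[symmetric] act_smult[OF G(1) M _ gc])
  show "act G N (mor ?I M N f x) ?g = mor G M N f (act G M x ?g)"
   if "fd N" "f \<in> mhom A M N" "x \<in> carrier (obj ?I M)" for N f x
   using act_mor[OF G(1) M that(1,2) _ gc, of x] that(3) by (simp add: IdF_def)
 qed
 have "retr ?I G"
 proof (rule retrI[OF i p(1)])
  fix M :: "('a, 'k) mod_k" and x assume M: "fd M" and "x \<in> carrier (obj ?I M)"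
  then have x: "x \<in> carrier M" by (simp add: IP)
  show "\<pi> M (act G M x ?g) = x"
   using ntr_act[OF p(1) M x gc] p(2)[of "\<one>"] act_I[OF one_closed] m_one[OF M x] by (simp add: ideal_bimod_simps)
 qed
 then show ?thesis by (rule D_retr[OF I GD])
qed

lemma ge_refl: "G \<in> D' A \<Longrightarrow> ge_L A (D' A) G G" "G \<in> D' A \<Longrightarrow> ge_R A (D' A) G G"
 unfolding ge_L_def ge_R_def using summand_D[OF D_lin _ retr_refl, of G] IdF_D comp_IdF[of G] by force+

lemma ge_L_J: "ge_L A (D' A) G F \<Longrightarrow> ge_J A (D' A) G F"
 unfolding ge_L_def ge_J_def using IdF_D by (metis comp_IdF(1))

lemma ge_R_J: "ge_R A (D' A) G F \<Longrightarrow> ge_J A (D' A) G F"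
 unfolding ge_R_def ge_J_def using IdF_D by (metis comp_IdF(2))

lemma no_retr_PR:
 fixes U W :: "('a, 'k) endo_k"
 assumes G: "G \<in> cls S" and S: "S \<in> PS" and H: "H \<in> cls T" "T \<in> PR" and U: "lin U" and W: "lin W"
 shows "\<not> retr G (U \<circ>\<^sub>F H \<circ>\<^sub>F W)"
proof
 assume r: "retr G (U \<circ>\<^sub>F H \<circ>\<^sub>F W)"
 obtain u where u: "thin G S u" using G unfolding cls_def by blast
 obtain k l where kl: "k \<in> V" "l \<in> V" "T = up k l" using H(2) unfolding PR_def by blast
 obtain K w where K: "repF K (E k k) (E l l) w" "K \<in> cls (up k l)" by (rule cls_repF[OF kl(1,2)])
 obtain v v' where v: "thin H (up k l) v" "thin K (up k l) v'" using H(1) K(2) kl(3) unfolding cls_def by blast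
 have "retr (U \<circ>\<^sub>F H \<circ>\<^sub>F W) (U \<circ>\<^sub>F K \<circ>\<^sub>F W)"
  by (rule retr_whisker_right[OF W retr_whisker_left[OF U thinD(1)[OF v(1)] thinD(1)[OF v(2)] nat_iso_retr[OF thin_unique[OF v]]]])
 from no_retr[OF u _ _ _ K(1) kl(1,2) U W] retr_trans[OF r this] S show False unfolding PS_def by blast
qed

lemma ge_J_retr:
 fixes F :: "('a, 'k) endo_k"
 assumes G: "G \<in> TC" and F: "lin F" and ge: "ge_J A (D' A) G F"
 obtains Y Y' where "Y \<in> TC" "Y' \<in> TC" "retr G (Y \<circ>\<^sub>F F \<circ>\<^sub>F Y')"
proof -
 obtain H H' where H: "H \<in> D' A" "H' \<in> D' A" "is_summand A (D' A) G (H \<circ>\<^sub>F F \<circ>\<^sub>F H')" using ge unfolding ge_J_def by blast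
 have "retr G (H \<circ>\<^sub>F (F \<circ>\<^sub>F H'))" using summand_retr[OF H(3)] by (simp add: comp_assoc)
 from reduce_left[OF G H(1) functor_comp_lin[OF F D_lin[OF H(2)]] this] obtain Y
  where Y: "Y \<in> TC" "retr G (Y \<circ>\<^sub>F F \<circ>\<^sub>F H')" by (auto simp: comp_assoc)
 from reduce_right[OF G H(2) functor_comp_lin[OF subsetD[OF TC_lin Y(1)] F] Y(2)] show thesis using that Y(1) by blast
qed

text \<open>By \<open>no_retr_PR\<close> all factors of the product are nonprincipal, so the outer
  ones are subsets of \<open>Lam\<close>. A pair \<open>(a, b)\<close> in \<open>S\<close> is then
  linked through \<open>(a, c)\<close> in \<open>Lam\<close>, \<open>(c, d)\<close> in
  \<open>T\<close> and \<open>(d, b)\<close> in \<open>Lam\<close>, and \<open>T\<close> is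
  up-closed.\<close>

lemma ge_J_PS:
 assumes S: "S \<in> PS" and T: "T \<in> PS \<union> PR" and G: "G \<in> cls S" and F: "F \<in> cls T" and ge: "ge_J A (D' A) G F"
 shows "T \<in> PS" "S \<subseteq> T"
proof -
 note Fl = cls_lin[OF F] and Gl = cls_lin[OF G]
 have I: "(IdF :: ('a, 'k) endo_k) \<in> lin_functors A" by (rule IdF_lin)
 obtain Y Y' where Y: "Y \<in> TC" "Y' \<in> TC" and r: "retr G (Y \<circ>\<^sub>F F \<circ>\<^sub>F Y')"
  by (rule ge_J_retr[OF cls_TC[OF _ G] Fl ge]) (use S in blast)
 note Yl = subsetD[OF TC_lin Y(1)] subsetD[OF TC_lin Y(2)]
 show TS: "T \<in> PS" using no_retr_PR[OF G S F _ Yl] r T by blast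
 obtain R R' where R: "R \<in> PS \<union> PR" "Y \<in> cls R" "R' \<in> PS \<union> PR" "Y' \<in> cls R'" using Y TC_cls by blast
 \<comment> \<open>Identity functors pad the composite so that each factor in turn becomes the
   middle one.\<close>
 have r1: "retr G (IdF \<circ>\<^sub>F Y \<circ>\<^sub>F (F \<circ>\<^sub>F Y'))" using r by (simp add: comp_IdF comp_assoc)
 have "R \<in> PS" using no_retr_PR[OF G S R(2) _ I functor_comp_lin[OF Fl Yl(2)]] r1 R(1) by blast
 moreover have r2: "retr G (Y \<circ>\<^sub>F F \<circ>\<^sub>F Y' \<circ>\<^sub>F IdF)" using r by (simp add: comp_IdF)
 have "R' \<in> PS" using no_retr_PR[OF G S R(4) _ functor_comp_lin[OF Yl(1) Fl] I] r2 R(3) by blast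
 ultimately have L: "R \<subseteq> Lam" "R' \<subseteq> Lam" by (simp_all add: PS_def)
 obtain u v y y' where t: "thin G S u" "thin F T v" "thin Y R y" "thin Y' R' y'" using G F R unfolding cls_def by blast
 show "S \<subseteq> T"
 proof (rule subrelI)
  fix a b assume ab: "(a, b) \<in> S"
  note V = filtD(1,2)[OF thinD(2)[OF t(1)] ab]
  have "supp G a b" using supp_thin[OF t(1) V] ab by simp
  from supp_retr[OF Gl functor_comp_lin[OF functor_comp_lin[OF Yl(1) Fl] Yl(2)] r this V]
  have "supp (Y \<circ>\<^sub>F (F \<circ>\<^sub>F Y')) a b" by (simp add: comp_assoc)
  then obtain c where c: "(a, c) \<in> R" "supp (F \<circ>\<^sub>F Y') c b" by (rule supp_comp[OF t(3) functor_comp_lin[OF Fl Yl(2)] _ V]) blast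
  have cV: "c \<in> V" by (rule filtD(2)[OF thinD(2)[OF t(3)] c(1)])
  obtain d where d: "(c, d) \<in> T" "supp Y' d b" by (rule supp_comp[OF t(2) Yl(2) c(2) cV V(2)]) blast
  have "(d, b) \<in> R'" using supp_thin[OF t(4) filtD(2)[OF thinD(2)[OF t(2)] d(1)] V(2)] d(2) by simp
  then show "(a, b) \<in> T" using filtD(5)[OF thinD(2)[OF t(2)] d(1)] c(1) L by blast
 qed
qed

text \<open>By supports of composites, left multiplication can move the second index in one
  direction only, and right multiplication the first index. With antisymmetry this keeps different
  left cells and different right cells apart.\<close>

lemma up_lin:
 assumes "G \<in> cls (up i j)" "F \<in> cls (up i' j')" "i \<in> V" "j \<in> V"
 shows "ge_L A (D' A) G F \<Longrightarrow> (j', j) \<in> Lam" and "ge_R A (D' A) G F \<Longrightarrow> (i, i') \<in> Lam"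
proof -
 obtain u v where t: "thin G (up i j) u" "thin F (up i' j') v" using assms(1,2) unfolding cls_def by blast
 note Gl = thinD(1)[OF t(1)] and Fl = thinD(1)[OF t(2)]
 have GT: "G \<in> TC" by (rule cls_TC[OF _ assms(1)]) (use up_PR assms(3,4) in blast)
 have s: "supp G i j" using supp_thin[OF t(1) assms(3,4)] up_self assms(3,4) by simp
 show "(j', j) \<in> Lam" if "ge_L A (D' A) G F"
 proof -
  obtain H where "H \<in> D' A" "retr G (H \<circ>\<^sub>F F)" using \<open>ge_L A (D' A) G F\<close> unfolding ge_L_def using summand_retr by blast
  then obtain Y where Y: "Y \<in> TC" "retr G (Y \<circ>\<^sub>F F)" using reduce_left[OF GT _ Fl] by blast
  obtain R y where y: "thin Y R y" using Y(1) unfolding TC_def by blast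
  from supp_retr[OF Gl functor_comp_lin[OF thinD(1)[OF y] Fl] Y(2) s assms(3,4)]
  obtain c where c: "(i, c) \<in> R" "supp F c j" by (rule supp_comp[OF y Fl _ assms(3,4)]) blast
  then have "(c, j) \<in> up i' j'" using supp_thin[OF t(2) filtD(2)[OF thinD(2)[OF y] c(1)] assms(4)] by simp
  then show "(j', j) \<in> Lam" by (simp add: up_def)
 qed
 show "(i, i') \<in> Lam" if "ge_R A (D' A) G F"
 proof -
  obtain H where H: "H \<in> D' A" "retr G (F \<circ>\<^sub>F H)" using \<open>ge_R A (D' A) G F\<close> unfolding ge_R_def using summand_retr by blast
  from supp_retr[OF Gl functor_comp_lin[OF Fl D_lin[OF H(1)]] H(2) s assms(3,4)]
  obtain c where "(i, c) \<in> up i' j'" by (rule supp_comp[OF t(2) D_lin[OF H(1)] _ assms(3,4)]) blast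
  then show "(i, i') \<in> Lam" by (simp add: up_def)
 qed
qed

text \<open>Instances of \<open>F_comp\<close>: an index is changed to any other by one
  multiplication on its side.\<close>

lemma up_ge:
 assumes V: "i \<in> V" "j \<in> V" "i' \<in> V" "j' \<in> V"
 shows "class_ge (ge_L A (D' A)) (cls (up i' j)) (cls (up i j))"
  and "class_ge (ge_R A (D' A)) (cls (up i j')) (cls (up i j))"
  and "class_ge (ge_J A (D' A)) (cls (up i' j')) (cls (up i j))"
proof -
 have comp: "is_summand A (D' A) K L" if "K \<in> D' A" "lin L" "nat_iso A K L" for K L
  by (rule summand_D[OF D_lin[OF that(1)] D_retr[OF that(2,1) nat_iso_retr[OF nat_iso_sym[OF that(3)]]] nat_iso_retr[OF that(3)]])
 obtain H w where H: "repF H (E i i) (E j j) w" "H \<in> cls (up i j)" "H \<in> D' A" by (rule cls_repF[OF V(1,2)])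
 obtain G v where G: "repF G (E i' i') (E i i) v" "G \<in> cls (up i' i)" "G \<in> D' A" by (rule cls_repF[OF V(3,1)])
 obtain G' v' where G': "repF G' (E j j) (E j' j') v'" "G' \<in> cls (up j j')" "G' \<in> D' A" by (rule cls_repF[OF V(2,4)])
 note l = D_lin[OF H(3)] D_lin[OF G(3)] D_lin[OF G'(3)]
 obtain K x where K: "repF K (E i' i') (E j j) x" "K \<in> cls (up i' j)" "K \<in> D' A" by (rule cls_repF[OF V(3,2)])
 have 1: "is_summand A (D' A) K (G \<circ>\<^sub>F H)"
  by (rule comp[OF K(3) functor_comp_lin[OF l(2,1)] F_comp[OF G(1) H(1) K(1) V(3,1,2)]])
 then show "class_ge (ge_L A (D' A)) (cls (up i' j)) (cls (up i j))"
  unfolding class_ge_def ge_L_def using K(2) H(2) G(3) by blast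
 obtain L y where L: "repF L (E i i) (E j' j') y" "L \<in> cls (up i j')" "L \<in> D' A" by (rule cls_repF[OF V(1,4)])
 have 2: "is_summand A (D' A) L (H \<circ>\<^sub>F G')"
  by (rule comp[OF L(3) functor_comp_lin[OF l(1,3)] F_comp[OF H(1) G'(1) L(1) V(1,2,4)]])
 then show "class_ge (ge_R A (D' A)) (cls (up i j')) (cls (up i j))"
  unfolding class_ge_def ge_R_def using L(2) H(2) G'(3) by blast
 obtain M z where M: "repF M (E i' i') (E j' j') z" "M \<in> cls (up i' j')" "M \<in> D' A" by (rule cls_repF[OF V(3,4)])
 note LHG = F_comp[OF H(1) G'(1) L(1) V(1,2,4)] and MGL = F_comp[OF G(1) L(1) M(1) V(3,1,4)]
 note lH = functor_comp_lin[OF l(1,3)] and lL = D_lin[OF L(3)]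
 have "retr M (G \<circ>\<^sub>F (H \<circ>\<^sub>F G'))"
  by (rule retr_trans[OF nat_iso_retr[OF MGL] retr_whisker_left[OF l(2) lL lH nat_iso_retr[OF LHG]]])
 moreover have "G \<circ>\<^sub>F (H \<circ>\<^sub>F G') \<in> D' A"
  by (rule D_retr[OF functor_comp_lin[OF l(2) lH] M(3)
     retr_trans[OF retr_whisker_left[OF l(2) lH lL nat_iso_retr[OF nat_iso_sym[OF LHG]]] nat_iso_retr[OF nat_iso_sym[OF MGL]]]])
 ultimately have "is_summand A (D' A) M (G \<circ>\<^sub>F H \<circ>\<^sub>F G')" using summand_D[OF D_lin[OF M(3)]] by (simp add: comp_assoc)
 then show "class_ge (ge_J A (D' A)) (cls (up i' j')) (cls (up i j))"
  unfolding class_ge_def ge_J_def using M(2) H(2) G(3) G'(3) by blast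
qed

text \<open>Shared by the three preorders, which differ only in the relation \<open>P\<close> they
  induce among principal sets. On \<open>PS\<close>, equivalence means inclusion both ways, so cells
  are singletons; by \<open>ge_J_PS\<close> no class from \<open>PS\<close> lies above one from
  \<open>PR\<close>, so the two kinds never mix.\<close>

lemma cells_cls:
 assumes J: "\<And>G F. ge G F \<Longrightarrow> ge_J A (D' A) G F"
  and refl: "\<And>G. G \<in> D' A \<Longrightarrow> ge G G"
  and up: "\<And>i j i' j'. i \<in> V \<Longrightarrow> j \<in> V \<Longrightarrow> i' \<in> V \<Longrightarrow> j' \<in> V \<Longrightarrow>
   class_ge ge (cls (up i j)) (cls (up i' j')) \<and> class_ge ge (cls (up i' j')) (cls (up i j)) \<longleftrightarrow> P i j i' j'"
 shows "cells A (D' A) ge = {{cls S} | S. S \<in> PS} \<union>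
  {{cls (up i' j') | i' j'. i' \<in> V \<and> j' \<in> V \<and> P i j i' j'} | i j. i \<in> V \<and> j \<in> V}"
proof -
 let ?R = "{(U, W) \<in> cls ` (PS \<union> PR) \<times> cls ` (PS \<union> PR). class_ge ge U W \<and> class_ge ge W U}"
 have one: "?R `` {cls S} = {cls S}" if S: "S \<in> PS" for S
 proof (intro equalityI subsetI)
  fix W assume "W \<in> ?R `` {cls S}"
  then obtain T where T: "T \<in> PS \<union> PR" "W = cls T" "class_ge ge (cls S) (cls T)" "class_ge ge (cls T) (cls S)" by blast
  have 1: "T \<in> PS" "S \<subseteq> T" using T(3) ge_J_PS[OF S T(1)] J unfolding class_ge_def by blast+
  moreover have "T \<subseteq> S" using T(4) ge_J_PS(2)[OF 1(1), of S] S J unfolding class_ge_def by blast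
  ultimately show "W \<in> {cls S}" using T(2) equalityI[of S T] by simp
 next
  fix W assume "W \<in> {cls S}"
  moreover obtain G where "G \<in> cls S" using cls_nonempty S by blast
  ultimately show "W \<in> ?R `` {cls S}" using S refl[OF cls_D] unfolding class_ge_def by blast
 qed
 have two: "?R `` {cls (up i j)} = {cls (up i' j') | i' j'. i' \<in> V \<and> j' \<in> V \<and> P i j i' j'}" if ij: "i \<in> V" "j \<in> V" for i j
 proof (intro equalityI subsetI)
  fix W assume "W \<in> ?R `` {cls (up i j)}"
  then obtain T where T: "T \<in> PS \<union> PR" "W = cls T" "class_ge ge (cls (up i j)) (cls T)" "class_ge ge (cls T) (cls (up i j))" by blast
  have "T \<notin> PS"
  proof
   assume TS: "T \<in> PS"
   have "up i j \<in> PS" using T(4) ge_J_PS(1)[OF TS, of "up i j"] up_PR[OF ij] J unfolding class_ge_def by blast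
   then show False using ij unfolding PS_def principal_def by blast
  qed
  then obtain i' j' where "i' \<in> V" "j' \<in> V" "T = up i' j'" using T(1) unfolding PR_def by blast
  then show "W \<in> {cls (up i' j') | i' j'. i' \<in> V \<and> j' \<in> V \<and> P i j i' j'}" using up[OF ij] T(2-4) by blast
 next
  fix W assume "W \<in> {cls (up i' j') | i' j'. i' \<in> V \<and> j' \<in> V \<and> P i j i' j'}"
  then show "W \<in> ?R `` {cls (up i j)}" using up[OF ij] up_PR ij by blast
 qed
 have q: "f ` (X1 \<union> X2) // r = {r `` {f S} | S. S \<in> X1} \<union> {r `` {f S} | S. S \<in> X2}"
  for f :: "('v \<times> 'v) set \<Rightarrow> 'z" and X1 X2 r unfolding quotient_def by blast
 have "cells A (D' A) ge = {?R `` {cls S} | S. S \<in> PS} \<union> {?R `` {cls S} | S. S \<in> PR}"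
  unfolding cells_def indec_classes_cls by (rule q)
 also have "{?R `` {cls S} | S. S \<in> PS} = {{cls S} | S. S \<in> PS}"
  by (simp only: one cong: rev_conj_cong)
 also have "{?R `` {cls S} | S. S \<in> PR} = {?R `` {cls (up i j)} | i j. i \<in> V \<and> j \<in> V}" unfolding PR_def by blast
 also have "\<dots> = {{cls (up i' j') | i' j'. i' \<in> V \<and> j' \<in> V \<and> P i j i' j'} | i j. i \<in> V \<and> j \<in> V}"
  by (simp only: two cong: rev_conj_cong)
 finally show ?thesis .
qed

theorem incidence_cells:
 assumes ne: "V \<noteq> {}"
 shows "left_cells A (D' A) = {{cls S} | S. S \<in> PS} \<union> {{cls (up i j) | i. i \<in> V} | j. j \<in> V}"
  and "right_cells A (D' A) = {{cls S} | S. S \<in> PS} \<union> {{cls (up i j) | j. j \<in> V} | i. i \<in> V}"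
  and "two_sided_cells A (D' A) = {{cls S} | S. S \<in> PS} \<union> {{cls (up i j) | i j. i \<in> V \<and> j \<in> V}}"
  and "maximal_two_sided_cell A (D' A) {cls (up i j) | i j. i \<in> V \<and> j \<in> V}"
proof -
 have "cells A (D' A) (ge_L A (D' A)) = {{cls S} | S. S \<in> PS} \<union>
   {{cls (up i' j') | i' j'. i' \<in> V \<and> j' \<in> V \<and> j' = j} | i j. i \<in> V \<and> j \<in> V}"
 proof (rule cells_cls[OF ge_L_J ge_refl(1)])
  fix i j i' j' assume V: "i \<in> V" "j \<in> V" "i' \<in> V" "j' \<in> V"
  show "class_ge (ge_L A (D' A)) (cls (up i j)) (cls (up i' j')) \<and> class_ge (ge_L A (D' A)) (cls (up i' j')) (cls (up i j)) \<longleftrightarrow> j' = j"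
   using up_ge(1)[of i' j i] up_ge(1)[of i j i'] up_lin(1)[of _ i j _ i' j'] up_lin(1)[of _ i' j' _ i j] V Lam_antisym
   unfolding class_ge_def by blast
 qed
 then show "left_cells A (D' A) = {{cls S} | S. S \<in> PS} \<union> {{cls (up i j) | i. i \<in> V} | j. j \<in> V}"
  unfolding left_cells_def by auto
 have "cells A (D' A) (ge_R A (D' A)) = {{cls S} | S. S \<in> PS} \<union>
   {{cls (up i' j') | i' j'. i' \<in> V \<and> j' \<in> V \<and> i' = i} | i j. i \<in> V \<and> j \<in> V}"
 proof (rule cells_cls[OF ge_R_J ge_refl(2)])
  fix i j i' j' assume V: "i \<in> V" "j \<in> V" "i' \<in> V" "j' \<in> V"
  show "class_ge (ge_R A (D' A)) (cls (up i j)) (cls (up i' j')) \<and> class_ge (ge_R A (D' A)) (cls (up i' j')) (cls (up i j)) \<longleftrightarrow> i' = i"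
   using up_ge(2)[of i j' j] up_ge(2)[of i j j'] up_lin(2)[of _ i j _ i' j'] up_lin(2)[of _ i' j' _ i j] V Lam_antisym
   unfolding class_ge_def by blast
 qed
 then show "right_cells A (D' A) = {{cls S} | S. S \<in> PS} \<union> {{cls (up i j) | j. j \<in> V} | i. i \<in> V}"
  unfolding right_cells_def by auto
 have "cells A (D' A) (ge_J A (D' A)) = {{cls S} | S. S \<in> PS} \<union>
   {{cls (up i' j') | i' j'. i' \<in> V \<and> j' \<in> V \<and> True} | i j. i \<in> V \<and> j \<in> V}"
  by (rule cells_cls) (use up_ge(3) ge_L_J[OF ge_refl(1)] in blast)+
 then show J: "two_sided_cells A (D' A) = {{cls S} | S. S \<in> PS} \<union> {{cls (up i j) | i j. i \<in> V \<and> j \<in> V}}"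
  unfolding two_sided_cells_def using ne by auto
 show "maximal_two_sided_cell A (D' A) {cls (up i j) | i j. i \<in> V \<and> j \<in> V}"
  unfolding maximal_two_sided_cell_def J
 proof (intro conjI ballI impI)
  fix J' assume J': "J' \<in> {{cls S} | S. S \<in> PS} \<union> {{cls (up i j) | i j. i \<in> V \<and> j \<in> V}}"
   and ge: "\<exists>W\<in>J'. \<exists>U\<in>{cls (up i j) | i j. i \<in> V \<and> j \<in> V}. class_ge (ge_J A (D' A)) W U"
  show "J' = {cls (up i j) | i j. i \<in> V \<and> j \<in> V}"
  proof (rule ccontr)
   assume "J' \<noteq> {cls (up i j) | i j. i \<in> V \<and> j \<in> V}"
   then obtain S where S: "S \<in> PS" "J' = {cls S}" using J' by blast
   obtain i j where ij: "i \<in> V" "j \<in> V" "class_ge (ge_J A (D' A)) (cls S) (cls (up i j))" using ge S(2) by blast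
   have "up i j \<in> PS" using ij(3) ge_J_PS(1)[OF S(1), of "up i j"] up_PR[OF ij(1,2)] unfolding class_ge_def by blast
   then show False using ij(1,2) unfolding PS_def principal_def by blast
  qed
 qed simp
qed

section \<open>Minimal generating sets of paths\<close>

definition EE :: "('v \<times> 'v) set \<Rightarrow> 'a set" where
 "EE T = (\<lambda>(a, b). E a b) ` T"

lemma IS_least:
 assumes J: "ideal J A" and S: "S \<subseteq> SI J"
 shows "IS S \<subseteq> J"
proof
 interpret J: ideal J A by (rule J)
 fix x assume "x \<in> IS S"
 then show "x \<in> J"
  unfolding IS_def by (induction rule: add_span.induct) (use S in \<open>auto simp: SI_def intro!: ideal_ks[OF J]\<close>)
qed

lemma IS_SI: "ideal I A \<Longrightarrow> IS (SI I) = I"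
 using IS_least[of I "SI I"] ideal_span[of I] by (auto simp: IS_def)

text \<open>Under the correspondence of ideals with up-closed sets, generating an ideal becomes
  taking the union of principal up-sets.\<close>

lemma genideal_EE:
 assumes I: "ideal I A" and T: "T \<subseteq> Lam"
 shows "Idl\<^bsub>A\<^esub> (EE T) = I \<longleftrightarrow> (\<Union>(i, j)\<in>T. up i j) = SI I"
proof -
 let ?U = "\<Union>(i, j)\<in>T. up i j"
 have f: "filt ?U"
  unfolding filt_def
 proof (intro conjI allI impI)
  show "?U \<subseteq> V \<times> V" using Lam_V by (auto simp: up_def)
  fix a b a' b' assume "(a, b) \<in> ?U" and l: "(a', a) \<in> Lam" "(b, b') \<in> Lam"
  then obtain i j where ij: "(i, j) \<in> T" "(a, b) \<in> up i j" by blast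
  show "(a', b') \<in> ?U" using filtD(5)[OF up_filt ij(2) l] ij(1) by blast
 qed
 have UL: "?U \<subseteq> Lam"
 proof (rule subrelI)
  fix a b assume "(a, b) \<in> ?U"
  then obtain i j where "(i, j) \<in> T" "(a, i) \<in> Lam" "(j, b) \<in> Lam" by (auto simp: up_def)
  then show "(a, b) \<in> Lam" using T Lam_trans by blast
 qed
 have TU: "T \<subseteq> ?U"
 proof (rule subrelI)
  fix i j assume ij: "(i, j) \<in> T"
  then have "(i, j) \<in> up i j" using T Lam_V up_self by blast
  then show "(i, j) \<in> ?U" using ij by blast
 qed
 note IU = IS_ideal[OF f UL]
 have "Idl\<^bsub>A\<^esub> (EE T) = IS ?U"
 proof (rule equalityI)
  show "Idl\<^bsub>A\<^esub> (EE T) \<subseteq> IS ?U"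
   by (rule genideal_minimal[OF IU]) (use IS_E[OF UL subsetD[OF TU]] in \<open>auto simp only: EE_def\<close>)
  have Ec: "EE T \<subseteq> carrier A" using T E_closed by (auto simp: EE_def)
  note J = genideal_ideal[OF Ec]
  have "T \<subseteq> SI (Idl\<^bsub>A\<^esub> (EE T))" using T genideal_self[OF Ec] by (auto simp: SI_def EE_def)
  then have "?U \<subseteq> SI (Idl\<^bsub>A\<^esub> (EE T))" using up_subset[OF SI_filt[OF J]] by blast
  then show "IS ?U \<subseteq> Idl\<^bsub>A\<^esub> (EE T)" by (rule IS_least[OF J])
 qed
 then show ?thesis using SI_IS[OF f UL] IS_SI[OF I] by metis
qed

lemma mins_sub: "mins S \<subseteq> S"
 by (auto simp: mins_def)

text \<open>A family of principal up-sets covers \<open>SI I\<close> only if every minimal element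
  is among its base points, and by finiteness the minimal elements alone suffice. Hence the minimal
  generating set is unique.\<close>

lemma minimal_generators:
 assumes I: "ideal I A" and T: "T \<subseteq> Lam"
 shows "Idl\<^bsub>A\<^esub> (EE T) = I \<and> (\<forall>T'. T' \<subset> T \<longrightarrow> Idl\<^bsub>A\<^esub> (EE T') \<noteq> I) \<longleftrightarrow> T = mins (SI I)"
proof -
 note f = SI_filt[OF I]
 have m: "(\<Union>(i, j)\<in>mins (SI I). up i j) = SI I"
  using mins_below[OF f] up_subset[OF f] mins_sub by fast
 have sub: "mins (SI I) \<subseteq> T'" if "(\<Union>(i, j)\<in>T'. up i j) = SI I" "T' \<subseteq> Lam" for T'
 proof (rule subrelI)
  fix i j assume ij: "(i, j) \<in> mins (SI I)"
  then have "(i, j) \<in> (\<Union>(i, j)\<in>T'. up i j)" using mins_sub that(1) by blast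
  then obtain a b where ab: "(a, b) \<in> T'" "(i, j) \<in> up a b" by blast
  have "(a, b) \<in> up a b" using that(2) ab(1) up_self Lam_V by blast
  then have "(a, b) \<in> SI I" using that(1) ab(1) by blast
  then show "(i, j) \<in> T'" using ij ab unfolding mins_def by blast
 qed
 have L: "mins (SI I) \<subseteq> Lam" using mins_sub SI_sub by blast
 have g: "Idl\<^bsub>A\<^esub> (EE T') = I \<longleftrightarrow> (\<Union>(i, j)\<in>T'. up i j) = SI I" if "T' \<subseteq> Lam" for T' by (rule genideal_EE[OF I that])
 show ?thesis
 proof
  assume a: "Idl\<^bsub>A\<^esub> (EE T) = I \<and> (\<forall>T'. T' \<subset> T \<longrightarrow> Idl\<^bsub>A\<^esub> (EE T') \<noteq> I)"
  then have "mins (SI I) \<subseteq> T" using sub[OF _ T] g[OF T] by blast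
  moreover have "\<not> mins (SI I) \<subset> T" using a g[OF L] m by blast
  ultimately show "T = mins (SI I)" by blast
 next
  assume t: "T = mins (SI I)"
  have "Idl\<^bsub>A\<^esub> (EE T') \<noteq> I" if "T' \<subset> T" for T'
  proof
   assume "Idl\<^bsub>A\<^esub> (EE T') = I"
   moreover have "T' \<subseteq> Lam" using that T by blast
   ultimately have "T \<subseteq> T'" using sub[of T'] g[of T'] t by blast
   then show False using that by blast
  qed
  then show "Idl\<^bsub>A\<^esub> (EE T) = I \<and> (\<forall>T'. T' \<subset> T \<longrightarrow> Idl\<^bsub>A\<^esub> (EE T') \<noteq> I)" using g[OF T] m t by blast
 qed
qed

lemma card_mins:
 assumes S: "filt S"
 shows "card (mins S) = 1 \<longleftrightarrow> principal S"
proof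
 assume "card (mins S) = 1"
 then obtain i j where m: "mins S = {(i, j)}" by (metis card_1_singletonE surj_pair)
 then have ij: "(i, j) \<in> S" using mins_sub by blast
 have "S = up i j"
 proof (intro equalityI subrelI)
  show "(a, b) \<in> up i j" if "(a, b) \<in> S" for a b using mins_below[OF S that] unfolding m by blast
  show "(a, b) \<in> S" if "(a, b) \<in> up i j" for a b using that up_subset[OF S ij] by blast
 qed
 then show "principal S" unfolding principal_def using filtD(1,2)[OF S ij] by blast
next
 assume "principal S"
 then obtain i j where ij: "i \<in> V" "j \<in> V" "S = up i j" unfolding principal_def by blast
 have "mins S = {(i, j)}"
 proof (intro equalityI subrelI)
  show "(a, b) \<in> {(i, j)}" if "(a, b) \<in> mins S" for a b
   using that up_self[OF ij(1,2)] unfolding mins_def ij(3) by blast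
  show "(a, b) \<in> mins S" if "(a, b) \<in> {(i, j)}" for a b
   using that up_self[OF ij(1,2)] Lam_antisym unfolding mins_def ij(3) up_def by blast
 qed
 then show "card (mins S) = 1" by simp
qed

end

section \<open>Path algebras of tree quivers\<close>

lemma not_distinct_map:
 assumes "\<not> distinct (map f xs)"
 obtains as x bs y cs where "xs = as @ x # bs @ y # cs" "f x = f y"
proof -
 obtain as bs cs z where "map f xs = as @ [z] @ bs @ [z] @ cs" using not_distinct_decomp[OF assms] by blast
 then show thesis using that by (auto simp: map_eq_append_conv map_eq_Cons_conv append_eq_map_conv Cons_eq_map_conv)
qed

lemma (in pre_digraph) cas_appendI: "cas u p w \<Longrightarrow> cas w q v \<Longrightarrow> cas u (p @ q) v"
 by (induction p arbitrary: u) auto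

lemma double_simps:
 "verts (double_quiver Q) = verts Q" "arcs (double_quiver Q) = arcs Q \<times> UNIV"
 "tail (double_quiver Q) (e, True) = tail Q e" "head (double_quiver Q) (e, True) = head Q e"
 "tail (double_quiver Q) (e, False) = head Q e" "head (double_quiver Q) (e, False) = tail Q e"
 by (simp_all add: double_quiver_def)

lemma double_cas:
 "pre_digraph.cas Q u p v \<Longrightarrow> pre_digraph.cas (double_quiver Q) u (map (\<lambda>e. (e, True)) p) v"
 "pre_digraph.cas Q u p v \<Longrightarrow> pre_digraph.cas (double_quiver Q) v (rev (map (\<lambda>e. (e, False)) p)) u"
proof -
 show "pre_digraph.cas Q u p v \<Longrightarrow> pre_digraph.cas (double_quiver Q) u (map (\<lambda>e. (e, True)) p) v"
  by (induction p arbitrary: u) (simp_all add: pre_digraph.cas.simps double_simps)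
 show "pre_digraph.cas Q u p v \<Longrightarrow> pre_digraph.cas (double_quiver Q) v (rev (map (\<lambda>e. (e, False)) p)) u"
 proof (induction p arbitrary: u)
  case (Cons e p)
  then show ?case
   by (auto simp: pre_digraph.cas.simps double_simps intro!: pre_digraph.cas_appendI[of _ _ _ "head Q e"])
 qed (simp add: pre_digraph.cas.simps)
qed

text \<open>A counterexample of minimal length consists of two walks without common inner vertices;
 it gives a cycle of the underlying graph.\<close>

lemma unique_walk:
 assumes Q: "finite_tree_quiver Q"
  and p: "pre_digraph.awalk Q u p v" and q: "pre_digraph.awalk Q u q v"
 shows "p = q"
proof -
 interpret fin_digraph Q using Q by (simp add: finite_tree_quiver_def)
 show ?thesis
  using p q
 proof (induction "length p + length q" arbitrary: u v p q rule: less_induct)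
  case less
  note p = less(2) and q = less(3)
  show ?case
  proof (rule ccontr)
   assume ne: "p \<noteq> q"
   have IH: "p' = q'" if "awalk u' p' v'" "awalk u' q' v'" "length p' + length q' < length p + length q" for u' v' p' q'
    by (rule less(1)[OF that(3,1,2)])
   have sp: "awalk u xs (tail Q e) \<and> e \<in> arcs Q \<and> awalk (head Q e) ys v" if "awalk u (xs @ e # ys) v" for u v xs e ys
    using that by (auto simp: awalk_Cons_iff)
   have snoc: "awalk u (xs @ [e]) (head Q e)" if "awalk u (xs @ e # ys) v" for u v xs e ys
    using sp[OF that] by (intro awalk_appendI[of _ _ "tail Q e"]) (auto simp: awalk_simps)
   \<comment> \<open>A repeated head gives a nonempty closed walk inside \<open>p\<close>; with the
     empty walk at the same vertex it forms a smaller counterexample.\<close>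
   have dp: "distinct (map (head Q) p)"
   proof (rule ccontr)
    assume "\<not> ?thesis"
    then obtain as x bs y cs where d: "p = as @ x # bs @ y # cs" "head Q x = head Q y" by (rule not_distinct_map)
    have "awalk (head Q x) (bs @ y # cs) v" using sp p d(1) by blast
    then have w: "awalk (head Q x) (bs @ [y]) (head Q x)" using snoc d(2) by metis
    have "awalk (head Q x) [] (head Q x)" using awalk_hd_in_verts[OF w] by (simp add: awalk_Nil_iff)
    from IH[OF w this] d(1) show False by simp
   qed
   \<comment> \<open>Tails are used for \<open>q\<close> because \<open>q\<close> is going to be
     traversed backwards in the cycle.\<close>
   have dq: "distinct (map (tail Q) q)"
   proof (rule ccontr)
    assume "\<not> ?thesis"
    then obtain as x bs y cs where d: "q = as @ x # bs @ y # cs" "tail Q x = tail Q y" by (rule not_distinct_map)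
    have x: "x \<in> arcs Q" "awalk (head Q x) (bs @ y # cs) v" using sp q d(1) by blast+
    then have "awalk (head Q x) bs (tail Q y)" using sp by blast
    then have w: "awalk (tail Q x) (x # bs) (tail Q x)" using x(1) d(2) by (simp add: awalk_Cons_iff)
    have "awalk (tail Q x) [] (tail Q x)" using awalk_hd_in_verts[OF w] by (simp add: awalk_Nil_iff)
    from IH[OF w this] d(1) show False by simp
   qed
   \<comment> \<open>A common inner vertex cuts both walks into two shorter pairs with equal ends;
     these agree by induction, so \<open>p\<close> and \<open>q\<close> would be equal.\<close>
   have dj: "head Q e \<noteq> tail Q e'" if e: "e \<in> set p" "e' \<in> set q" for e e'
   proof
    assume h: "head Q e = tail Q e'"
    obtain p1 p2 q1 q2 where d: "p = p1 @ e # p2" "q = q1 @ e' # q2" using split_list[OF e(1)] split_list[OF e(2)] by blast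
    have pw: "awalk u (p1 @ e # p2) v" using p unfolding d(1) .
    have qw: "awalk u (q1 @ e' # q2) v" using q unfolding d(2) .
    have w: "awalk u q1 (head Q e)" "awalk (head Q e) p2 v" "awalk (head Q e) (e' # q2) v"
     using sp[OF pw] sp[OF qw] h by (simp_all add: awalk_Cons_iff)
    have "length (p1 @ [e]) + length q1 < length p + length q" "length p2 + length (e' # q2) < length p + length q"
     by (simp_all add: d)
    note IH[OF snoc[OF pw] w(1) this(1)] IH[OF w(2,3) this(2)]
    then show False using ne d by simp
   qed
   have dd: "e \<notin> set q" if e: "e \<in> set p" for e
   proof
    assume e': "e \<in> set q"
    obtain p1 p2 q1 q2 where d: "p = p1 @ e # p2" "q = q1 @ e # q2" using split_list[OF e] split_list[OF e'] by blast
    have pw: "awalk u (p1 @ e # p2) v" using p unfolding d(1) .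
    have qw: "awalk u (q1 @ e # q2) v" using q unfolding d(2) .
    have "length p1 + length q1 < length p + length q" "length p2 + length q2 < length p + length q" by (simp_all add: d)
    with IH sp[OF pw] sp[OF qw] have "p1 = q1" "p2 = q2" by blast+
    then show False using ne d by simp
   qed
   \<comment> \<open>Forward along \<open>p\<close> and back along \<open>q\<close>. The vertices
     after the first are the heads of \<open>p\<close> and the tails of \<open>q\<close>, which are
     distinct by the facts above.\<close>
   let ?r = "map (\<lambda>e. (e, True)) p @ rev (map (\<lambda>e. (e, False)) q)"
   interpret D: pre_digraph "double_quiver Q" .
   have cp: "cas u p v" "cas u q v" "set p \<subseteq> arcs Q" "set q \<subseteq> arcs Q" "u \<in> verts Q" using p q by (auto simp: awalk_def)
   have cr: "D.cas u ?r u" by (rule D.cas_appendI[OF double_cas(1)[OF cp(1)] double_cas(2)[OF cp(2)]])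
   have "tl (D.awalk_verts u ?r) = map (head (double_quiver Q)) ?r" using D.awalk_verts_conv'[OF cr] by simp
   also have "\<dots> = map (head Q) p @ rev (map (tail Q) q)" by (simp add: double_simps comp_def rev_map)
   finally have "distinct (tl (D.awalk_verts u ?r))" using dp dq dj by auto
   moreover have "D.awalk u ?r u" using cr cp by (auto simp: D.awalk_def double_simps)
   moreover have "?r \<noteq> []" using ne by auto
   ultimately have "D.cycle ?r" unfolding D.cycle_def by blast
   moreover have "distinct (map fst ?r)"
    using dp dq dd by (auto simp: comp_def rev_map distinct_map)
   ultimately have "underlying_cycle Q ?r" by (simp add: underlying_cycle_def)
   then show False using Q by (auto simp: finite_tree_quiver_def)
  qed
 qed
qed

section \<open>The path algebra as an incidence algebra\<close>

locale tree_algebra = fin_digraph Q for Q :: "('v, 'e) pre_digraph" +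
 fixes A :: "('k::field, ('v, 'e) qpath \<Rightarrow> 'k) module" (structure)
 assumes tree: "finite_tree_quiver Q" and A_eq: "A = path_algebra Q"
begin

abbreviation "V \<equiv> verts Q"

definition Lam where "Lam = {(a, b). \<exists>p. awalk b p a}"

definition pth where "pth a b = (THE p. awalk b p a)"

definition E where "E a b = (path_elem (b, pth a b) :: ('v, 'e) qpath \<Rightarrow> 'k)"

definition cf :: "(('v, 'e) qpath \<Rightarrow> 'k) \<Rightarrow> 'v \<Rightarrow> 'v \<Rightarrow> 'k" where
 "cf f a b = (if (a, b) \<in> Lam then f (b, pth a b) else 0)"

lemma pthI: "awalk b p a \<Longrightarrow> pth a b = p"
 unfolding pth_def using unique_walk[OF tree] by (intro the_equality) blast+

lemma LamI: "awalk b p a \<Longrightarrow> (a, b) \<in> Lam"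
 unfolding Lam_def by blast

lemma pthD: "(a, b) \<in> Lam \<Longrightarrow> awalk b (pth a b) a"
 unfolding Lam_def using pthI by auto

lemma Lam_verts: "(a, b) \<in> Lam \<Longrightarrow> a \<in> V \<and> b \<in> V"
 using pthD awalk_hd_in_verts awalk_last_in_verts by blast

lemma awalk_end: "awalk u p v \<Longrightarrow> awalk u p w \<Longrightarrow> v = w"
 using awalk_ends[of u p v u w] by auto

lemma awalk_suffix: "awalk u (p @ q) v \<Longrightarrow> awalk u p w \<Longrightarrow> awalk w q v"
 using awlast_of_awalk by simp

lemma qpaths_Lam: "qpaths Q = (\<lambda>(a, b). (b, pth a b)) ` Lam"
proof (intro equalityI subsetI)
 fix x assume "x \<in> qpaths Q"
 then obtain u p v where x: "x = (u, p)" "awalk u p v" by (auto simp: qpaths_def)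
 then show "x \<in> (\<lambda>(a, b). (b, pth a b)) ` Lam" using pthI[OF x(2)] LamI[OF x(2)] by force
qed (use pthD in \<open>auto simp: qpaths_def\<close>)

lemma qp_inj: "inj_on (\<lambda>(a, b). (b, pth a b)) Lam"
proof (rule inj_onI)
 fix x y assume x: "x \<in> Lam" and y: "y \<in> Lam" and e: "(\<lambda>(a, b). (b, pth a b)) x = (\<lambda>(a, b). (b, pth a b)) y"
 obtain a b c d where xy: "x = (a, b)" "y = (c, d)" by (cases x, cases y)
 have bd: "b = d \<and> pth a b = pth c d" using e unfolding xy prod.case prod.inject .
 have "awalk b (pth a b) a" "awalk d (pth c d) c" using pthD x y unfolding xy by blast+
 then have "a = c" using bd awalk_end by metis
 then show "x = y" using bd xy by simp
qed

lemma fin_qpaths: "finite (qpaths Q)"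
proof -
 have "Lam \<subseteq> V \<times> V" by (auto dest: Lam_verts)
 then show ?thesis unfolding qpaths_Lam by (intro finite_imageI) (rule finite_subset, auto)
qed

lemma A_simps:
 "carrier A = {f. {p. f p \<noteq> 0} \<subseteq> qpaths Q}" "\<zero> = (\<lambda>_. 0)" "f \<oplus> g = (\<lambda>p. f p + g p)" "c \<odot> f = (\<lambda>p. c * f p)"
 using finite_subset[OF _ fin_qpaths] by (auto simp: A_eq path_algebra_def)

text \<open>Together with \<open>cf_mult\<close> this embeds the path algebra into matrices indexed
  by vertices, so that ring identities become matrix identities.\<close>

lemma cf_eqI:
 assumes f: "f \<in> carrier A" and g: "g \<in> carrier A" and e: "\<And>a b. cf f a b = cf g a b"
 shows "f = g"
proof
 fix x
 show "f x = g x"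
 proof (cases "x \<in> qpaths Q")
  case True
  then obtain a b where ab: "(a, b) \<in> Lam" "x = (b, pth a b)" by (auto simp: qpaths_Lam)
  then show ?thesis using e[of a b] by (simp add: cf_def)
 next
  case False
  then have "f x = 0" "g x = 0" using f g by (auto simp: A_simps)
  then show ?thesis by simp
 qed
qed

text \<open>A nonzero term of the convolution comes from two paths whose concatenation is the list
  at which the product is evaluated, so that list is a path.\<close>

lemma mult_closed: "f \<in> carrier A \<Longrightarrow> g \<in> carrier A \<Longrightarrow> f \<otimes> g \<in> carrier A"
proof -
 assume f: "f \<in> carrier A" and g: "g \<in> carrier A"
 have "(f \<otimes> g) (u, p) = 0" if n: "(u, p) \<notin> qpaths Q" for u p
 proof -
  have "f (last (awalk_verts u (take n p)), drop n p) * g (u, take n p) = 0" for n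
  proof (rule ccontr)
   assume "\<not> ?thesis"
   then have "(last (awalk_verts u (take n p)), drop n p) \<in> qpaths Q" "(u, take n p) \<in> qpaths Q"
    using f g by (auto simp: A_simps)
   then obtain w v where "awalk u (take n p) w" "awalk (last (awalk_verts u (take n p))) (drop n p) v" by (auto simp: qpaths_def)
   then have "awalk u (take n p @ drop n p) v" by (intro awalk_appendI) auto
   then show False using n by (auto simp: qpaths_def)
  qed
  then show ?thesis unfolding A_eq path_algebra_def by (simp only: partial_object.simps monoid.simps prod.case sum.neutral_const)
 qed
 then show ?thesis by (auto simp: A_simps)
qed

lemma Lam_refl: "a \<in> V \<Longrightarrow> (a, a) \<in> Lam" and pth_refl: "a \<in> V \<Longrightarrow> pth a a = []"
 using LamI[of a "[]" a] pthI[of a "[]" a] by (simp_all add: awalk_Nil_iff)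

lemma Lam_append: "(a, c) \<in> Lam \<Longrightarrow> (c, b) \<in> Lam \<Longrightarrow> (a, b) \<in> Lam \<and> pth a b = pth c b @ pth a c"
proof -
 assume l: "(a, c) \<in> Lam" "(c, b) \<in> Lam"
 note w = awalk_appendI[OF pthD[OF l(2)] pthD[OF l(1)]]
 show ?thesis using LamI[OF w] pthI[OF w] by simp
qed

text \<open>The positions on a path correspond to the vertices between its end points.\<close>

lemma cf_mult: "cf (f \<otimes> g) a b = (\<Sum>c\<in>V. cf f a c * cf g c b)"
proof (cases "(a, b) \<in> Lam")
 case False
 then have "cf f a c * cf g c b = 0" for c using Lam_append by (auto simp: cf_def)
 then show ?thesis using False by (simp only: sum.neutral_const) (simp add: cf_def)
next
 case True
 let ?C = "{c. (a, c) \<in> Lam \<and> (c, b) \<in> Lam}"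
 define p where "p = pth a b"
 define w where "w n = last (awalk_verts b (take n p))" for n
 have ww: "awalk b (take n p) (w n) \<and> awalk (w n) (drop n p) a" for n
  using pthD[OF True] awalk_append_iff[of b "take n p" "drop n p" a] by (simp add: p_def w_def)
 have t: "pth (w n) b = take n p" "pth a (w n) = drop n p" "w n \<in> ?C" for n
  using pthI[OF conjunct1[OF ww]] pthI[OF conjunct2[OF ww]] LamI[OF conjunct1[OF ww]] LamI[OF conjunct2[OF ww]] by simp_all
 have bij: "bij_betw w {..length p} ?C"
  unfolding bij_betw_def
 proof
  show "inj_on w {..length p}"
  proof (rule inj_onI)
   fix n m assume nm: "n \<in> {..length p}" "m \<in> {..length p}" "w n = w m"
   have "take n p = take m p" using t(1)[of n] t(1)[of m] nm(3) by simp
   then have "length (take n p) = length (take m p)" by (rule arg_cong)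
   then show "n = m" using nm(1,2) by simp
  qed
  show "w ` {..length p} = ?C"
  proof (intro equalityI subsetI)
   fix c assume "c \<in> ?C"
   then have c: "(a, c) \<in> Lam" "(c, b) \<in> Lam" by auto
   have pc: "p = pth c b @ pth a c" using Lam_append[OF c] by (simp add: p_def)
   have "w (length (pth c b)) = c" using pthD[OF c(2)] by (simp add: w_def pc)
   moreover have "length (pth c b) \<le> length p" by (simp add: pc)
   ultimately show "c \<in> w ` {..length p}" by force
  qed (use t(3) in auto)
 qed
 have "cf (f \<otimes> g) a b = (\<Sum>n\<le>length p. f (w n, drop n p) * g (b, take n p))"
  using True by (simp add: cf_def A_eq path_algebra_def p_def w_def)
 also have "\<dots> = (\<Sum>n\<le>length p. cf f a (w n) * cf g (w n) b)"
  using t(3) by (intro sum.cong refl) (simp add: cf_def t(1,2))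
 also have "\<dots> = (\<Sum>c\<in>?C. cf f a c * cf g c b)" by (rule sum.reindex_bij_betw[OF bij])
 also have "\<dots> = (\<Sum>c\<in>V. cf f a c * cf g c b)"
  by (rule sum.mono_neutral_left) (use Lam_verts in \<open>auto simp: cf_def\<close>)
 finally show ?thesis .
qed

lemma cf_add': "cf (f \<oplus> g) a b = cf f a b + cf g a b"
 by (simp add: cf_def A_simps)

lemma cf_ks': "cf (r \<odot> f) a b = r * cf f a b"
 by (simp add: cf_def A_simps)

lemma E_carrier: "(a, b) \<in> Lam \<Longrightarrow> E a b \<in> carrier A"
 by (auto simp: A_simps E_def path_elem_def qpaths_Lam)

lemma cf_E': "(a, b) \<in> Lam \<Longrightarrow> cf (E a b) a' b' = (if a = a' \<and> b = b' then 1 else 0)"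
 using inj_onD[OF qp_inj, of "(a', b')" "(a, b)"] by (auto simp: cf_def E_def path_elem_def)

lemma one_carrier: "\<one> \<in> carrier A" and cf_one: "cf \<one> a b = (if a = b \<and> a \<in> V then 1 else 0)"
proof -
 have o: "\<one> (u, p) = (if u \<in> V \<and> p = [] then 1 else 0)" for u p by (simp add: A_eq path_algebra_def)
 show "\<one> \<in> carrier A" by (auto simp: A_simps o qpaths_def awalk_Nil_iff split: if_splits)
 show "cf \<one> a b = (if a = b \<and> a \<in> V then 1 else 0)"
  using Lam_refl pth_refl Lam_verts pthD[of a b] by (auto simp: cf_def o awalk_Nil_iff)
qed

lemma add_carrier: "f \<in> carrier A \<Longrightarrow> g \<in> carrier A \<Longrightarrow> f \<oplus> g \<in> carrier A"
 and ks_carrier: "f \<in> carrier A \<Longrightarrow> c \<odot> f \<in> carrier A"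
 by (auto simp: A_simps subset_iff) (metis add.right_neutral)

lemma A_ring: "ring A"
proof (rule ringI)
 show "abelian_group A"
 proof (rule abelian_groupI)
  fix f assume f: "f \<in> carrier A"
  show "\<exists>g\<in>carrier A. g \<oplus> f = \<zero>" by (rule bexI[of _ "(- 1) \<odot> f"]) (simp_all add: ks_carrier[OF f], simp add: A_simps)
 qed (simp_all add: add_carrier, simp_all add: A_simps add_ac)
 show "monoid A"
 proof (rule monoidI)
  fix f g h assume c: "f \<in> carrier A" "g \<in> carrier A" "h \<in> carrier A"
  show "f \<otimes> g \<otimes> h = f \<otimes> (g \<otimes> h)"
  proof (rule cf_eqI)
   fix a b
   show "cf (f \<otimes> g \<otimes> h) a b = cf (f \<otimes> (g \<otimes> h)) a b"
    unfolding cf_mult sum_distrib_left sum_distrib_right by (subst sum.swap) (simp add: mult.assoc)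
  qed (simp_all add: mult_closed c)
 next
  fix f assume f: "f \<in> carrier A"
  have z: "cf f a b = 0" if "a \<notin> V \<or> b \<notin> V" for a b using that Lam_verts by (auto simp: cf_def)
  have "(\<Sum>c\<in>V. (if a = c \<and> a \<in> V then 1 else 0) * h c) = (\<Sum>c\<in>V. if a = c then h c else 0)"
   "(\<Sum>c\<in>V. h c * (if c = a \<and> c \<in> V then 1 else 0)) = (\<Sum>c\<in>V. if a = c then h c else 0)" for a and h :: "'v \<Rightarrow> 'k"
   by (rule sum.cong; auto)+
  then show "\<one> \<otimes> f = f" "f \<otimes> \<one> = f"
   by (auto intro!: cf_eqI simp: mult_closed one_carrier f cf_mult cf_one z)
 qed (simp_all add: mult_closed one_carrier)
qed (auto intro!: cf_eqI simp: mult_closed add_carrier cf_mult cf_add' distrib_left distrib_right sum.distrib)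

lemma A_span': "f \<in> carrier A \<Longrightarrow> f \<in> add_span A {c \<odot> E a b | c a b. (a, b) \<in> Lam}"
proof -
 assume f: "f \<in> carrier A"
 have "finite T \<Longrightarrow> T \<subseteq> qpaths Q \<Longrightarrow> {p. f p \<noteq> 0} \<subseteq> T \<Longrightarrow> f \<in> add_span A {c \<odot> E a b | c a b. (a, b) \<in> Lam}" for T f
 proof (induction T arbitrary: f rule: finite_induct)
  case empty
  then have "f = \<zero>" by (auto simp: A_simps)
  then show ?case by (simp add: add_span.zero)
 next
  case (insert x T)
  obtain a b where ab: "(a, b) \<in> Lam" "x = (b, pth a b)" using insert(4) by (auto simp: qpaths_Lam)
  let ?U = "{c \<odot> E a b | c a b. (a, b) \<in> Lam}"
  have eq: "f = f x \<odot> E a b \<oplus> (f(x := 0))" by (auto simp: A_simps E_def path_elem_def ab(2))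
  have "f(x := 0) \<in> add_span A ?U" by (rule insert(3)) (use insert(4,5) in auto)
  moreover have "f x \<odot> E a b \<in> ?U" using ab(1) by blast
  ultimately have "f x \<odot> E a b \<oplus> (f(x := 0)) \<in> add_span A ?U" by (intro add_span.add)
  then show ?case unfolding eq[symmetric] .
 qed
 from this[OF fin_qpaths subset_refl] f show ?thesis by (simp add: A_simps)
qed

sublocale inc_alg A V Lam E cf
proof -
 have fin_Lam: "finite Lam" using finite_imageD[OF fin_qpaths[unfolded qpaths_Lam] qp_inj] .
 interpret R: ring A by (rule A_ring)
 have "kalg A"
 proof (unfold_locales)
  show "\<exists>S. finite S \<and> S \<subseteq> carrier A \<and> carrier A \<subseteq> add_span A {c \<odot> s | c s. s \<in> S}"
  proof (intro exI conjI)
   show "finite ((\<lambda>(a, b). E a b) ` Lam)" by (rule finite_imageI[OF fin_Lam])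
   show "(\<lambda>(a, b). E a b) ` Lam \<subseteq> carrier A" using E_carrier by auto
   show "carrier A \<subseteq> add_span A {c \<odot> s | c s. s \<in> (\<lambda>(a, b). E a b) ` Lam}"
   proof
    fix f assume "f \<in> carrier A"
    from A_span'[OF this] show "f \<in> add_span A {c \<odot> s | c s. s \<in> (\<lambda>(a, b). E a b) ` Lam}"
     by (rule add_span_mono) auto
   qed
  qed
 qed (auto intro!: cf_eqI simp: mult_closed add_carrier ks_carrier cf_mult cf_add' cf_ks' algebra_simps sum_distrib_left)
 then interpret kalg A .
 show "inc_alg A V Lam E cf"
 proof unfold_locales
  show "(a, b) \<in> Lam \<Longrightarrow> a \<in> V \<and> b \<in> V" "a \<in> V \<Longrightarrow> (a, a) \<in> Lam" for a b by (erule Lam_verts, erule Lam_refl)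
  show "(a, b) \<in> Lam \<Longrightarrow> (b, c) \<in> Lam \<Longrightarrow> (a, c) \<in> Lam" for a b c using Lam_append by blast
  \<comment> \<open>Going from \<open>a\<close> to \<open>b\<close> and back is the trivial path at
    \<open>a\<close>, so both parts are empty.\<close>
  show "a = b" if ab: "(a, b) \<in> Lam" "(b, a) \<in> Lam" for a b
   using Lam_append[OF ab] pth_refl[of a] Lam_verts[OF ab(1)] pthD[OF ab(1)] by (simp add: awalk_Nil_iff)
  show "(c, d) \<in> Lam \<or> (d, c) \<in> Lam"
   if l: "(a, c) \<in> Lam" "(a, d) \<in> Lam" "(c, b) \<in> Lam" "(d, b) \<in> Lam" for a b c d
  proof -
   \<comment> \<open>Both sides are the unique path from \<open>b\<close> to \<open>a\<close>. The
     paths from \<open>b\<close> to \<open>c\<close> and from \<open>b\<close> to \<open>d\<close>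
     are therefore initial segments of one list, and the rest of the longer one connects
     \<open>c\<close> and \<open>d\<close>.\<close>
   have "pth c b @ pth a c = pth d b @ pth a d" using Lam_append[OF l(1,3)] Lam_append[OF l(2,4)] by simp
   then obtain us where "pth c b = pth d b @ us \<or> pth c b @ us = pth d b" by (auto simp: append_eq_append_conv2)
   then show ?thesis
   proof
    assume "pth c b = pth d b @ us"
    then have "awalk d us c" using awalk_suffix[OF _ pthD[OF l(4)], of us] pthD[OF l(3)] by simp
    then show ?thesis using LamI by blast
   next
    assume "pth c b @ us = pth d b"
    then have "awalk c us d" using awalk_suffix[OF _ pthD[OF l(3)], of us d] pthD[OF l(4)] by simp
    then show ?thesis using LamI by blast
   qed
  qed
  have sE: "(\<Sum>d\<in>V. cf (E a b) a' d * cf x d b') = (if a = a' then cf x b b' else 0)" if l: "(a, b) \<in> Lam" for a b a' b' x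
  proof -
   have "(\<Sum>d\<in>V. cf (E a b) a' d * cf x d b') = (\<Sum>d\<in>V. if b = d then (if a = a' then cf x d b' else 0) else 0)"
    by (rule sum.cong) (simp_all add: cf_E'[OF l])
   then show ?thesis using Lam_verts[OF l] by simp
  qed
  have pm: "cf (E a b \<otimes> x) a' b' = (if a = a' then cf x b b' else 0)" if "(a, b) \<in> Lam" for a b a' b' x
   unfolding cf_mult by (rule sE[OF that])
  show "E a b \<otimes> E b c = E a c" if l: "(a, b) \<in> Lam" "(b, c) \<in> Lam" for a b c
   by (rule cf_eqI) (use l Lam_append[OF l] in \<open>auto simp: mult_closed E_carrier pm cf_E'\<close>)
  show "E a b \<otimes> E c d = \<zero>" if l: "(a, b) \<in> Lam" "(c, d) \<in> Lam" "b \<noteq> c" for a b c d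
   by (rule cf_eqI) (use l in \<open>simp_all add: mult_closed E_carrier pm cf_E'\<close>, simp_all add: cf_def A_simps)
  have fs: "cf (finsum A h T) a b = (\<Sum>v\<in>T. cf (h v) a b)" if "finite T" "h \<in> T \<rightarrow> carrier A" for h T a b
   using that
  proof (induction T rule: finite_induct)
   case empty
   then show ?case by (simp add: cf_def A_simps)
  next
   case (insert x T)
   then show ?case by (subst R.finsum_insert) (auto simp: cf_add')
  qed
  show "\<one> = (\<Oplus>v\<in>V. E v v)"
  proof (rule cf_eqI)
   fix a b
   have "cf (\<Oplus>v\<in>V. E v v) a b = (\<Sum>v\<in>V. cf (E v v) a b)"
    by (rule fs) (use E_carrier Lam_refl in auto)
   also have "\<dots> = (\<Sum>v\<in>V. if v = a then (if a = b then 1 else 0) else 0)"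
    by (rule sum.cong) (auto simp: cf_E' Lam_refl)
   finally have "cf (\<Oplus>v\<in>V. E v v) a b = (\<Sum>v\<in>V. if v = a then (if a = b then 1 else 0) else 0)" .
   then show "cf \<one> a b = cf (\<Oplus>v\<in>V. E v v) a b" by (simp add: cf_one)
  qed (use one_carrier E_carrier Lam_refl in \<open>auto intro!: R.finsum_closed\<close>)
 qed (use E_carrier A_span' cf_add' cf_ks' cf_E' in auto)
qed

lemma E_vertex: "v \<in> V \<Longrightarrow> E v v = \<epsilon> v"
 by (simp add: E_def pth_refl)

text \<open>Sets of paths are images of subsets of \<open>Lam\<close> under an injection, so
  minimality among the former is minimality among the latter, and the description operator in
  \<open>path_gens\<close> picks out \<open>mins\<close>.\<close>

lemma path_gens_mins:
 assumes I: "ideal I A"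
 shows "path_gens Q I = (\<lambda>(a, b). (b, pth a b)) ` mins (SI I)"
proof -
 let ?q = "\<lambda>(a, b). (b, pth a b)"
 have L: "mins (SI I) \<subseteq> Lam" using mins_sub SI_sub by blast
 have e: "path_elem ` ?q ` T = EE T" for T by (simp add: EE_def E_def image_image case_prod_beta')
 note mg = minimal_generators[OF I]
 show ?thesis
  unfolding path_gens_def A_eq[symmetric]
 proof (rule the_equality)
  show "?q ` mins (SI I) \<subseteq> qpaths Q \<and> Idl\<^bsub>A\<^esub> (path_elem ` ?q ` mins (SI I)) = I \<and>
    (\<forall>T. T \<subset> ?q ` mins (SI I) \<longrightarrow> Idl\<^bsub>A\<^esub> (path_elem ` T) \<noteq> I)"
  proof (intro conjI allI impI)
   show "?q ` mins (SI I) \<subseteq> qpaths Q" unfolding qpaths_Lam by (rule image_mono[OF L])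
   show "Idl\<^bsub>A\<^esub> (path_elem ` ?q ` mins (SI I)) = I" unfolding e using mg[OF L] by simp
   fix T assume T: "T \<subset> ?q ` mins (SI I)"
   then obtain T' where T': "T = ?q ` T'" "T' \<subseteq> mins (SI I)" by (meson psubset_imp_subset subset_imageE)
   then have "T' \<subset> mins (SI I)" using T by blast
   then show "Idl\<^bsub>A\<^esub> (path_elem ` T) \<noteq> I" unfolding T'(1) e using mg[OF L] by simp
  qed
  fix S assume S: "S \<subseteq> qpaths Q \<and> Idl\<^bsub>A\<^esub> (path_elem ` S) = I \<and> (\<forall>T. T \<subset> S \<longrightarrow> Idl\<^bsub>A\<^esub> (path_elem ` T) \<noteq> I)"
  then obtain T where T: "S = ?q ` T" "T \<subseteq> Lam" unfolding qpaths_Lam by (meson subset_imageE)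
  have "Idl\<^bsub>A\<^esub> (EE T') \<noteq> I" if "T' \<subset> T" for T'
   using S image_strict_mono[OF inj_on_subset[OF qp_inj T(2)] that] unfolding T(1) e[symmetric] by blast
  moreover have "Idl\<^bsub>A\<^esub> (EE T) = I" using S unfolding T(1) e by blast
  ultimately have "T = mins (SI I)" using mg[OF T(2)] by blast
  then show "S = ?q ` mins (SI I)" using T(1) by simp
 qed
qed

text \<open>By \<open>card_mins\<close> the condition on \<open>path_gens\<close> says that
  \<open>SI I\<close> is nonprincipal, and every \<open>S\<close> in \<open>PS\<close> arises
  because \<open>S = SI (IS S)\<close>.\<close>

lemma ideal_cells: "{{iso_class A (D' A) (Dp A I)} | I. indecomposable_ideal A I \<and> card (path_gens Q I) \<noteq> 1} = {{cls S} | S. S \<in> PS}"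
proof -
 have c: "card (path_gens Q I) = 1 \<longleftrightarrow> principal (SI I)" if I: "ideal I A" for I
 proof -
  have "mins (SI I) \<subseteq> Lam" using mins_sub SI_sub by blast
  then show ?thesis
   unfolding path_gens_mins[OF I] using card_image[OF inj_on_subset[OF qp_inj]] card_mins[OF SI_filt[OF I]] by simp
 qed
 show ?thesis
 proof (intro equalityI subsetI)
  fix Y assume "Y \<in> {{iso_class A (D' A) (Dp A I)} | I. indecomposable_ideal A I \<and> card (path_gens Q I) \<noteq> 1}"
  then obtain I where I: "Y = {iso_class A (D' A) (Dp A I)}" "indecomposable_ideal A I" "card (path_gens Q I) \<noteq> 1" by blast
  have id: "ideal I A" "conn (SI I)" using I(2) by (simp_all add: indecomposable_ideal_iff)
  have "SI I \<in> PS" using id I(3) c[OF id(1)] SI_sub unfolding PS_def by blast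
  then show "Y \<in> {{cls S} | S. S \<in> PS}" using I(1) iso_class_Dp[OF I(2)] by blast
 next
  fix Y assume "Y \<in> {{cls S} | S. S \<in> PS}"
  then obtain S where S: "Y = {cls S}" "conn S" "S \<subseteq> Lam" "\<not> principal S" unfolding PS_def by blast
  have f: "filt S" using S(2) by (simp add: conn_def)
  note id = IS_ideal[OF f S(3)] and si = SI_IS[OF f S(3)]
  have ind: "indecomposable_ideal A (IS S)" using id si S(2) by (simp add: indecomposable_ideal_iff)
  moreover have "card (path_gens Q (IS S)) \<noteq> 1" using c[OF id] si S(4) by simp
  ultimately show "Y \<in> {{iso_class A (D' A) (Dp A I)} | I. indecomposable_ideal A I \<and> card (path_gens Q I) \<noteq> 1}"
   using S(1) iso_class_Dp[OF ind] si by force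
 qed
qed

lemma F_proj_cls: "i \<in> V \<Longrightarrow> j \<in> V \<Longrightarrow> iso_class A (D' A) (F_proj A i j) = cls (up i j)"
 using iso_class_F[of i j] by (simp add: F_proj_def SA_def TA_def E_vertex)

lemma V_nonempty: "V \<noteq> {}"
 using tree by (auto simp: finite_tree_quiver_def connected_def strongly_connected_def)

end

theorem lemma17:
  fixes Q :: "('v, 'e) pre_digraph"
    and A :: "('k::alg_closed_field, ('v, 'e) qpath \<Rightarrow> 'k) module"
    and D :: "(('v, 'e) qpath \<Rightarrow> 'k, nat \<Rightarrow> 'k) endofunctor set"
  assumes "finite_tree_quiver Q"
    and "A = path_algebra Q"
    and "D = D' A"
  shows "left_cells A D =
           {{iso_class A D (Dp A I)} | I. indecomposable_ideal A I \<and> card (path_gens Q I) \<noteq> 1} \<union>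
           {{iso_class A D (F_proj A i j) | i. i \<in> verts Q} | j. j \<in> verts Q} \<and>
         right_cells A D =
           {{iso_class A D (Dp A I)} | I. indecomposable_ideal A I \<and> card (path_gens Q I) \<noteq> 1} \<union>
           {{iso_class A D (F_proj A i j) | j. j \<in> verts Q} | i. i \<in> verts Q} \<and>
         two_sided_cells A D =
           {{iso_class A D (Dp A I)} | I. indecomposable_ideal A I \<and> card (path_gens Q I) \<noteq> 1} \<union>
           {{iso_class A D (F_proj A i j) | i j. i \<in> verts Q \<and> j \<in> verts Q}} \<and>
         maximal_two_sided_cell A D
           {iso_class A D (F_proj A i j) | i j. i \<in> verts Q \<and> j \<in> verts Q}"
proof -
  interpret fin_digraph Q using assms(1) by (simp add: finite_tree_quiver_def)
  interpret tree_algebra Q A by unfold_locales (rule assms)+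
  have "{{iso_class A D (F_proj A i j) | i. i \<in> V} | j. j \<in> V} = {{cls (up i j) | i. i \<in> V} | j. j \<in> V}"
    "{{iso_class A D (F_proj A i j) | j. j \<in> V} | i. i \<in> V} = {{cls (up i j) | j. j \<in> V} | i. i \<in> V}"
    "{iso_class A D (F_proj A i j) | i j. i \<in> V \<and> j \<in> V} = {cls (up i j) | i j. i \<in> V \<and> j \<in> V}"
    by (simp_all only: assms(3) F_proj_cls cong: rev_conj_cong)
  then show ?thesis using incidence_cells[OF V_nonempty] ideal_cells unfolding assms(3) by simp
qed

end
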